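(* Let $(Z_t)_{t\geq0}$ be a free L\'evy process of the second kind with marginal laws $\mu_t$, and let $\rho$ be the L\'evy measure of the semigroup $\{F_{\mu_t}\}_{t\ge0}$. Suppose that there is a time parameter $t_0>0$ such that $m(\mu_{t_0})=0$ or $m(\mu_{t_0})=\infty$. Then: (1) For every $t>0$, the function $H_{\mu_t}$ is not slowly varying. (2) The function $H_\rho$ is not slowly varying. In particular, the second moments satisfy $m_2(\rho)=\infty$ and $m_2(\mu_t)=\infty$ for every $t>0$.
   Context: Let $\mathbb{C}^{+}=\{z\in\mathbb{C}:\Im z>0\}$ and let $\mathcal{M}$ be the set of all Borel probability measures on $\mathbb{R}$. For $\mu\in\mathcal{M}$ let $G_\mu(z)=\int_{-\infty}^{\infty}\frac{1}{z-t}\,d\mu(t)$ and $F_\mu=1/G_\mu$ on $\mathbb{C}^{+}$; $F_\mu$ determines $\mu$. The monotone convolution $\mu\triangleright\nu\in\mathcal{M}$ is the measure determined by $F_{\mu\triangleright\nu}(z)=F_\mu(F_\nu(z))$, $z\in\mathbb{C}^{+}$. The symbol $\boxplus$ denotes Voiculescu's free additive convolution. A free additive process (in law) is a family $(Z_t)_{t\ge0}$ of (self-adjoint, noncommutative) random variables such that: (i) for all $n\ge1$ and $0\le t_0<t_1<\cdots<t_n$, the increments $Z_{t_0},Z_{t_1}-Z_{t_0},\ldots,Z_{t_n}-Z_{t_{n-1}}$ are freely independent; (ii) for every $t\ge0$, the distribution of $Z_{s+t}-Z_t$ converges weakly to $\delta_0$ as $s\to0$; (iii) the distribution of $Z_0$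 is $\delta_0$ and the distribution of $Z_t$ is nondegenerate (not a point mass) for $t>0$. The marginal law $\mu_t$ is the distribution of $Z_t$, and if $\mu_{s,t}$ is the distribution of $Z_t-Z_s$ ($s<t$), then $\mu_t=\mu_s\boxplus\mu_{s,t}$ and $\mu_{s,u}=\mu_{s,t}\boxplus\mu_{t,u}$ for $0\le s<t<u$. By Biane's subordination theorem there exist unique measures $\sigma_{s,t}\in\mathcal{M}$ such that $\mu_t=\mu_s\triangleright\sigma_{s,t}$ and $\sigma_{s,t}\triangleright\sigma_{t,u}=\sigma_{s,u}$ for all $0\le s<t<u$. The process is a free L\'evy process of the second kind if $\sigma_{s+h,t+h}=\sigma_{s,t}$ for all $0\le s<t$ and $h\ge0$. Then $\mu_t=\sigma_{0,t}$ satisfy $\mu_s\triangleright\mu_t=\mu_{s+t}$, and $\{F_{\mu_t}\}_{t\ge0}$ is a composition semigroup of analytic self-maps of $\mathbb{C}^{+}$. Its infinitesimal generator $\varphi(z)=\lim_{\varepsilon\to0^{+}}\frac{F_{\mu_\varepsilon}(z)-z}{\varepsilon}$ exists on $\mathbb{C}^{+}$ and has a unique representation $\varphi(z)=a+\int_{-\infty}^{\infty}\frac{1+xz}{x-z}\,d\rho(x)$ with $a\in\mathbb{R}$ and $\rho$ a finite positive Borel measure on $\mathbb{R}$; $\rho$ is called the L\'evy measure. For a finite positive Borel measure $\mu$ on $\mathbb{R}$: $H_\mu(x)=\int_{-x}^{x}t^2\,d\mu(t)$, $x\ge0$; $m(\mu)=\int t\,d\mu(t)$ and $m_2(\mu)=\int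 t^2\,d\mu(t)$ when these integrals converge absolutely, while $m(\mu)=\infty$ (resp. $m_2(\mu)=\infty$) means that the corresponding integral does not converge absolutely. A positive Borel function $f$ is slowly varying if $\lim_{x\to\infty}f(cx)/f(x)=1$ for every constant $c>0$ (for functions such as $H_\mu$, positivity is needed only for large $x$). *)

theory Defs
  imports "HOL-Probability.Probability"
begin

text \<open>Operators on a complex Hilbert space\<close>

class complex_hilbert_space = real_inner + complete_space +
  fixes scaleC :: "complex \<Rightarrow> 'a \<Rightarrow> 'a"
    and cinner :: "'a \<Rightarrow> 'a \<Rightarrow> complex"
  assumes scaleC_add_right: "scaleC c (x + y) = scaleC c x + scaleC c y"
    and scaleC_add_left: "scaleC (c + d) x = scaleC c x + scaleC d x"
    and scaleC_scaleC: "scaleC c (scaleC d x) = scaleC (c * d) x"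
    and scaleC_of_real: "scaleC (complex_of_real r) x = scaleR r x"
    and cinner_commute: "cinner x y = cnj (cinner y x)"
    and cinner_add_left: "cinner (x + y) z = cinner x z + cinner y z"
    and cinner_scaleC_left: "cinner (scaleC c x) y = c * cinner x y"
    and Re_cinner: "Re (cinner x y) = inner x y"

definition bounded_operator :: "('h::complex_hilbert_space \<Rightarrow> 'h) \<Rightarrow> bool" where
  "bounded_operator A \<longleftrightarrow> bounded_linear A \<and> (\<forall>c x. A (scaleC c x) = scaleC c (A x))"

definition is_adjoint :: "('h::complex_hilbert_space \<Rightarrow> 'h) \<Rightarrow> ('h \<Rightarrow> 'h) \<Rightarrow> bool" where
  "is_adjoint A B \<longleftrightarrow> (\<forall>x y. cinner (A x) y = cinner x (B y))"

text \<open>The order on self-adjoint bounded operators; for these, \<open>cinner (A x) x\<close> is real and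
  hence equal to \<open>inner (A x) x\<close>.\<close>

definition op_le :: "('h::complex_hilbert_space \<Rightarrow> 'h) \<Rightarrow> ('h \<Rightarrow> 'h) \<Rightarrow> bool" where
  "op_le A B \<longleftrightarrow> (\<forall>x. inner (A x) x \<le> inner (B x) x)"

definition commutant :: "('h::complex_hilbert_space \<Rightarrow> 'h) set \<Rightarrow> ('h \<Rightarrow> 'h) set" where
  "commutant S = {A. bounded_operator A \<and> (\<forall>B\<in>S. A \<circ> B = B \<circ> A)}"

definition von_neumann_algebra :: "('h::complex_hilbert_space \<Rightarrow> 'h) set \<Rightarrow> bool" where
  "von_neumann_algebra M \<longleftrightarrow>
     commutant (commutant M) = M \<and> (\<forall>A\<in>M. \<exists>B\<in>M. is_adjoint A B)"

definition self_adjoint_elements :: "('h::complex_hilbert_space \<Rightarrow> 'h) set \<Rightarrow> ('h \<Rightarrow> 'h) set" where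
  "self_adjoint_elements M = {A \<in> M. is_adjoint A A}"

text \<open>A tracial \<open>W\<^sup>*\<close>-probability space: a von Neumann algebra with a faithful normal tracial state.
  Normality is stated for upward directed sets of self-adjoint elements having a supremum \<open>T\<close>.\<close>

locale tracial_W_star_probability_space =
  fixes M :: "('h::complex_hilbert_space \<Rightarrow> 'h) set"
    and \<tau> :: "('h \<Rightarrow> 'h) \<Rightarrow> complex"
  assumes von_neumann: "von_neumann_algebra M"
    and state_add: "\<lbrakk>A \<in> M; B \<in> M\<rbrakk> \<Longrightarrow> \<tau> (\<lambda>x. A x + B x) = \<tau> A + \<tau> B"
    and state_scale: "A \<in> M \<Longrightarrow> \<tau> (\<lambda>x. scaleC c (A x)) = c * \<tau> A"
    and state_pos: "\<lbrakk>A \<in> M; is_adjoint A B\<rbrakk> \<Longrightarrow> \<tau> (B \<circ> A) \<in> \<real>\<^sub>\<ge>\<^sub>0"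
    and state_unit: "\<tau> id = 1"
    and faithful: "\<lbrakk>A \<in> M; is_adjoint A B; \<tau> (B \<circ> A) = 0\<rbrakk> \<Longrightarrow> A = (\<lambda>_. 0)"
    and tracial: "\<lbrakk>A \<in> M; B \<in> M\<rbrakk> \<Longrightarrow> \<tau> (A \<circ> B) = \<tau> (B \<circ> A)"
    and normal: "\<lbrakk>D \<noteq> {}; D \<subseteq> self_adjoint_elements M;
        \<forall>A\<in>D. \<forall>B\<in>D. \<exists>C\<in>D. op_le A C \<and> op_le B C;
        T \<in> self_adjoint_elements M; \<forall>A\<in>D. op_le A T;
        \<forall>S\<in>self_adjoint_elements M. (\<forall>A\<in>D. op_le A S) \<longrightarrow> op_le T S\<rbrakk>
      \<Longrightarrow> Re (\<tau> T) = (SUP A\<in>D. Re (\<tau> A))"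

text \<open>Unbounded operators are represented by their graphs.  The adjoint of a densely defined
  operator is given by the set on the right of the second conjunct; being equal to it makes
  \<open>T\<close> automatically a closed, single-valued linear relation.\<close>

definition self_adjoint_operator :: "('h::complex_hilbert_space \<times> 'h) set \<Rightarrow> bool" where
  "self_adjoint_operator T \<longleftrightarrow>
     closure (Domain T) = UNIV \<and>
     T = {(y, w). \<forall>(x, v)\<in>T. cinner v y = cinner x w}"

definition affiliated ::
  "('h::complex_hilbert_space \<Rightarrow> 'h) set \<Rightarrow> ('h \<times> 'h) set \<Rightarrow> bool" where
  "affiliated M T \<longleftrightarrow> (\<forall>A\<in>commutant M. \<forall>(x, y)\<in>T. (A x, A y) \<in> T)"

text \<open>A self-adjoint random variable: a possibly unbounded self-adjoint operator affiliated with
  \<open>M\<close>.\<close>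

definition random_var :: "('h::complex_hilbert_space \<Rightarrow> 'h) set \<Rightarrow> ('h \<times> 'h) set \<Rightarrow> bool" where
  "random_var M T \<longleftrightarrow> self_adjoint_operator T \<and> affiliated M T"

text \<open>The strong difference \<open>S - T\<close>: the closure of the difference on the common domain.  For a
  finite von Neumann algebra it is again a random variable when \<open>S\<close> and \<open>T\<close> are.\<close>

definition op_diff ::
  "('h::complex_hilbert_space \<times> 'h) set \<Rightarrow> ('h \<times> 'h) set \<Rightarrow> ('h \<times> 'h) set" where
  "op_diff S T = closure {(x, u - v) | x u v. (x, u) \<in> S \<and> (x, v) \<in> T}"

text \<open>The von Neumann algebra \<open>W\<^sup>*(T)\<close> generated by \<open>T\<close>.\<close>

definition generated_vN :: "('h::complex_hilbert_space \<times> 'h) set \<Rightarrow> ('h \<Rightarrow> 'h) set" where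
  "generated_vN T = \<Inter>{N. von_neumann_algebra N \<and> affiliated N T}"


text \<open>Laws\<close>

definition projection_valued_measure ::
  "(real set \<Rightarrow> 'h::complex_hilbert_space \<Rightarrow> 'h) \<Rightarrow> bool" where
  "projection_valued_measure E \<longleftrightarrow>
     (\<forall>B\<in>sets borel. bounded_operator (E B) \<and> is_adjoint (E B) (E B)) \<and>
     (\<forall>A\<in>sets borel. \<forall>B\<in>sets borel. E (A \<inter> B) = E A \<circ> E B) \<and>
     E UNIV = id \<and>
     (\<forall>B x. range B \<subseteq> sets borel \<and> disjoint_family B \<longrightarrow>
        (\<lambda>n::nat. E (B n) x) sums E (\<Union>n. B n) x)"

definition scalar_spectral_measure ::
  "(real set \<Rightarrow> 'h::complex_hilbert_space \<Rightarrow> 'h) \<Rightarrow> 'h \<Rightarrow> real measure" where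
  "scalar_spectral_measure E x =
     measure_of UNIV (sets borel) (\<lambda>B. ennreal ((norm (E B x))\<^sup>2))"

text \<open>\<open>T\<close> is the operator \<open>\<integral>t dE(t)\<close>; by polarization, the quadratic form on the domain determines
  the operator.\<close>

definition spectral_measure_of ::
  "('h::complex_hilbert_space \<times> 'h) set \<Rightarrow> (real set \<Rightarrow> 'h \<Rightarrow> 'h) \<Rightarrow> bool" where
  "spectral_measure_of T E \<longleftrightarrow>
     projection_valued_measure E \<and>
     Domain T = {x. integrable (scalar_spectral_measure E x) (\<lambda>t. t\<^sup>2)} \<and>
     (\<forall>(x, y)\<in>T. cinner y x = complex_of_real (\<integral>t. t \<partial>scalar_spectral_measure E x))"

text \<open>The law of \<open>T\<close> is \<open>\<tau> \<circ> E\<close>, where \<open>E\<close> is the spectral measure of \<open>T\<close>; by the spectral theorem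
  \<open>E\<close> exists, is unique and takes its values in \<open>M\<close>.\<close>

definition has_law ::
  "('h::complex_hilbert_space \<Rightarrow> 'h) set \<Rightarrow> (('h \<Rightarrow> 'h) \<Rightarrow> complex) \<Rightarrow>
     ('h \<times> 'h) set \<Rightarrow> real measure \<Rightarrow> bool" where
  "has_law M \<tau> T \<mu> \<longleftrightarrow>
     random_var M T \<and> real_distribution \<mu> \<and>
     (\<exists>E. spectral_measure_of T E \<and>
        (\<forall>B\<in>sets borel. E B \<in> M \<and> complex_of_real (measure \<mu> B) = \<tau> (E B)))"

definition freely_independent ::
  "(('h::complex_hilbert_space \<Rightarrow> 'h) \<Rightarrow> complex) \<Rightarrow> 'i set \<Rightarrow> ('i \<Rightarrow> ('h \<times> 'h) set) \<Rightarrow> bool" where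
  "freely_independent \<tau> I X \<longleftrightarrow>
     (\<forall>ws :: ('i \<times> ('h \<Rightarrow> 'h)) list.
        ws \<noteq> [] \<and> distinct_adj (map fst ws) \<and>
        (\<forall>(i, A)\<in>set ws. i \<in> I \<and> A \<in> generated_vN (X i) \<and> \<tau> A = 0)
        \<longrightarrow> \<tau> (foldr (\<circ>) (map snd ws) id) = 0)"


text \<open>Free additive processes in law.  The marginal laws \<open>\<mu> t\<close> and the laws \<open>\<nu> s t\<close> of
  \<open>Z t - Z s\<close> are uniquely determined by \<open>Z\<close>; they are carried along as parameters.\<close>

definition increment ::
  "(real \<Rightarrow> ('h::complex_hilbert_space \<times> 'h) set) \<Rightarrow> (nat \<Rightarrow> real) \<Rightarrow> nat \<Rightarrow> ('h \<times> 'h) set" where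
  "increment Z ts i = (case i of 0 \<Rightarrow> Z (ts 0) | Suc j \<Rightarrow> op_diff (Z (ts (Suc j))) (Z (ts j)))"

locale free_additive_process = tracial_W_star_probability_space M \<tau>
  for M :: "('h::complex_hilbert_space \<Rightarrow> 'h) set" and \<tau> :: "('h \<Rightarrow> 'h) \<Rightarrow> complex" +
  fixes Z :: "real \<Rightarrow> ('h \<times> 'h) set"
    and \<mu> :: "real \<Rightarrow> real measure"
    and \<nu> :: "real \<Rightarrow> real \<Rightarrow> real measure"
  assumes marginal_law: "0 \<le> t \<Longrightarrow> has_law M \<tau> (Z t) (\<mu> t)"
    and increment_law: "\<lbrakk>0 \<le> s; 0 \<le> t\<rbrakk> \<Longrightarrow> has_law M \<tau> (op_diff (Z t) (Z s)) (\<nu> s t)"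
    and free_increments: "\<lbrakk>1 \<le> n; 0 \<le> ts 0; strict_mono_on {..n} ts\<rbrakk>
      \<Longrightarrow> freely_independent \<tau> {..n} (increment Z ts)"
    and stochastic_continuity: "\<lbrakk>0 \<le> t; \<And>k. 0 \<le> u k; u \<longlonglongrightarrow> t\<rbrakk>
      \<Longrightarrow> weak_conv_m (\<lambda>k. \<nu> t (u k)) (return borel 0)"
    and law_0: "\<mu> 0 = return borel 0"
    and nondegenerate: "0 < t \<Longrightarrow> \<mu> t \<noteq> return borel a"


text \<open>Monotone convolution and free Levy processes of the second kind\<close>

definition G_transform :: "real measure \<Rightarrow> complex \<Rightarrow> complex" where
  "G_transform \<mu> z = (\<integral>t. 1 / (z - complex_of_real t) \<partial>\<mu>)"

definition F_transform :: "real measure \<Rightarrow> complex \<Rightarrow> complex" where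
  "F_transform \<mu> z = 1 / G_transform \<mu> z"

text \<open>\<open>\<kappa>\<close> is the monotone convolution of \<open>\<mu>\<close> and \<open>\<nu>\<close>.\<close>

definition is_monotone_convolution ::
  "real measure \<Rightarrow> real measure \<Rightarrow> real measure \<Rightarrow> bool" where
  "is_monotone_convolution \<mu> \<nu> \<kappa> \<longleftrightarrow>
     real_distribution \<kappa> \<and>
     (\<forall>z. 0 < Im z \<longrightarrow> F_transform \<kappa> z = F_transform \<mu> (F_transform \<nu> z))"

definition subordination_family ::
  "(real \<Rightarrow> real measure) \<Rightarrow> (real \<Rightarrow> real \<Rightarrow> real measure) \<Rightarrow> bool" where
  "subordination_family \<mu> \<sigma> \<longleftrightarrow>
     (\<forall>s t. 0 \<le> s \<and> s < t \<longrightarrow>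
        real_distribution (\<sigma> s t) \<and> is_monotone_convolution (\<mu> s) (\<sigma> s t) (\<mu> t)) \<and>
     (\<forall>s t u. 0 \<le> s \<and> s < t \<and> t < u \<longrightarrow>
        is_monotone_convolution (\<sigma> s t) (\<sigma> t u) (\<sigma> s u))"

text \<open>By Biane's theorem there is exactly one subordination family (on the indices
  \<open>0 \<le> s < t\<close>), so the existential quantifier below just names it.\<close>

locale free_Levy_process_second_kind = free_additive_process +
  assumes stationary: "\<exists>\<sigma>. subordination_family \<mu> \<sigma> \<and>
    (\<forall>s t h. 0 \<le> s \<and> s < t \<and> 0 \<le> h \<longrightarrow> \<sigma> (s + h) (t + h) = \<sigma> s t)"

definition is_Levy_measure :: "(real \<Rightarrow> real measure) \<Rightarrow> real measure \<Rightarrow> bool" where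
  "is_Levy_measure \<mu> \<rho> \<longleftrightarrow>
     finite_borel_measure \<rho> \<and>
     (\<exists>a::real. \<forall>z. 0 < Im z \<longrightarrow>
        ((\<lambda>\<epsilon>. (F_transform (\<mu> \<epsilon>) z - z) / complex_of_real \<epsilon>) \<longlongrightarrow>
          complex_of_real a +
          (\<integral>x. (1 + complex_of_real x * z) / (complex_of_real x - z) \<partial>\<rho>)) (at_right 0))"


text \<open>Moments and slow variation\<close>

definition truncated_second_moment :: "real measure \<Rightarrow> real \<Rightarrow> real" where
  "truncated_second_moment \<mu> x = (\<integral>t\<in>{-x..x}. t\<^sup>2 \<partial>\<mu>)"

definition mean :: "real measure \<Rightarrow> ereal" where
  "mean \<mu> = (if integrable \<mu> (\<lambda>t. t) then ereal (\<integral>t. t \<partial>\<mu>) else \<infinity>)"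

definition second_moment :: "real measure \<Rightarrow> ereal" where
  "second_moment \<mu> = (if integrable \<mu> (\<lambda>t. t\<^sup>2) then ereal (\<integral>t. t\<^sup>2 \<partial>\<mu>) else \<infinity>)"

definition slowly_varying :: "(real \<Rightarrow> real) \<Rightarrow> bool" where
  "slowly_varying f \<longleftrightarrow>
     f \<in> borel_measurable borel \<and> (\<forall>\<^sub>F x in at_top. 0 < f x) \<and>
     (\<forall>c>0. ((\<lambda>x. f (c * x) / f x) \<longlongrightarrow> 1) at_top)"

end

theory Submission imports Defs "HOL-Real_Asymp.Real_Asymp"
begin

text \<open>Write \<open>N\<^sub>t(z) = F\<^sub>t(z) - z\<close>.  Each of the four claims fails only if \<open>H(y) = y Im N\<^sub>T(iy)\<close> is slowly varying for
  some \<open>T > 0\<close>: this function is asymptotic to the truncated second moments of \<open>\<mu>\<^sub>T\<close> and, via the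
  generator, to a multiple of that of \<open>\<rho>\<close> (plus the total mass of \<open>\<rho>\<close>).  Suppose it is.  Then the means of
  the \<open>\<mu>\<^sub>t\<close> exist and are additive in \<open>t\<close>, so the hypothesis makes them vanish and \<open>N\<^sub>T(iy)\<close> tends to \<open>0\<close>.  Iterating \<open>F\<^sub>T\<close> about
  \<open>n = B\<^sup>2 / H(B)\<close> times gives the arcsine limits \<open>F\<^sub>n\<^sub>T(Bz) / B \<rightarrow> sqrt(z\<^sup>2 - 2)\<close> and
  \<open>F\<^sub>2\<^sub>n\<^sub>T(Bz) / B \<rightarrow> sqrt(z\<^sup>2 - 4)\<close>.  The increment between the times \<open>nT\<close> and \<open>2nT\<close> is free from the past, so
  subordination determines the limit of its rescaled transform on the imaginary axis.  That limit violates
  Pick's inequality: the arcsine law of variance \<open>1\<close> is not a free summand of the one of variance \<open>2\<close>.\<close>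

section \<open>Reciprocal Cauchy transforms\<close>

text \<open>Transforms of the laws are never expanded in Nevanlinna's integral representation; the
  analytic input is Cauchy-Schwarz for two points, that is, positivity of 2 by 2 Pick matrices. The
  contradiction is at heart one of fourth moments. The arcsine laws of variance 1 and 2 have fourth
  free cumulants -1/2 and -2, so a free difference would have variance 1 and fourth moment 1/2,
  below the square of its variance. Since the increments may lack moments, this is read off from a
  quantity \<open>w d\<close>, which Pick's inequality makes nondecreasing in the height
  \<open>w\<close> but which the limit makes decrease to 1. The process is given by unbounded
  operators and strong differences, so subordination is derived from resolvents, in one direction: a
  common value \<open>u\<close> of \<open>F\<close> at two points determines \<open>F\<close> of the
  sum at a third. The point for the increment comes from a fixed-point argument that needs
  tightness; the large constants, such as heights of \<open>10 ^ 6\<close> in units of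
  \<open>B\<close>, pay for it.\<close>

lemma cauchy_schwarz_of_quadratic:
  fixes c :: complex and A B :: real
  assumes "\<And>\<alpha>. 0 \<le> A + 2 * Re (\<alpha> * c) + (cmod \<alpha>)\<^sup>2 * B" and "0 \<le> A" "0 \<le> B"
  shows "(cmod c)\<^sup>2 \<le> A * B"
proof (cases "B = 0")
  case True
  \<comment> \<open>Without the quadratic term the inequality is affine along alpha = -t cnj c, and
    an unbounded t forces c = 0.\<close>
  have le: "2 * t * (cmod c)\<^sup>2 \<le> A" for t :: real
    using assms(1)[of "- complex_of_real t * cnj c"] True
    by (simp add: cmod_power2) (simp add: power2_eq_square algebra_simps)
  have "(cmod c)\<^sup>2 \<le> 0"
  proof (rule ccontr)
    assume "\<not> (cmod c)\<^sup>2 \<le> 0"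
    thus False using le[of "(A + 1) / (cmod c)\<^sup>2"] assms(2) by simp
  qed
  thus ?thesis using True by simp
next
  case False
  hence B: "B > 0" using assms(3) by simp
  have cc: "Re (cnj c * c) = (cmod c)\<^sup>2"
    by (simp add: cmod_power2) (simp add: power2_eq_square)
  \<comment> \<open>The minimiser of the quadratic is alpha = -cnj c / B.\<close>
  have "0 \<le> A + 2 * Re (- complex_of_real (1/B) * cnj c * c) + (cmod (- complex_of_real (1/B) * cnj c))\<^sup>2 * B"
    using assms(1) by blast
  also have "Re (- complex_of_real (1/B) * cnj c * c) = - (cmod c)\<^sup>2 / B"
    using cc by (simp add: algebra_simps add_divide_distrib diff_divide_distrib)
  also have "(cmod (- complex_of_real (1/B) * cnj c))\<^sup>2 * B = (cmod c)\<^sup>2 / B"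
    using B by (simp add: norm_mult norm_divide power2_eq_square)
  finally show ?thesis using B by (simp add: field_simps)
qed

text \<open>Expanding |cnj f + alpha g|^2 makes \<open>f g\<close> the cross term. The pairing is
  kept bilinear, without conjugation, so that both points of a Pick kernel enter alike.\<close>

lemma integral_cauchy_schwarz:
  fixes f g :: "'a \<Rightarrow> complex"
  assumes "integrable M (\<lambda>x. f x * g x)" "integrable M (\<lambda>x. (cmod (f x))\<^sup>2)"
    "integrable M (\<lambda>x. (cmod (g x))\<^sup>2)"
  shows "(cmod (\<integral>x. f x * g x \<partial>M))\<^sup>2 \<le> (\<integral>x. (cmod (f x))\<^sup>2 \<partial>M) * (\<integral>x. (cmod (g x))\<^sup>2 \<partial>M)"
proof (rule cauchy_schwarz_of_quadratic)
  fix \<alpha> :: complex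
  have eq: "(cmod (cnj (f x) + \<alpha> * g x))\<^sup>2
      = (cmod (f x))\<^sup>2 + 2 * Re (\<alpha> * (f x * g x)) + (cmod \<alpha>)\<^sup>2 * (cmod (g x))\<^sup>2" for x
    unfolding cmod_power2 by (simp add: power2_eq_square algebra_simps)
  have i: "integrable M (\<lambda>x. \<alpha> * (f x * g x))" by (rule integrable_mult_right[OF assms(1)])
  have r: "(\<integral>x. Re (\<alpha> * (f x * g x)) \<partial>M) = Re (\<alpha> * (\<integral>x. f x * g x \<partial>M))"
    by (simp only: integral_Re[OF i] integral_mult_right_zero)
  have "0 \<le> (\<integral>x. (cmod (cnj (f x) + \<alpha> * g x))\<^sup>2 \<partial>M)" by simp
  also have "\<dots> = (\<integral>x. (cmod (f x))\<^sup>2 \<partial>M) + 2 * (\<integral>x. Re (\<alpha> * (f x * g x)) \<partial>M) + (cmod \<alpha>)\<^sup>2 * (\<integral>x. (cmod (g x))\<^sup>2 \<partial>M)"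
    unfolding eq integral_mult_right_zero[symmetric]
    by (intro Bochner_Integration.integral_add[THEN trans] arg_cong2[where f="(+)"] refl
        Bochner_Integration.integrable_add integrable_mult_right integrable_Re i assms)
  also note r
  finally show "0 \<le> (\<integral>x. (cmod (f x))\<^sup>2 \<partial>M) + 2 * Re (\<alpha> * (\<integral>x. f x * g x \<partial>M)) + (cmod \<alpha>)\<^sup>2 * (\<integral>x. (cmod (g x))\<^sup>2 \<partial>M)" .
qed auto

text \<open>The part of \<open>F\<close> beyond the identity. It maps the upper half-plane into its
  closure and is a real constant exactly for point masses.\<close>

definition Nev :: "real measure \<Rightarrow> complex \<Rightarrow> complex" where
  "Nev \<mu> z = F_transform \<mu> z - z"

lemma norm_resolvent_le: "norm (1 / (z - complex_of_real t)) \<le> 1 / \<bar>Im z\<bar>" if "Im z \<noteq> 0"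
proof -
  have "\<bar>Im z\<bar> \<le> norm (z - complex_of_real t)"
    using abs_Im_le_cmod[of "z - complex_of_real t"] by simp
  thus ?thesis using that by (simp add: norm_divide frac_le)
qed

lemma resolvent_ne: "z - complex_of_real t \<noteq> 0" if "Im z \<noteq> 0"
  using that by (metis Im_complex_of_real eq_iff_diff_eq_0)

context real_distribution
begin

lemma integrable_bdd:
  fixes f :: "real \<Rightarrow> 'b::{banach, second_countable_topology}"
  assumes "f \<in> borel_measurable borel" "\<And>x. norm (f x) \<le> B"
  shows "integrable M f"
proof (rule integrable_const_bound[where B=B])
  show "f \<in> borel_measurable M"
    using assms(1) by (simp add: measurable_cong_sets[OF events_eq_borel refl])
qed (use assms in auto)

lemma integrable_resolvent: "Im z \<noteq> 0 \<Longrightarrow> integrable M (\<lambda>t. 1 / (z - complex_of_real t))"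
  by (rule integrable_bdd[where B="1 / \<bar>Im z\<bar>"]) (use norm_resolvent_le in auto)

lemma G_cnj: "G_transform M (cnj z) = cnj (G_transform M z)"
proof -
  have "(\<integral>t. cnj (1 / (z - complex_of_real t)) \<partial>M) = cnj (G_transform M z)"
    unfolding G_transform_def by (rule Bochner_Integration.integral_cnj)
  thus ?thesis by (simp add: G_transform_def)
qed

lemma F_cnj: "F_transform M (cnj z) = cnj (F_transform M z)"
  by (simp add: F_transform_def G_cnj)

lemma G_pair:
  assumes "Im z \<noteq> 0" "Im w \<noteq> 0" "z \<noteq> w"
  shows "integrable M (\<lambda>t. 1 / (z - complex_of_real t) * (1 / (w - complex_of_real t)))"
    "(\<integral>t. 1 / (z - complex_of_real t) * (1 / (w - complex_of_real t)) \<partial>M)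
      = (G_transform M z - G_transform M w) / (w - z)"
proof -
  have eq: "1 / (z - complex_of_real t) * (1 / (w - complex_of_real t))
     = (1 / (w - z)) * (1 / (z - complex_of_real t) - 1 / (w - complex_of_real t))" for t
    using resolvent_ne[OF assms(1)] resolvent_ne[OF assms(2)] assms(3) by (simp add: field_simps)
  show "integrable M (\<lambda>t. 1 / (z - complex_of_real t) * (1 / (w - complex_of_real t)))"
    unfolding eq using integrable_resolvent assms by auto
  show "(\<integral>t. 1 / (z - complex_of_real t) * (1 / (w - complex_of_real t)) \<partial>M)
      = (G_transform M z - G_transform M w) / (w - z)"
    unfolding eq using integrable_resolvent assms 
    by (simp add: G_transform_def)
qed

lemma Im_G: "Im (G_transform M z) = - Im z * (\<integral>t. 1 / (cmod (z - complex_of_real t))\<^sup>2 \<partial>M)"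
  if "Im z \<noteq> 0"
proof -
  have "Im (1 / (z - complex_of_real t)) = - Im z * (1 / (cmod (z - complex_of_real t))\<^sup>2)" for t
    by (simp add: Im_divide cmod_power2)
  hence "Im (G_transform M z) = (\<integral>t. - Im z * (1 / (cmod (z - complex_of_real t))\<^sup>2) \<partial>M)"
    unfolding G_transform_def by (subst integral_Im[symmetric, OF integrable_resolvent[OF that]]) simp
  also have "\<dots> = - Im z * (\<integral>t. 1 / (cmod (z - complex_of_real t))\<^sup>2 \<partial>M)"
    by (rule integral_mult_right_zero)
  finally show ?thesis .
qed

lemma integral_resolvent_sq_pos: "0 < (\<integral>t. 1 / (cmod (z - complex_of_real t))\<^sup>2 \<partial>M)" if "Im z \<noteq> 0"
proof -
  have b: "norm (1 / (cmod (z - complex_of_real t))\<^sup>2) \<le> 1 / \<bar>Im z\<bar>^2" for t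
    using power_mono[OF norm_resolvent_le[OF that, of t], of 2] by (simp add: norm_divide power_divide)
  have i: "integrable M (\<lambda>t. 1 / (cmod (z - complex_of_real t))\<^sup>2)"
    by (rule integrable_bdd[OF _ b]) simp
  have "(\<integral>t. 1 / (cmod (z - complex_of_real t))\<^sup>2 \<partial>M) \<noteq> 0"
  proof
    assume "(\<integral>t. 1 / (cmod (z - complex_of_real t))\<^sup>2 \<partial>M) = 0"
    hence "AE t in M. 1 / (cmod (z - complex_of_real t))\<^sup>2 = 0"
      using integral_nonneg_eq_0_iff_AE[OF i] by simp
    hence "AE t in M. False" using resolvent_ne[OF that] by simp
    thus False using AE_False by (simp add: emeasure_space_1)
  qed
  moreover have "0 \<le> (\<integral>t. 1 / (cmod (z - complex_of_real t))\<^sup>2 \<partial>M)" by simp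
  ultimately show ?thesis by linarith
qed

lemma G_nonzero: "Im z \<noteq> 0 \<Longrightarrow> G_transform M z \<noteq> 0"
  using Im_G[of z] integral_resolvent_sq_pos[of z] by (metis less_irrefl mult_eq_0_iff neg_equal_0_iff_equal zero_complex.sel(2))

text \<open>The deviation \<open>F z / (z - x) - 1\<close> measures how far \<open>M\<close> is from a point mass; its \<open>L\<^sup>2\<close> Gram
  matrix is the Pick kernel of \<open>F - id\<close>.\<close>

definition dev :: "complex \<Rightarrow> real \<Rightarrow> complex" where
  "dev z t = F_transform M z / (z - complex_of_real t) - 1"

lemma dev_measurable [measurable]: "dev z \<in> borel_measurable borel"
  unfolding dev_def by measurable

lemma dev_cnj: "dev (cnj z) t = cnj (dev z t)"
  by (simp add: dev_def F_cnj)

lemma dev_bdd: "Im z \<noteq> 0 \<Longrightarrow> norm (dev z t) \<le> norm (F_transform M z) * (1 / \<bar>Im z\<bar>) + 1"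
  unfolding dev_def
  using norm_triangle_ineq4[of "F_transform M z / (z - complex_of_real t)" 1]
    mult_left_mono[OF norm_resolvent_le[of z t], of "norm (F_transform M z)"]
  by (simp add: norm_divide)

text \<open>Partial fractions reduce the pairing to values of \<open>G\<close>. As nothing is
  conjugated, \<open>w\<close> may lie in either half-plane: the identity yields divided differences
  of \<open>Nev\<close> and, at \<open>cnj w\<close>, the Hermitian Pick kernel.\<close>

lemma dev_pair:
  assumes "Im z \<noteq> 0" "Im w \<noteq> 0" "z \<noteq> w"
  shows "(\<integral>t. dev z t * dev w t \<partial>M) = (Nev M z - Nev M w) / (z - w)"
proof -
  have e: "dev z t * dev w t = F_transform M z * F_transform M w * (1 / (z - complex_of_real t) * (1 / (w - complex_of_real t)))
     - F_transform M z * (1 / (z - complex_of_real t)) - F_transform M w * (1 / (w - complex_of_real t)) + 1" for t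
    by (simp add: dev_def algebra_simps)
  have [simp]: "F_transform M z * G_transform M z = 1" "F_transform M w * G_transform M w = 1"
    using G_nonzero assms by (auto simp: F_transform_def)
  have "(\<integral>t. dev z t * dev w t \<partial>M) = F_transform M z * F_transform M w * ((G_transform M z - G_transform M w) / (w - z)) - 1"
  proof -
    let ?a = "\<lambda>t. 1 / (z - complex_of_real t)" and ?b = "\<lambda>t. 1 / (w - complex_of_real t)"
    note i = G_pair(1)[OF assms, THEN integrable_mult_right] integrable_resolvent[THEN integrable_mult_right, OF assms(1)]
      integrable_resolvent[THEN integrable_mult_right, OF assms(2)]
    have "(\<integral>t. dev z t * dev w t \<partial>M) = F_transform M z * F_transform M w * (\<integral>t. ?a t * ?b t \<partial>M)
       - F_transform M z * (\<integral>t. ?a t \<partial>M) - F_transform M w * (\<integral>t. ?b t \<partial>M) + 1"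
      unfolding e integral_mult_right_zero[symmetric]
      apply (subst Bochner_Integration.integral_add)
      subgoal by (intro Bochner_Integration.integrable_diff i)
      subgoal by simp
      apply (subst Bochner_Integration.integral_diff)
      subgoal by (intro Bochner_Integration.integrable_diff i)
      subgoal by (intro i)
      apply (subst Bochner_Integration.integral_diff)
      subgoal by (intro i)
      subgoal by (intro i)
      by (simp add: prob_space[unfolded space_eq_univ])
    thus ?thesis unfolding G_pair(2)[OF assms] by (simp flip: G_transform_def)
  qed
  also have "\<dots> = (Nev M z - Nev M w) / (z - w)"
  proof -
    have "F_transform M z * F_transform M w * (G_transform M z - G_transform M w) = F_transform M w - F_transform M z"
      by (simp add: algebra_simps)
    hence "F_transform M z * F_transform M w * ((G_transform M z - G_transform M w) / (w - z)) = (F_transform M w - F_transform M z)/(w-z)"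
      by simp
    also have "\<dots> - 1 = (Nev M z - Nev M w) / (z - w)"
      using assms(3) by (simp add: Nev_def divide_simps) (simp add: algebra_simps)
    finally show ?thesis .
  qed
  finally show ?thesis .
qed

text \<open>The diagonal of the Pick kernel, obtained by pairing \<open>z\<close> with
  \<open>cnj z\<close>; it makes \<open>Im Nev\<close> nonnegative.\<close>

lemma dev_norm_sq:
  assumes "Im z > 0"
  shows "(\<integral>t. (cmod (dev z t))\<^sup>2 \<partial>M) = Im (Nev M z) / Im z"
proof -
  have "complex_of_real (\<integral>t. (cmod (dev z t))\<^sup>2 \<partial>M) = (\<integral>t. dev z t * dev (cnj z) t \<partial>M)"
    by (simp add: dev_cnj complex_norm_square[symmetric] flip: of_real_power)
  also have "\<dots> = (Nev M z - Nev M (cnj z)) / (z - cnj z)"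
    using assms by (intro dev_pair) (auto simp: complex_eq_iff)
  also have "\<dots> = (Nev M z - cnj (Nev M z)) / (z - cnj z)"
    by (simp add: Nev_def F_cnj)
  also have "\<dots> = complex_of_real (Im (Nev M z) / Im z)"
    using assms by (simp add: complex_diff_cnj)
  finally show ?thesis using of_real_eq_iff by blast
qed

lemma dev_sq_integrable: "Im z \<noteq> 0 \<Longrightarrow> integrable M (\<lambda>t. (cmod (dev z t))\<^sup>2)"
  using power_mono[OF dev_bdd[of z], of _ 2]
  by (intro integrable_bdd[where B="(norm (F_transform M z) * (1 / \<bar>Im z\<bar>) + 1)\<^sup>2"]) (auto simp: )

lemma dev_pair_integrable: "Im z \<noteq> 0 \<Longrightarrow> Im w \<noteq> 0 \<Longrightarrow> integrable M (\<lambda>t. dev z t * dev w t)"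
  by (intro integrable_bdd[where B="(norm (F_transform M z) * (1 / \<bar>Im z\<bar>) + 1) * (norm (F_transform M w) * (1 / \<bar>Im w\<bar>) + 1)"])
    (use dev_bdd in \<open>auto simp: norm_mult intro!: mult_mono\<close>)

lemma Im_Nev_nonneg: "Im z > 0 \<Longrightarrow> Im (Nev M z) \<ge> 0"
proof -
  assume z: "Im z > 0"
  have "0 \<le> (\<integral>t. (cmod (dev z t))\<^sup>2 \<partial>M)" by simp
  thus ?thesis using dev_norm_sq[OF z] z by (simp add: zero_le_divide_iff)
qed

lemma Im_F_ge: "Im z > 0 \<Longrightarrow> Im (F_transform M z) \<ge> Im z"
  using Im_Nev_nonneg[of z] by (simp add: Nev_def)

lemma Im_F_pos: "Im z > 0 \<Longrightarrow> Im (F_transform M z) > 0"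
  using Im_F_ge[of z] by simp

lemma dev_cs:
  assumes "Im z \<noteq> 0" "Im w \<noteq> 0" "z \<noteq> w"
  shows "(cmod ((Nev M z - Nev M w) / (z - w)))\<^sup>2
     \<le> (\<integral>t. (cmod (dev z t))\<^sup>2 \<partial>M) * (\<integral>t. (cmod (dev w t))\<^sup>2 \<partial>M)"
  unfolding dev_pair[OF assms, symmetric]
  by (intro integral_cauchy_schwarz dev_pair_integrable dev_sq_integrable assms)

text \<open>Cauchy-Schwarz for two points of the same half-plane. Harnack's inequality, the monotone
  heights, the contraction estimates and the final contradiction all come from this bound.\<close>

lemma Nev_lipschitz_sq:
  assumes "Im z > 0" "Im w > 0"
  shows "(cmod (Nev M z - Nev M w))\<^sup>2 \<le> (cmod (z - w))\<^sup>2 * (Im (Nev M z) / Im z * (Im (Nev M w) / Im w))"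
proof (cases "z = w")
  case False
  thus ?thesis using dev_cs[of z w] assms
    by (simp add: dev_norm_sq norm_divide power_divide divide_le_eq mult.commute)
qed simp

text \<open>Cauchy-Schwarz with \<open>w\<close> reflected into the lower half-plane: the classical
  two-point Pick inequality.\<close>

lemma Nev_pick:
  assumes "Im z > 0" "Im w > 0"
  shows "(cmod (Nev M z - cnj (Nev M w)))\<^sup>2 \<le> (cmod (z - cnj w))\<^sup>2 * (Im (Nev M z) / Im z * (Im (Nev M w) / Im w))"
proof -
  have ne: "z \<noteq> cnj w" using assms by (auto simp: complex_eq_iff)
  have "Nev M (cnj w) = cnj (Nev M w)" by (simp add: Nev_def F_cnj)
  moreover have "(\<integral>t. (cmod (dev (cnj w) t))\<^sup>2 \<partial>M) = Im (Nev M w) / Im w"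
    using dev_norm_sq[OF assms(2)] by (simp add: dev_cnj)
  ultimately show ?thesis using dev_cs[of z "cnj w"] assms ne
    by (simp add: dev_norm_sq norm_divide power_divide divide_le_eq mult.commute)
qed

end

section \<open>Bounded operators with an adjoint\<close>

lemma cinner_add_right: "cinner x (y + z) = cinner x y + cinner x (z::'a::complex_hilbert_space)"
  by (metis cinner_add_left cinner_commute complex_cnj_add)

lemma cinner_scaleC_right: "cinner x (scaleC c y) = cnj c * cinner x (y::'a::complex_hilbert_space)"
  by (metis cinner_commute cinner_scaleC_left complex_cnj_mult)

lemma cinner_scaleR_left: "cinner (r *\<^sub>R x) y = of_real r * cinner x (y::'a::complex_hilbert_space)"
  by (simp add: scaleC_of_real[symmetric] cinner_scaleC_left)

lemma cinner_scaleR_right: "cinner x (r *\<^sub>R y) = of_real r * cinner x (y::'a::complex_hilbert_space)"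
  by (simp add: scaleC_of_real[symmetric] cinner_scaleC_right)

lemma cinner_self: "cinner x x = complex_of_real ((norm (x::'a::complex_hilbert_space))\<^sup>2)"
proof -
  have "Im (cinner x x) = 0" using cinner_commute[of x x] by (metis Im_complex_of_real Reals_cnj_iff complex_is_Real_iff)
  thus ?thesis by (simp add: complex_eq_iff Re_cinner power2_norm_eq_inner)
qed

lemma scaleC_one [simp]: "scaleC 1 x = (x::'a::complex_hilbert_space)"
  using scaleC_of_real[of 1 x] by simp

lemma norm_scaleC: "norm (scaleC c x) = cmod c * norm (x::'a::complex_hilbert_space)"
proof -
  have "complex_of_real ((norm (scaleC c x))\<^sup>2) = (c * cnj c) * cinner x x"
    by (simp del: of_real_power add: cinner_self[symmetric] cinner_scaleC_left cinner_scaleC_right)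
  also have "\<dots> = complex_of_real ((cmod c * norm x)\<^sup>2)"
    by (simp add: cinner_self complex_norm_square[symmetric] power_mult_distrib)
  finally have "(norm (scaleC c x))\<^sup>2 = (cmod c * norm x)\<^sup>2" using of_real_eq_iff by blast
  thus ?thesis by (simp add: power2_eq_iff_nonneg)
qed

text \<open>Rotating \<open>x\<close> by a phase makes the complex inner product real, where
  Cauchy-Schwarz for the real inner product applies.\<close>

lemma norm_cinner_le: "cmod (cinner x y) \<le> norm x * norm (y::'a::complex_hilbert_space)"
proof (cases "cinner x y = 0")
  case False
  define \<alpha> where "\<alpha> = cnj (cinner x y) / cmod (cinner x y)"
  have a: "cmod \<alpha> = 1" using False by (simp add: \<alpha>_def norm_divide)
  have "cinner (scaleC \<alpha> x) y = cmod (cinner x y)"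
    using False by (simp add: cinner_scaleC_left \<alpha>_def mult.commute[of "cnj _"] complex_norm_square[symmetric] power2_eq_square)
  hence "cmod (cinner x y) = inner (scaleC \<alpha> x) y" by (metis Re_cinner Re_complex_of_real)
  also have "\<dots> \<le> norm (scaleC \<alpha> x) * norm y" by (rule norm_cauchy_schwarz)
  finally show ?thesis by (simp add: norm_scaleC a)
qed simp

lemma bounded_bilinear_cinner: "bounded_bilinear (cinner :: 'a::complex_hilbert_space \<Rightarrow> _)"
  by unfold_locales
    (auto simp: cinner_add_left cinner_add_right cinner_scaleR_left cinner_scaleR_right scaleR_conv_of_real
      intro!: exI[of _ 1] norm_cinner_le)

lemma scaleC_scaleR: "scaleC c (r *\<^sub>R x) = r *\<^sub>R scaleC c (x::'a::complex_hilbert_space)"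
  by (simp add: scaleC_of_real[symmetric] scaleC_scaleC mult.commute)

lemma bounded_bilinear_scaleC: "bounded_bilinear (scaleC :: _ \<Rightarrow> 'a::complex_hilbert_space \<Rightarrow> _)"
  by unfold_locales
    (auto simp: scaleC_add_left scaleC_add_right scaleC_scaleR norm_scaleC scaleR_conv_of_real
      scaleC_scaleC[symmetric] scaleC_of_real intro!: exI[of _ 1])

interpretation cinner: bounded_bilinear "cinner :: 'a::complex_hilbert_space \<Rightarrow> _"
  by (rule bounded_bilinear_cinner)

interpretation scaleC: bounded_bilinear "scaleC :: _ \<Rightarrow> 'a::complex_hilbert_space \<Rightarrow> _"
  by (rule bounded_bilinear_scaleC)

lemma cinner_ext:
  assumes "\<And>y. cinner x y = cinner x' (y::'a::complex_hilbert_space)"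
  shows "x = x'"
proof -
  have "cinner (x - x') (x - x') = 0" using assms by (simp add: cinner.diff_left)
  thus ?thesis by (simp add: cinner_self)
qed

lemma cinner_ext_right:
  assumes "\<And>y. cinner y x = cinner (y::'a::complex_hilbert_space) x'"
  shows "x = x'"
  using assms by (intro cinner_ext) (metis cinner_commute)

lemma is_adjoint_sym: "is_adjoint A B \<Longrightarrow> is_adjoint B A"
  unfolding is_adjoint_def by (metis cinner_commute)

lemma is_adjoint_unique: "is_adjoint A B \<Longrightarrow> is_adjoint A B' \<Longrightarrow> B = B'"
  unfolding is_adjoint_def by (intro ext cinner_ext_right) simp

lemma is_adjoint_id: "is_adjoint id id"
  by (simp add: is_adjoint_def)

lemma is_adjoint_zero: "is_adjoint (\<lambda>_. 0) (\<lambda>_. 0)"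
  by (simp add: is_adjoint_def cinner.zero_left cinner.zero_right)

lemma is_adjoint_add: "is_adjoint A B \<Longrightarrow> is_adjoint C D \<Longrightarrow> is_adjoint (\<lambda>x. A x + C x) (\<lambda>x. B x + D x)"
  by (simp add: is_adjoint_def cinner_add_left cinner_add_right)

lemma is_adjoint_diff: "is_adjoint A B \<Longrightarrow> is_adjoint C D \<Longrightarrow> is_adjoint (\<lambda>x. A x - C x) (\<lambda>x. B x - D x)"
  by (simp add: is_adjoint_def cinner.diff_left cinner.diff_right)

lemma is_adjoint_minus: "is_adjoint A B \<Longrightarrow> is_adjoint (\<lambda>x. - A x) (\<lambda>x. - B x)"
  by (simp add: is_adjoint_def cinner.minus_left cinner.minus_right)

lemma is_adjoint_comp: "is_adjoint A B \<Longrightarrow> is_adjoint C D \<Longrightarrow> is_adjoint (A \<circ> C) (D \<circ> B)"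
  by (simp add: is_adjoint_def)

lemma is_adjoint_scaleC: "is_adjoint (scaleC c) (scaleC (cnj c))"
  by (simp add: is_adjoint_def cinner_scaleC_left cinner_scaleC_right)

lemma bounded_operator_id: "bounded_operator id"
  by (simp add: bounded_operator_def id_def)

lemma bounded_operator_zero: "bounded_operator (\<lambda>_. 0)"
  by (simp add: bounded_operator_def scaleC.zero_right)

lemma bounded_operator_add: "bounded_operator A \<Longrightarrow> bounded_operator B \<Longrightarrow> bounded_operator (\<lambda>x. A x + B x)"
  by (simp add: bounded_operator_def bounded_linear_add scaleC_add_right)

lemma bounded_operator_diff: "bounded_operator A \<Longrightarrow> bounded_operator B \<Longrightarrow> bounded_operator (\<lambda>x. A x - B x)"
  by (simp add: bounded_operator_def bounded_linear_sub scaleC.diff_right)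

lemma bounded_operator_minus: "bounded_operator A \<Longrightarrow> bounded_operator (\<lambda>x. - A x)"
  by (simp add: bounded_operator_def bounded_linear_minus scaleC.minus_right)

lemma bounded_operator_comp: "bounded_operator A \<Longrightarrow> bounded_operator B \<Longrightarrow> bounded_operator (A \<circ> B)"
  by (simp add: bounded_operator_def bounded_linear_compose o_def)

lemma bounded_operator_scaleC: "bounded_operator (scaleC c)"
  by (simp add: bounded_operator_def scaleC.bounded_linear_right scaleC_scaleC mult.commute)

text \<open>Demanding a bounded adjoint inside the type makes \<open>star\<close> total without the
  Riesz representation theorem. Elements of a von Neumann algebra qualify because the algebra is
  closed under adjoints.\<close>

typedef (overloaded) ('h::complex_hilbert_space) adop =
  "{A::'h \<Rightarrow> 'h. bounded_operator A \<and> (\<exists>B. bounded_operator B \<and> is_adjoint A B)}"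
  morphisms app Adop
  by (intro exI[of _ id]) (auto intro: is_adjoint_id bounded_operator_id)

setup_lifting type_definition_adop

instantiation adop :: (complex_hilbert_space) ring
begin

lift_definition zero_adop :: "'a adop" is "\<lambda>_. 0"
  using bounded_operator_zero is_adjoint_zero by blast

lift_definition plus_adop :: "'a adop \<Rightarrow> 'a adop \<Rightarrow> 'a adop" is "\<lambda>A B x. A x + B x"
  using bounded_operator_add is_adjoint_add by blast

lift_definition minus_adop :: "'a adop \<Rightarrow> 'a adop \<Rightarrow> 'a adop" is "\<lambda>A B x. A x - B x"
  using bounded_operator_diff is_adjoint_diff by blast

lift_definition uminus_adop :: "'a adop \<Rightarrow> 'a adop" is "\<lambda>A x. - A x"
  using bounded_operator_minus is_adjoint_minus by blast

lift_definition times_adop :: "'a adop \<Rightarrow> 'a adop \<Rightarrow> 'a adop" is "\<lambda>A B. A \<circ> B"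
  using bounded_operator_comp is_adjoint_comp by blast

instance
proof
  fix a b c :: "'a adop"
  note reps = app_inject[symmetric] plus_adop.rep_eq minus_adop.rep_eq uminus_adop.rep_eq zero_adop.rep_eq
    times_adop.rep_eq fun_eq_iff
  show "a + b + c = a + (b + c)" by (simp add: reps add.assoc)
  show "a + b = b + a" by (simp add: reps add.commute)
  show "0 + a = a" "- a + a = 0" "a - b = a + - b" by (simp_all add: reps)
  show "a * b * c = a * (b * c)" "(a + b) * c = a * c + b * c" by (simp_all add: reps)
  have "bounded_operator (app a)" using app[of a] by simp
  thus "a * (b + c) = a * b + a * c"
    by (simp add: reps bounded_operator_def linear_simps(1))
qed

end

instantiation adop :: (complex_hilbert_space) monoid_mult
begin

lift_definition one_adop :: "'a adop" is id
  using bounded_operator_id is_adjoint_id by blast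

instance
  by standard (transfer; auto)+

end

text \<open>Scalars become central elements of the operator ring, so that scaling is ring
  multiplication.\<close>

lift_definition cs :: "complex \<Rightarrow> ('h::complex_hilbert_space) adop" is "\<lambda>c. scaleC c"
  using bounded_operator_scaleC is_adjoint_scaleC by blast

lift_definition star :: "('h::complex_hilbert_space) adop \<Rightarrow> 'h adop" is
  "\<lambda>A. SOME B. bounded_operator B \<and> is_adjoint A B"
  by (metis (mono_tags, lifting) is_adjoint_sym someI_ex)

lemma app_simps [simp]:
  "app 0 x = 0" "app (A + B) x = app A x + app B x" "app (A - B) x = app A x - app B x"
  "app (- A) x = - app A x" "app (A * B) x = app A (app B x)" "app 1 x = x" "app (cs c) x = scaleC c x"
  by (transfer; simp)+

lemma app_0: "app 0 = (\<lambda>_. 0)" and app_1: "app 1 = id" and app_times: "app (A * B) = app A \<circ> app B"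
  and app_plus: "app (A + B) = (\<lambda>x. app A x + app B x)"
  by (transfer; simp)+

lemma bounded_operator_app: "bounded_operator (app A)"
  by transfer simp

lemma bounded_linear_app: "bounded_linear (app A)"
  using bounded_operator_app unfolding bounded_operator_def by blast

lemmas app_linear = linear_simps[OF bounded_linear_app]
lemmas app_tendsto = bounded_linear.tendsto[OF bounded_linear_app]

lemma app_scaleC: "app A (scaleC c x) = scaleC c (app A x)"
  using bounded_operator_app unfolding bounded_operator_def by blast

lemma adop_eqI: "(\<And>x. app A x = app B x) \<Longrightarrow> A = B"
  by (metis app_inject ext)

lemma is_adjoint_star: "is_adjoint (app A) (app (star A))"
  by transfer (metis (mono_tags, lifting) someI_ex)

lemma cinner_star: "cinner (app A x) y = cinner x (app (star A) y)"
  using is_adjoint_star unfolding is_adjoint_def by blast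

lemma star_eqI: "is_adjoint (app A) (app B) \<Longrightarrow> star A = B"
  by (metis app_inject is_adjoint_star is_adjoint_unique)

lemma cinner_star': "cinner (app (star A) x) y = cinner x (app A y)"
  using is_adjoint_sym[OF is_adjoint_star] unfolding is_adjoint_def by blast

lemma inner_star: "inner (app A x) y = inner x (app (star A) y)"
  by (metis Re_cinner cinner_star)

lemma inner_star': "inner (app (star A) x) y = inner x (app A y)"
  by (metis Re_cinner cinner_star')

lemma star_star [simp]: "star (star A) = A"
  by (intro star_eqI is_adjoint_sym[OF is_adjoint_star])

lemma star_add [simp]: "star (A + B) = star A + star B"
  by (rule star_eqI) (simp add: is_adjoint_def cinner_add_left cinner_add_right cinner_star)

lemma star_diff [simp]: "star (A - B) = star A - star B"
  by (rule star_eqI) (simp add: is_adjoint_def cinner.diff_left cinner.diff_right cinner_star)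

lemma star_times [simp]: "star (A * B) = star B * star A"
  by (rule star_eqI) (simp add: is_adjoint_def cinner_star)

lemma star_one [simp]: "star 1 = 1"
  by (rule star_eqI) (simp add: is_adjoint_def)

lemma star_zero [simp]: "star 0 = 0"
  by (rule star_eqI) (simp add: is_adjoint_def cinner.zero_left cinner.zero_right)

lemma star_cs [simp]: "star (cs c) = cs (cnj c)"
  by (rule star_eqI) (simp add: is_adjoint_def cinner_scaleC_left cinner_scaleC_right)

lemma star_power: "star (A ^ n) = star A ^ n"
  by (induction n) (simp_all add: power_commutes)

lemma cs_comm: "A * cs c = cs c * A"
  by (rule adop_eqI) (simp add: app_scaleC)

lemma cs_mult: "cs (c * d) = cs c * cs d"
  by (rule adop_eqI) (simp add: scaleC_scaleC)

lemma cs_1 [simp]: "cs 1 = 1"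
  by (rule adop_eqI) simp

definition bnd :: "('h::complex_hilbert_space) adop \<Rightarrow> real \<Rightarrow> bool" where
  "bnd A K \<longleftrightarrow> 0 \<le> K \<and> (\<forall>x. norm (app A x) \<le> K * norm x)"

lemma bndD: "bnd A K \<Longrightarrow> norm (app A x) \<le> K * norm x"
  by (simp add: bnd_def)

lemma bnd_ex: "\<exists>K>0. bnd A K"
  using bounded_linear.pos_bounded[OF bounded_linear_app, of A] by (auto simp: bnd_def mult.commute intro: less_imp_le)

lemma bnd_star:
  assumes "bnd A K" shows "bnd (star A) K"
  unfolding bnd_def
proof safe
  show "0 \<le> K" using assms by (simp add: bnd_def)
  fix x
  have "(norm (app (star A) x))\<^sup>2 = inner (app A (app (star A) x)) x"
    by (simp add: power2_norm_eq_inner inner_star)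
  also have "\<dots> \<le> norm (app A (app (star A) x)) * norm x" by (rule norm_cauchy_schwarz)
  also have "\<dots> \<le> (K * norm (app (star A) x)) * norm x" by (intro mult_right_mono bndD assms) auto
  finally have "norm (app (star A) x) * norm (app (star A) x) \<le> norm (app (star A) x) * (K * norm x)"
    by (simp add: power2_eq_square algebra_simps)
  thus "norm (app (star A) x) \<le> K * norm x"
    using assms by (cases "norm (app (star A) x) = 0") (auto simp: bnd_def)
qed

lemma bnd_mult: "bnd A K \<Longrightarrow> bnd B L \<Longrightarrow> bnd (A * B) (K * L)"
  unfolding bnd_def
proof safe
  fix x assume "0 \<le> K" "\<forall>x. norm (app A x) \<le> K * norm x" "0 \<le> L" "\<forall>x. norm (app B x) \<le> L * norm x"
  hence "norm (app A (app B x)) \<le> K * norm (app B x)" "K * norm (app B x) \<le> K * (L * norm x)"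
    by (auto intro: mult_left_mono)
  thus "norm (app (A * B) x) \<le> K * L * norm x" by (simp add: mult.assoc)
qed auto

definition positive_op :: "('h::complex_hilbert_space) adop \<Rightarrow> bool" where
  "positive_op A \<longleftrightarrow> star A = A \<and> (\<forall>x. 0 \<le> inner (app A x) x)"

text \<open>Even powers are squares of self-adjoint operators, odd powers have the form
  \<open>B^k B B^k\<close>; this avoids square roots of operators.\<close>

lemma positive_op_power:
  assumes "positive_op B" shows "positive_op (B ^ n)"
proof -
  have s: "star B = B" using assms by (simp add: positive_op_def)
  have 0: "inner (app (B ^ n) x) x \<ge> 0" for x
  proof (cases "even n")
    case True
    then obtain k where k: "n = k + k" by (metis mult_2 evenE)
    show ?thesis by (simp add: k power_add) (metis inner_ge_zero inner_star s star_power)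
  next
    case False
    then obtain k where k: "n = k + (k + 1)" by (metis oddE mult_2 add.assoc)
    have "inner (app (B ^ n) x) x = inner (app B (app (B ^ k) x)) (app (B ^ k) x)"
      unfolding k by (simp add: power_add power_commutes) (metis inner_star s star_power app_simps(5) power_commutes)
    thus ?thesis using assms by (simp add: positive_op_def)
  qed
  thus ?thesis using s by (simp add: positive_op_def star_power)
qed

lemma commutant_app_iff: "app A \<in> commutant S \<longleftrightarrow> (\<forall>B\<in>S. \<forall>x. app A (B x) = B (app A x))"
  by (auto simp: commutant_def bounded_operator_app fun_eq_iff)

context
  fixes S :: "('h::complex_hilbert_space \<Rightarrow> 'h) set"
  assumes bo: "\<And>B. B \<in> S \<Longrightarrow> bounded_operator B"
begin

lemma commutant_app_one: "app 1 \<in> commutant S" and commutant_app_zero: "app 0 \<in> commutant S"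
  and commutant_app_cs: "app (cs c) \<in> commutant S"
  using bo by (auto simp: commutant_app_iff bounded_operator_def linear_simps)

lemma commutant_app_plus: "app A \<in> commutant S \<Longrightarrow> app B \<in> commutant S \<Longrightarrow> app (A + B) \<in> commutant S"
  and commutant_app_minus: "app A \<in> commutant S \<Longrightarrow> app B \<in> commutant S \<Longrightarrow> app (A - B) \<in> commutant S"
  and commutant_app_times: "app A \<in> commutant S \<Longrightarrow> app B \<in> commutant S \<Longrightarrow> app (A * B) \<in> commutant S"
  using bo by (auto simp: commutant_app_iff bounded_operator_def linear_simps)

end

section \<open>Von Neumann algebras inside the ring of adjointable operators\<close>

definition ops :: "('h::complex_hilbert_space \<Rightarrow> 'h) set \<Rightarrow> 'h adop set" where
  "ops N = {A. app A \<in> N}"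

locale vN =
  fixes N :: "('h::complex_hilbert_space \<Rightarrow> 'h) set"
  assumes vN: "von_neumann_algebra N"
begin

lemma bicommutant: "commutant (commutant N) = N"
  using vN by (simp add: von_neumann_algebra_def)

lemma commutant_bo: "B \<in> commutant S \<Longrightarrow> bounded_operator B"
  by (simp add: commutant_def)

lemma commutant_N_bo: "B \<in> commutant N \<Longrightarrow> bounded_operator B"
  by (rule commutant_bo)

text \<open>The bicommutant identity. Resolvents, strong limits and cut-offs are placed in the
  algebra by checking that they commute with its commutant.\<close>

lemma ops_iff: "A \<in> ops N \<longleftrightarrow> (\<forall>B\<in>commutant N. \<forall>x. app A (B x) = B (app A x))"
  unfolding ops_def by (subst bicommutant[symmetric]) (simp add: commutant_app_iff)

lemma ops_basic [simp, intro]: "1 \<in> ops N" "0 \<in> ops N" "cs c \<in> ops N"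
  "A \<in> ops N \<Longrightarrow> B \<in> ops N \<Longrightarrow> A + B \<in> ops N"
  "A \<in> ops N \<Longrightarrow> B \<in> ops N \<Longrightarrow> A - B \<in> ops N"
  "A \<in> ops N \<Longrightarrow> B \<in> ops N \<Longrightarrow> A * B \<in> ops N"
  unfolding ops_def mem_Collect_eq
  using commutant_app_one[of "commutant N", OF commutant_N_bo] commutant_app_zero[of "commutant N", OF commutant_N_bo]
    commutant_app_cs[of "commutant N", OF commutant_N_bo] commutant_app_plus[of "commutant N", OF commutant_N_bo]
    commutant_app_minus[of "commutant N", OF commutant_N_bo] commutant_app_times[of "commutant N", OF commutant_N_bo]
  unfolding bicommutant by blast+

lemma ops_Adop:
  assumes "A \<in> N" shows "app (Adop A) = A" "Adop A \<in> ops N"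
proof -
  have b: "bounded_operator A" if "A \<in> N" for A using that bicommutant commutant_bo by metis
  show "app (Adop A) = A"
  proof -
    obtain B where "B \<in> N" "is_adjoint A B" using vN assms unfolding von_neumann_algebra_def by blast
    thus ?thesis using assms b by (intro Adop_inverse CollectI) blast
  qed
  thus "Adop A \<in> ops N" using assms by (simp add: ops_def)
qed

lemma ops_star [simp, intro]: "A \<in> ops N \<Longrightarrow> star A \<in> ops N"
  using vN ops_Adop unfolding von_neumann_algebra_def ops_def
  by (metis (mono_tags, lifting) mem_Collect_eq star_eqI)

lemma ops_power [simp, intro]: "A \<in> ops N \<Longrightarrow> A ^ n \<in> ops N"
  by (induction n) auto

lemma ops_sum [intro]: "(\<And>i. i \<in> I \<Longrightarrow> f i \<in> ops N) \<Longrightarrow> sum f I \<in> ops N"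
  by (induction I rule: infinite_finite_induct) auto

end

section \<open>The trace and its L2 norm\<close>

context tracial_W_star_probability_space
begin

sublocale vN M
  by unfold_locales (rule von_neumann)

definition tr :: "'h adop \<Rightarrow> complex" where "tr A = \<tau> (app A)"

lemma tr_add: "A \<in> ops M \<Longrightarrow> B \<in> ops M \<Longrightarrow> tr (A + B) = tr A + tr B"
  using state_add[of "app A" "app B"] by (simp add: tr_def ops_def app_plus)

lemma app_cs_times: "app (cs c * A) = (\<lambda>x. scaleC c (app A x))"
  by (rule ext) simp

lemma tr_cs: "A \<in> ops M \<Longrightarrow> tr (cs c * A) = c * tr A"
  using state_scale[of "app A"] by (simp add: tr_def ops_def app_cs_times)

lemma cs_minus_one: "cs (-1) * B = - B"
  by (rule adop_eqI) (simp add: scaleC.minus_left)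

lemma tr_diff:
  assumes "A \<in> ops M" "B \<in> ops M" shows "tr (A - B) = tr A - tr B"
proof -
  have "A - B = A + cs (-1) * B" by (simp add: cs_minus_one)
  thus ?thesis using assms by (simp only: tr_add tr_cs ops_basic) simp
qed

lemma tr_one [simp]: "tr 1 = 1"
  using state_unit by (simp add: tr_def app_1)

lemma tr_zero [simp]: "tr 0 = 0"
  using tr_diff[of 1 1] by simp

lemma tr_cs1: "tr (cs c) = c"
  using tr_cs[of 1 c] by simp

lemma tr_sum: "(\<And>i. i \<in> I \<Longrightarrow> f i \<in> ops M) \<Longrightarrow> tr (sum f I) = (\<Sum>i\<in>I. tr (f i))"
  by (induction I rule: infinite_finite_induct) (auto simp: tr_add ops_sum)

lemma tr_comm: "A \<in> ops M \<Longrightarrow> B \<in> ops M \<Longrightarrow> tr (A * B) = tr (B * A)"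
  using tracial[of "app A" "app B"] by (simp add: tr_def ops_def app_times)

lemma tr_pos: "A \<in> ops M \<Longrightarrow> tr (star A * A) \<in> \<real>\<^sub>\<ge>\<^sub>0"
  using state_pos[OF _ is_adjoint_star, of A] by (simp add: tr_def ops_def app_times)

definition n2 :: "'h adop \<Rightarrow> real" where "n2 A = Re (tr (star A * A))"

lemma tr_star_mult: "A \<in> ops M \<Longrightarrow> tr (star A * A) = complex_of_real (n2 A)"
  using tr_pos[of A] by (auto simp: n2_def nonneg_Reals_def)

lemma n2_nonneg [simp]: "A \<in> ops M \<Longrightarrow> 0 \<le> n2 A"
  using tr_pos[of A] by (auto simp: n2_def nonneg_Reals_def)

text \<open>The trace of star (A + c) (A + c) is real for every scalar \<open>c\<close>; taking c =
  1 and c = i separates imaginary and real parts.\<close>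

lemma tr_star: assumes A: "A \<in> ops M" shows "tr (star A) = cnj (tr A)"
proof -
  have r: "Im (tr (star B * B)) = 0" if "B \<in> ops M" for B using tr_star_mult[OF that] by simp
  have e: "star (A + cs c) * (A + cs c) = star A * A + cs c * star A + cs (cnj c) * A + cs (cnj c * c)" for c
    unfolding star_add star_cs distrib_left distrib_right cs_mult cs_comm[of "star A"]
    by (simp only: add.assoc add.commute add.left_commute)
  have "Im (c * tr (star A) + cnj c * tr A) = 0" for c
    using r[of "A + cs c"] r[of A] A unfolding e
    by (simp add: tr_add tr_cs tr_cs1 mult.commute)
  from this[of 1] this[of \<i>] show ?thesis by (simp add: complex_eq_iff)
qed

lemma n2_star: "A \<in> ops M \<Longrightarrow> n2 (star A) = n2 A"
  by (simp add: n2_def tr_comm)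

lemma n2_add:
  assumes "A \<in> ops M" "B \<in> ops M"
  shows "n2 (A + cs c * B) = n2 A + 2 * Re (c * tr (star A * B)) + (cmod c)\<^sup>2 * n2 B"
proof -
  have "star (A + cs c * B) * (A + cs c * B) 
     = star A * A + cs c * (star A * B) + cs (cnj c) * star (star A * B) + cs (c * cnj c) * (star B * B)"
  proof -
    have "star (A + cs c * B) * (A + cs c * B) = (star A + star B * cs (cnj c)) * (A + cs c * B)"
      by (simp only: star_add star_times star_cs)
    also have "star B * cs (cnj c) = cs (cnj c) * star B" by (rule cs_comm)
    also have "(star A + cs (cnj c) * star B) * (A + cs c * B)
      = star A * A + (star A * cs c) * B + cs (cnj c) * (star B * A) + cs (cnj c) * (star B * cs c) * B"
      by (simp only: distrib_left distrib_right mult.assoc add.assoc add.commute add.left_commute)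
    also have "cs (cnj c) * (star B * cs c) * B = cs (c * cnj c) * (star B * B)"
      unfolding cs_comm[of "star B"] cs_mult mult.commute[of c] by (simp only: mult.assoc)
    also have "star A * cs c * B = cs c * (star A * B)"
      unfolding cs_comm[of "star A"] by (simp only: mult.assoc)
    finally show ?thesis by (simp only: star_times star_star)
  qed
  hence "tr (star (A + cs c * B) * (A + cs c * B)) = tr (star A * A) + c * tr (star A * B) + cnj c * cnj (tr (star A * B)) + c * cnj c * tr (star B * B)"
    using assms by (simp only: tr_add tr_cs tr_star ops_basic ops_star)
  moreover have "c * cnj c * tr (star B * B) = complex_of_real ((cmod c)\<^sup>2 * n2 B)"
    unfolding tr_star_mult[OF assms(2)] of_real_mult complex_norm_square ..
  ultimately show ?thesis by (simp add: n2_def)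
qed

lemma tr_cauchy_schwarz:
  assumes "A \<in> ops M" "B \<in> ops M" shows "(cmod (tr (A * B)))\<^sup>2 \<le> n2 A * n2 B"
proof (rule cauchy_schwarz_of_quadratic)
  fix \<alpha>
  show "0 \<le> n2 A + 2 * Re (\<alpha> * tr (A * B)) + (cmod \<alpha>)\<^sup>2 * n2 B"
    using n2_add[of "star A" B \<alpha>] n2_nonneg[of "star A + cs \<alpha> * B"] assms by (simp add: n2_star)
qed (use assms in auto)

definition nn :: "'h adop \<Rightarrow> real" where "nn A = sqrt (n2 A)"

lemma nn_nonneg [simp]: "A \<in> ops M \<Longrightarrow> 0 \<le> nn A" by (simp add: nn_def)

lemma tr_le_nn: "A \<in> ops M \<Longrightarrow> B \<in> ops M \<Longrightarrow> cmod (tr (A * B)) \<le> nn A * nn B"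
  using real_le_rsqrt[OF tr_cauchy_schwarz, of A B] by (simp add: nn_def real_sqrt_mult)

lemma nn_star: "A \<in> ops M \<Longrightarrow> nn (star A) = nn A"
  by (simp add: nn_def n2_star)

lemma nn_cs: "A \<in> ops M \<Longrightarrow> nn (cs c * A) = cmod c * nn A"
proof -
  assume "A \<in> ops M"
  hence "n2 (cs c * A) = (cmod c)\<^sup>2 * n2 A" using n2_add[of 0 A c] by (simp add: n2_def)
  thus ?thesis by (simp add: nn_def real_sqrt_mult)
qed

lemma nn_triangle: assumes "A \<in> ops M" "B \<in> ops M" shows "nn (A + B) \<le> nn A + nn B"
proof -
  have "n2 (A + B) = n2 A + 2 * Re (tr (star A * B)) + n2 B" using n2_add[of A B 1] assms by simp
  also have "Re (tr (star A * B)) \<le> nn A * nn B"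
    using tr_le_nn[of "star A" B] assms complex_Re_le_cmod[of "tr (star A * B)"] by (simp add: nn_star)
  also have "n2 A + 2 * (nn A * nn B) + n2 B = (nn A + nn B)\<^sup>2"
    using assms by (simp add: nn_def power2_sum)
  finally have "n2 (A + B) \<le> (nn A + nn B)\<^sup>2" by simp
  thus ?thesis using assms unfolding nn_def[of "A + B"] by (intro real_le_lsqrt) auto
qed

lemma nn_sum: "(\<And>i. i \<in> I \<Longrightarrow> f i \<in> ops M) \<Longrightarrow> nn (sum f I) \<le> (\<Sum>i\<in>I. nn (f i))"
proof (induction I rule: infinite_finite_induct)
  case (insert x F)
  thus ?case using nn_triangle[of "f x" "sum f F"] ops_sum[of F f] by auto
qed (simp_all add: nn_def n2_def)

lemma nn_diff: assumes "A \<in> ops M" "B \<in> ops M" shows "nn (A - B) \<le> nn A + nn B"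
proof -
  have "A - B = A + cs (-1) * B" by (simp add: cs_minus_one)
  thus ?thesis using nn_triangle[of A "cs (-1) * B"] nn_cs[of B "-1"] assms by (simp only: ops_basic) simp
qed

text \<open>Monotonicity of the trace is the case of a two-element directed set in the normality axiom.\<close>

lemma tr_mono:
  assumes "A \<in> ops M" "B \<in> ops M" "star A = A" "star B = B"
    and le: "\<And>x. inner (app A x) x \<le> inner (app B x) x"
  shows "Re (tr A) \<le> Re (tr B)"
proof -
  have sa: "app X \<in> self_adjoint_elements M" if "X \<in> ops M" "star X = X" for X
  proof -
    have "is_adjoint (app X) (app X)" using is_adjoint_star[of X] unfolding that(2) .
    thus ?thesis using that(1) unfolding self_adjoint_elements_def ops_def by blast
  qed
  let ?D = "{app A, app B}"
  have "Re (\<tau> (app B)) = (SUP X\<in>?D. Re (\<tau> X))"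
  proof (rule normal)
    show "?D \<subseteq> self_adjoint_elements M" "app B \<in> self_adjoint_elements M" using sa[OF assms(1,3)] sa[OF assms(2,4)] by blast+
    have "op_le X (app B)" if "X \<in> ?D" for X using that le unfolding op_le_def by auto
    thus "\<forall>X\<in>?D. op_le X (app B)" "\<forall>X\<in>?D. \<forall>Y\<in>?D. \<exists>C\<in>?D. op_le X C \<and> op_le Y C" by blast+
  qed blast+
  moreover have "Re (\<tau> (app A)) \<le> (SUP X\<in>?D. Re (\<tau> X))"
    by (rule cSUP_upper) auto
  ultimately show ?thesis by (simp add: tr_def)
qed

text \<open>As operators, star (A B) (A B) is at most \<open>K\<close> squared times star B B, and
  the trace is monotone.\<close>

lemma n2_mult_left:
  assumes "A \<in> ops M" "B \<in> ops M" "bnd A K" shows "n2 (A * B) \<le> K\<^sup>2 * n2 B"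
proof -
  have "Re (tr (star (A * B) * (A * B))) \<le> Re (tr (cs (complex_of_real (K\<^sup>2)) * (star B * B)))"
  proof (rule tr_mono)
    fix x
    have "norm (app A (app B x)) \<le> K * norm (app B x)" using assms by (simp add: bndD)
    hence "(norm (app A (app B x)))\<^sup>2 \<le> (K * norm (app B x))\<^sup>2" by (intro power_mono) auto
    thus "inner (app (star (A * B) * (A * B)) x) x \<le> inner (app (cs (complex_of_real (K\<^sup>2)) * (star B * B)) x) x"
      by (simp add: inner_star' power2_norm_eq_inner power_mult_distrib scaleC_of_real del: of_real_power)
    show "star (cs (complex_of_real (K\<^sup>2)) * (star B * B)) = cs (complex_of_real (K\<^sup>2)) * (star B * B)"
      by (simp add: cs_comm[of "star B * B"])
  qed (use assms in \<open>auto simp: mult.assoc\<close>)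
  thus ?thesis using assms by (simp add: n2_def tr_cs)
qed

lemma nn_mult_left: "A \<in> ops M \<Longrightarrow> B \<in> ops M \<Longrightarrow> bnd A K \<Longrightarrow> nn (A * B) \<le> K * nn B"
proof -
  assume *: "A \<in> ops M" "B \<in> ops M" "bnd A K"
  have "sqrt (n2 (A * B)) \<le> sqrt (K\<^sup>2 * n2 B)" using n2_mult_left[OF *] by simp
  also have "\<dots> = K * sqrt (n2 B)" using *(3) by (simp add: real_sqrt_mult bnd_def)
  finally show ?thesis by (simp add: nn_def)
qed

text \<open>Traciality makes the L2 norm invariant under \<open>star\<close>, which turns right
  multiplication into left multiplication.\<close>

lemma nn_mult_right:
  assumes "A \<in> ops M" "B \<in> ops M" "bnd B K" shows "nn (A * B) \<le> K * nn A"
  using nn_mult_left[of "star B" "star A" K] assms nn_star[of "A * B"] by (simp add: nn_star bnd_star)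

lemma nn_one: "nn 1 = 1"
  by (simp add: nn_def n2_def)

end

section \<open>Projections, kernels and meets\<close>

definition is_proj :: "('h::complex_hilbert_space) adop \<Rightarrow> bool" where
  "is_proj p \<longleftrightarrow> star p = p \<and> p * p = p"

lemma is_proj_app: "is_proj p \<Longrightarrow> app p (app p x) = app p x"
  by (metis app_simps(5) is_proj_def)

lemma is_proj_inner: "is_proj p \<Longrightarrow> inner (app p x) x = (norm (app p x))\<^sup>2"
  by (metis inner_star is_proj_app is_proj_def power2_norm_eq_inner inner_commute)

lemma is_proj_bnd: "is_proj p \<Longrightarrow> bnd p 1"
  unfolding bnd_def
proof safe
  fix x assume p: "is_proj p"
  have "norm (app p x) * norm (app p x) \<le> norm (app p x) * norm x"
    using is_proj_inner[OF p, of x] norm_cauchy_schwarz[of "app p x" x] by (simp add: power2_eq_square)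
  thus "norm (app p x) \<le> 1 * norm x" by (cases "norm (app p x) = 0") auto
qed auto

lemma is_proj_compl: "is_proj p \<Longrightarrow> is_proj (1 - p)"
  by (simp add: is_proj_def algebra_simps)

lemma positive_op_one_minus:
  assumes "bnd T 1" shows "positive_op (1 - star T * T)"
  unfolding positive_op_def
proof safe
  fix x
  have "norm (app T x) \<le> norm x" using bndD[OF assms, of x] by simp
  hence "(norm (app T x))\<^sup>2 \<le> (norm x)\<^sup>2" by (intro power_mono) auto
  thus "0 \<le> inner (app (1 - star T * T) x) x"
    by (simp add: inner_diff_left inner_star' power2_norm_eq_inner)
qed simp

lemma power_intertwine: "T * (1 - S * T) ^ n = (1 - T * S) ^ n * (T :: 'h::complex_hilbert_space adop)"
proof (induction n)
  case (Suc n)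
  have "T * (1 - S * T) ^ Suc n = (T - T * S * T) * (1 - S * T) ^ n"
    by (simp add: algebra_simps)
  also have "\<dots> = (1 - T * S) * (T * (1 - S * T) ^ n)"
    by (simp add: algebra_simps)
  finally show ?case by (simp add: Suc mult.assoc)
qed simp

text \<open>For X Y of the form C star C, scaled to a contraction, the left side approximates the
  projection onto the closed range of \<open>C\<close>; the lemma factors the approximant through
  \<open>C\<close>.\<close>

lemma one_minus_power: "\<exists>S'. 1 - (1 - X * Y) ^ n = X * (S' :: 'h::complex_hilbert_space adop)"
proof (induction n)
  case (Suc n)
  then obtain S' where S: "(1 - X * Y) ^ n = 1 - X * S'" by (metis diff_eq_eq diff_add_cancel add_diff_cancel_left')
  have "1 - (1 - X * Y) ^ Suc n = X * (S' + Y * (1 - X * S'))"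
    by (simp add: S algebra_simps)
  thus ?case by blast
qed (intro exI[of _ 0], simp)

context
  fixes T :: "'h::complex_hilbert_space adop"
  assumes T: "bnd T 1"
begin

text \<open>For a contraction \<open>T\<close> these powers decrease strongly to the projection onto
  the kernel of \<open>T\<close>; they replace spectral calculus for star T T.\<close>

definition contr :: "nat \<Rightarrow> 'h adop" where "contr n = (1 - star T * T) ^ n"

lemma star_contr [simp]: "star (contr n) = contr n"
  by (simp add: contr_def star_power)

lemma contr_add: "contr (m + n) = contr m * contr n"
  by (simp add: contr_def power_add)

lemma contr_inner_nonneg: "0 \<le> inner (app (contr n) x) x"
  using positive_op_power[OF positive_op_one_minus[OF T]] by (simp add: positive_op_def contr_def)

text \<open>Intertwining rewrites the difference of consecutive powers as star T (1 - T star T)^n T,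
  which is positive.\<close>

lemma contr_inner_Suc: "inner (app (contr (Suc n)) x) x \<le> inner (app (contr n) x) x"
proof -
  have "star (star T * (1 - T * star T) ^ n) = star ((1 - star T * T) ^ n * star T)"
    by (simp add: star_power power_intertwine)
  hence *: "(1 - star T * T) ^ n * star T = star T * (1 - T * star T) ^ n"
    by (metis star_star)
  have "contr n - contr (Suc n) = (1 - star T * T) ^ n * star T * T"
    by (simp add: contr_def power_commutes[symmetric] power_Suc2 algebra_simps del: power_Suc)
  also have "\<dots> = star T * (1 - T * star T) ^ n * T" by (simp only: *)
  finally have "inner (app (contr n - contr (Suc n)) x) x = inner (app ((1 - T * star T) ^ n) (app T x)) (app T x)"
    by (simp add: inner_star' mult.assoc)
  also have "\<dots> \<ge> 0"
    using positive_op_power[OF positive_op_one_minus[OF bnd_star[OF T]]] by (simp add: positive_op_def)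
  finally show ?thesis by (simp add: inner_diff_left)
qed

lemma contr_inner_antimono: "m \<le> n \<Longrightarrow> inner (app (contr n) x) x \<le> inner (app (contr m) x) x"
  by (rule lift_Suc_antimono_le[of "\<lambda>n. inner (app (contr n) x) x", OF contr_inner_Suc])

text \<open>Self-adjointness turns the squared norm into values of the decreasing form at 2n, n + m
  and 2m. Convergence of the forms thus gives strong convergence.\<close>

lemma contr_norm_diff:
  assumes "m \<le> n"
  shows "(norm (app (contr n) x - app (contr m) x))\<^sup>2
    \<le> inner (app (contr (2 * m)) x) x - inner (app (contr (2 * n)) x) x"
proof -
  have e: "inner (app (contr i) x) (app (contr j) x) = inner (app (contr (i + j)) x) x" for i j
    by (metis app_simps(5) contr_add inner_star inner_commute star_contr add.commute)
  have "(norm (app (contr n) x - app (contr m) x))\<^sup>2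
     = inner (app (contr (2 * n)) x) x - 2 * inner (app (contr (n + m)) x) x + inner (app (contr (2 * m)) x) x"
    unfolding power2_norm_eq_inner inner_diff_left inner_diff_right
      e[of n n, folded mult_2] e[of m m, folded mult_2] e[of n m] e[of m n] add.commute[of m n] by simp
  moreover have "inner (app (contr (n + m)) x) x \<ge> inner (app (contr (2 * n)) x) x"
    using assms by (intro contr_inner_antimono) auto
  ultimately show ?thesis by linarith
qed

lemma contr_convergent: "convergent (\<lambda>n. app (contr n) x)"
proof (rule Cauchy_convergent, rule CauchyI')
  fix e :: real assume e: "e > 0"
  let ?a = "\<lambda>n. inner (app (contr n) x) x"
  obtain L where "?a \<longlonglongrightarrow> L"
    by (rule decseq_convergent[of ?a 0])
      (use contr_inner_nonneg contr_inner_antimono in \<open>auto simp: decseq_def\<close>)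
  hence "Cauchy ?a" by (rule LIMSEQ_imp_Cauchy)
  from CauchyD[OF this, of "e\<^sup>2"] e
  obtain N where N: "\<And>m n. m \<ge> N \<Longrightarrow> n \<ge> N \<Longrightarrow> norm (?a m - ?a n) < e\<^sup>2" by auto
  show "\<exists>N. \<forall>m\<ge>N. \<forall>n>m. dist (app (contr m) x) (app (contr n) x) < e"
  proof (intro exI allI impI)
    fix m n assume "N \<le> m" "m < n"
    hence "(norm (app (contr n) x - app (contr m) x))\<^sup>2 < e\<^sup>2"
      using contr_norm_diff[of m n x] N[of "2 * m" "2 * n"] by simp
    hence "norm (app (contr n) x - app (contr m) x) < e" by (rule power2_less_imp_less) (use e in simp)
    thus "dist (app (contr m) x) (app (contr n) x) < e" by (simp only: dist_norm norm_minus_commute)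
  qed
qed

definition contr_lim :: "'h \<Rightarrow> 'h" where "contr_lim x = lim (\<lambda>n. app (contr n) x)"

lemma contr_lim: "(\<lambda>n. app (contr n) x) \<longlonglongrightarrow> contr_lim x"
  unfolding contr_lim_def by (rule contr_convergent[unfolded convergent_LIMSEQ_iff])

lemma contr_norm_le: "norm (app (contr n) x) \<le> norm x"
proof -
  have "(norm (app (contr n) x))\<^sup>2 = inner (app (contr (n + n)) x) x"
    unfolding contr_add power2_norm_eq_inner app_simps inner_star star_contr ..
  also have "\<dots> \<le> inner (app (contr 0) x) x" by (rule contr_inner_antimono) simp
  finally have "(norm (app (contr n) x))\<^sup>2 \<le> (norm x)\<^sup>2"
    unfolding power2_norm_eq_inner[of x] by (simp add: contr_def)
  thus ?thesis by (rule power2_le_imp_le) simp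
qed

lemma contr_lim_bounded_operator: "bounded_operator contr_lim"
proof -
  have "contr_lim (x + y) = contr_lim x + contr_lim y" for x y
    by (rule LIMSEQ_unique[OF contr_lim])
      (use tendsto_add[OF contr_lim[of x] contr_lim[of y]] in \<open>simp add: app_linear\<close>)
  moreover have "contr_lim (r *\<^sub>R x) = r *\<^sub>R contr_lim x" for r x
    by (rule LIMSEQ_unique[OF contr_lim])
      (use tendsto_scaleR[OF tendsto_const contr_lim, of r x] in \<open>simp add: app_linear\<close>)
  moreover have "norm (contr_lim x) \<le> norm x * 1" for x
    using LIMSEQ_le_const2[OF tendsto_norm[OF contr_lim[of x]]] contr_norm_le by auto
  ultimately have "bounded_linear contr_lim" by (rule bounded_linear_intro)
  moreover have "contr_lim (scaleC c x) = scaleC c (contr_lim x)" for c x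
    by (rule LIMSEQ_unique[OF contr_lim])
      (use scaleC.tendsto[OF tendsto_const contr_lim, of c x] in \<open>simp add: app_scaleC\<close>)
  ultimately show ?thesis by (simp add: bounded_operator_def)
qed

lemma contr_lim_adjoint: "is_adjoint contr_lim contr_lim"
  unfolding is_adjoint_def
proof safe
  fix x y
  show "cinner (contr_lim x) y = cinner x (contr_lim y)"
  proof (rule LIMSEQ_unique)
    show "(\<lambda>n. cinner (app (contr n) x) y) \<longlonglongrightarrow> cinner (contr_lim x) y"
      by (intro cinner.tendsto contr_lim tendsto_const)
    show "(\<lambda>n. cinner (app (contr n) x) y) \<longlonglongrightarrow> cinner x (contr_lim y)"
      by (subst cinner_star) (simp, intro cinner.tendsto contr_lim tendsto_const)
  qed
qed

lemma contr_fix: "app (contr 1) (contr_lim x) = contr_lim x"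
proof (rule LIMSEQ_unique)
  show "(\<lambda>n. app (contr 1) (app (contr n) x)) \<longlonglongrightarrow> app (contr 1) (contr_lim x)"
    by (intro app_tendsto contr_lim)
  have "app (contr 1) (app (contr n) x) = app (contr (Suc n)) x" for n
    using contr_add[of 1 n] by (metis app_simps(5) plus_1_eq_Suc)
  thus "(\<lambda>n. app (contr 1) (app (contr n) x)) \<longlonglongrightarrow> contr_lim x"
    using LIMSEQ_Suc[OF contr_lim[of x]] by simp
qed

lemma contr_lim_fix_iff: "contr_lim x = x \<longleftrightarrow> app T x = 0"
proof
  assume "contr_lim x = x"
  hence "app (contr 1) x = x" using contr_fix[of x] by simp
  hence "app (star T) (app T x) = 0" by (simp add: contr_def)
  hence "inner (app T x) (app T x) = 0" by (metis inner_star inner_zero_right)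
  thus "app T x = 0" by simp
next
  assume *: "app T x = 0"
  have "app (contr n) x = x" for n
    by (induction n) (simp_all add: contr_def * app_linear)
  hence "(\<lambda>n. app (contr n) x) \<longlonglongrightarrow> x" by simp
  thus "contr_lim x = x" by (rule LIMSEQ_unique[OF contr_lim])
qed

lemma contr_lim_idem: "contr_lim (contr_lim x) = contr_lim x"
proof -
  \<comment> \<open>A vector fixed by 1 - star T T is annihilated by star T T, hence by
    \<open>T\<close>.\<close>
  have "app (star T) (app T (contr_lim x)) = 0" using contr_fix[of x] by (simp add: contr_def)
  hence "inner (app T (contr_lim x)) (app T (contr_lim x)) = 0" by (metis inner_star inner_zero_right)
  thus ?thesis by (simp add: contr_lim_fix_iff)
qed

end

context tracial_W_star_probability_space
begin

text \<open>Induction that carries one \<open>T\<close> around the trace. In the limit it says that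
  the kernels of \<open>T\<close> and star T have equal trace.\<close>

lemma tr_power_swap:
  assumes "T \<in> ops M"
  shows "tr ((1 - T * star T) ^ n) = tr ((1 - star T * T) ^ n)"
proof (induction n)
  case (Suc n)
  have m: "(1 - T * star T) ^ n \<in> ops M" "(1 - star T * T) ^ n \<in> ops M" using assms by auto
  have "(1 - T * star T) ^ Suc n = (1 - T * star T) ^ n - (1 - T * star T) ^ n * T * star T"
    by (simp add: power_Suc2 algebra_simps del: power_Suc)
  also have "(1 - T * star T) ^ n * T = T * (1 - star T * T) ^ n" by (simp add: power_intertwine)
  finally have "tr ((1 - T * star T) ^ Suc n) = tr ((1 - T * star T) ^ n) - tr (T * ((1 - star T * T) ^ n * star T))"
    using assms m by (simp add: tr_diff mult.assoc)
  also have "tr (T * ((1 - star T * T) ^ n * star T)) = tr ((1 - star T * T) ^ n * (star T * T))"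
    using assms m by (subst tr_comm) (auto simp: mult.assoc)
  also have "tr ((1 - T * star T) ^ n) - tr ((1 - star T * T) ^ n * (star T * T)) = tr ((1 - star T * T) ^ n - (1 - star T * T) ^ n * (star T * T))"
    using assms m Suc by (simp add: tr_diff)
  also have "(1 - star T * T) ^ n - (1 - star T * T) ^ n * (star T * T) = (1 - star T * T) ^ Suc n"
    by (simp add: power_Suc2 algebra_simps del: power_Suc)
  finally show ?case .
qed simp

text \<open>The strong limit of the powers is the projection; normality of the state is what makes
  the traces converge along with them.\<close>

lemma kernel_projection:
  assumes TM: "T \<in> ops M" and T: "bnd T 1"
  obtains k where "k \<in> ops M" "is_proj k" "\<And>x. app k x = x \<longleftrightarrow> app T x = 0"
    "(\<lambda>n. Re (tr ((1 - star T * T) ^ n))) \<longlonglongrightarrow> Re (tr k)"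
proof
  let ?k = "Adop (contr_lim T)"
  \<comment> \<open>Each power commutes with the commutant of \<open>M\<close>, and this passes to
    the strong limit.\<close>
  have "contr_lim T \<in> commutant (commutant M)"
    unfolding commutant_def[of "commutant M"]
  proof (safe intro!: contr_lim_bounded_operator T ext)
    fix B x assume B: "B \<in> commutant M"
    have cm: "app (contr T n) (B y) = B (app (contr T n) y)" for n y
    proof -
      have "contr T n \<in> ops M" using TM by (auto simp: contr_def[OF T])
      thus ?thesis using B unfolding ops_iff by blast
    qed
    have "(\<lambda>n. B (app (contr T n) x)) \<longlonglongrightarrow> B (contr_lim T x)"
      using commutant_bo[OF B] contr_lim[OF T, of x] by (auto simp: bounded_operator_def intro: bounded_linear.tendsto)
    thus "(contr_lim T \<circ> B) x = (B \<circ> contr_lim T) x"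
      using contr_lim[OF T, of "B x"] by (simp add: cm LIMSEQ_unique)
  qed
  hence cM: "contr_lim T \<in> M" by (simp add: bicommutant)
  have app: "app ?k = contr_lim T" using ops_Adop[OF cM] by simp
  show kM: "?k \<in> ops M" using ops_Adop[OF cM] by simp
  have "star ?k = ?k" by (rule star_eqI) (simp add: app contr_lim_adjoint[OF T])
  thus pk: "is_proj ?k" unfolding is_proj_def
    using contr_lim_idem[OF T] by (auto intro!: adop_eqI simp: app)
  show "app ?k x = x \<longleftrightarrow> app T x = 0" for x using contr_lim_fix_iff[OF T] by (simp add: app)
  let ?B = "\<lambda>n. 1 - contr T n"
  have BM: "?B n \<in> ops M" for n using TM by (auto simp: contr_def[OF T])
  have sB: "star (?B n) = ?B n" for n by (simp add: star_contr[OF T])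
  have lim: "(\<lambda>n. inner (app (contr T n) x) x) \<longlonglongrightarrow> inner (app ?k x) x" for x
    unfolding app by (intro tendsto_inner contr_lim[OF T] tendsto_const)
  have sa: "app X \<in> self_adjoint_elements M" if "X \<in> ops M" "star X = X" for X
  proof -
    have "is_adjoint (app X) (app X)" using is_adjoint_star[of X] unfolding that(2) .
    thus ?thesis using that(1) unfolding self_adjoint_elements_def ops_def by blast
  qed
  have kn: "inner (app ?k x) x \<le> inner (app (contr T n) x) x" for n x
    using LIMSEQ_le_const2[OF lim[of x]] contr_inner_antimono[OF T, of n] by auto
  let ?D = "range (\<lambda>n. app (?B n))"
  \<comment> \<open>Normality applies to the increasing sequence 1 - contr n, whose supremum among
    self-adjoint elements is 1 - k.\<close>
  have sup: "Re (\<tau> (app (1 - ?k))) = (SUP X\<in>?D. Re (\<tau> X))"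
  proof (rule normal)
    show "?D \<noteq> {}" by simp
    show "?D \<subseteq> self_adjoint_elements M" using sa[OF BM sB] by blast
    have "op_le (app (?B m)) (app (?B (max m n))) \<and> op_le (app (?B n)) (app (?B (max m n)))" for m n
      using contr_inner_antimono[OF T, of m "max m n"] contr_inner_antimono[OF T, of n "max m n"]
      by (simp add: op_le_def inner_diff_left)
    thus "\<forall>A\<in>?D. \<forall>B\<in>?D. \<exists>C\<in>?D. op_le A C \<and> op_le B C" by blast
    show "app (1 - ?k) \<in> self_adjoint_elements M"
      using kM pk by (intro sa) (auto simp: is_proj_def)
    show "\<forall>A\<in>?D. op_le A (app (1 - ?k))" using kn by (auto simp: op_le_def inner_diff_left)
    show "\<forall>S\<in>self_adjoint_elements M. (\<forall>A\<in>?D. op_le A S) \<longrightarrow> op_le (app (1 - ?k)) S"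
    proof (intro ballI impI)
      fix S assume "\<forall>A\<in>?D. op_le A S"
      hence "inner x x - inner (S x) x \<le> inner (app (contr T n) x) x" for n x
        by (auto simp: op_le_def inner_diff_left algebra_simps)
      hence "inner x x - inner (S x) x \<le> inner (app ?k x) x" for x
        by (intro LIMSEQ_le_const[OF lim[of x]]) auto
      thus "op_le (app (1 - ?k)) S" by (simp add: op_le_def inner_diff_left algebra_simps)
    qed
  qed
  hence sup': "Re (tr (1 - ?k)) = (SUP n. Re (tr (?B n)))" by (simp add: tr_def image_image)
  have inc: "incseq (\<lambda>n. Re (tr (?B n)))"
    by (intro incseq_SucI tr_mono BM sB) (simp add: inner_diff_left contr_inner_Suc[OF T])
  have "Re (tr (?B n)) \<le> Re (tr (1 - ?k))" for n
    using kM pk kn by (intro tr_mono BM sB) (auto simp: is_proj_def inner_diff_left)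
  hence "bdd_above (range (\<lambda>n. Re (tr (?B n))))" by (intro bdd_aboveI[of _ "Re (tr (1 - ?k))"]) auto
  from LIMSEQ_incseq_SUP[OF this inc] have "(\<lambda>n. Re (tr (?B n))) \<longlonglongrightarrow> Re (tr (1 - ?k))"
    unfolding sup' .
  from tendsto_diff[OF tendsto_const this, of 1]
  show "(\<lambda>n. Re (tr ((1 - star T * T) ^ n))) \<longlonglongrightarrow> Re (tr ?k)"
    using kM TM by (simp add: tr_diff contr_def[OF T])
qed

lemma tr_proj_n2: "p \<in> ops M \<Longrightarrow> is_proj p \<Longrightarrow> n2 p = Re (tr p)"
  by (simp add: n2_def is_proj_def)

text \<open>With T = (1 - g) e the kernel of \<open>T\<close> is the range of 1 - e plus the
  intersection of the ranges, so its projection \<open>k\<close> is (1 - e) + h with h = e k. The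
  trace bound then reduces to tr k >= tr g.\<close>

lemma proj_meet:
  assumes e: "e \<in> ops M" "is_proj e" and g: "g \<in> ops M" "is_proj g"
  obtains h where "h \<in> ops M" "is_proj h" "\<And>x. app h x = x \<longleftrightarrow> app e x = x \<and> app g x = x"
    "Re (tr h) \<ge> Re (tr e) + Re (tr g) - 1"
proof -
  define T where "T = (1 - g) * e"
  have TM: "T \<in> ops M" using e g by (auto simp: T_def)
  have T: "bnd T 1" unfolding T_def using bnd_mult[OF is_proj_bnd is_proj_bnd, OF is_proj_compl] e g by fastforce
  obtain k where k: "k \<in> ops M" "is_proj k" "\<And>x. app k x = x \<longleftrightarrow> app T x = 0"
    "(\<lambda>n. Re (tr ((1 - star T * T) ^ n))) \<longlonglongrightarrow> Re (tr k)"
    using kernel_projection[OF TM T] by blast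
  \<comment> \<open>The kernel of \<open>T\<close> contains the range of 1 - e, so \<open>k\<close>
    commutes with \<open>e\<close>.\<close>
  have "T * (1 - e) = 0" using e by (simp add: T_def is_proj_def algebra_simps)
  hence "app T (app (1 - e) x) = 0" for x by (metis app_simps(1,5))
  hence "k * (1 - e) = 1 - e" using k(3) by (intro adop_eqI) (simp only: app_simps(5))
  hence ke: "k * e = k - (1 - e)" by (simp add: algebra_simps)
  hence "star (k * e) = k - (1 - e)" using e k by (simp add: is_proj_def)
  hence ek: "e * k = k - (1 - e)" using e k by (simp add: is_proj_def)
  have ee: "e * e = e" "k * k = k" "star e = e" "star k = k" "g * g = g" "star g = g"
    using e k g by (auto simp: is_proj_def)
  show ?thesis
  proof (rule that[of "e * k"])
    show "e * k \<in> ops M" using e k by simp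
    show "is_proj (e * k)" unfolding is_proj_def
    proof
      show "star (e * k) = e * k" using ek ke ee by simp
      have "e * k * (e * k) = e * (k * e) * k" by (simp only: mult.assoc)
      also have "k * e = e * k" by (simp only: ek ke)
      also have "e * (e * k) * k = (e * e) * (k * k)" by (simp only: mult.assoc)
      finally show "e * k * (e * k) = e * k" by (simp only: ee)
    qed
    show "app (e * k) x = x \<longleftrightarrow> app e x = x \<and> app g x = x" for x
    proof
      assume h: "app (e * k) x = x"
      hence "app e x = x" by (metis app_simps(5) ee(1) mult.assoc)
      moreover have "app (k * e) x = x" using h ek ke by simp
      hence "app k x = x" by (metis app_simps(5) ee(2) mult.assoc)
      hence "app T x = 0" using k(3) by simp
      ultimately show "app e x = x \<and> app g x = x" by (simp add: T_def)
    next
      assume *: "app e x = x \<and> app g x = x"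
      hence "app T x = 0" by (simp add: T_def)
      hence "app k x = x" using k(3) by simp
      thus "app (e * k) x = x" using * by simp
    qed
    let ?Q = "1 - g" and ?B = "1 - T * star T"
    \<comment> \<open>T star T lives under 1 - g, so the powers of 1 - T star T fix the range of
      \<open>g\<close> and dominate \<open>g\<close>. By \<open>tr_power_swap\<close> they have the
      traces that converge to tr k.\<close>
    have gB: "g * ?B ^ n = g" "?B ^ n * g = g" for n
    proof -
      have Q: "g * ?Q = 0" "?Q * g = 0" "star ?Q = ?Q" using ee by (simp_all add: algebra_simps)
      have "g * (T * star T) = (g * ?Q) * (e * star T)" "T * star T * g = T * e * (?Q * g)"
        unfolding T_def star_times Q(3) ee by (simp_all only: mult.assoc)
      hence "g * (T * star T) = 0" "T * star T * g = 0" by (simp_all only: Q mult_zero_left mult_zero_right)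
      hence *: "g * ?B = g" "?B * g = g" by (simp_all add: right_diff_distrib left_diff_distrib mult.assoc)
      show "g * ?B ^ n = g" "?B ^ n * g = g"
        by (induction n) (simp_all add: mult.assoc[symmetric] *, simp add: mult.assoc *)
    qed
    have gle: "Re (tr g) \<le> Re (tr ((1 - star T * T) ^ n))" for n
      unfolding tr_power_swap[OF TM, symmetric]
    proof (rule tr_mono)
      fix x
      have B: "?B ^ n = g + ?Q * (?B ^ n * ?Q)" using gB[of n] ee by (simp add: algebra_simps)
      have Q: "star ?Q = ?Q" using ee by simp
      have "app (?B ^ n) x = app g x + app ?Q (app (?B ^ n) (app ?Q x))"
        by (subst B) (simp only: app_simps(2,5))
      hence "inner (app (?B ^ n) x) x = inner (app g x) x + inner (app (?B ^ n) (app ?Q x)) (app ?Q x)"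
        by (simp only: inner_add_left inner_star[of ?Q] Q)
      moreover have "inner (app (?B ^ n) (app ?Q x)) (app ?Q x) \<ge> 0"
        using positive_op_power[OF positive_op_one_minus[OF bnd_star[OF T]]] by (simp add: positive_op_def)
      ultimately show "inner (app g x) x \<le> inner (app (?B ^ n) x) x" by simp
    qed (use TM g ee in \<open>auto simp: star_power\<close>)
    have "Re (tr g) \<le> Re (tr k)" by (rule LIMSEQ_le_const[OF k(4)]) (use gle in auto)
    thus "Re (tr (e * k)) \<ge> Re (tr e) + Re (tr g) - 1"
      using e k unfolding ek by (simp add: tr_diff)
  qed
qed

end

section \<open>Resolvents of self-adjoint operators\<close>

text \<open>The projection theorem: a minimising sequence converges to the nearest point
  \<open>p\<close>, and y - p is orthogonal to \<open>V\<close>. Orthogonality here is for the real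
  inner product.\<close>

lemma closed_subspace_orthogonal:
  fixes V :: "'a::{real_inner, complete_space} set"
  assumes "closed V" "subspace V" "y \<notin> V"
  obtains v where "v \<noteq> 0" "\<And>s. s \<in> V \<Longrightarrow> inner s v = 0"
proof -
  define d where "d = infdist y V"
  have V0: "0 \<in> V" using assms(2) by (rule subspace_0)
  have d: "d > 0" using assms V0 unfolding d_def by (metis empty_iff in_closed_iff_infdist_zero infdist_nonneg less_eq_real_def)
  have dle: "d \<le> norm (y - s)" if "s \<in> V" for s
    using infdist_le[OF that, of y] by (simp add: d_def dist_norm)
  have "\<exists>s\<in>V. norm (y - s) < d + 1 / real (Suc n)" for n
  proof (rule ccontr)
    assume *: "\<not> ?thesis"
    have "d + 1 / real (Suc n) \<le> infdist y V"
      using V0 * unfolding infdist_def by (auto simp: dist_norm not_less intro!: cINF_greatest)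
    thus False by (simp add: d_def)
  qed
  then obtain s where s: "\<And>n. s n \<in> V" "\<And>n. norm (y - s n) < d + 1 / real (Suc n)" by metis
  \<comment> \<open>The parallelogram law; the midpoint of two points of \<open>V\<close> is again
    at distance at least \<open>d\<close>.\<close>
  have par: "(norm (s m - s n))\<^sup>2 \<le> 2 * ((norm (y - s m))\<^sup>2 - d\<^sup>2) + 2 * ((norm (y - s n))\<^sup>2 - d\<^sup>2)" for m n
  proof -
    have "(1/2) *\<^sub>R (s m + s n) \<in> V" using assms(2) s by (intro subspace_scale subspace_add)
    hence "d\<^sup>2 \<le> (norm (y - (1/2) *\<^sub>R (s m + s n)))\<^sup>2" using dle d by (intro power_mono) auto
    moreover have "(norm (s m - s n))\<^sup>2 + 4 * (norm (y - (1/2) *\<^sub>R (s m + s n)))\<^sup>2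
       = 2 * (norm (y - s m))\<^sup>2 + 2 * (norm (y - s n))\<^sup>2"
      by (simp add: power2_norm_eq_inner inner_diff_left inner_diff_right inner_add_left inner_add_right algebra_simps inner_commute)
    ultimately show ?thesis by (simp add: algebra_simps)
  qed
  have "(\<lambda>n. (d + 1 / real (Suc n))\<^sup>2 - d\<^sup>2) \<longlonglongrightarrow> (d + 0)\<^sup>2 - d\<^sup>2"
    by (intro tendsto_intros LIMSEQ_Suc[OF lim_1_over_n])
  hence lim: "(\<lambda>n. (d + 1 / real (Suc n))\<^sup>2 - d\<^sup>2) \<longlonglongrightarrow> 0" by simp
  have "Cauchy s"
  proof (rule CauchyI)
    fix e :: real assume e: "e > 0"
    have "\<forall>\<^sub>F n in sequentially. (d + 1 / real (Suc n))\<^sup>2 - d\<^sup>2 < e\<^sup>2 / 4"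
      using order_tendstoD(2)[OF lim, of "e\<^sup>2/4"] e by simp
    then obtain N where N: "\<And>n. n \<ge> N \<Longrightarrow> (d + 1 / real (Suc n))\<^sup>2 - d\<^sup>2 < e\<^sup>2 / 4"
      by (auto simp: eventually_sequentially)
    have le: "(norm (y - s n))\<^sup>2 - d\<^sup>2 < e\<^sup>2/4" if "n \<ge> N" for n
    proof -
      have "(norm (y - s n))\<^sup>2 \<le> (d + 1 / real (Suc n))\<^sup>2" using s(2)[of n] by (intro power_mono) auto
      thus ?thesis using N[OF that] by linarith
    qed
    show "\<exists>N. \<forall>m\<ge>N. \<forall>n\<ge>N. norm (s m - s n) < e"
    proof (intro exI allI impI)
      fix m n assume "m \<ge> N" "n \<ge> N"
      hence "(norm (s m - s n))\<^sup>2 < e\<^sup>2" using par[of m n] le[OF \<open>m \<ge> N\<close>] le[OF \<open>n \<ge> N\<close>] by simp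
      thus "norm (s m - s n) < e" by (rule power2_less_imp_less) (use e in simp)
    qed
  qed
  then obtain p where p: "s \<longlonglongrightarrow> p" using Cauchy_convergent convergent_def by blast
  have pV: "p \<in> V" using assms(1) s(1) p closed_sequentially by blast
  have "norm (y - p) \<le> d + 0"
  proof (rule LIMSEQ_le)
    show "(\<lambda>n. norm (y - s n)) \<longlonglongrightarrow> norm (y - p)" by (intro tendsto_intros p)
    show "(\<lambda>n. d + 1 / real (Suc n)) \<longlonglongrightarrow> d + 0" by (intro tendsto_intros LIMSEQ_Suc[OF lim_1_over_n])
  qed (use s(2) less_imp_le in blast)
  hence np: "norm (y - p) = d" using dle[OF pV] by simp
  show ?thesis
  proof (rule that[of "y - p"])
    show "y - p \<noteq> 0" using assms(3) pV by auto
    fix t assume t: "t \<in> V"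
    show "inner t (y - p) = 0"
    proof (rule ccontr)
      assume ne: "inner t (y - p) \<noteq> 0"
      hence t0: "inner t t > 0" by auto
      \<comment> \<open>The step along \<open>t\<close> that shortens y - p the most.\<close>
      define r where "r = inner t (y - p) / inner t t"
      have "p + r *\<^sub>R t \<in> V" using assms(2) pV t by (intro subspace_add subspace_scale)
      hence "d\<^sup>2 \<le> (norm (y - (p + r *\<^sub>R t)))\<^sup>2" using dle d by (intro power_mono) auto
      also have "y - (p + r *\<^sub>R t) = (y - p) - r *\<^sub>R t" by simp
      also have "(norm ((y - p) - r *\<^sub>R t))\<^sup>2 = d\<^sup>2 - 2 * r * inner t (y - p) + r\<^sup>2 * inner t t"
        unfolding np[symmetric] power2_norm_eq_inner
        by (simp only: inner_diff_left[of "y - p" "r *\<^sub>R t"] inner_diff_right[of _ "y - p" "r *\<^sub>R t"] inner_scaleR_left inner_scaleR_right inner_commute[of "y - p" t])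
          (simp add: power2_eq_square algebra_simps)
      also have "\<dots> = d\<^sup>2 - (inner t (y - p))\<^sup>2 / inner t t"
        using t0 by (simp add: r_def power2_eq_square field_simps)
      finally show False using t0 ne by (simp add: divide_le_0_iff)
    qed
  qed
qed

lemma dense_cinner_ext:
  fixes w w' :: "'h::complex_hilbert_space"
  assumes "closure D = UNIV" "\<And>x. x \<in> D \<Longrightarrow> cinner x w = cinner x w'"
  shows "w = w'"
proof -
  have "closed {x. cinner x w = cinner x w'}"
    by (intro closed_Collect_eq bounded_linear.linear linear_continuous_on cinner.bounded_linear_left)
  hence "closure D \<subseteq> {x. cinner x w = cinner x w'}" using assms(2) by (intro closure_minimal) auto
  thus ?thesis using assms(1) by (intro cinner_ext_right) auto
qed

locale self_adjoint =
  fixes T :: "('h::complex_hilbert_space \<times> 'h) set"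
  assumes sa: "self_adjoint_operator T"
begin

lemma dense: "closure (Domain T) = UNIV" using sa by (simp add: self_adjoint_operator_def)

lemma in_iff: "(y, w) \<in> T \<longleftrightarrow> (\<forall>(x, v)\<in>T. cinner v y = cinner x w)"
proof -
  have "T = {(y, w). \<forall>(x, v)\<in>T. cinner v y = cinner x w}" using sa by (simp add: self_adjoint_operator_def)
  thus ?thesis by blast
qed

lemma symm: "(x, u) \<in> T \<Longrightarrow> (y, v) \<in> T \<Longrightarrow> cinner u y = cinner x v"
  using in_iff by blast

lemma unique: "(x, u) \<in> T \<Longrightarrow> (x, u') \<in> T \<Longrightarrow> u = u'"
  using symm by (intro dense_cinner_ext[OF dense]) (metis DomainE)

lemma zero_in: "(0, 0) \<in> T"
  by (subst in_iff) (auto simp: cinner.zero_right)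

lemma add_in: "(x, u) \<in> T \<Longrightarrow> (y, v) \<in> T \<Longrightarrow> (x + y, u + v) \<in> T"
  by (subst in_iff) (auto simp: cinner_add_right symm)

lemma diff_in: "(x, u) \<in> T \<Longrightarrow> (y, v) \<in> T \<Longrightarrow> (x - y, u - v) \<in> T"
  by (subst in_iff) (auto simp: cinner.diff_right symm)

lemma scaleC_in: "(x, u) \<in> T \<Longrightarrow> (scaleC c x, scaleC c u) \<in> T"
  by (subst in_iff) (auto simp: cinner_scaleC_right symm)

lemma scaleR_in: "(x, u) \<in> T \<Longrightarrow> (r *\<^sub>R x, r *\<^sub>R u) \<in> T"
  using scaleC_in[of x u "of_real r"] by (simp add: scaleC_of_real)

lemma closed_in:
  assumes "\<And>n::nat. (x n, u n) \<in> T" "x \<longlonglongrightarrow> x'" "u \<longlonglongrightarrow> u'" shows "(x', u') \<in> T"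
proof (subst in_iff, safe)
  fix y v assume yv: "(y, v) \<in> T"
  have "(\<lambda>n. cinner v (x n)) \<longlonglongrightarrow> cinner v x'" by (intro cinner.tendsto tendsto_const assms)
  moreover have "(\<lambda>n. cinner v (x n)) \<longlonglongrightarrow> cinner y u'"
    unfolding symm[OF yv assms(1)] by (intro cinner.tendsto tendsto_const assms)
  ultimately show "cinner v x' = cinner y u'" by (rule LIMSEQ_unique)
qed

lemma form_real:
  assumes "(x, u) \<in> T" shows "cinner u x = complex_of_real (inner u x)"
proof -
  have "cnj (cinner u x) = cinner u x"
    using symm[OF assms assms] cinner_commute[of x u] by simp
  hence "Im (cinner u x) = 0" by (metis Reals_cnj_iff complex_is_Real_iff)
  thus ?thesis by (simp add: complex_eq_iff Re_cinner)
qed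

text \<open>The form of \<open>T\<close> is real, so the imaginary part of the form of omega - T is
  Im omega times the squared norm.\<close>

lemma norm_lower:
  assumes "(x, u) \<in> T" shows "\<bar>Im \<omega>\<bar> * norm x \<le> norm (scaleC \<omega> x - u)"
proof -
  have "cinner (scaleC \<omega> x - u) x = \<omega> * complex_of_real ((norm x)\<^sup>2) - complex_of_real (inner u x)"
    by (simp add: cinner.diff_left cinner_scaleC_left cinner_self form_real[OF assms])
  hence "Im (cinner (scaleC \<omega> x - u) x) = Im \<omega> * (norm x)\<^sup>2" by simp
  hence "\<bar>Im \<omega>\<bar> * (norm x)\<^sup>2 \<le> norm (scaleC \<omega> x - u) * norm x"
    using abs_Im_le_cmod[of "cinner (scaleC \<omega> x - u) x"] norm_cinner_le[of "scaleC \<omega> x - u" x]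
    by (simp add: abs_mult)
  thus ?thesis by (cases "norm x = 0") (auto simp: power2_eq_square)
qed

text \<open>The range of omega - T is closed by \<open>norm_lower\<close>. A nonzero vector
  orthogonal to it would be an eigenvector of \<open>T\<close> with the non-real eigenvalue
  \<open>cnj \<omega>\<close>.\<close>

lemma resolvent_surj:
  assumes \<omega>: "Im \<omega> \<noteq> 0" shows "\<exists>x. (x, scaleC \<omega> x - y) \<in> T"
proof -
  define V where "V = {scaleC \<omega> x - u | x u. (x, u) \<in> T}"
  have sub: "subspace V"
    unfolding subspace_def V_def
  proof safe
    show "\<exists>x u. 0 = scaleC \<omega> x - u \<and> (x, u) \<in> T"
      using zero_in by (intro exI[of _ 0]) (simp add: scaleC.zero_right)
  next
    fix x u y v assume "(x, u) \<in> T" "(y, v) \<in> T"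
    thus "\<exists>z w. scaleC \<omega> x - u + (scaleC \<omega> y - v) = scaleC \<omega> z - w \<and> (z, w) \<in> T"
      by (intro exI[of _ "x + y"] exI[of _ "u + v"]) (simp add: add_in scaleC_add_right)
  next
    fix r x u assume "(x, u) \<in> T"
    thus "\<exists>z w. r *\<^sub>R (scaleC \<omega> x - u) = scaleC \<omega> z - w \<and> (z, w) \<in> T"
      by (intro exI[of _ "r *\<^sub>R x"] exI[of _ "r *\<^sub>R u"]) (simp add: scaleR_in scaleC_scaleR scaleR_diff_right)
  qed
  have cl: "closed V"
    unfolding closed_sequential_limits
  proof safe
    fix f l assume f: "\<forall>n. f n \<in> V" "f \<longlonglongrightarrow> l"
    from f(1) have "\<forall>n. \<exists>x u. f n = scaleC \<omega> x - u \<and> (x, u) \<in> T" by (simp add: V_def)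
    then obtain x u where xu: "\<And>n. f n = scaleC \<omega> (x n) - u n" "\<And>n. (x n, u n) \<in> T" by metis
    have "Cauchy x"
    proof (rule CauchyI)
      fix e :: real assume e: "e > 0"
      hence "0 < e * \<bar>Im \<omega>\<bar>" using \<omega> by simp
      then obtain N where N: "\<And>m n. m \<ge> N \<Longrightarrow> n \<ge> N \<Longrightarrow> norm (f m - f n) < e * \<bar>Im \<omega>\<bar>"
        using CauchyD[OF LIMSEQ_imp_Cauchy[OF f(2)]] by blast
      show "\<exists>N. \<forall>m\<ge>N. \<forall>n\<ge>N. norm (x m - x n) < e"
      proof (intro exI allI impI)
        fix m n assume "m \<ge> N" "n \<ge> N"
        hence "norm (f m - f n) < e * \<bar>Im \<omega>\<bar>" by (rule N)
        moreover have "f m - f n = scaleC \<omega> (x m - x n) - (u m - u n)" by (simp add: xu scaleC.diff_right)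
        ultimately have "\<bar>Im \<omega>\<bar> * norm (x m - x n) < e * \<bar>Im \<omega>\<bar>"
          using norm_lower[OF diff_in[OF xu(2)[of m] xu(2)[of n]], of \<omega>] by simp
        thus "norm (x m - x n) < e" using \<omega> by (simp add: mult.commute)
      qed
    qed
    then obtain x' where x': "x \<longlonglongrightarrow> x'" using Cauchy_convergent convergent_def by blast
    have "(\<lambda>n. scaleC \<omega> (x n) - f n) \<longlonglongrightarrow> scaleC \<omega> x' - l"
      by (intro tendsto_diff scaleC.tendsto tendsto_const x' f(2))
    hence "u \<longlonglongrightarrow> scaleC \<omega> x' - l" by (simp add: xu)
    from closed_in[OF xu(2) x' this] show "l \<in> V" unfolding V_def
      by (intro CollectI exI[of _ x'] exI[of _ "scaleC \<omega> x' - l"]) simp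
  qed
  have "y \<in> V"
  proof (rule ccontr)
    assume "y \<notin> V"
    then obtain v where v: "v \<noteq> 0" "\<And>s. s \<in> V \<Longrightarrow> inner s v = 0"
      using closed_subspace_orthogonal[OF cl sub] by blast
    have "(v, scaleC (cnj \<omega>) v) \<in> T"
    proof (subst in_iff, safe)
      fix x u assume xu: "(x, u) \<in> T"
      let ?s = "scaleC \<omega> x - u"
      have 1: "?s \<in> V" unfolding V_def using xu by blast
      \<comment> \<open>\<open>v\<close> is only orthogonal for the real inner product; testing also
        with -i s upgrades this to the complex one.\<close>
      have "scaleC (-\<i>) ?s = scaleC \<omega> (scaleC (-\<i>) x) - scaleC (-\<i>) u"
        by (simp add: scaleC.diff_right scaleC_scaleC mult.commute)
      hence 2: "scaleC (-\<i>) ?s \<in> V" unfolding V_def using scaleC_in[OF xu, of "-\<i>"] by blast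
      have "Re (cinner ?s v) = 0" "Re (cinner (scaleC (-\<i>) ?s) v) = 0"
        using v(2)[OF 1] v(2)[OF 2] by (simp_all add: Re_cinner)
      hence "cinner ?s v = 0" by (simp add: complex_eq_iff cinner_scaleC_left)
      thus "cinner u v = cinner x (scaleC (cnj \<omega>) v)"
        by (simp add: cinner.diff_left cinner_scaleC_left cinner_scaleC_right)
    qed
    from form_real[OF this] have "cnj \<omega> * complex_of_real ((norm v)\<^sup>2) = complex_of_real (inner (scaleC (cnj \<omega>) v) v)"
      by (simp only: cinner_scaleC_left cinner_self)
    hence "Im (cnj \<omega> * complex_of_real ((norm v)\<^sup>2)) = 0" by (metis Im_complex_of_real)
    thus False using \<omega> v(1) by simp
  qed
  then obtain x u where xu: "y = scaleC \<omega> x - u" "(x, u) \<in> T" unfolding V_def by blast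
  hence "u = scaleC \<omega> x - y" by simp
  thus ?thesis using xu by blast
qed

lemma resolvent_unique:
  assumes "Im \<omega> \<noteq> 0" "(x, scaleC \<omega> x - y) \<in> T" "(x', scaleC \<omega> x' - y) \<in> T" shows "x = x'"
proof -
  have "\<bar>Im \<omega>\<bar> * norm (x - x') \<le> 0"
    using norm_lower[OF diff_in[OF assms(2,3)], of \<omega>] by (simp add: scaleC.diff_right)
  thus ?thesis using assms(1) by (simp add: mult_le_0_iff)
qed

text \<open>The resolvent read off the graph: (omega - T) x = y means that (x, omega x - y) lies in
  \<open>T\<close>.\<close>

definition rsv_fun :: "complex \<Rightarrow> 'h \<Rightarrow> 'h" where
  "rsv_fun \<omega> y = (THE x. (x, scaleC \<omega> x - y) \<in> T)"

definition rsv :: "complex \<Rightarrow> 'h adop" where "rsv \<omega> = Adop (rsv_fun \<omega>)"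

context
  fixes \<omega> :: complex
  assumes \<omega>: "Im \<omega> \<noteq> 0"
begin

lemma rsv_fun_in: "(rsv_fun \<omega> y, scaleC \<omega> (rsv_fun \<omega> y) - y) \<in> T"
  unfolding rsv_fun_def using resolvent_surj[OF \<omega>, of y] resolvent_unique[OF \<omega>] by (metis (mono_tags, lifting) theI')

lemma rsv_fun_eqI: "(x, scaleC \<omega> x - y) \<in> T \<Longrightarrow> rsv_fun \<omega> y = x"
  using resolvent_unique[OF \<omega>] rsv_fun_in by blast

lemma rsv_fun_norm: "norm (rsv_fun \<omega> y) \<le> norm y * (1 / \<bar>Im \<omega>\<bar>)"
  using norm_lower[OF rsv_fun_in[of y], of \<omega>] \<omega> by (simp add: field_simps)

lemma rsv_fun_bounded: "bounded_operator (rsv_fun \<omega>)"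
  unfolding bounded_operator_def
proof (safe intro!: bounded_linear_intro[where K="1 / \<bar>Im \<omega>\<bar>"] rsv_fun_norm rsv_fun_eqI)
  fix x y
  have "scaleC \<omega> (rsv_fun \<omega> x + rsv_fun \<omega> y) - (x + y)
    = (scaleC \<omega> (rsv_fun \<omega> x) - x) + (scaleC \<omega> (rsv_fun \<omega> y) - y)" by (simp add: scaleC_add_right)
  thus "(rsv_fun \<omega> x + rsv_fun \<omega> y, scaleC \<omega> (rsv_fun \<omega> x + rsv_fun \<omega> y) - (x + y)) \<in> T"
    using add_in[OF rsv_fun_in[of x] rsv_fun_in[of y]] by (simp only:)
next
  fix r x
  have "scaleC \<omega> (r *\<^sub>R rsv_fun \<omega> x) - r *\<^sub>R x = r *\<^sub>R (scaleC \<omega> (rsv_fun \<omega> x) - x)"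
    by (simp add: scaleC_scaleR scaleR_diff_right)
  thus "(r *\<^sub>R rsv_fun \<omega> x, scaleC \<omega> (r *\<^sub>R rsv_fun \<omega> x) - r *\<^sub>R x) \<in> T"
    using scaleR_in[OF rsv_fun_in[of x], of r] by (simp only:)
next
  fix c x
  have "scaleC \<omega> (scaleC c (rsv_fun \<omega> x)) - scaleC c x = scaleC c (scaleC \<omega> (rsv_fun \<omega> x) - x)"
    by (simp add: scaleC.diff_right scaleC_scaleC mult.commute)
  thus "(scaleC c (rsv_fun \<omega> x), scaleC \<omega> (scaleC c (rsv_fun \<omega> x)) - scaleC c x) \<in> T"
    using scaleC_in[OF rsv_fun_in[of x], of c] by (simp only:)
qed

end

lemma rsv_fun_adjoint:
  assumes "Im \<omega> \<noteq> 0" shows "is_adjoint (rsv_fun \<omega>) (rsv_fun (cnj \<omega>))"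
  unfolding is_adjoint_def
proof safe
  fix y z
  have c: "Im (cnj \<omega>) \<noteq> 0" using assms by simp
  have "cinner (scaleC \<omega> (rsv_fun \<omega> y) - y) (rsv_fun (cnj \<omega>) z)
     = cinner (rsv_fun \<omega> y) (scaleC (cnj \<omega>) (rsv_fun (cnj \<omega>) z) - z)"
    by (rule symm[OF rsv_fun_in[OF assms] rsv_fun_in[OF c]])
  thus "cinner (rsv_fun \<omega> y) z = cinner y (rsv_fun (cnj \<omega>) z)"
    by (simp add: cinner.diff_left cinner.diff_right cinner_scaleC_left cinner_scaleC_right)
qed

context
  fixes \<omega> :: complex
  assumes \<omega>: "Im \<omega> \<noteq> 0"
begin

lemma app_rsv: "app (rsv \<omega>) = rsv_fun \<omega>"
  unfolding rsv_def using rsv_fun_bounded[OF \<omega>] rsv_fun_bounded[of "cnj \<omega>"] rsv_fun_adjoint[OF \<omega>] \<omega>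
  by (intro Adop_inverse) auto

lemma rsv_in: "(app (rsv \<omega>) y, scaleC \<omega> (app (rsv \<omega>) y) - y) \<in> T"
  using rsv_fun_in[OF \<omega>] by (simp add: app_rsv)

lemma rsv_eq: "(x, u) \<in> T \<Longrightarrow> app (rsv \<omega>) (scaleC \<omega> x - u) = x"
  using rsv_fun_eqI[OF \<omega>, of x "scaleC \<omega> x - u"] by (simp add: app_rsv)

lemma rsv_bnd: "bnd (rsv \<omega>) (1 / \<bar>Im \<omega>\<bar>)"
  using rsv_fun_norm[OF \<omega>] by (simp add: bnd_def app_rsv mult.commute)

text \<open>Operators in the commutant preserve the graph of \<open>T\<close>, and the graph
  determines the resolvent, so the two commute.\<close>

lemma rsv_in_vN:
  assumes "von_neumann_algebra N" "affiliated N T"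
  shows "rsv \<omega> \<in> ops N"
proof -
  interpret vN N by unfold_locales (rule assms)
  show ?thesis unfolding ops_iff
  proof safe
    fix B x assume B: "B \<in> commutant N"
    have b: "bounded_operator B" by (rule commutant_bo[OF B])
    have "(B (app (rsv \<omega>) x), B (scaleC \<omega> (app (rsv \<omega>) x) - x)) \<in> T"
      using assms(2) B rsv_in[of x] unfolding affiliated_def by blast
    moreover have "B (scaleC \<omega> (app (rsv \<omega>) x) - x) = scaleC \<omega> (B (app (rsv \<omega>) x)) - B x"
      using b by (simp add: bounded_operator_def linear_simps)
    ultimately show "app (rsv \<omega>) (B x) = B (app (rsv \<omega>) x)"
      using rsv_eq by fastforce
  qed
qed

lemma rsv_generated: "app (rsv \<omega>) \<in> generated_vN T"
  using rsv_in_vN by (auto simp: generated_vN_def ops_def)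

end

lemma star_rsv: "Im \<omega> \<noteq> 0 \<Longrightarrow> star (rsv \<omega>) = rsv (cnj \<omega>)"
  using rsv_fun_adjoint[of \<omega>] app_rsv[of \<omega>] app_rsv[of "cnj \<omega>"] by (intro star_eqI) simp

lemma rsv_identity:
  assumes "Im \<omega> \<noteq> 0" "Im \<omega>' \<noteq> 0"
  shows "rsv \<omega> - rsv \<omega>' = cs (\<omega>' - \<omega>) * (rsv \<omega> * rsv \<omega>')"
proof (rule adop_eqI)
  fix y
  let ?x = "app (rsv \<omega>') y"
  have "?x = app (rsv \<omega>) (scaleC \<omega> ?x - (scaleC \<omega>' ?x - y))"
    using rsv_eq[OF assms(1) rsv_in[OF assms(2), of y]] by simp
  also have "scaleC \<omega> ?x - (scaleC \<omega>' ?x - y) = y - scaleC (\<omega>' - \<omega>) ?x"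
    by (simp add: scaleC.diff_left)
  finally have "?x = app (rsv \<omega>) (y - scaleC (\<omega>' - \<omega>) ?x)" .
  thus "app (rsv \<omega> - rsv \<omega>') y = app (cs (\<omega>' - \<omega>) * (rsv \<omega> * rsv \<omega>')) y"
    by (simp add: app_linear app_scaleC eq_diff_eq diff_eq_eq add.commute)
qed

end

section \<open>Spectral measures and laws\<close>

locale spectral_op = self_adjoint T for T :: "('h::complex_hilbert_space \<times> 'h) set" +
  fixes E :: "real set \<Rightarrow> 'h \<Rightarrow> 'h"
  assumes spectral: "spectral_measure_of T E"
begin

lemma pvm: "projection_valued_measure E"
  using spectral by (simp add: spectral_measure_of_def)

lemma E_bo: "B \<in> sets borel \<Longrightarrow> bounded_operator (E B)"
  and E_adj: "B \<in> sets borel \<Longrightarrow> is_adjoint (E B) (E B)"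
  and E_Int: "A \<in> sets borel \<Longrightarrow> B \<in> sets borel \<Longrightarrow> E A (E B x) = E (A \<inter> B) x"
  and E_UNIV: "E UNIV x = x"
  using pvm by (simp_all add: projection_valued_measure_def)

lemma E_sums: "range B \<subseteq> sets borel \<Longrightarrow> disjoint_family B \<Longrightarrow> (\<lambda>n::nat. E (B n) x) sums E (\<Union>n. B n) x"
  using pvm by (simp add: projection_valued_measure_def)

lemma E_linear: "B \<in> sets borel \<Longrightarrow> bounded_linear (E B)"
  using E_bo by (simp add: bounded_operator_def)

lemma E_scaleC: "B \<in> sets borel \<Longrightarrow> E B (scaleC c x) = scaleC c (E B x)"
  using E_bo by (simp add: bounded_operator_def)

lemmas E_lin = linear_simps[OF E_linear]

lemma E_idem: "B \<in> sets borel \<Longrightarrow> E B (E B x) = E B x"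
  by (simp add: E_Int)

lemma E_empty: "E {} x = 0"
proof -
  have "(\<lambda>n::nat. E {} x) sums E (\<Union>n::nat. {}) x"
    by (rule E_sums) (auto simp: disjoint_family_on_def)
  hence "summable (\<lambda>n::nat. E {} x)" by (rule sums_summable)
  thus ?thesis by (simp add: summable_const_iff)
qed

lemma E_Un:
  assumes "A \<in> sets borel" "B \<in> sets borel" "A \<inter> B = {}"
  shows "E (A \<union> B) x = E A x + E B x"
proof -
  have "(\<lambda>n. E (binaryset A B n) x) sums E (\<Union>n. binaryset A B n) x"
    by (rule E_sums) (use assms in \<open>auto simp: range_binaryset_eq disjoint_family_on_def binaryset_def\<close>)
  moreover have "(\<lambda>n. E (binaryset A B n) x) sums (E A x + E B x)"
    using binaryset_sums[of "\<lambda>A. E A x" A B] by (simp add: E_empty)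
  ultimately show ?thesis by (metis UN_binaryset_eq sums_unique2)
qed

lemma E_Compl: "B \<in> sets borel \<Longrightarrow> E (- B) x = x - E B x"
  using E_Un[of B "- B" x] by (simp add: E_UNIV eq_diff_eq add.commute borel_comp)

lemma E_inner: "B \<in> sets borel \<Longrightarrow> inner (E B x) y = inner x (E B y)"
  using E_adj[of B] unfolding is_adjoint_def by (metis Re_cinner)

lemma norm_E: "B \<in> sets borel \<Longrightarrow> (norm (E B x))\<^sup>2 = inner (E B x) x"
  by (simp add: power2_norm_eq_inner E_inner[of B x] E_idem inner_commute)

abbreviation m :: "'h \<Rightarrow> real measure" where "m \<equiv> scalar_spectral_measure E"

lemma sets_m [simp]: "sets (m x) = sets borel"
  using sets.sigma_sets_eq[of "borel :: real measure"] by (simp add: scalar_spectral_measure_def)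

lemma space_m [simp]: "space (m x) = UNIV"
  by (simp add: scalar_spectral_measure_def)

lemma emeasure_m: "B \<in> sets borel \<Longrightarrow> emeasure (m x) B = ennreal ((norm (E B x))\<^sup>2)"
proof (rule emeasure_measure_of[OF scalar_spectral_measure_def[of E x]])
  show "positive (sets (m x)) (\<lambda>B. ennreal ((norm (E B x))\<^sup>2))"
    by (simp add: positive_def E_empty)
  show "countably_additive (sets (m x)) (\<lambda>B. ennreal ((norm (E B x))\<^sup>2))"
    unfolding countably_additive_def
  proof safe
    fix A :: "nat \<Rightarrow> real set"
    assume A: "range A \<subseteq> sets (m x)" "disjoint_family A" "(\<Union>i. A i) \<in> sets (m x)"
    have "(\<lambda>n. inner (E (A n) x) x) sums inner (E (\<Union>n. A n) x) x"
      using A by (intro bounded_linear.sums[OF bounded_linear_inner_left] E_sums) auto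
    moreover have "(norm (E (A n) x))\<^sup>2 = inner (E (A n) x) x" for n
      using A by (intro norm_E) auto
    moreover have "(norm (E (\<Union>n. A n) x))\<^sup>2 = inner (E (\<Union>n. A n) x) x"
      using A by (intro norm_E) simp
    ultimately show "(\<Sum>i. ennreal ((norm (E (A i) x))\<^sup>2)) = ennreal ((norm (E (\<Union>i. A i) x))\<^sup>2)"
      by (intro suminf_ennreal_eq zero_le_power2) simp
  qed
qed auto

lemma finite_m: "finite_measure (m x)"
  by (rule finite_measureI) (simp add: emeasure_m E_UNIV)

lemma measure_m: "B \<in> sets borel \<Longrightarrow> measure (m x) B = (norm (E B x))\<^sup>2"
  by (simp add: measure_def emeasure_m)

lemma borel_m [simp]: "borel_measurable (m x) = borel_measurable borel"
  by (rule measurable_cong_sets) simp_all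

lemma AE_m: "B \<in> sets borel \<Longrightarrow> E B x = x \<Longrightarrow> AE t in m x. t \<in> B"
  by (rule AE_I[where N="- B"]) (auto simp: emeasure_m E_Compl borel_comp)

lemma m_E: 
  assumes "C \<in> sets borel"
  shows "m (E C z) = density (m z) (\<lambda>t. ennreal (indicator C t))"
proof (rule measure_eqI)
  fix A assume "A \<in> sets (m (E C z))"
  hence A: "A \<in> sets borel" by simp
  show "emeasure (m (E C z)) A = emeasure (density (m z) (\<lambda>t. ennreal (indicator C t))) A"
    using A assms unfolding ennreal_indicator
    by (subst emeasure_restricted) (auto simp: emeasure_m E_Int Int_commute)
qed simp

lemma integral_m_E:
  assumes "C \<in> sets borel" "f \<in> borel_measurable borel"
  shows "(\<integral>t. f t \<partial>m (E C z)) = (\<integral>t. indicator C t * (f t :: real) \<partial>m z)"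
  unfolding m_E[OF assms(1)] using assms by (subst integral_density) auto

lemma domain_iff: "(\<exists>u. (x, u) \<in> T) \<longleftrightarrow> integrable (m x) (\<lambda>t. t\<^sup>2)"
proof -
  have "Domain T = {x. integrable (m x) (\<lambda>t. t\<^sup>2)}" using spectral by (simp add: spectral_measure_of_def)
  thus ?thesis by blast
qed

lemma form: assumes "(x, u) \<in> T" shows "inner u x = (\<integral>t. t \<partial>m x)"
proof -
  have "cinner u x = complex_of_real (\<integral>t. t \<partial>m x)"
    using spectral assms unfolding spectral_measure_of_def by blast
  thus ?thesis by (metis Re_cinner Re_complex_of_real)
qed

lemma integrable_id:
  assumes "(x, u) \<in> T" shows "integrable (m x) (\<lambda>t. t)"
proof -
  interpret finite_measure "m x" by (rule finite_m)
  have "integrable (m x) (\<lambda>t. t\<^sup>2)" using assms domain_iff[of x] by blast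
  hence "integrable (m x) (\<lambda>t. 1 + t\<^sup>2)" by simp
  thus ?thesis
  proof (rule Bochner_Integration.integrable_bound)
    have "\<bar>t\<bar> \<le> 1 + t\<^sup>2" for t :: real
      using sum_power2_ge_zero[of "\<bar>t\<bar> - 1" 0] by (simp add: power2_diff)
    thus "AE t in m x. norm t \<le> norm (1 + t\<^sup>2)" by (auto intro!: always_eventually order_trans[OF _ abs_ge_self])
  qed simp
qed

lemma range_domain:
  assumes B: "B \<in> sets borel" "B \<subseteq> {-K..K}" "E B x = x"
  shows "\<exists>u. (x, u) \<in> T"
  unfolding domain_iff
proof -
  interpret finite_measure "m x" by (rule finite_m)
  have "AE t in m x. norm (t\<^sup>2) \<le> K\<^sup>2"
    using AE_m[OF B(1,3)]
  proof eventually_elim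
    case (elim t)
    hence "t \<in> {-K..K}" using B(2) by blast
    hence "\<bar>t\<bar> \<le> K" by (simp add: abs_le_iff)
    thus ?case by (metis abs_ge_zero norm_power power_mono real_norm_def)
  qed
  thus "integrable (m x) (\<lambda>t. t\<^sup>2)" by (intro integrable_const_bound) auto
qed

text \<open>\<open>T\<close> is linked to \<open>E\<close> only by its domain and quadratic form, so
  the reduction of \<open>T\<close> by spectral subspaces has to be derived. Splitting the form at x
  + y over \<open>C\<close> and its complement cancels the diagonal terms; symmetry of
  \<open>T\<close> makes the two cross terms equal.\<close>

lemma spectral_orthogonal:
  assumes C: "C \<in> sets borel" and xu: "(x, u) \<in> T" "E C x = x" and yv: "(y, v) \<in> T" "E C y = 0"
  shows "cinner u y = 0"
proof -
  have *: "inner u y = 0" if yv: "(y, v) \<in> T" "E C y = 0" for y v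
  proof -
    have zw: "(x + y, u + v) \<in> T" by (rule add_in[OF xu(1) yv(1)])
    have z: "E C (x + y) = x" "E (- C) (x + y) = y"
      using C xu yv by (simp_all add: E_Compl E_lin)
    have "inner (u + v) (x + y) = (\<integral>t. t \<partial>m (x + y))" by (rule form[OF zw])
    also have "\<dots> = (\<integral>t. indicator C t * t + indicator (- C) t * t \<partial>m (x + y))"
      by (rule Bochner_Integration.integral_cong) (auto simp: indicator_def)
    also have "\<dots> = (\<integral>t. indicator C t * t \<partial>m (x + y)) + (\<integral>t. indicator (- C) t * t \<partial>m (x + y))"
    proof (rule Bochner_Integration.integral_add)
      have i: "integrable (m (x + y)) (\<lambda>t. t)" by (rule integrable_id[OF zw])
      show "integrable (m (x + y)) (\<lambda>t. indicator C t * t)" "integrable (m (x + y)) (\<lambda>t. indicator (- C) t * t)"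
        using C i by (auto intro!: integrable_real_mult_indicator simp: mult.commute[of "indicator _ _"] borel_comp)
    qed
    also have "\<dots> = inner u x + inner v y"
      using integral_m_E[of C "\<lambda>t. t" "x + y"] integral_m_E[of "- C" "\<lambda>t. t" "x + y"] C
      by (simp add: z form[OF xu(1)] form[OF yv(1)] borel_comp)
    finally have "inner u y + inner v x = 0" by (simp add: inner_add_left inner_add_right)
    moreover have "inner v x = inner u y"
      using symm[OF xu(1) yv(1)] by (metis Re_cinner inner_commute)
    ultimately show ?thesis by simp
  qed
  have "Re (cinner u y) = 0" using *[OF yv] by (simp add: Re_cinner)
  moreover have "Re (cinner u (scaleC \<i> y)) = 0"
    using *[OF scaleC_in[OF yv(1), of \<i>]] yv(2) C by (simp add: Re_cinner E_scaleC scaleC.zero_right)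
  ultimately show ?thesis by (simp add: complex_eq_iff cinner_scaleC_right)
qed

text \<open>By orthogonality \<open>u\<close> is perpendicular to y - E B y for all \<open>y\<close>
  in the dense domain; E B y is in the domain because \<open>B\<close> is bounded.\<close>

lemma range_invariant:
  assumes B: "B \<in> sets borel" "B \<subseteq> {-K..K}" "E B x = x" and xu: "(x, u) \<in> T"
  shows "E B u = u"
proof (rule dense_cinner_ext[OF dense])
  fix y assume "y \<in> Domain T"
  then obtain v where yv: "(y, v) \<in> T" by blast
  obtain w where w: "(E B y, w) \<in> T" using range_domain[OF B(1,2)] E_idem[OF B(1)] by blast
  have "cinner u (y - E B y) = 0"
    by (rule spectral_orthogonal[OF B(1) xu B(3) diff_in[OF yv w]]) (simp add: B E_lin E_idem)
  hence "cinner u y = cinner (E B u) y"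
    using E_adj[OF B(1)] by (simp add: cinner.diff_right is_adjoint_def)
  thus "cinner y (E B u) = cinner y u" by (metis cinner_commute)
qed

text \<open>The form of T - c is at most delta on the range of E B. Polarising between
  \<open>x\<close> and a multiple of s = (T - c) x turns this form bound into a norm bound.\<close>

lemma spectral_local:
  assumes B: "B \<in> sets borel" "B \<subseteq> {c - \<delta>..c + \<delta>}" "E B x = x" and xu: "(x, u) \<in> T" and \<delta>: "\<delta> \<ge> 0"
  shows "norm (u - c *\<^sub>R x) \<le> \<delta> * norm x"
proof -
  define K where "K = \<bar>c\<bar> + \<delta>"
  have BK: "B \<subseteq> {-K..K}"
  proof
    fix t assume "t \<in> B"
    hence "t \<in> {c - \<delta>..c + \<delta>}" using B(2) by blast
    thus "t \<in> {-K..K}" by (auto simp: K_def)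
  qed
  have Q: "\<bar>inner (w - c *\<^sub>R z) z\<bar> \<le> \<delta> * (norm z)\<^sup>2" if zw: "(z, w) \<in> T" "E B z = z" for z w
  proof -
    interpret finite_measure "m z" by (rule finite_m)
    have mu: "measure (m z) UNIV = (norm z)\<^sup>2" by (simp add: measure_m E_UNIV)
    have "inner (w - c *\<^sub>R z) z = (\<integral>t. t \<partial>m z) - (\<integral>t. c \<partial>m z)"
      by (simp add: inner_diff_left form[OF zw(1)] mu power2_norm_eq_inner)
    also have "\<dots> = (\<integral>t. t - c \<partial>m z)"
      by (rule Bochner_Integration.integral_diff[symmetric]) (auto intro: integrable_id[OF zw(1)])
    also have "\<bar>\<dots>\<bar> \<le> (\<integral>t. \<bar>t - c\<bar> \<partial>m z)" by (rule integral_abs_bound)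
    also have "\<dots> \<le> (\<integral>t. \<delta> \<partial>m z)"
    proof (rule integral_mono_AE)
      show "integrable (m z) (\<lambda>t. \<bar>t - c\<bar>)" by (auto intro!: integrable_abs integrable_id[OF zw(1)])
      show "AE t in m z. \<bar>t - c\<bar> \<le> \<delta>" using AE_m[OF B(1) zw(2)]
      proof eventually_elim
        case (elim t)
        hence "t \<in> {c - \<delta>..c + \<delta>}" using B(2) by blast
        thus ?case by (simp add: abs_le_iff)
      qed
    qed simp
    finally show ?thesis by (simp add: mu mult.commute)
  qed
  define s where "s = u - c *\<^sub>R x"
  have Es: "E B s = s" using range_invariant[OF B(1) BK B(3) xu] B by (simp add: s_def E_lin)
  show ?thesis
  proof (cases "s = 0")
    case True thus ?thesis using \<delta> by (simp add: s_def)
  next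
    case False
    \<comment> \<open>Scaling \<open>s\<close> to the length of \<open>x\<close> makes the
      parallelogram sum equal to 4 times the squared norm of \<open>x\<close>.\<close>
    define r where "r = norm x / norm s"
    define y where "y = r *\<^sub>R s"
    have Ey: "E B y = y" using B Es by (simp add: y_def E_lin)
    obtain v where v: "(y, v) \<in> T" using range_domain[OF B(1) BK Ey] by blast
    have ny: "norm y = norm x" using False by (simp add: y_def r_def)
    have vx: "inner v x = inner u y" using symm[OF xu v] by (metis Re_cinner inner_commute)
    have 1: "\<bar>inner (u + v - c *\<^sub>R (x + y)) (x + y)\<bar> \<le> \<delta> * (norm (x + y))\<^sup>2"
      by (rule Q[OF add_in[OF xu v]]) (simp add: B E_lin Ey)
    have 2: "\<bar>inner (u - v - c *\<^sub>R (x - y)) (x - y)\<bar> \<le> \<delta> * (norm (x - y))\<^sup>2"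
      by (rule Q[OF diff_in[OF xu v]]) (simp add: B E_lin Ey)
    have "4 * inner s y = inner (u + v - c *\<^sub>R (x + y)) (x + y) - inner (u - v - c *\<^sub>R (x - y)) (x - y)"
      by (simp add: s_def inner_add_left inner_add_right inner_diff_left inner_diff_right vx inner_commute[of y x] algebra_simps)
    also have "\<dots> \<le> \<delta> * (norm (x + y))\<^sup>2 + \<delta> * (norm (x - y))\<^sup>2" using 1 2 by linarith
    also have "\<dots> = \<delta> * (2 * (norm x)\<^sup>2 + 2 * (norm y)\<^sup>2)"
      by (simp add: power2_norm_eq_inner inner_add_left inner_add_right inner_diff_left inner_diff_right algebra_simps)
    finally have "inner s y \<le> \<delta> * (norm x)\<^sup>2" by (simp add: ny)
    moreover have "inner s y = norm x * norm s"
      using False by (simp add: y_def r_def power2_norm_eq_inner[symmetric] power2_eq_square)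
    ultimately have "norm x * norm s \<le> norm x * (\<delta> * norm x)" by (simp add: power2_eq_square algebra_simps)
    moreover have "norm s = 0" if "norm x = 0"
    proof -
      have "x = 0" using that by simp
      thus ?thesis using xu zero_in unique by (auto simp: s_def)
    qed
    ultimately have "norm s \<le> \<delta> * norm x" using False by (cases "norm x = 0") auto
    thus ?thesis by (simp add: s_def)
  qed
qed

lemma m_nonnull: "AE t in m x. False \<Longrightarrow> x = 0"
proof -
  assume "AE t in m x. False"
  then obtain N where "{t \<in> space (m x). \<not> False} \<subseteq> N" "emeasure (m x) N = 0" by (elim AE_E)
  hence "emeasure (m x) UNIV = 0" by (simp add: top.extremum_unique)
  thus "x = 0" by (simp add: emeasure_m E_UNIV)
qed

text \<open>Strictness matters: it excludes nonzero vectors common to this spectral subspace and to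
  a subspace where the form is at most \<open>K\<close>.\<close>

lemma spectral_gt:
  assumes xu: "(x, u) \<in> T" and E: "E {K<..} x = x" and "x \<noteq> 0"
  shows "K * (norm x)\<^sup>2 < inner u x"
proof -
  interpret finite_measure "m x" by (rule finite_m)
  have mu: "measure (m x) UNIV = (norm x)\<^sup>2" by (simp add: measure_m E_UNIV)
  have AE: "AE t in m x. t \<in> {K<..}" by (rule AE_m[OF _ E]) simp
  have i: "integrable (m x) (\<lambda>t. t - K)" by (auto intro: integrable_id[OF xu])
  have nn: "AE t in m x. 0 \<le> t - K" using AE by eventually_elim simp
  have "(\<integral>t. t - K \<partial>m x) \<noteq> 0"
  proof
    assume "(\<integral>t. t - K \<partial>m x) = 0"
    hence "AE t in m x. t - K = 0" using integral_nonneg_eq_0_iff_AE[OF i nn] by simp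
    hence "AE t in m x. False" using AE by eventually_elim simp
    thus False using m_nonnull assms(3) by blast
  qed
  moreover have "0 \<le> (\<integral>t. t - K \<partial>m x)" by (rule integral_nonneg_AE[OF nn])
  moreover have "(\<integral>t. t - K \<partial>m x) = inner u x - K * (norm x)\<^sup>2"
    using integrable_id[OF xu] by (simp add: form[OF xu] mu)
  ultimately show ?thesis by linarith
qed

lemma spectral_lt:
  assumes xu: "(x, u) \<in> T" and E: "E {..<K} x = x" and "x \<noteq> 0"
  shows "inner u x < K * (norm x)\<^sup>2"
proof -
  interpret finite_measure "m x" by (rule finite_m)
  have mu: "measure (m x) UNIV = (norm x)\<^sup>2" by (simp add: measure_m E_UNIV)
  have AE: "AE t in m x. t \<in> {..<K}" by (rule AE_m[OF _ E]) simp
  have i: "integrable (m x) (\<lambda>t. K - t)" by (auto intro: integrable_id[OF xu])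
  have nn: "AE t in m x. 0 \<le> K - t" using AE by eventually_elim simp
  have "(\<integral>t. K - t \<partial>m x) \<noteq> 0"
  proof
    assume "(\<integral>t. K - t \<partial>m x) = 0"
    hence "AE t in m x. K - t = 0" using integral_nonneg_eq_0_iff_AE[OF i nn] by simp
    hence "AE t in m x. False" using AE by eventually_elim simp
    thus False using m_nonnull assms(3) by blast
  qed
  moreover have "0 \<le> (\<integral>t. K - t \<partial>m x)" by (rule integral_nonneg_AE[OF nn])
  moreover have "(\<integral>t. K - t \<partial>m x) = K * (norm x)\<^sup>2 - inner u x"
    using integrable_id[OF xu] by (simp add: form[OF xu] mu)
  ultimately show ?thesis by linarith
qed

end

section \<open>The trace of the resolvent as the Cauchy transform of the law\<close>

locale law_op = tracial_W_star_probability_space M \<tau>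
  for M :: "('h::complex_hilbert_space \<Rightarrow> 'h) set" and \<tau> :: "('h \<Rightarrow> 'h) \<Rightarrow> complex" +
  fixes T :: "('h \<times> 'h) set" and \<mu> :: "real measure"
  assumes law: "has_law M \<tau> T \<mu>"
begin

definition E :: "real set \<Rightarrow> 'h \<Rightarrow> 'h" where
  "E = (SOME E. spectral_measure_of T E \<and>
    (\<forall>B\<in>sets borel. E B \<in> M \<and> complex_of_real (measure \<mu> B) = \<tau> (E B)))"

lemma E_spec: "spectral_measure_of T E" "\<And>B. B \<in> sets borel \<Longrightarrow> E B \<in> M"
  "\<And>B. B \<in> sets borel \<Longrightarrow> \<tau> (E B) = complex_of_real (measure \<mu> B)"
proof -
  have "\<exists>E. spectral_measure_of T E \<and> (\<forall>B\<in>sets borel. E B \<in> M \<and> complex_of_real (measure \<mu> B) = \<tau> (E B))"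
    using law unfolding has_law_def by blast
  from someI_ex[OF this] have "spectral_measure_of T E \<and> (\<forall>B\<in>sets borel. E B \<in> M \<and> complex_of_real (measure \<mu> B) = \<tau> (E B))"
    unfolding E_def[symmetric] .
  thus "spectral_measure_of T E" "\<And>B. B \<in> sets borel \<Longrightarrow> E B \<in> M"
    "\<And>B. B \<in> sets borel \<Longrightarrow> \<tau> (E B) = complex_of_real (measure \<mu> B)" by auto
qed

lemma aff: "affiliated M T"
  using law by (simp add: has_law_def random_var_def)

sublocale spectral_op T E
  by unfold_locales (use law E_spec in \<open>simp_all add: has_law_def random_var_def\<close>)

sublocale D: real_distribution \<mu>
  using law by (simp add: has_law_def)

definition P :: "real set \<Rightarrow> 'h adop" where "P B = Adop (E B)"

context
  fixes B :: "real set"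
  assumes B: "B \<in> sets borel"
begin

lemma app_P: "app (P B) = E B" and P_M [simp]: "P B \<in> ops M"
  unfolding P_def using ops_Adop[OF E_spec(2)[OF B]] by simp_all

lemma P_proj [simp]: "is_proj (P B)"
proof -
  have "star (P B) = P B" by (rule star_eqI) (simp add: app_P E_adj[OF B])
  thus ?thesis unfolding is_proj_def using E_idem[OF B] by (auto intro!: adop_eqI simp: app_P)
qed

lemma tr_P: "tr (P B) = complex_of_real (measure \<mu> B)"
  using E_spec(3)[OF B] by (simp add: tr_def app_P)

lemma nn_P: "nn (P B) = sqrt (measure \<mu> B)"
  by (simp add: nn_def tr_proj_n2 tr_P)

end

lemma rsv_M [simp]: "Im \<omega> \<noteq> 0 \<Longrightarrow> rsv \<omega> \<in> ops M"
  by (rule rsv_in_vN[OF _ von_neumann aff])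

text \<open>Comparing \<open>\<tau>(R P\<^sub>B)\<close> with the integral over \<open>B\<close>; both are additive in \<open>B\<close>, so it is enough to
  bound their difference on short intervals.\<close>

definition discr :: "complex \<Rightarrow> real set \<Rightarrow> complex" where
  "discr \<omega> B = tr (rsv \<omega> * P B) - (\<integral>t. indicator B t *\<^sub>R (1 / (\<omega> - complex_of_real t)) \<partial>\<mu>)"

context
  fixes \<omega> :: complex
  assumes \<omega>: "Im \<omega> \<noteq> 0"
begin

lemma discr_integrable:
  assumes "B \<in> sets borel" shows "integrable \<mu> (\<lambda>t. indicator B t *\<^sub>R (1 / (\<omega> - complex_of_real t)))"
  by (rule integrable_mult_indicator) (use assms D.integrable_resolvent[OF \<omega>] in simp_all)

lemma discr_Un:
  assumes "A \<in> sets borel" "B \<in> sets borel" "A \<inter> B = {}"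
  shows "discr \<omega> (A \<union> B) = discr \<omega> A + discr \<omega> B"
proof -
  have "P (A \<union> B) = P A + P B" using assms by (intro adop_eqI) (simp add: app_P E_Un)
  hence 1: "tr (rsv \<omega> * P (A \<union> B)) = tr (rsv \<omega> * P A) + tr (rsv \<omega> * P B)"
    using assms \<omega> by (simp add: distrib_left tr_add)
  have "indicator (A \<union> B) t *\<^sub>R (1 / (\<omega> - complex_of_real t))
     = indicator A t *\<^sub>R (1 / (\<omega> - complex_of_real t)) + indicator B t *\<^sub>R (1 / (\<omega> - complex_of_real t))" for t
    using assms(3) by (auto simp: indicator_def)
  thus ?thesis unfolding discr_def 1
    using discr_integrable assms by simp
qed

lemma integral_indicator_bound:
  fixes f :: "real \<Rightarrow> complex"
  assumes "B \<in> sets borel" "f \<in> borel_measurable borel" "\<And>t. t \<in> B \<Longrightarrow> norm (f t) \<le> K" "0 \<le> K"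
  shows "norm (\<integral>t. indicator B t *\<^sub>R f t \<partial>\<mu>) \<le> K * measure \<mu> B"
proof -
  have le: "norm (indicator B t *\<^sub>R f t) \<le> K * indicator B t" for t
    using assms by (auto simp: indicator_def)
  have i: "integrable \<mu> (\<lambda>t. indicator B t *\<^sub>R f t)"
    using assms le by (intro D.integrable_bdd[where B=K]) (auto simp: indicator_def)
  have "norm (\<integral>t. indicator B t *\<^sub>R f t \<partial>\<mu>) \<le> (\<integral>t. norm (indicator B t *\<^sub>R f t) \<partial>\<mu>)"
    by (rule integral_norm_bound)
  also have "\<dots> \<le> (\<integral>t. K * indicator B t \<partial>\<mu>)"
  proof (rule integral_mono)
    show "integrable \<mu> (\<lambda>t. K * indicator B t)" using assms by (simp add: D.emeasure_finite less_top[symmetric])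
  qed (use i[THEN integrable_norm] le in auto)
  also have "\<dots> = K * measure \<mu> B" using assms by simp
  finally show ?thesis .
qed

text \<open>A crude bound for the part outside a large interval: writing the projection as its own
  square splits the trace into two L2 norms that each contribute the root of the mass of
  \<open>B\<close>.\<close>

lemma discr_bound:
  assumes B: "B \<in> sets borel" shows "norm (discr \<omega> B) \<le> 2 / \<bar>Im \<omega>\<bar> * measure \<mu> B"
proof -
  have "cmod (tr (rsv \<omega> * P B)) = cmod (tr (rsv \<omega> * P B * P B))"
    using P_proj[OF B] by (simp add: is_proj_def mult.assoc)
  also have "\<dots> \<le> nn (rsv \<omega> * P B) * nn (P B)" using \<omega> B by (intro tr_le_nn) auto
  also have "\<dots> \<le> (1 / \<bar>Im \<omega>\<bar> * nn (P B)) * nn (P B)"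
    using \<omega> B by (intro mult_right_mono nn_mult_left rsv_bnd) auto
  also have "\<dots> = 1 / \<bar>Im \<omega>\<bar> * measure \<mu> B" by (simp add: nn_P[OF B])
  finally have 1: "cmod (tr (rsv \<omega> * P B)) \<le> 1 / \<bar>Im \<omega>\<bar> * measure \<mu> B" .
  have 2: "norm (\<integral>t. indicator B t *\<^sub>R (1 / (\<omega> - complex_of_real t)) \<partial>\<mu>) \<le> 1 / \<bar>Im \<omega>\<bar> * measure \<mu> B"
    by (rule integral_indicator_bound) (use B \<omega> norm_resolvent_le[OF \<omega>] in auto)
  show ?thesis using norm_triangle_ineq4[of "tr (rsv \<omega> * P B)" "\<integral>t. indicator B t *\<^sub>R (1 / (\<omega> - complex_of_real t)) \<partial>\<mu>"] 1 2
    by (simp add: discr_def)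
qed

text \<open>On an interval around \<open>c\<close> both terms are close to \<open>k\<close> times
  the mass of \<open>B\<close>, where \<open>k\<close> is the value of the scalar resolvent at
  \<open>c\<close>; for the operator term this is \<open>spectral_local\<close>.\<close>

lemma discr_local:
  assumes B: "B \<in> sets borel" "B \<subseteq> {c - \<delta>..c + \<delta>}" and \<delta>: "0 \<le> \<delta>"
  shows "norm (discr \<omega> B) \<le> 2 * \<delta> / (Im \<omega>)\<^sup>2 * measure \<mu> B"
proof -
  define k where "k = 1 / (\<omega> - complex_of_real c)"
  have nk: "cmod k \<le> 1 / \<bar>Im \<omega>\<bar>" unfolding k_def by (rule norm_resolvent_le[OF \<omega>])
  have kne: "\<omega> - complex_of_real c \<noteq> 0" by (rule resolvent_ne[OF \<omega>])
  have nk2: "cmod k * (1 / \<bar>Im \<omega>\<bar>) \<le> 1 / (Im \<omega>)\<^sup>2"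
    using mult_right_mono[OF nk, of "1 / \<bar>Im \<omega>\<bar>"] by (simp add: power2_eq_square)
  let ?A = "(rsv \<omega> - cs k) * P B"
  have bA: "bnd ?A (\<delta> / (Im \<omega>)\<^sup>2)" unfolding bnd_def
  proof safe
    fix x
    let ?y = "E B x"
    have Ey: "E B ?y = ?y" by (rule E_idem[OF B(1)])
    have BK: "B \<subseteq> {-(\<bar>c\<bar> + \<delta>)..\<bar>c\<bar> + \<delta>}"
    proof
      fix t assume "t \<in> B"
      hence "t \<in> {c - \<delta>..c + \<delta>}" using B(2) by blast
      thus "t \<in> {-(\<bar>c\<bar> + \<delta>)..\<bar>c\<bar> + \<delta>}" by auto
    qed
    obtain u where u: "(?y, u) \<in> T" using range_domain[OF B(1) BK Ey] by blast
    have n1: "norm (u - c *\<^sub>R ?y) \<le> \<delta> * norm ?y" by (rule spectral_local[OF B Ey u \<delta>])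
    \<comment> \<open>Since omega - c equals (omega - T) + (T - c), the resolvent applied to (omega
      - c) y is y plus the resolvent of (T - c) y.\<close>
    have "app (rsv \<omega>) (scaleC (\<omega> - complex_of_real c) ?y) = app (rsv \<omega>) ((scaleC \<omega> ?y - u) + (u - c *\<^sub>R ?y))"
      by (simp add: scaleC.diff_left scaleC_of_real)
    also have "\<dots> = ?y + app (rsv \<omega>) (u - c *\<^sub>R ?y)" unfolding app_linear(1) rsv_eq[OF \<omega> u] ..
    finally have "scaleC k (scaleC (\<omega> - complex_of_real c) (app (rsv \<omega>) ?y)) = scaleC k ?y + scaleC k (app (rsv \<omega>) (u - c *\<^sub>R ?y))"
      by (simp add: app_scaleC scaleC_add_right)
    hence "app (rsv \<omega>) ?y = scaleC k ?y + scaleC k (app (rsv \<omega>) (u - c *\<^sub>R ?y))"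
      using kne by (simp add: scaleC_scaleC k_def)
    hence "norm (app ?A x) = cmod k * norm (app (rsv \<omega>) (u - c *\<^sub>R ?y))"
      by (simp add: app_P[OF B(1)] norm_scaleC)
    also have "\<dots> \<le> cmod k * (1 / \<bar>Im \<omega>\<bar> * (\<delta> * norm ?y))"
      using bndD[OF rsv_bnd[OF \<omega>]] n1 by (intro mult_left_mono order_trans[OF bndD[OF rsv_bnd[OF \<omega>]]] mult_left_mono) auto
    also have "\<dots> = (cmod k * (1 / \<bar>Im \<omega>\<bar>)) * (\<delta> * norm ?y)" by simp
    also have "\<dots> \<le> 1 / (Im \<omega>)\<^sup>2 * (\<delta> * norm x)"
      using bndD[OF is_proj_bnd[OF P_proj[OF B(1)]], of x] \<delta>
      by (intro mult_mono nk2 mult_left_mono) (auto simp: app_P[OF B(1)])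
    finally show "norm (app ?A x) \<le> \<delta> / (Im \<omega>)\<^sup>2 * norm x" by simp
  qed (use \<delta> in simp)
  have PB: "P B * P B = P B" using P_proj[OF B(1)] by (simp add: is_proj_def)
  have M: "?A \<in> ops M" using \<omega> B by auto
  have "tr (rsv \<omega> * P B) - k * complex_of_real (measure \<mu> B) = tr (?A * P B * P B)"
    using \<omega> B by (simp add: PB mult.assoc left_diff_distrib tr_diff tr_cs tr_P)
  also have "cmod \<dots> \<le> nn (?A * P B) * nn (P B)" using M B by (intro tr_le_nn) auto
  also have "\<dots> \<le> (\<delta> / (Im \<omega>)\<^sup>2 * nn (P B)) * nn (P B)"
    using M B by (intro mult_right_mono nn_mult_left bA) auto
  also have "\<dots> = \<delta> / (Im \<omega>)\<^sup>2 * measure \<mu> B" by (simp add: nn_P[OF B(1)])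
  finally have 1: "cmod (tr (rsv \<omega> * P B) - k * complex_of_real (measure \<mu> B)) \<le> \<delta> / (Im \<omega>)\<^sup>2 * measure \<mu> B" .
  have "norm (\<integral>t. indicator B t *\<^sub>R (1 / (\<omega> - complex_of_real t) - k) \<partial>\<mu>) \<le> \<delta> / (Im \<omega>)\<^sup>2 * measure \<mu> B"
  proof (rule integral_indicator_bound)
    fix t assume "t \<in> B"
    hence "t \<in> {c - \<delta>..c + \<delta>}" using B(2) by blast
    hence t: "\<bar>t - c\<bar> \<le> \<delta>" by (simp add: abs_le_iff)
    have "1 / (\<omega> - complex_of_real t) - k = 1 / (\<omega> - complex_of_real t) * k * complex_of_real (t - c)"
      using kne resolvent_ne[OF \<omega>, of t] by (simp add: k_def field_simps)
    hence "norm (1 / (\<omega> - complex_of_real t) - k) = norm (1 / (\<omega> - complex_of_real t)) * cmod k * \<bar>t - c\<bar>"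
      by (simp add: norm_mult norm_divide flip: of_real_diff)
    also have "\<dots> \<le> (1 / \<bar>Im \<omega>\<bar>) * (1 / \<bar>Im \<omega>\<bar>) * \<delta>"
      by (intro mult_mono norm_resolvent_le[OF \<omega>] nk t) auto
    finally show "norm (1 / (\<omega> - complex_of_real t) - k) \<le> \<delta> / (Im \<omega>)\<^sup>2" by (simp add: power2_eq_square)
  qed (use B \<delta> in auto)
  moreover have "(\<integral>t. indicator B t *\<^sub>R (1 / (\<omega> - complex_of_real t) - k) \<partial>\<mu>)
     = (\<integral>t. indicator B t *\<^sub>R (1 / (\<omega> - complex_of_real t)) \<partial>\<mu>) - k * complex_of_real (measure \<mu> B)"
  proof -
    have "integrable \<mu> (\<lambda>t. indicator B t *\<^sub>R k)"
      using B by (intro integrable_mult_indicator) auto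
    moreover have "(\<integral>t. indicator B t *\<^sub>R k \<partial>\<mu>) = k * complex_of_real (measure \<mu> B)"
      using B(1) by (simp add: D.emeasure_finite less_top[symmetric] scaleR_conv_of_real mult.commute)
    ultimately show ?thesis using discr_integrable[OF B(1)]
      by (simp add: scaleR_diff_right)
  qed
  ultimately have 2: "cmod ((\<integral>t. indicator B t *\<^sub>R (1 / (\<omega> - complex_of_real t)) \<partial>\<mu>) - k * complex_of_real (measure \<mu> B)) \<le> \<delta> / (Im \<omega>)\<^sup>2 * measure \<mu> B"
    by simp
  show ?thesis
    using norm_triangle_ineq4[of "tr (rsv \<omega> * P B) - k * complex_of_real (measure \<mu> B)"
      "(\<integral>t. indicator B t *\<^sub>R (1 / (\<omega> - complex_of_real t)) \<partial>\<mu>) - k * complex_of_real (measure \<mu> B)"] 1 2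
    by (simp add: discr_def)
qed

text \<open>Additivity over adjacent short intervals: the local bound is proportional to the mass,
  so the factor delta survives the summation.\<close>

lemma discr_interval:
  assumes "0 < \<delta>"
  shows "norm (discr \<omega> {a..<a + real n * \<delta>}) \<le> 2 * \<delta> / (Im \<omega>)\<^sup>2 * measure \<mu> {a..<a + real n * \<delta>}"
proof (induction n)
  case 0
  thus ?case using discr_bound[of "{}"] by simp
next
  case (Suc n)
  let ?I = "{a..<a + real n * \<delta>}" and ?J = "{a + real n * \<delta>..<a + real (Suc n) * \<delta>}"
  have u: "{a..<a + real (Suc n) * \<delta>} = ?I \<union> ?J" using assms by (auto simp: distrib_right)
      (smt (verit, best) mult_nonneg_nonneg of_nat_0_le_iff)
  have "norm (discr \<omega> ?J) \<le> 2 * \<delta> / (Im \<omega>)\<^sup>2 * measure \<mu> ?J"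
    by (rule discr_local[where c="a + real n * \<delta>"]) (use assms in \<open>auto simp: distrib_right\<close>)
  moreover have "discr \<omega> (?I \<union> ?J) = discr \<omega> ?I + discr \<omega> ?J" by (rule discr_Un) auto
  moreover have "measure \<mu> (?I \<union> ?J) = measure \<mu> ?I + measure \<mu> ?J"
    by (rule D.finite_measure_Union) auto
  ultimately show ?case unfolding u using Suc norm_triangle_ineq[of "discr \<omega> ?I" "discr \<omega> ?J"]
    by (simp add: distrib_left)
qed

text \<open>The line is cut into a long interval and its complement; first the interval exhausts the
  line, then delta tends to 0.\<close>

lemma tr_rsv: "tr (rsv \<omega>) = G_transform \<mu> \<omega>"
proof -
  have U: "discr \<omega> UNIV = tr (rsv \<omega>) - G_transform \<mu> \<omega>"
  proof -
    have "P UNIV = 1" by (rule adop_eqI) (simp add: app_P E_UNIV)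
    thus ?thesis by (simp add: discr_def G_transform_def)
  qed
  have "norm (discr \<omega> UNIV) \<le> 2 * \<delta> / (Im \<omega>)\<^sup>2" if \<delta>: "\<delta> > 0" for \<delta>
  proof -
    define I where "I N = {- (real N * \<delta>)..<- (real N * \<delta>) + real (2 * N) * \<delta>}" for N
    have I': "I N = {- (real N * \<delta>)..<real N * \<delta>}" for N by (simp add: I_def algebra_simps)
    have le: "norm (discr \<omega> UNIV) \<le> 2 * \<delta> / (Im \<omega>)\<^sup>2 + 2 / \<bar>Im \<omega>\<bar> * (1 - measure \<mu> (I N))" for N
    proof -
      have Ib: "I N \<in> sets borel" by (simp add: I_def)
      have "discr \<omega> UNIV = discr \<omega> (I N) + discr \<omega> (- I N)"
        using discr_Un[of "I N" "- I N"] Ib by (simp add: borel_comp)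
      hence "norm (discr \<omega> UNIV) \<le> norm (discr \<omega> (I N)) + norm (discr \<omega> (- I N))"
        by (simp add: norm_triangle_ineq)
      also have "norm (discr \<omega> (I N)) \<le> 2 * \<delta> / (Im \<omega>)\<^sup>2 * measure \<mu> (I N)"
        unfolding I_def by (rule discr_interval[OF \<delta>])
      also have "2 * \<delta> / (Im \<omega>)\<^sup>2 * measure \<mu> (I N) \<le> 2 * \<delta> / (Im \<omega>)\<^sup>2 * 1"
        using \<delta> by (intro mult_left_mono D.prob_le_1) auto
      also have "norm (discr \<omega> (- I N)) \<le> 2 / \<bar>Im \<omega>\<bar> * measure \<mu> (- I N)"
        using Ib by (intro discr_bound) (simp add: borel_comp)
      also have "measure \<mu> (- I N) = 1 - measure \<mu> (I N)"
        using D.prob_compl[of "I N"] Ib by (simp add: Compl_eq_Diff_UNIV)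
      finally show ?thesis by simp
    qed
    have "(\<lambda>N. measure \<mu> (I N)) \<longlonglongrightarrow> measure \<mu> (\<Union>N. I N)"
    proof (rule D.finite_Lim_measure_incseq)
      show "range I \<subseteq> sets \<mu>" by (auto simp: I_def)
      show "incseq I" unfolding incseq_def
      proof (intro allI impI)
        fix k l :: nat assume "k \<le> l"
        hence "real k * \<delta> \<le> real l * \<delta>" using \<delta> by simp
        thus "I k \<subseteq> I l" unfolding I' by (intro subsetI, unfold atLeastLessThan_iff) linarith
      qed
    qed
    also have "(\<Union>N. I N) = UNIV"
    proof -
      have "x \<in> (\<Union>N. I N)" for x
      proof -
        obtain N where "\<bar>x\<bar> < real N * \<delta>" using reals_Archimedean3[OF \<delta>] by blast
        hence "x \<in> I N" unfolding I' by (simp add: abs_less_iff)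
        thus ?thesis by blast
      qed
      thus ?thesis by blast
    qed
    also have "measure \<mu> UNIV = 1" using D.prob_space by simp
    finally have "(\<lambda>N. 2 * \<delta> / (Im \<omega>)\<^sup>2 + 2 / \<bar>Im \<omega>\<bar> * (1 - measure \<mu> (I N))) \<longlonglongrightarrow> 2 * \<delta> / (Im \<omega>)\<^sup>2 + 2 / \<bar>Im \<omega>\<bar> * (1 - 1)"
      by (intro tendsto_intros)
    hence "norm (discr \<omega> UNIV) \<le> 2 * \<delta> / (Im \<omega>)\<^sup>2 + 2 / \<bar>Im \<omega>\<bar> * (1 - 1)"
      by (rule LIMSEQ_le_const) (use le in auto)
    thus ?thesis by simp
  qed
  note le = this
  have "norm (discr \<omega> UNIV) \<le> 0"
  proof (rule field_le_epsilon)
    fix e :: real assume "e > 0"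
    thus "norm (discr \<omega> UNIV) \<le> 0 + e" using le[of "e * (Im \<omega>)\<^sup>2 / 2"] \<omega> by simp
  qed
  thus ?thesis using U by simp
qed

end

text \<open>The resolvent identity between omega and its conjugate.\<close>

lemma n2_rsv:
  assumes "Im \<omega> > 0" shows "n2 (rsv \<omega>) = - Im (G_transform \<mu> \<omega>) / Im \<omega>"
proof -
  have c: "Im (cnj \<omega>) \<noteq> 0" "Im \<omega> \<noteq> 0" using assms by auto
  have "tr (rsv (cnj \<omega>) - rsv \<omega>) = (\<omega> - cnj \<omega>) * tr (star (rsv \<omega>) * rsv \<omega>)"
    unfolding rsv_identity[OF c] star_rsv[OF c(2)] using c by (simp add: tr_cs)
  hence "cnj (G_transform \<mu> \<omega>) - G_transform \<mu> \<omega> = (\<omega> - cnj \<omega>) * complex_of_real (n2 (rsv \<omega>))"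
    using c by (simp add: tr_diff tr_rsv D.G_cnj tr_star_mult)
  hence "Im (cnj (G_transform \<mu> \<omega>) - G_transform \<mu> \<omega>) = Im ((\<omega> - cnj \<omega>) * complex_of_real (n2 (rsv \<omega>)))" by simp
  thus ?thesis using assms by (simp add: field_simps)
qed

text \<open>The operator counterpart of \<^const>\<open>real_distribution.dev\<close>.\<close>

definition cent :: "complex \<Rightarrow> 'h adop" where
  "cent \<omega> = cs (F_transform \<mu> \<omega>) * rsv \<omega> - 1"

context
  fixes \<omega> :: complex
  assumes \<omega>: "Im \<omega> > 0"
begin

lemma cent_M [simp]: "cent \<omega> \<in> ops M" using \<omega> by (auto simp: cent_def)

lemma FG: "F_transform \<mu> \<omega> * G_transform \<mu> \<omega> = 1"
  using D.G_nonzero[of \<omega>] \<omega> by (simp add: F_transform_def)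

lemma tr_cent: "tr (cent \<omega>) = 0"
  using \<omega> by (simp add: cent_def tr_diff tr_cs tr_rsv FG)

text \<open>This equals \<open>Im (Nev \<mu> \<omega>) / Im \<omega>\<close>, the value that
  \<open>dev_norm_sq\<close> gives for the scalar counterpart.\<close>

lemma n2_cent: "n2 (cent \<omega>) = Im (F_transform \<mu> \<omega>) / Im \<omega> - 1"
proof -
  let ?F = "F_transform \<mu> \<omega>" and ?G = "G_transform \<mu> \<omega>"
  have "cent \<omega> = cs (-1) + cs ?F * rsv \<omega>" using cs_minus_one[of "1 :: 'h adop"] by (simp add: cent_def)
  hence "n2 (cent \<omega>) = n2 (cs (-1)) + 2 * Re (?F * tr (star (cs (-1)) * rsv \<omega>)) + (cmod ?F)\<^sup>2 * n2 (rsv \<omega>)"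
    using \<omega> by (simp add: n2_add)
  also have "n2 (cs (-1)) = 1" by (simp add: n2_def cs_mult[symmetric])
  also have "tr (star (cs (-1)) * rsv \<omega>) = - ?G" using \<omega> by (simp only: star_cs) (simp add: tr_cs tr_rsv)
  also have "Re (?F * - ?G) = -1" using FG by simp
  also have "(cmod ?F)\<^sup>2 * n2 (rsv \<omega>) = Im ?F / Im \<omega>"
  proof -
    have G: "?G = 1 / ?F" "?F \<noteq> 0" using FG by (auto simp: eq_divide_eq mult.commute)
    hence "(cmod ?F)\<^sup>2 * - Im ?G = Im ?F" by (simp add: Im_divide cmod_power2)
    thus ?thesis using n2_rsv[OF \<omega>] by (metis minus_divide_left mult.commute times_divide_eq_left)
  qed
  finally show ?thesis by simp
qed

end

end

section \<open>Subordination for free sums\<close>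

lemma generated_iff:
  "app A \<in> generated_vN T \<longleftrightarrow> (\<forall>N. von_neumann_algebra N \<and> affiliated N T \<longrightarrow> A \<in> ops N)"
  by (auto simp: generated_vN_def ops_def)

lemma generated_closed:
  "app 1 \<in> generated_vN T" "app (cs c) \<in> generated_vN T"
  "app A \<in> generated_vN T \<Longrightarrow> app B \<in> generated_vN T \<Longrightarrow> app (A - B) \<in> generated_vN T"
  "app A \<in> generated_vN T \<Longrightarrow> app B \<in> generated_vN T \<Longrightarrow> app (A * B) \<in> generated_vN T"
  "app A \<in> generated_vN T \<Longrightarrow> app (star A) \<in> generated_vN T"
  unfolding generated_iff by (auto intro: vN.ops_basic vN.ops_star vN.intro)

lemma (in real_distribution) measure_interval_tendsto:
  "(\<lambda>n. measure M {-real n..real n}) \<longlonglongrightarrow> 1"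
proof -
  have "(\<lambda>n. measure M {-real n..real n}) \<longlonglongrightarrow> measure M (\<Union>n. {-real n..real n})"
  proof (rule finite_Lim_measure_incseq)
    show "incseq (\<lambda>n. {-real n..real n})" unfolding incseq_def by auto
  qed auto
  also have "(\<Union>n. {-real n..real n}) = UNIV"
  proof -
    have "x \<in> (\<Union>n. {-real n..real n})" for x
    proof -
      obtain n where "\<bar>x\<bar> \<le> real n" using real_arch_simple by blast
      hence "x \<in> {-real n..real n}" by (simp add: abs_le_iff)
      thus ?thesis by blast
    qed
    thus ?thesis by blast
  qed
  finally show ?thesis using prob_space by simp
qed

context law_op
begin

text \<open>The operator \<open>A\<close> is T h. It is bounded since \<open>h\<close> lies under a
  bounded spectral projection of \<open>T\<close>, and belongs to \<open>M\<close> since its graph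
  is compatible with the commutant.\<close>

lemma cutoff:
  assumes h: "h \<in> ops M" "is_proj h" and K: "0 \<le> K" and hE: "\<And>y. E {-K..K} (app h y) = app h y"
  obtains A where "A \<in> ops M" "\<And>y. (app h y, app A y) \<in> T"
    "\<And>y. norm (app A y) \<le> K * norm (app h y)"
proof -
  have B: "{-K..K} \<in> sets borel" by simp
  have "\<exists>u. (app h y, u) \<in> T" for y by (rule range_domain[OF B order_refl hE])
  then obtain f where f: "\<And>y. (app h y, f y) \<in> T" by metis
  have nf: "norm (f y) \<le> K * norm (app h y)" for y
    using spectral_local[OF B, of 0 K "app h y" "f y"] hE f K by simp
  have f_eq: "(app h y, u) \<in> T \<Longrightarrow> f y = u" for y u using f unique by blast
  have "bounded_operator f" unfolding bounded_operator_def
  proof (safe intro!: bounded_linear_intro[where K=K] f_eq)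
    fix x y show "(app h (x + y), f x + f y) \<in> T" using add_in[OF f f] by (simp add: app_linear)
  next
    fix r x show "(app h (r *\<^sub>R x), r *\<^sub>R f x) \<in> T" using scaleR_in[OF f] by (simp add: app_linear)
  next
    fix c x show "(app h (scaleC c x), scaleC c (f x)) \<in> T" using scaleC_in[OF f] by (simp add: app_scaleC)
  next
    fix x
    have "norm (app h x) \<le> norm x" using bndD[OF is_proj_bnd[OF h(2)], of x] by simp
    hence "K * norm (app h x) \<le> K * norm x" using K by (rule mult_left_mono)
    thus "norm (f x) \<le> norm x * K" using nf[of x] by (simp add: mult.commute)
  qed
  moreover have "f (B x) = B (f x)" if "B \<in> commutant M" for B x
  proof (rule f_eq)
    have "(B (app h x), B (f x)) \<in> T" using aff that f unfolding affiliated_def by blast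
    moreover have "B (app h x) = app h (B x)" using h(1) that unfolding ops_iff by simp
    ultimately show "(app h (B x), B (f x)) \<in> T" by simp
  qed
  ultimately have "f \<in> commutant (commutant M)" by (auto simp: commutant_def[of "commutant M"])
  hence "f \<in> M" by (simp add: bicommutant)
  from ops_Adop[OF this] show ?thesis using f nf by (intro that[of "Adop f"]) auto
qed

end

section \<open>Alternating words in two free algebras, and the free sum\<close>

definition wprod :: "(bool \<times> ('h::complex_hilbert_space) adop) list \<Rightarrow> 'h adop" where
  "wprod ws = foldr (*) (map snd ws) 1"

lemma wprod_simps [simp]: "wprod [] = 1" "wprod (w # ws) = snd w * wprod ws"
  by (simp_all add: wprod_def)

lemma wprod_append: "wprod (ws @ vs) = wprod ws * wprod vs"
  by (induction ws) (simp_all add: mult.assoc)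

lemma wprod_rev_star: "wprod (rev (map (\<lambda>(i, A). (i, star A)) ws)) = star (wprod ws)"
  by (induction ws) (auto simp: wprod_append)

lemma app_wprod: "app (wprod ws) = foldr (\<circ>) (map snd (map (\<lambda>(i, A). (i, app A)) ws)) id"
  by (induction ws) (auto simp: app_1 app_times)

fun alt :: "(bool \<Rightarrow> 'a) \<Rightarrow> bool \<Rightarrow> nat \<Rightarrow> (bool \<times> 'a) list" where
  "alt L b 0 = []"
| "alt L b (Suc n) = (b, L b) # alt L (\<not> b) n"

lemma distinct_adj_alt: "distinct_adj (map fst (alt L b n))"
proof (induction n arbitrary: b)
  case (Suc n)
  show ?case using Suc[of "\<not> b"] by (cases n) auto
qed simp

lemma set_alt: "(i, A) \<in> set (alt L b n) \<Longrightarrow> A = L i"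
  by (induction n arbitrary: b) auto

lemma wprod_alt_two: "wprod (alt L b (2 * k)) = (L b * L (\<not> b)) ^ k"
  by (induction k) (simp_all add: mult.assoc)

lemma wprod_alt_odd: "wprod (alt L b (Suc (2 * k))) = L b * (L (\<not> b) * L b) ^ k"
  by (simp add: wprod_alt_two)

text \<open>The label \<open>True\<close> stands for \<open>Y\<close>, \<open>False\<close> for
  \<open>X\<close>. What is given is the strong difference \<open>Y\<close> of \<open>Z\<close> and
  \<open>X\<close>, so Z = X + Y is used only on vectors in the domains of both \<open>X\<close> and
  \<open>Z\<close>.\<close>

locale free_pair = tracial_W_star_probability_space M \<tau> +
  X: law_op M \<tau> X \<mu>X + Y: law_op M \<tau> Y \<mu>Y + Z: law_op M \<tau> Z \<mu>Z
  for M :: "('h::complex_hilbert_space \<Rightarrow> 'h) set" and \<tau> :: "('h \<Rightarrow> 'h) \<Rightarrow> complex"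
    and X Y Z :: "('h \<times> 'h) set" and \<mu>X \<mu>Y \<mu>Z :: "real measure" +
  assumes Y_eq: "Y = op_diff Z X"
    and free: "freely_independent \<tau> UNIV (\<lambda>i. if i then Y else X)"
begin

lemma sum_in: "(x, u) \<in> X \<Longrightarrow> (x, v) \<in> Z \<Longrightarrow> (x, v - u) \<in> Y"
  unfolding Y_eq op_diff_def by (rule subsetD[OF closure_subset]) blast

text \<open>\<open>h\<close> is the meet of two spectral projections; on its range \<open>X\<close>
  and \<open>Z\<close> are both bounded by \<open>K\<close>, and the trace missing from
  \<open>h\<close> is controlled by the tails of the two laws.\<close>

lemma meet_cutoff:
  assumes K: "0 \<le> K"
  obtains h AX AZ where "h \<in> ops M" "is_proj h" "AX \<in> ops M" "AZ \<in> ops M"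
    "\<And>y. (app h y, app AX y) \<in> X" "\<And>y. (app h y, app AZ y) \<in> Z"
    "\<And>y. norm (app AX y) \<le> K * norm (app h y)" "\<And>y. norm (app AZ y) \<le> K * norm (app h y)"
    "1 - Re (tr h) \<le> measure \<mu>X {x. \<bar>x\<bar> > K} + measure \<mu>Z {x. \<bar>x\<bar> > K}"
proof -
  have B: "{-K..K} \<in> sets borel" by simp
  obtain h where h: "h \<in> ops M" "is_proj h"
    "\<And>x. app h x = x \<longleftrightarrow> app (X.P {-K..K}) x = x \<and> app (Z.P {-K..K}) x = x"
    "Re (tr h) \<ge> Re (tr (X.P {-K..K})) + Re (tr (Z.P {-K..K})) - 1"
    using proj_meet[OF X.P_M[OF B] X.P_proj[OF B] Z.P_M[OF B] Z.P_proj[OF B]] by metis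
  have hh: "app h (app h y) = app h y" for y by (rule is_proj_app[OF h(2)])
  have "X.E {-K..K} (app h y) = app h y" "Z.E {-K..K} (app h y) = app h y" for y
    using h(3)[of "app h y"] hh by (simp_all add: X.app_P Z.app_P)
  then obtain AX AZ where A: "AX \<in> ops M" "AZ \<in> ops M"
    "\<And>y. (app h y, app AX y) \<in> X" "\<And>y. (app h y, app AZ y) \<in> Z"
    "\<And>y. norm (app AX y) \<le> K * norm (app h y)" "\<And>y. norm (app AZ y) \<le> K * norm (app h y)"
    using X.cutoff[OF h(1,2) K] Z.cutoff[OF h(1,2) K] by metis
  have c: "{x. \<bar>x\<bar> > K} = UNIV - {-K..K}" by auto
  have "measure \<mu>X {x. \<bar>x\<bar> > K} = 1 - measure \<mu>X {-K..K}" "measure \<mu>Z {x. \<bar>x\<bar> > K} = 1 - measure \<mu>Z {-K..K}"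
    unfolding c using X.D.prob_compl[of "{-K..K}"] Z.D.prob_compl[of "{-K..K}"] by simp_all
  hence "1 - Re (tr h) \<le> measure \<mu>X {x. \<bar>x\<bar> > K} + measure \<mu>Z {x. \<bar>x\<bar> > K}"
    using h(4) by (simp add: X.tr_P Z.tr_P)
  thus ?thesis using that h A by blast
qed

lemma zero_of_no_range: assumes "is_proj h'" "\<And>x. app h' x = x \<Longrightarrow> x = 0" shows "h' = 0"
  by (rule adop_eqI) (use assms is_proj_app[OF assms(1)] in auto)

text \<open>On the range of \<open>h\<close> the form of \<open>Y\<close> is at most 2K. A spectral
  projection of \<open>Y\<close> beyond 2K therefore meets \<open>h\<close> in 0, and
  \<open>proj_meet\<close> bounds its trace by 1 - tr h. The two tails of \<open>Y\<close> give the
  factor 2.\<close>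

lemma tail_bound:
  assumes K: "0 \<le> K"
  shows "measure \<mu>Y {x. \<bar>x\<bar> > 2 * K} \<le> 2 * (measure \<mu>X {x. \<bar>x\<bar> > K} + measure \<mu>Z {x. \<bar>x\<bar> > K})"
proof -
  obtain h AX AZ where h: "h \<in> ops M" "is_proj h" "AX \<in> ops M" "AZ \<in> ops M"
    "\<And>y. (app h y, app AX y) \<in> X" "\<And>y. (app h y, app AZ y) \<in> Z"
    "\<And>y. norm (app AX y) \<le> K * norm (app h y)" "\<And>y. norm (app AZ y) \<le> K * norm (app h y)"
    "1 - Re (tr h) \<le> measure \<mu>X {x. \<bar>x\<bar> > K} + measure \<mu>Z {x. \<bar>x\<bar> > K}"
    using meet_cutoff[OF K] by metis
  have form: "\<exists>w. (x, w) \<in> Y \<and> \<bar>inner w x\<bar> \<le> 2 * K * (norm x)\<^sup>2" if hx: "app h x = x" for x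
  proof (intro exI conjI)
    show "(x, app AZ x - app AX x) \<in> Y" using sum_in[OF h(5)[of x] h(6)[of x]] hx by simp
    have "norm (app AZ x - app AX x) \<le> K * norm x + K * norm x"
      using norm_triangle_ineq4[of "app AZ x" "app AX x"] h(7)[of x] h(8)[of x] hx by simp
    hence "norm (app AZ x - app AX x) * norm x \<le> (K * norm x + K * norm x) * norm x"
      by (rule mult_right_mono) simp
    thus "\<bar>inner (app AZ x - app AX x) x\<bar> \<le> 2 * K * (norm x)\<^sup>2"
      using Cauchy_Schwarz_ineq2[of "app AZ x - app AX x" x] by (simp add: power2_eq_square algebra_simps)
  qed
  have tail: "measure \<mu>Y S \<le> 1 - Re (tr h)"
    if S: "S \<in> sets borel" and no: "\<And>x w. (x, w) \<in> Y \<Longrightarrow> Y.E S x = x \<Longrightarrow> \<bar>inner w x\<bar> \<le> 2 * K * (norm x)\<^sup>2 \<Longrightarrow> x = 0" for S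
  proof -
    obtain h' where h': "h' \<in> ops M" "is_proj h'" "\<And>x. app h' x = x \<longleftrightarrow> app (Y.P S) x = x \<and> app h x = x"
      "Re (tr h') \<ge> Re (tr (Y.P S)) + Re (tr h) - 1"
      using proj_meet[OF Y.P_M[OF S] Y.P_proj[OF S] h(1,2)] by metis
    have "h' = 0"
    proof (rule zero_of_no_range[OF h'(2)])
      fix x assume "app h' x = x"
      hence "Y.E S x = x" "app h x = x" using h'(3) by (simp_all add: Y.app_P[OF S])
      thus "x = 0" using form no by blast
    qed
    thus ?thesis using h'(4) by (simp add: Y.tr_P[OF S])
  qed
  have 1: "measure \<mu>Y {2 * K<..} \<le> 1 - Re (tr h)"
  proof (rule tail)
    fix x w assume *: "(x, w) \<in> Y" "Y.E {2 * K<..} x = x" "\<bar>inner w x\<bar> \<le> 2 * K * (norm x)\<^sup>2"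
    show "x = 0" using Y.spectral_gt[OF *(1,2)] *(3) by force
  qed simp
  have 2: "measure \<mu>Y {..<- (2 * K)} \<le> 1 - Re (tr h)"
  proof (rule tail)
    fix x w assume *: "(x, w) \<in> Y" "Y.E {..<- (2 * K)} x = x" "\<bar>inner w x\<bar> \<le> 2 * K * (norm x)\<^sup>2"
    show "x = 0" using Y.spectral_lt[OF *(1,2)] *(3) by force
  qed simp
  have "{x. \<bar>x\<bar> > 2 * K} = {2 * K<..} \<union> {..<- (2 * K)}" by auto
  hence "measure \<mu>Y {x. \<bar>x\<bar> > 2 * K} \<le> measure \<mu>Y {2 * K<..} + measure \<mu>Y {..<- (2 * K)}"
    by (simp add: measure_Un_le)
  moreover have "a \<le> 2 * d" if "a \<le> b + c" "b \<le> e" "c \<le> e" "e \<le> d" for a b c d e :: real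
    using that by linarith
  ultimately show ?thesis using 1 2 h(9) by blast
qed

lemma tr_word_zero:
  assumes "ws \<noteq> []" "distinct_adj (map fst ws)"
    and "\<And>i A. (i, A) \<in> set ws \<Longrightarrow> app A \<in> generated_vN (if i then Y else X) \<and> tr A = 0"
  shows "tr (wprod ws) = 0"
proof -
  let ?vs = "map (\<lambda>(i, A). (i, app A)) ws"
  have "\<tau> (foldr (\<circ>) (map snd ?vs) id) = 0"
  proof (rule mp[OF spec[OF free[unfolded freely_independent_def]]], intro conjI ballI)
    show "?vs \<noteq> []" using assms(1) by simp
    show "distinct_adj (map fst ?vs)" using assms(2) by (simp add: comp_def case_prod_beta)
  next
    fix v assume "v \<in> set ?vs"
    then obtain i A where "v = (i, app A)" "(i, A) \<in> set ws" by auto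
    thus "case v of (i, A) \<Rightarrow> i \<in> UNIV \<and> A \<in> generated_vN (if i then Y else X) \<and> \<tau> A = 0"
      using assms(3) by (simp add: tr_def)
  qed
  thus ?thesis by (simp add: tr_def app_wprod)
qed

context
  fixes L :: "bool \<Rightarrow> 'h adop"
  assumes L: "\<And>i. app (L i) \<in> generated_vN (if i then Y else X)" "\<And>i. tr (L i) = 0" "\<And>i. L i \<in> ops M"
begin

lemma tr_alt: "0 < n \<Longrightarrow> tr (wprod (alt L b n)) = 0"
proof (rule tr_word_zero)
  assume "0 < n" thus "alt L b n \<noteq> []" by (cases n) auto
next
  fix i A assume "(i, A) \<in> set (alt L b n)"
  hence "A = L i" by (rule set_alt)
  thus "app A \<in> generated_vN (if i then Y else X) \<and> tr A = 0" using L by simp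
qed (rule distinct_adj_alt)

lemma wprod_alt_M: "wprod (alt L b n) \<in> ops M"
  by (induction n arbitrary: b) (auto simp: L)

text \<open>Centring star (L b) (L b) leaves a letter \<open>c\<close> for which the word star A, c,
  A is again alternating, hence of trace 0; only the scalar n2 (L b) survives.\<close>

lemma n2_alt_Suc: "n2 (wprod (alt L b (Suc n))) = n2 (L b) * n2 (wprod (alt L (\<not> b) n))"
proof -
  let ?A = "wprod (alt L (\<not> b) n)" and ?ws = "alt L (\<not> b) n"
  define c where "c = star (L b) * L b - cs (complex_of_real (n2 (L b)))"
  have cM: "c \<in> ops M" using L by (simp add: c_def)
  have c0: "tr c = 0" using L by (simp add: c_def tr_diff tr_cs1 tr_star_mult)
  have cG: "app c \<in> generated_vN (if b then Y else X)"
    unfolding c_def by (intro generated_closed L)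
  let ?W = "rev (map (\<lambda>(i, A). (i, star A)) ?ws) @ (b, c) # ?ws"
  have "tr (wprod ?W) = 0"
  proof (rule tr_word_zero)
    have d: "distinct_adj (map fst ((b, c) # ?ws))"
      using distinct_adj_alt[of L "\<not> b" n] by (cases n) auto
    have m: "map fst (rev (map (\<lambda>(i, A). (i, star A)) ?ws)) = rev (map fst ?ws)"
      by (simp add: rev_map comp_def case_prod_beta)
    show "distinct_adj (map fst ?W)"
    proof (cases n)
      case (Suc k)
      have "distinct_adj (rev (map fst ?ws))" using distinct_adj_alt by simp
      moreover have "last (rev (map fst ?ws)) \<noteq> b" using Suc by simp
      ultimately show ?thesis using d unfolding map_append m by (subst distinct_adj_append_iff) auto
    qed simp
  next
    fix i A assume "(i, A) \<in> set ?W"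
    then consider "i = b \<and> A = c" | "A = star (L i)" | "A = L i" using set_alt[of _ _ L "\<not> b" n] by auto
    thus "app A \<in> generated_vN (if i then Y else X) \<and> tr A = 0"
    proof cases
      case 1 thus ?thesis using cG c0 by simp
    next
      case 2 thus ?thesis using L tr_star[OF L(3)] generated_closed(5)[OF L(1)] by simp
    next
      case 3 thus ?thesis using L by simp
    qed
  qed simp
  hence z: "tr (star ?A * (c * ?A)) = 0" by (simp add: wprod_append wprod_rev_star)
  have "star (L b * ?A) * (L b * ?A) = star ?A * (c * ?A) + cs (complex_of_real (n2 (L b))) * (star ?A * ?A)"
  proof -
    have "star (L b * ?A) * (L b * ?A) = star ?A * ((star (L b) * L b) * ?A)" by (simp add: mult.assoc)
    also have "star (L b) * L b = c + cs (complex_of_real (n2 (L b)))" by (simp add: c_def)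
    also have "star ?A * ((c + cs (complex_of_real (n2 (L b)))) * ?A)
        = star ?A * (c * ?A) + (star ?A * cs (complex_of_real (n2 (L b)))) * ?A"
      by (simp only: distrib_left distrib_right mult.assoc)
    finally show ?thesis unfolding cs_comm[of "star ?A"] by (simp only: mult.assoc)
  qed
  hence "tr (star (L b * ?A) * (L b * ?A)) = complex_of_real (n2 (L b)) * complex_of_real (n2 ?A)"
    using L cM wprod_alt_M[of "\<not> b" n] z by (simp add: tr_add tr_cs tr_star_mult)
  thus ?thesis by (simp add: n2_def[of "L b * _"])
qed

lemma nn_power: "nn ((L b * L (\<not> b)) ^ k) = (nn (L b) * nn (L (\<not> b))) ^ k"
proof -
  have "n2 (wprod (alt L b (2 * k))) = (n2 (L b) * n2 (L (\<not> b))) ^ k"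
  proof (induction k)
    case (Suc k)
    have "n2 (wprod (alt L b (Suc (Suc (2 * k))))) = n2 (L b) * (n2 (L (\<not> b)) * n2 (wprod (alt L b (2 * k))))"
      by (simp only: n2_alt_Suc not_not)
    thus ?case using Suc by simp
  qed (simp add: n2_def)
  thus ?thesis by (simp add: wprod_alt_two nn_def real_sqrt_mult real_sqrt_power)
qed

end

text \<open>For \<open>z = \<omega>1 + \<omega>2 - u\<close> one has formally \<open>(z - Z)\<^sup>-\<^sup>1 = u (\<omega>1 - X)\<^sup>-\<^sup>1 (1 - q p)\<^sup>-\<^sup>1 (\<omega>2 - Y)\<^sup>-\<^sup>1\<close>, where \<open>p\<close> and \<open>q\<close> are the
  free centred elements below.  By freeness the \<open>L\<^sup>2\<close> norm of \<open>(q p)\<^sup>k\<close> is \<open>r\<^sup>k\<close>, and \<open>r < 1\<close> is equivalent to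
  \<open>Im z > 0\<close>; so the Neumann series converges in \<open>L\<^sup>2\<close>, where its trace can be read off.\<close>

lemma subordination:
  assumes \<omega>: "Im \<omega>1 > 0" "Im \<omega>2 > 0" and u: "F_transform \<mu>X \<omega>1 = u" "F_transform \<mu>Y \<omega>2 = u"
    and z: "z = \<omega>1 + \<omega>2 - u" "Im z > 0"
  shows "F_transform \<mu>Z z = u"
proof -
  define p where "p = X.cent \<omega>1"
  define q where "q = Y.cent \<omega>2"
  define a1 where "a1 = X.rsv \<omega>1"
  define a2 where "a2 = Y.rsv \<omega>2"
  define R where "R = Z.rsv z"
  define r where "r = nn q * nn p"
  have ne: "Im \<omega>1 \<noteq> 0" "Im \<omega>2 \<noteq> 0" "Im z \<noteq> 0" using \<omega> z by auto
  have M [simp]: "p \<in> ops M" "q \<in> ops M" "a1 \<in> ops M" "a2 \<in> ops M" "R \<in> ops M"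
    using ne \<omega> by (simp_all add: p_def q_def a1_def a2_def R_def)
  have p_eq: "p = cs u * a1 - 1" and q_eq: "q = cs u * a2 - 1"
    by (simp_all add: p_def q_def X.cent_def Y.cent_def u a1_def a2_def)
  have Imu: "Im u > 0" using X.D.Im_F_pos[OF \<omega>(1)] u by simp
  hence u0: "u \<noteq> 0" by auto
  have r0: "0 \<le> r" by (simp add: r_def)
  \<comment> \<open>The squared ratio is 1 - Im u Im z / (Im omega1 Im omega2).\<close>
  have r1: "r < 1"
  proof -
    have "n2 q * n2 p = (Im u / Im \<omega>2 - 1) * (Im u / Im \<omega>1 - 1)"
      using \<omega> by (simp add: p_def q_def X.n2_cent Y.n2_cent u)
    also have "\<dots> = 1 - Im u * (Im \<omega>1 + Im \<omega>2 - Im u) / (Im \<omega>1 * Im \<omega>2)"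
      using \<omega> by (simp add: field_simps)
    also have "\<dots> < 1" using \<omega> z Imu by simp
    finally have "sqrt (n2 q * n2 p) < 1" by simp
    thus ?thesis by (simp add: r_def nn_def real_sqrt_mult)
  qed
  define L where "L = (\<lambda>i. if i then q else p)"
  have L: "app (L i) \<in> generated_vN (if i then Y else X)" "tr (L i) = 0" "L i \<in> ops M" for i
  proof -
    have "app p \<in> generated_vN X" unfolding p_eq a1_def
      by (intro generated_closed X.rsv_generated ne)
    moreover have "app q \<in> generated_vN Y" unfolding q_eq a2_def
      by (intro generated_closed Y.rsv_generated ne)
    ultimately show "app (L i) \<in> generated_vN (if i then Y else X)" by (simp add: L_def)
    show "tr (L i) = 0" using \<omega> by (simp add: L_def p_def q_def X.tr_cent Y.tr_cent)
    show "L i \<in> ops M" by (simp add: L_def)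
  qed
  have nnk: "nn ((q * p) ^ k) = r ^ k" for k
    using nn_power[OF L, of True k] by (simp add: L_def r_def)
  define S where "S = (\<lambda>N. \<Sum>k<N. (q * p) ^ k)"
  define LN where "LN = (\<lambda>N. cs u * (a1 * (S N * a2)))"
  have SM [simp]: "S N \<in> ops M" for N unfolding S_def by (rule ops_sum) simp
  have LNM [simp]: "LN N \<in> ops M" for N by (simp add: LN_def)
  have a1_eq: "a1 = cs (1/u) * (p + 1)" and a2_eq: "a2 = cs (1/u) * (q + 1)"
    using u0 by (simp_all add: p_eq q_eq mult.assoc[symmetric] cs_mult[symmetric])
  \<comment> \<open>Expanding u a1 = p + 1 and u a2 = q + 1, every term is an alternating centred
    word except the constant one at k = 0. Hence the requirement N > 0.\<close>
  have tr_LN: "tr (LN N) = 1 / u" if "N > 0" for N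
  proof -
    have z1: "tr (p * (q * p) ^ k) = 0" "tr ((q * p) ^ k * q) = 0" "tr (p * (q * p) ^ k * q) = 0" for k
    proof -
      show "tr (p * (q * p) ^ k) = 0"
        using tr_alt[OF L, of "Suc (2 * k)" False] unfolding wprod_alt_odd by (simp add: L_def)
      have "(q * p) ^ k * q = q * (p * q) ^ k"
        by (induction k) (simp_all add: mult.assoc)
      thus "tr ((q * p) ^ k * q) = 0"
        using tr_alt[OF L, of "Suc (2 * k)" True] unfolding wprod_alt_odd by (simp add: L_def)
      have "p * (q * p) ^ k * q = (p * q) ^ Suc k"
        by (induction k) (simp_all add: mult.assoc)
      thus "tr (p * (q * p) ^ k * q) = 0"
        using tr_alt[OF L, of "2 * Suc k" False] unfolding wprod_alt_two by (simp add: L_def)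
    qed
    have z2: "tr ((q * p) ^ k) = (if k = 0 then 1 else 0)" for k
      using tr_alt[OF L, of "2 * k" True] unfolding wprod_alt_two by (auto simp: L_def)
    have t: "tr ((p + 1) * (q * p) ^ k * (q + 1)) = (if k = 0 then 1 else 0)" for k
    proof -
      have "(p + 1) * (q * p) ^ k * (q + 1) = p * (q * p) ^ k * q + p * (q * p) ^ k + (q * p) ^ k * q + (q * p) ^ k"
        by (simp add: distrib_left distrib_right add.assoc)
      thus ?thesis by (simp add: tr_add z1 z2)
    qed
    have "LN N = cs (1/u) * (\<Sum>k<N. (p + 1) * (q * p) ^ k * (q + 1))"
    proof -
      have "LN N = cs u * (cs (1/u) * (p + 1) * (S N * (cs (1/u) * (q + 1))))"
        unfolding LN_def a1_eq a2_eq ..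
      also have "S N * (cs (1/u) * (q + 1)) = cs (1/u) * (S N * (q + 1))"
        using cs_comm[of "S N" "1/u"] by (metis mult.assoc)
      also have "cs u * (cs (1/u) * (p + 1) * (cs (1/u) * (S N * (q + 1))))
          = (cs u * cs (1/u)) * ((p + 1) * cs (1/u) * (S N * (q + 1)))"
        by (simp only: mult.assoc)
      also have "cs u * cs (1/u) = 1" using u0 by (simp add: cs_mult[symmetric])
      also have "1 * ((p + 1) * cs (1/u) * (S N * (q + 1))) = cs (1/u) * ((p + 1) * S N * (q + 1))"
        unfolding cs_comm[of "p + 1"] by (simp only: mult.assoc mult_1_left)
      finally show ?thesis by (simp add: S_def sum_distrib_left sum_distrib_right)
    qed
    hence "tr (LN N) = (1/u) * (\<Sum>k<N. tr ((p + 1) * (q * p) ^ k * (q + 1)))"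
      by (simp add: tr_cs tr_sum ops_sum del: cs_mult)
    also have "(\<Sum>k<N. tr ((p + 1) * (q * p) ^ k * (q + 1))) = 1"
      unfolding t using that by (simp add: sum.delta)
    finally show ?thesis by simp
  qed
  \<comment> \<open>An L2 bound for the difference of partial sum and resolvent, uniform in
    \<open>N\<close>.\<close>
  define Mo where "Mo = cmod u * (1 / \<bar>Im \<omega>1\<bar> * (1 / \<bar>Im \<omega>2\<bar> * (1 / (1 - r)))) + 1 / \<bar>Im z\<bar>"
  have b1: "bnd a1 (1 / \<bar>Im \<omega>1\<bar>)" and b2: "bnd a2 (1 / \<bar>Im \<omega>2\<bar>)" and bR: "bnd R (1 / \<bar>Im z\<bar>)"
    unfolding a1_def a2_def R_def by (rule X.rsv_bnd Y.rsv_bnd Z.rsv_bnd; rule ne)+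
  have nn_D: "nn (LN N - R) \<le> Mo" for N
  proof -
    have "nn (S N) \<le> (\<Sum>k<N. r ^ k)"
      unfolding S_def using nn_sum[of "{..<N}" "\<lambda>k. (q * p) ^ k"] by (simp add: nnk)
    also have "\<dots> \<le> 1 / (1 - r)"
      using sum_le_suminf[of "\<lambda>k. r ^ k" "{..<N}"] r0 r1 by (simp add: suminf_geometric)
    finally have s: "nn (S N) \<le> 1 / (1 - r)" .
    have "nn (a1 * (S N * a2)) \<le> 1 / \<bar>Im \<omega>1\<bar> * nn (S N * a2)" by (intro nn_mult_left b1) auto
    also have "\<dots> \<le> 1 / \<bar>Im \<omega>1\<bar> * (1 / \<bar>Im \<omega>2\<bar> * nn (S N))" by (intro mult_left_mono nn_mult_right b2) auto
    also have "\<dots> \<le> 1 / \<bar>Im \<omega>1\<bar> * (1 / \<bar>Im \<omega>2\<bar> * (1 / (1 - r)))" by (intro mult_left_mono s) auto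
    finally have "cmod u * nn (a1 * (S N * a2)) \<le> cmod u * (1 / \<bar>Im \<omega>1\<bar> * (1 / \<bar>Im \<omega>2\<bar> * (1 / (1 - r))))"
      by (rule mult_left_mono) simp
    hence "nn (LN N) \<le> cmod u * (1 / \<bar>Im \<omega>1\<bar> * (1 / \<bar>Im \<omega>2\<bar> * (1 / (1 - r))))"
      by (simp add: LN_def nn_cs)
    moreover have "nn R \<le> 1 / \<bar>Im z\<bar>"
      using nn_mult_left[of R 1, OF _ _ bR] by (simp add: nn_one)
    ultimately show ?thesis using nn_diff[of "LN N" R] by (simp add: Mo_def)
  qed
  have Mo0: "0 \<le> Mo" by (rule order_trans[OF nn_nonneg nn_D[of 0]]) simp
  define d where "d = 1 / u - tr R"
  have tr_D: "tr (LN N - R) = d" if "N > 0" for N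
    using tr_LN[OF that] by (simp add: tr_diff d_def)
  \<comment> \<open>Algebra with the unbounded operators is legitimate only after cutting down to
    the range of \<open>h\<close>. The uncontrolled part has trace 1 - tr h, which is bounded by
    tails that vanish as \<open>K\<close> grows.\<close>
  have dK: "(cmod d)\<^sup>2 \<le> Mo\<^sup>2 * (measure \<mu>X {x. \<bar>x\<bar> > K} + measure \<mu>Z {x. \<bar>x\<bar> > K})" if K: "0 \<le> K" for K
  proof -
    obtain h AX AZ where h: "h \<in> ops M" "is_proj h" and A [simp]: "AX \<in> ops M" "AZ \<in> ops M" and
      hA: "\<And>y. (app h y, app AX y) \<in> X" "\<And>y. (app h y, app AZ y) \<in> Z"
      "\<And>y. norm (app AX y) \<le> K * norm (app h y)" "\<And>y. norm (app AZ y) \<le> K * norm (app h y)"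
      and trh: "1 - Re (tr h) \<le> measure \<mu>X {x. \<bar>x\<bar> > K} + measure \<mu>Z {x. \<bar>x\<bar> > K}"
      using meet_cutoff[OF K] by metis
    note [simp] = h(1)
    \<comment> \<open>\<open>C\<close> is (z - Z) h, and \<open>W\<close> below is (omega1 - X)
      h.\<close>
    define C where "C = cs z * h - AZ"
    define W where "W = cs \<omega>1 * h - AX"
    have CM [simp]: "C \<in> ops M" "W \<in> ops M" by (simp_all add: C_def W_def)
    have RC: "R * C = h" unfolding R_def C_def
      by (rule adop_eqI) (simp add: Z.rsv_eq[OF ne(3) hA(2)])
    have aW: "a1 * W = h" unfolding a1_def W_def
      by (rule adop_eqI) (simp add: X.rsv_eq[OF ne(1) hA(1)])
    \<comment> \<open>Because z = omega1 + omega2 - u, the bracket is (omega2 - Y) h.\<close>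
    have key: "a2 * (C - W + cs u * h) = h"
    proof (rule adop_eqI)
      fix y
      have "app (C - W + cs u * h) y = scaleC \<omega>2 (app h y) - (app AZ y - app AX y)"
        unfolding C_def W_def z(1) by (simp add: scaleC_add_left scaleC.diff_left algebra_simps)
      hence "app (a2 * (C - W + cs u * h)) y = app a2 (scaleC \<omega>2 (app h y) - (app AZ y - app AX y))"
        by (simp only: app_simps(5))
      also have "\<dots> = app h y" unfolding a2_def by (rule Y.rsv_eq[OF ne(2) sum_in[OF hA(1,2)]])
      finally show "app (a2 * (C - W + cs u * h)) y = app h y" .
    qed
    \<comment> \<open>Uses 1 - q p = u a1 + u a2 - u^2 a2 a1 together with a1 W = h.\<close>
    have key2: "cs u * (a2 * C) = (1 - q * p) * W"
    proof -
      have "a2 * C = h + a2 * W - a2 * (cs u * h)"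
        using key by (simp add: distrib_left right_diff_distrib) (metis add_diff_cancel_right' diff_add_cancel diff_add_eq)
      hence "cs u * (a2 * C) = cs u * h + cs u * (a2 * W) - cs u * (a2 * (cs u * h))"
        by (simp add: distrib_left right_diff_distrib)
      also have "a2 * (cs u * h) = cs u * (a2 * h)" using cs_comm[of a2 u] by (metis mult.assoc)
      finally have 1: "cs u * (a2 * C) = cs u * (a1 * W) + cs u * (a2 * W) - cs u * (cs u * (a2 * (a1 * W)))"
        by (simp only: aW)
      have "q * p = cs u * (a2 * (cs u * a1)) - cs u * a2 - cs u * a1 + 1"
        unfolding p_eq q_eq by (simp add: algebra_simps)
      also have "a2 * (cs u * a1) = cs u * (a2 * a1)" using cs_comm[of a2 u] by (metis mult.assoc)
      finally have "1 - q * p = cs u * a1 + cs u * a2 - cs u * (cs u * (a2 * a1))" by simp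
      thus ?thesis unfolding 1 by (simp only: distrib_right left_diff_distrib mult.assoc)
    qed
    have telescope: "S N * (1 - q * p) = 1 - (q * p) ^ N" for N
    proof (induction N)
      case (Suc N)
      have "S (Suc N) * (1 - q * p) = S N * (1 - q * p) + ((q * p) ^ N - (q * p) ^ N * (q * p))"
        unfolding S_def sum.lessThan_Suc distrib_right by (simp only: right_diff_distrib mult_1_right)
      thus ?case unfolding Suc by (simp add: power_Suc2 del: power_Suc)
    qed (simp add: S_def)
    \<comment> \<open>Telescoping the Neumann series on the range of \<open>C\<close> leaves one
      remainder, whose L2 norm decays like r^N.\<close>
    have DC: "(LN N - R) * C = cs (-1) * (a1 * ((q * p) ^ N * W))" for N
    proof -
      have "LN N * C = cs u * a1 * S N * (a2 * C)" by (simp add: LN_def mult.assoc)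
      also have "cs u * a1 * S N = a1 * S N * cs u"
        using cs_comm[of "a1 * S N" u] by (simp only: mult.assoc)
      also have "a1 * S N * cs u * (a2 * C) = a1 * S N * (cs u * (a2 * C))" by (simp only: mult.assoc)
      also have "\<dots> = a1 * (S N * (1 - q * p)) * W" unfolding key2 by (simp only: mult.assoc)
      also have "\<dots> = h - a1 * ((q * p) ^ N * W)"
        unfolding telescope by (simp add: right_diff_distrib left_diff_distrib aW mult.assoc)
      finally show ?thesis by (simp add: left_diff_distrib RC cs_minus_one)
    qed
    obtain c where c: "c > 0" "bnd C c" using bnd_ex by blast
    obtain w where w: "w > 0" "bnd W w" using bnd_ex by blast
    have nnDC: "nn ((LN N - R) * C) \<le> 1 / \<bar>Im \<omega>1\<bar> * (w * r ^ N)" for N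
    proof -
      have "nn ((LN N - R) * C) = nn (a1 * ((q * p) ^ N * W))" unfolding DC by (simp add: nn_cs)
      also have "\<dots> \<le> 1 / \<bar>Im \<omega>1\<bar> * nn ((q * p) ^ N * W)" by (intro nn_mult_left b1) auto
      also have "\<dots> \<le> 1 / \<bar>Im \<omega>1\<bar> * (w * nn ((q * p) ^ N))" by (intro mult_left_mono nn_mult_right w) auto
      finally show ?thesis by (simp add: nnk)
    qed
    \<comment> \<open>Rescaled to a contraction, as \<open>kernel_projection\<close>
      demands.\<close>
    define C' where "C' = cs (complex_of_real (1 / c)) * C"
    have C'M [simp]: "C' \<in> ops M" by (simp add: C'_def)
    have C'b: "bnd C' 1" unfolding bnd_def
    proof safe
      fix x
      show "norm (app C' x) \<le> 1 * norm x"
        using bndD[OF c(2), of x] c(1) by (simp add: C'_def norm_scaleC norm_divide field_simps)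
    qed simp
    \<comment> \<open>These approximate the projection onto the orthogonal complement of the range
      of \<open>C\<close>, where nothing is known about LN - R beyond the bound
      \<open>Mo\<close>.\<close>
    define Pn where "Pn = (\<lambda>n. (1 - C' * star C') ^ n)"
    have PnM [simp]: "Pn n \<in> ops M" for n by (simp add: Pn_def)
    have bound: "cmod d \<le> Mo * nn (Pn n)" for n
    proof -
      obtain S' where S': "1 - Pn n = C' * S'" using one_minus_power[of C' "star C'" n] by (auto simp: Pn_def)
      have Pn_eq: "1 - Pn n = C * (cs (complex_of_real (1 / c)) * S')"
        unfolding S' C'_def cs_comm[of C, symmetric] by (simp only: mult.assoc)
      define S1 where "S1 = R * (1 - Pn n)"
      have Ch: "C = C * h"
      proof (rule adop_eqI)
        fix y
        have "app AZ (app h y) = app AZ y"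
          using hA(2)[of "app h y"] hA(2)[of y] Z.unique is_proj_app[OF h(2)] by metis
        thus "app C y = app (C * h) y" by (simp add: C_def is_proj_app[OF h(2)])
      qed
      have P1: "1 - Pn n = C * S1"
      proof -
        have "C * S1 = C * (R * C) * (cs (complex_of_real (1 / c)) * S')"
          unfolding S1_def Pn_eq by (simp only: mult.assoc)
        thus ?thesis unfolding RC Ch[symmetric] Pn_eq ..
      qed
      have S1M [simp]: "S1 \<in> ops M" by (simp add: S1_def)
      have le: "cmod d \<le> 1 / \<bar>Im \<omega>1\<bar> * (w * r ^ N) * nn S1 + Mo * nn (Pn n)" if "N > 0" for N
      proof -
        let ?D = "LN N - R"
        have "?D = ?D * C * S1 + ?D * Pn n"
        proof -
          have "?D * (C * S1) = ?D * (1 - Pn n)" by (simp only: P1)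
          thus ?thesis by (simp add: right_diff_distrib mult.assoc)
        qed
        hence "tr ?D = tr (?D * C * S1 + ?D * Pn n)" by (rule arg_cong)
        also have "\<dots> = tr (?D * C * S1) + tr (?D * Pn n)" by (rule tr_add) auto
        finally have "d = tr (?D * C * S1) + tr (?D * Pn n)" using tr_D[OF that] by simp
        hence "cmod d \<le> cmod (tr (?D * C * S1)) + cmod (tr (?D * Pn n))" by (simp only: norm_triangle_ineq)
        also have "cmod (tr (?D * C * S1)) \<le> nn (?D * C) * nn S1" by (rule tr_le_nn) auto
        also have "\<dots> \<le> 1 / \<bar>Im \<omega>1\<bar> * (w * r ^ N) * nn S1" by (rule mult_right_mono[OF nnDC]) simp
        also have "cmod (tr (?D * Pn n)) \<le> nn ?D * nn (Pn n)" by (rule tr_le_nn) auto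
        also have "\<dots> \<le> Mo * nn (Pn n)" by (rule mult_right_mono[OF nn_D]) simp
        finally show ?thesis by simp
      qed
      have "(\<lambda>N. 1 / \<bar>Im \<omega>1\<bar> * (w * r ^ N) * nn S1 + Mo * nn (Pn n))
          \<longlonglongrightarrow> 1 / \<bar>Im \<omega>1\<bar> * (w * 0) * nn S1 + Mo * nn (Pn n)"
        by (intro tendsto_intros LIMSEQ_power_zero) (use r0 r1 in simp)
      hence "cmod d \<le> 1 / \<bar>Im \<omega>1\<bar> * (w * 0) * nn S1 + Mo * nn (Pn n)"
        by (rule LIMSEQ_le_const) (use le in \<open>auto intro!: exI[of _ 1]\<close>)
      thus ?thesis by simp
    qed
    obtain k where k: "k \<in> ops M" "is_proj k" "\<And>x. app k x = x \<longleftrightarrow> app C' x = 0"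
      "(\<lambda>n. Re (tr ((1 - star C' * C') ^ n))) \<longlonglongrightarrow> Re (tr k)"
      using kernel_projection[OF C'M C'b] by blast
    \<comment> \<open>\<open>C\<close> and \<open>h\<close> have the same kernel, so the limiting
      kernel projection is 1 - h.\<close>
    have Cx: "app C' x = 0 \<longleftrightarrow> app h x = 0" for x
    proof
      assume "app C' x = 0"
      hence "scaleC (complex_of_real c) (app C' x) = 0" by (simp add: scaleC.zero_right)
      hence "app C x = 0" using c(1) by (simp add: C'_def scaleC_scaleC)
      thus "app h x = 0" unfolding RC[symmetric] by (simp add: app_linear)
    next
      assume *: "app h x = 0"
      hence "app AZ x = 0" using hA(4)[of x] by simp
      thus "app C' x = 0" using * by (simp add: C'_def C_def scaleC.zero_right)
    qed
    have "k = 1 - h"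
    proof -
      have hk: "h * k = 0"
      proof (rule adop_eqI)
        fix x
        have "app h (app k x) = 0" using is_proj_app[OF k(2), of x] unfolding k(3) Cx .
        thus "app (h * k) x = app 0 x" by simp
      qed
      have "k * (1 - h) = 1 - h"
      proof (rule adop_eqI)
        fix x
        have "app h (app (1 - h) x) = 0" using is_proj_app[OF h(2)] by (simp add: app_linear)
        hence "app k (app (1 - h) x) = app (1 - h) x" unfolding k(3) Cx .
        thus "app (k * (1 - h)) x = app (1 - h) x" by (simp only: app_simps(5))
      qed
      hence "star (k * (1 - h)) = star (1 - h)" by (rule arg_cong)
      hence "(1 - h) * k = 1 - h" using k(2) h(2) by (simp add: is_proj_def)
      thus ?thesis using hk by (simp add: left_diff_distrib)
    qed
    hence trk: "Re (tr k) = 1 - Re (tr h)" by (simp add: tr_diff)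
    \<comment> \<open>\<open>Pn\<close> is built from C' star C', the kernel of C' from star C' C';
      traciality exchanges the two.\<close>
    have sq: "(cmod d)\<^sup>2 \<le> Mo\<^sup>2 * Re (tr ((1 - star C' * C') ^ (2 * n)))" for n
    proof -
      have "star (Pn n) = Pn n" by (simp add: Pn_def star_power)
      hence "n2 (Pn n) = Re (tr (Pn n * Pn n))" by (simp add: n2_def)
      also have "Pn n * Pn n = (1 - C' * star C') ^ (2 * n)" by (simp add: Pn_def power_add[symmetric] mult_2)
      also have "Re (tr \<dots>) = Re (tr ((1 - star C' * C') ^ (2 * n)))" by (simp only: tr_power_swap[OF C'M])
      finally have n2P: "n2 (Pn n) = Re (tr ((1 - star C' * C') ^ (2 * n)))" .
      have "(cmod d)\<^sup>2 \<le> (Mo * nn (Pn n))\<^sup>2" using bound by (intro power_mono) auto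
      also have "\<dots> = Mo\<^sup>2 * n2 (Pn n)" by (simp add: power_mult_distrib nn_def)
      finally show ?thesis unfolding n2P .
    qed
    have "(\<lambda>n. Re (tr ((1 - star C' * C') ^ (2 * n)))) \<longlonglongrightarrow> Re (tr k)"
      using LIMSEQ_subseq_LIMSEQ[OF k(4), of "\<lambda>n. 2 * n"] by (simp add: strict_mono_def comp_def)
    hence "(\<lambda>n. Mo\<^sup>2 * Re (tr ((1 - star C' * C') ^ (2 * n)))) \<longlonglongrightarrow> Mo\<^sup>2 * Re (tr k)"
      by (intro tendsto_mult tendsto_const)
    hence "(cmod d)\<^sup>2 \<le> Mo\<^sup>2 * Re (tr k)" by (rule LIMSEQ_le_const) (use sq in auto)
    also have "\<dots> \<le> Mo\<^sup>2 * (measure \<mu>X {x. \<bar>x\<bar> > K} + measure \<mu>Z {x. \<bar>x\<bar> > K})"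
      using trh unfolding trk by (rule mult_left_mono) simp
    finally show ?thesis .
  qed
  have cX: "(\<lambda>n. measure \<mu>X {x. \<bar>x\<bar> > real n}) \<longlonglongrightarrow> 0" and cZ: "(\<lambda>n. measure \<mu>Z {x. \<bar>x\<bar> > real n}) \<longlonglongrightarrow> 0"
  proof -
    have c: "{x. \<bar>x\<bar> > K} = UNIV - {-K..K}" for K :: real by auto
    have e: "measure \<mu>X {x. \<bar>x\<bar> > K} = 1 - measure \<mu>X {-K..K}" "measure \<mu>Z {x. \<bar>x\<bar> > K} = 1 - measure \<mu>Z {-K..K}" for K
      unfolding c using X.D.prob_compl[of "{-K..K}"] Z.D.prob_compl[of "{-K..K}"] by simp_all
    show "(\<lambda>n. measure \<mu>X {x. \<bar>x\<bar> > real n}) \<longlonglongrightarrow> 0"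
      unfolding e using tendsto_diff[OF tendsto_const X.D.measure_interval_tendsto, of 1] by simp
    show "(\<lambda>n. measure \<mu>Z {x. \<bar>x\<bar> > real n}) \<longlonglongrightarrow> 0"
      unfolding e using tendsto_diff[OF tendsto_const Z.D.measure_interval_tendsto, of 1] by simp
  qed
  have "(\<lambda>n. Mo\<^sup>2 * (measure \<mu>X {x. \<bar>x\<bar> > real n} + measure \<mu>Z {x. \<bar>x\<bar> > real n})) \<longlonglongrightarrow> Mo\<^sup>2 * (0 + 0)"
    by (intro tendsto_intros cX cZ)
  hence "(cmod d)\<^sup>2 \<le> Mo\<^sup>2 * (0 + 0)" by (rule LIMSEQ_le_const) (use dK in auto)
  hence "tr R = 1 / u" by (simp add: d_def)
  thus ?thesis using ne u0 by (simp add: R_def Z.tr_rsv F_transform_def)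
qed

end

section \<open>Slow variation\<close>

definition sv :: "(real \<Rightarrow> real) \<Rightarrow> bool" where
  "sv f \<longleftrightarrow> (\<forall>\<^sub>F x in at_top. 0 < f x) \<and> (\<forall>c>0. ((\<lambda>x. f (c * x) / f x) \<longlongrightarrow> 1) at_top)"

lemma filterlim_mult_at_top: "0 < c \<Longrightarrow> filterlim (\<lambda>x::real. c * x) at_top at_top"
  by (rule filterlim_tendsto_pos_mult_at_top[OF tendsto_const]) (auto intro: filterlim_ident)

lemma sv_ratio:
  assumes g: "sv g" and lim: "((\<lambda>x. f x / g x) \<longlongrightarrow> L) at_top" and L: "L > 0"
  shows "sv f"
proof -
  have gp: "\<forall>\<^sub>F x in at_top. 0 < g x" using g by (simp add: sv_def)
  have fp: "\<forall>\<^sub>F x in at_top. 0 < f x"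
    using gp order_tendstoD(1)[OF lim L] by eventually_elim (simp add: zero_less_divide_iff)
  have "((\<lambda>x. f (c * x) / f x) \<longlongrightarrow> 1) at_top" if c: "c > 0" for c
  proof -
    note comp = filterlim_mult_at_top[OF c]
    have 1: "((\<lambda>x. f (c * x) / g (c * x)) \<longlongrightarrow> L) at_top" by (rule filterlim_compose[OF lim comp])
    have 2: "((\<lambda>x. g (c * x) / g x) \<longlongrightarrow> 1) at_top" using g c by (simp add: sv_def)
    have "((\<lambda>x. (f (c * x) / g (c * x)) * (g (c * x) / g x) / (f x / g x)) \<longlongrightarrow> L * 1 / L) at_top"
      by (intro tendsto_intros 1 2 lim) (use L in simp)
    hence "((\<lambda>x. (f (c * x) / g (c * x)) * (g (c * x) / g x) / (f x / g x)) \<longlongrightarrow> 1) at_top"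
      using L by simp
    moreover have "\<forall>\<^sub>F x in at_top. (f (c * x) / g (c * x)) * (g (c * x) / g x) / (f x / g x) = f (c * x) / f x"
      using gp fp filterlim_iff[THEN iffD1, OF comp, rule_format, OF gp] by eventually_elim (simp add: field_simps)
    ultimately show ?thesis by (rule Lim_transform_eventually)
  qed
  thus ?thesis using fp by (simp add: sv_def)
qed

lemma sv_const_limit: "(f \<longlongrightarrow> L) at_top \<Longrightarrow> L > 0 \<Longrightarrow> sv f"
  by (rule sv_ratio[of "\<lambda>_. 1"]) (auto simp: sv_def)

text \<open>The ratio of \<open>f\<close> and \<open>g\<close> need not converge, so the increments
  are compared instead: each is at most \<open>e\<close> times its own function, and such bounds
  add.\<close>

lemma sv_add_limit:
  assumes f: "sv f" and g: "(g \<longlongrightarrow> d) at_top" and d: "d > 0"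
  shows "sv (\<lambda>x. f x + g x)"
proof -
  have gs: "sv g" by (rule sv_const_limit[OF g d])
  have ev: "\<forall>\<^sub>F x in at_top. 0 < f x" "\<forall>\<^sub>F x in at_top. 0 < g x" using f gs by (auto simp: sv_def)
  have "((\<lambda>x. (f (c * x) + g (c * x)) / (f x + g x)) \<longlongrightarrow> 1) at_top" if c: "c > 0" for c
  proof (rule tendstoI)
    fix e :: real assume e: "e > 0"
    have "\<forall>\<^sub>F x in at_top. dist (f (c * x) / f x) 1 < e" "\<forall>\<^sub>F x in at_top. dist (g (c * x) / g x) 1 < e"
      using f gs c e by (auto simp: sv_def dest: tendstoD)
    thus "\<forall>\<^sub>F x in at_top. dist ((f (c * x) + g (c * x)) / (f x + g x)) 1 < e"
      using ev
    proof eventually_elim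
      case (elim x)
      have "\<bar>f (c * x) - f x\<bar> < e * f x" "\<bar>g (c * x) - g x\<bar> < e * g x"
        using elim by (auto simp: dist_real_def abs_less_iff field_simps)
      hence "\<bar>(f (c * x) + g (c * x)) - (f x + g x)\<bar> < e * (f x + g x)" by (simp add: distrib_left)
      thus ?case using elim by (simp add: dist_real_def abs_less_iff field_simps)
    qed
  qed
  moreover have "\<forall>\<^sub>F x in at_top. 0 < f x + g x" using ev by eventually_elim simp
  ultimately show ?thesis by (simp add: sv_def)
qed

text \<open>Eventually f (4x) <= 2 f x, and sqrt 4 = 2, so iteration gives growth of order at most
  sqrt; monotonicity covers the points between powers of 4.\<close>

lemma sv_growth:
  assumes f: "sv f" and mono: "\<And>x y. 0 < x \<Longrightarrow> x \<le> y \<Longrightarrow> f x \<le> f y"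
  obtains C y0 where "C > 0" "y0 > 0" "\<And>y. y \<ge> y0 \<Longrightarrow> 0 < f y \<and> f y \<le> C * sqrt y"
proof -
  have "((\<lambda>x. f (4 * x) / f x) \<longlongrightarrow> 1) at_top" using f by (simp add: sv_def)
  hence "\<forall>\<^sub>F x in at_top. f (4 * x) / f x < 2" by (rule order_tendstoD) simp
  moreover have "\<forall>\<^sub>F x in at_top. 0 < f x" using f by (simp add: sv_def)
  ultimately have "\<forall>\<^sub>F x in at_top. 0 < f x \<and> f (4 * x) \<le> 2 * f x"
    by eventually_elim (simp add: divide_less_eq)
  then obtain y1 where y1: "\<And>x. x \<ge> y1 \<Longrightarrow> 0 < f x \<and> f (4 * x) \<le> 2 * f x"
    by (auto simp: eventually_at_top_linorder)
  define y0 where "y0 = max y1 1"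
  have y0: "y0 > 0" "y0 \<ge> y1" by (auto simp: y0_def)
  have ind: "f y \<le> 2 * f y0 * sqrt (y / y0)" if "y0 \<le> y" "y \<le> y0 * 4 ^ k" for k y
    using that
  proof (induction k arbitrary: y)
    case 0
    hence "y = y0" by simp
    thus ?case using y0 y1[of y0] by simp
  next
    case (Suc k)
    show ?case
    proof (cases "y \<le> 4 * y0")
      case True
      have "f y \<le> f (4 * y0)" using Suc.prems y0 True by (intro mono) auto
      also have "\<dots> \<le> 2 * f y0 * 1" using y1[of y0] y0 by simp
      also have "\<dots> \<le> 2 * f y0 * sqrt (y / y0)" using y0 y1[of y0] Suc.prems by (intro mult_left_mono) auto
      finally show ?thesis .
    next
      case False
      have "f y = f (4 * (y / 4))" by simp
      also have "\<dots> \<le> 2 * f (y / 4)" using y1[of "y / 4"] False y0 by simp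
      also have "f (y / 4) \<le> 2 * f y0 * sqrt (y / 4 / y0)" using False Suc.prems by (intro Suc.IH) auto
      also have "sqrt (y / 4 / y0) = sqrt (y / y0) / 2" by (simp add: real_sqrt_divide real_sqrt_mult)
      finally show ?thesis by simp
    qed
  qed
  have "0 < f y \<and> f y \<le> (2 * f y0 / sqrt y0) * sqrt y" if "y \<ge> y0" for y
  proof -
    obtain k where "y / y0 < 4 ^ k" using real_arch_pow[of 4 "y / y0"] by auto
    hence "y \<le> y0 * 4 ^ k" using y0 by (simp add: divide_less_eq mult.commute)
    from ind[OF that this] show ?thesis using y1[of y] that y0 by (simp add: real_sqrt_divide)
  qed
  thus ?thesis using that[of "2 * f y0 / sqrt y0" y0] y0 y1[of y0] by simp
qed

text \<open>Summation over dyadic scales from infinity, where \<open>g\<close> vanishes; the errors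
  form a geometric series.\<close>

lemma telescope_bound:
  fixes g e :: "real \<Rightarrow> real"
  assumes g: "\<And>R. R \<ge> R0 \<Longrightarrow> g R \<le> e R + g (2 * R)" and e: "\<And>R. R \<ge> R0 \<Longrightarrow> e (2 * R) \<le> q * e R"
    and q: "0 \<le> q" "q < 1" and lim: "(g \<longlongrightarrow> 0) at_top" and R: "R \<ge> R0" "R0 > 0"
  shows "g R \<le> e R / (1 - q)"
proof -
  have ind: "g R \<le> e R * (\<Sum>i<k. q ^ i) + g (2 ^ k * R)" if "R \<ge> R0" for k R
    using that
  proof (induction k arbitrary: R)
    case (Suc k)
    have "g R \<le> e R + g (2 * R)" by (rule g[OF Suc.prems])
    also have "g (2 * R) \<le> e (2 * R) * (\<Sum>i<k. q ^ i) + g (2 ^ k * (2 * R))"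
      using Suc.prems R(2) by (intro Suc.IH) simp
    also have "e (2 * R) * (\<Sum>i<k. q ^ i) \<le> (q * e R) * (\<Sum>i<k. q ^ i)"
      using e[OF Suc.prems] q by (intro mult_right_mono sum_nonneg) auto
    also have "e R + (q * e R * (\<Sum>i<k. q ^ i) + g (2 ^ k * (2 * R)))
        = e R * (\<Sum>i<Suc k. q ^ i) + g (2 ^ Suc k * R)"
      unfolding sum.lessThan_Suc_shift by (simp add: sum_distrib_left distrib_left mult.assoc mult.commute mult.left_commute)
    finally show ?case by simp
  qed simp
  have "filterlim (\<lambda>k. 2 ^ k * R) at_top sequentially"
    using R by real_asymp
  moreover have "(\<lambda>k. \<Sum>i<k. q ^ i) \<longlonglongrightarrow> 1 / (1 - q)"
    using geometric_sums[of q] q by (simp add: sums_def)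
  ultimately have "(\<lambda>k. e R * (\<Sum>i<k. q ^ i) + g (2 ^ k * R)) \<longlonglongrightarrow> e R * (1 / (1 - q)) + 0"
    by (intro tendsto_intros filterlim_compose[OF lim])
  hence "g R \<le> e R * (1 / (1 - q)) + 0"
    by (rule LIMSEQ_le_const) (use ind[OF R(1)] in auto)
  thus ?thesis by simp
qed

section \<open>Smoothed truncated second moments\<close>

text \<open>A smooth truncation: the kernel is comparable to the minimum of x^2 and y^2, and this is
  the form in which transforms on the imaginary axis see a second moment.\<close>

definition smooth2 :: "real measure \<Rightarrow> real \<Rightarrow> real" where
  "smooth2 \<rho> y = (\<integral>x. x\<^sup>2 * y\<^sup>2 / (x\<^sup>2 + y\<^sup>2) \<partial>\<rho>)"

lemma kernel_le_y: "x\<^sup>2 * y\<^sup>2 / (x\<^sup>2 + y\<^sup>2) \<le> (y::real)\<^sup>2"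
proof (cases "x\<^sup>2 + y\<^sup>2 = 0")
  case False
  hence "x\<^sup>2 + y\<^sup>2 > 0" using sum_power2_ge_zero[of x y] by linarith
  thus ?thesis by (simp add: divide_le_eq distrib_left)
qed simp

lemma kernel_le_x: "x\<^sup>2 * y\<^sup>2 / (x\<^sup>2 + y\<^sup>2) \<le> (x::real)\<^sup>2"
  using kernel_le_y[of y x] by (simp add: add.commute mult.commute)

lemma kernel_nonneg: "0 \<le> x\<^sup>2 * y\<^sup>2 / (x\<^sup>2 + (y::real)\<^sup>2)"
  by simp

lemma kernel_mono:
  fixes x y y' :: real
  assumes "0 < y" "y \<le> y'" shows "x\<^sup>2 * y\<^sup>2 / (x\<^sup>2 + y\<^sup>2) \<le> x\<^sup>2 * y'\<^sup>2 / (x\<^sup>2 + y'\<^sup>2)"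
proof -
  have "y\<^sup>2 \<le> y'\<^sup>2" "0 < y\<^sup>2" "0 < y'\<^sup>2" using assms by (auto intro: power_mono)
  hence p: "0 < x\<^sup>2 + y\<^sup>2" "0 < x\<^sup>2 + y'\<^sup>2" by (auto intro: add_nonneg_pos)
  have "x\<^sup>2 * x\<^sup>2 * y\<^sup>2 \<le> x\<^sup>2 * x\<^sup>2 * y'\<^sup>2" using \<open>y\<^sup>2 \<le> y'\<^sup>2\<close> by (intro mult_left_mono) auto
  thus ?thesis using p by (simp add: divide_le_eq pos_le_divide_eq frac_le_eq algebra_simps)
qed

locale fin_borel = finite_borel_measure \<rho> for \<rho> :: "real measure"
begin

lemma sets_borel [simp]: "sets \<rho> = sets borel" by (rule M_is_borel)

lemma space_UNIV [simp]: "space \<rho> = UNIV" using sets_eq_imp_space_eq[OF sets_borel] by simp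

lemma borel_meas [simp]: "borel_measurable \<rho> = borel_measurable borel"
  by (rule measurable_cong_sets) simp_all

lemma int_bdd:
  fixes f :: "real \<Rightarrow> 'b::{banach, second_countable_topology}"
  assumes "f \<in> borel_measurable borel" "\<And>x. norm (f x) \<le> B" shows "integrable \<rho> f"
  by (rule integrable_const_bound[where B=B]) (use assms in auto)

lemma kernel_integrable: "integrable \<rho> (\<lambda>x. x\<^sup>2 * y\<^sup>2 / (x\<^sup>2 + y\<^sup>2))"
  by (rule int_bdd[where B="y\<^sup>2"]) (use kernel_le_y kernel_nonneg in \<open>auto simp: abs_of_nonneg\<close>)

lemma smooth2_nonneg: "0 \<le> smooth2 \<rho> y"
  unfolding smooth2_def by (intro integral_nonneg_AE) simp

lemma smooth2_mono: "0 < y \<Longrightarrow> y \<le> y' \<Longrightarrow> smooth2 \<rho> y \<le> smooth2 \<rho> y'"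
  unfolding smooth2_def by (intro integral_mono kernel_integrable kernel_mono)

lemma trunc_eq: "truncated_second_moment \<rho> x = (\<integral>t. t\<^sup>2 * indicator {-x..x} t \<partial>\<rho>)"
  unfolding truncated_second_moment_def set_lebesgue_integral_def
  by (simp add: mult.commute)

lemma trunc_integrable: "integrable \<rho> (\<lambda>t. t\<^sup>2 * indicator {-x..x} t)"
proof (rule int_bdd[where B="x\<^sup>2"])
  fix t show "norm (t\<^sup>2 * indicator {-x..x} t) \<le> x\<^sup>2"
    by (auto simp: indicator_def abs_le_square_iff[symmetric] abs_le_iff)
qed simp

text \<open>Between R and 2R the mass is at most the growth of the truncated second moment over
  R^2.\<close>

lemma tail_step:
  assumes R: "R > 0"
  shows "measure \<rho> {x. \<bar>x\<bar> > R} \<le> (truncated_second_moment \<rho> (2 * R) - truncated_second_moment \<rho> R) / R\<^sup>2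
    + measure \<rho> {x. \<bar>x\<bar> > 2 * R}"
proof -
  have S: "{x. \<bar>x\<bar> > r} \<in> sets borel" for r :: real by simp
  have i: "integrable \<rho> (\<lambda>x. indicator {x. \<bar>x\<bar> > r} x :: real)" for r
    using S by (intro int_bdd[where B=1]) (auto simp: indicator_def)
  have "measure \<rho> {x. \<bar>x\<bar> > R} = (\<integral>x. indicator {x. \<bar>x\<bar> > R} x \<partial>\<rho>)" using S by simp
  also have "\<dots> \<le> (\<integral>x. (x\<^sup>2 * indicator {-(2*R)..2*R} x - x\<^sup>2 * indicator {-R..R} x) / R\<^sup>2 + indicator {x. \<bar>x\<bar> > 2 * R} x \<partial>\<rho>)"
  proof (rule integral_mono[OF i])
    show "integrable \<rho> (\<lambda>x. (x\<^sup>2 * indicator {-(2*R)..2*R} x - x\<^sup>2 * indicator {-R..R} x) / R\<^sup>2 + indicator {x. \<bar>x\<bar> > 2 * R} x)"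
      by (intro Bochner_Integration.integrable_add integrable_divide Bochner_Integration.integrable_diff trunc_integrable i)
    fix x :: real
    consider "\<bar>x\<bar> \<le> R" | "R < \<bar>x\<bar>" "\<bar>x\<bar> \<le> 2 * R" | "\<bar>x\<bar> > 2 * R" by linarith
    thus "indicator {x. \<bar>x\<bar> > R} x \<le> (x\<^sup>2 * indicator {-(2*R)..2*R} x - x\<^sup>2 * indicator {-R..R} x) / R\<^sup>2 + (indicator {x. \<bar>x\<bar> > 2 * R} x :: real)"
    proof cases
      case 1
      hence "x \<in> {-R..R}" "x \<in> {-(2*R)..2*R}" using R by auto
      thus ?thesis using 1 R by simp
    next
      case 2
      hence "x \<notin> {-R..R}" "x \<in> {-(2*R)..2*R}" by auto
      moreover have "R\<^sup>2 \<le> x\<^sup>2" using 2 R by (simp add: abs_le_square_iff[symmetric])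
      ultimately show ?thesis using 2 R by simp
    next
      case 3
      hence "x \<notin> {-R..R}" "x \<notin> {-(2*R)..2*R}" using R by auto
      thus ?thesis using 3 R by simp
    qed
  qed
  also have "\<dots> = (truncated_second_moment \<rho> (2 * R) - truncated_second_moment \<rho> R) / R\<^sup>2 + measure \<rho> {x. \<bar>x\<bar> > 2 * R}"
  proof -
    have "(\<integral>x. (x\<^sup>2 * indicator {-(2*R)..2*R} x - x\<^sup>2 * indicator {-R..R} x) / R\<^sup>2 + indicator {x. \<bar>x\<bar> > 2 * R} x \<partial>\<rho>)
      = (\<integral>x. (x\<^sup>2 * indicator {-(2*R)..2*R} x - x\<^sup>2 * indicator {-R..R} x) / R\<^sup>2 \<partial>\<rho>) + (\<integral>x. indicator {x. \<bar>x\<bar> > 2 * R} x \<partial>\<rho>)"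
      by (intro Bochner_Integration.integral_add integrable_divide Bochner_Integration.integrable_diff trunc_integrable i)
    also have "(\<integral>x. (x\<^sup>2 * indicator {-(2*R)..2*R} x - x\<^sup>2 * indicator {-R..R} x) / R\<^sup>2 \<partial>\<rho>)
      = (truncated_second_moment \<rho> (2 * R) - truncated_second_moment \<rho> R) / R\<^sup>2"
      unfolding trunc_eq by (subst integral_divide_zero, subst Bochner_Integration.integral_diff[OF trunc_integrable trunc_integrable]) simp
    finally show ?thesis using S by simp
  qed
  finally show ?thesis .
qed

lemma tail_tendsto: "((\<lambda>R. measure \<rho> {x. \<bar>x\<bar> > R}) \<longlongrightarrow> 0) at_top"
proof (rule tendstoI)
  fix e :: real assume e: "e > 0"
  have "(\<lambda>n. measure \<rho> {x. \<bar>x\<bar> > real n}) \<longlonglongrightarrow> measure \<rho> (\<Inter>n. {x. \<bar>x\<bar> > real n})"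
  proof (rule finite_Lim_measure_decseq)
    show "decseq (\<lambda>n. {x. \<bar>x\<bar> > real n})" by (auto simp: decseq_def)
  qed auto
  also have "(\<Inter>n. {x. \<bar>x\<bar> > real n}) = {}"
  proof -
    have "\<exists>n. \<not> \<bar>x\<bar> > real n" for x :: real using real_arch_simple[of "\<bar>x\<bar>"] by (auto simp: not_less)
    thus ?thesis by blast
  qed
  finally have "(\<lambda>n. measure \<rho> {x. \<bar>x\<bar> > real n}) \<longlonglongrightarrow> 0" by simp
  from order_tendstoD(2)[OF this e] obtain n where n: "measure \<rho> {x. \<bar>x\<bar> > real n} < e"
    by (auto simp: eventually_sequentially)
  show "\<forall>\<^sub>F R in at_top. dist (measure \<rho> {x. \<bar>x\<bar> > R}) 0 < e"
    using eventually_ge_at_top[of "real n"]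
  proof eventually_elim
    case (elim R)
    have "measure \<rho> {x. \<bar>x\<bar> > R} \<le> measure \<rho> {x. \<bar>x\<bar> > real n}"
      by (rule finite_measure_mono) (use elim in auto)
    thus ?case using n by simp
  qed
qed

lemma smooth2_upper:
  assumes "y > 0" shows "smooth2 \<rho> y \<le> truncated_second_moment \<rho> y + y\<^sup>2 * measure \<rho> {x. \<bar>x\<bar> > y}"
proof -
  have S: "{x. \<bar>x\<bar> > y} \<in> sets borel" by simp
  have i: "integrable \<rho> (\<lambda>x. y\<^sup>2 * indicator {x. \<bar>x\<bar> > y} x)"
    using S by (intro int_bdd[where B="y\<^sup>2"]) (auto simp: indicator_def)
  have "smooth2 \<rho> y \<le> (\<integral>x. x\<^sup>2 * indicator {-y..y} x + y\<^sup>2 * indicator {x. \<bar>x\<bar> > y} x \<partial>\<rho>)"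
    unfolding smooth2_def
  proof (rule integral_mono[OF kernel_integrable Bochner_Integration.integrable_add[OF trunc_integrable i]])
    fix x
    show "x\<^sup>2 * y\<^sup>2 / (x\<^sup>2 + y\<^sup>2) \<le> x\<^sup>2 * indicator {-y..y} x + y\<^sup>2 * indicator {x. \<bar>x\<bar> > y} x"
    proof (cases "\<bar>x\<bar> \<le> y")
      case True
      hence "x \<in> {-y..y}" by auto
      thus ?thesis using True kernel_le_x[of x y] by simp
    next
      case False
      hence "x \<notin> {-y..y}" by auto
      thus ?thesis using False kernel_le_y[of x y] by simp
    qed
  qed
  also have "\<dots> = truncated_second_moment \<rho> y + y\<^sup>2 * measure \<rho> {x. \<bar>x\<bar> > y}"
    using S by (subst Bochner_Integration.integral_add[OF trunc_integrable i]) (simp add: trunc_eq)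
  finally show ?thesis .
qed

lemma smooth2_lower:
  assumes "y > 0" "K > 0"
  shows "truncated_second_moment \<rho> (y / K) * (1 / (1 + 1 / K\<^sup>2)) \<le> smooth2 \<rho> y"
proof -
  have "truncated_second_moment \<rho> (y / K) * (1 / (1 + 1 / K\<^sup>2))
     = (\<integral>x. x\<^sup>2 * indicator {-(y/K)..y/K} x * (1 / (1 + 1 / K\<^sup>2)) \<partial>\<rho>)"
    unfolding trunc_eq by (rule integral_mult_left_zero[symmetric])
  also have "\<dots> \<le> smooth2 \<rho> y" unfolding smooth2_def
  proof (rule integral_mono[OF integrable_mult_left[OF trunc_integrable] kernel_integrable])
    fix x
    show "x\<^sup>2 * indicator {-(y/K)..y/K} x * (1 / (1 + 1 / K\<^sup>2)) \<le> x\<^sup>2 * y\<^sup>2 / (x\<^sup>2 + y\<^sup>2)"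
    proof (cases "x \<in> {-(y/K)..y/K}")
      case True
      hence "\<bar>x\<bar> \<le> \<bar>y / K\<bar>" using assms by (auto simp: abs_le_iff)
      hence "x\<^sup>2 \<le> (y / K)\<^sup>2" by (simp only: abs_le_square_iff)
      hence "x\<^sup>2 + y\<^sup>2 \<le> y\<^sup>2 * (1 + 1 / K\<^sup>2)" by (simp add: power_divide distrib_left)
      moreover have "0 < x\<^sup>2 + y\<^sup>2" using assms by (simp add: add_nonneg_pos)
      ultimately have "1 / (y\<^sup>2 * (1 + 1 / K\<^sup>2)) \<le> 1 / (x\<^sup>2 + y\<^sup>2)" by (intro frac_le) auto
      hence "x\<^sup>2 * y\<^sup>2 * (1 / (y\<^sup>2 * (1 + 1 / K\<^sup>2))) \<le> x\<^sup>2 * y\<^sup>2 * (1 / (x\<^sup>2 + y\<^sup>2))" by (rule mult_left_mono) simp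
      thus ?thesis using True assms by simp
    qed simp
  qed
  finally show ?thesis .
qed

text \<open>A Karamata-type argument: slow variation makes the tail mass at \<open>y\<close>
  negligible against H(y) / y^2, so smooth and sharp truncation are asymptotically equal.\<close>

lemma smooth2_sv:
  assumes H: "sv (truncated_second_moment \<rho>)"
  shows "sv (smooth2 \<rho>)"
proof (rule sv_ratio[OF H, of _ 1])
  let ?H = "truncated_second_moment \<rho>"
  have pos: "\<forall>\<^sub>F x in at_top. 0 < ?H x" using H by (simp add: sv_def)
  show "((\<lambda>x. smooth2 \<rho> x / ?H x) \<longlongrightarrow> 1) at_top"
  proof (rule tendstoI)
    fix e :: real assume e: "e > 0"
    \<comment> \<open>The dyadic sum below has ratio 1/2 and doubles epsilon, so 2 epsilon must stay
      below \<open>e\<close>.\<close>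
    define \<epsilon> where "\<epsilon> = min 1 (e / 4)"
    have \<epsilon>: "\<epsilon> > 0" "\<epsilon> \<le> 1" "2 * \<epsilon> < e" using e by (auto simp: \<epsilon>_def)
    have "\<forall>\<^sub>F x in at_top. ?H (2 * x) / ?H x < 1 + \<epsilon>"
      using H \<epsilon> by (intro order_tendstoD(2)[where y=1]) (auto simp: sv_def)
    hence "\<forall>\<^sub>F x in at_top. x > 0 \<and> 0 < ?H x \<and> ?H (2 * x) \<le> (1 + \<epsilon>) * ?H x"
      using pos eventually_gt_at_top[of 0] by eventually_elim (simp add: divide_less_eq)
    then obtain R0 where "\<And>x. x \<ge> R0 \<Longrightarrow> x > 0 \<and> 0 < ?H x \<and> ?H (2 * x) \<le> (1 + \<epsilon>) * ?H x"
      by (auto simp: eventually_at_top_linorder)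
    hence R0: "R0 > 0" "\<And>x. x \<ge> R0 \<Longrightarrow> 0 < ?H x \<and> ?H (2 * x) \<le> (1 + \<epsilon>) * ?H x" by auto
    \<comment> \<open>From R to 2R the numerator at most doubles (epsilon <= 1) while R^2 grows
      fourfold; this gives the ratio 1/2.\<close>
    have tail: "measure \<rho> {x. \<bar>x\<bar> > R} \<le> (\<epsilon> * ?H R / R\<^sup>2) / (1 - 1/2)" if "R \<ge> R0" for R
    proof (rule telescope_bound[where e="\<lambda>R. \<epsilon> * ?H R / R\<^sup>2" and ?R0.0=R0])
      fix R assume R: "R \<ge> R0"
      have "(?H (2 * R) - ?H R) / R\<^sup>2 \<le> \<epsilon> * ?H R / R\<^sup>2"
        using R0(2)[OF R] by (intro divide_right_mono) (auto simp: algebra_simps)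
      thus "measure \<rho> {x. R < \<bar>x\<bar>} \<le> \<epsilon> * ?H R / R\<^sup>2 + measure \<rho> {x. 2 * R < \<bar>x\<bar>}"
        using order_trans[OF tail_step[of R] add_right_mono] R R0(1) by simp
      have "?H (2 * R) \<le> (1 + \<epsilon>) * ?H R" using R0(2)[OF R] by simp
      also have "\<dots> \<le> 2 * ?H R" using R0(2)[OF R] \<epsilon> by (intro mult_right_mono) auto
      finally have "?H (2 * R) \<le> 2 * ?H R" .
      hence "\<epsilon> * ?H (2 * R) / (4 * R\<^sup>2) \<le> \<epsilon> * (2 * ?H R) / (4 * R\<^sup>2)"
        using \<epsilon> by (intro divide_right_mono mult_left_mono) auto
      thus "\<epsilon> * ?H (2 * R) / (2 * R)\<^sup>2 \<le> 1 / 2 * (\<epsilon> * ?H R / R\<^sup>2)" by (simp add: power_mult_distrib)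
    qed (use that R0 tail_tendsto in auto)
    \<comment> \<open>Large enough that truncating already at y / K loses only the factor 1 / (1 +
      1/K^2), which exceeds 1 - e.\<close>
    define K where "K = sqrt (2 / e) + 1"
    have K: "K > 0" "1 / K\<^sup>2 < e / 2"
    proof -
      have "2 / e = (sqrt (2 / e))\<^sup>2" using e by simp
      also have "\<dots> < K\<^sup>2" unfolding K_def by (intro power_strict_mono) (use e in auto)
      finally have *: "2 / e < K\<^sup>2" .
      show K: "K > 0" unfolding K_def using e by (intro add_nonneg_pos) auto
      show "1 / K\<^sup>2 < e / 2" using * e zero_less_power[OF K, of 2] by (simp add: field_simps)
    qed
    have "((\<lambda>x. ?H (1 / K * x) / ?H x * (1 / (1 + 1 / K\<^sup>2))) \<longlongrightarrow> 1 * (1 / (1 + 1 / K\<^sup>2))) at_top"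
    proof (intro tendsto_mult tendsto_const)
      have "1 / K > 0" using K by simp
      thus "((\<lambda>x. ?H (1 / K * x) / ?H x) \<longlongrightarrow> 1) at_top" using H unfolding sv_def by blast
    qed
    moreover have "1 - e < 1 * (1 / (1 + 1 / K\<^sup>2))"
    proof -
      have "(1 - e) * (1 + 1 / K\<^sup>2) < 1"
      proof (cases "e \<ge> 1")
        case True
        hence "(1 - e) * (1 + 1 / K\<^sup>2) \<le> 0" using K by (intro mult_nonpos_nonneg) auto
        thus ?thesis by simp
      next
        case False
        have "(1 - e) * (1 + 1 / K\<^sup>2) \<le> (1 - e) * (1 + e / 2)" using False K by (intro mult_left_mono) auto
        also have "\<dots> < 1" using e by (simp add: algebra_simps add_pos_pos)
        finally show ?thesis .
      qed
      thus ?thesis using K by (simp add: less_divide_eq add_pos_nonneg)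
    qed
    ultimately have low: "\<forall>\<^sub>F x in at_top. 1 - e < ?H (1 / K * x) / ?H x * (1 / (1 + 1 / K\<^sup>2))"
      by (rule order_tendstoD)
    show "\<forall>\<^sub>F x in at_top. dist (smooth2 \<rho> x / ?H x) 1 < e"
      using low eventually_ge_at_top[of R0]
    proof eventually_elim
      case (elim x)
      have x: "x > 0" "0 < ?H x" using elim R0 by auto
      have "x\<^sup>2 * measure \<rho> {t. \<bar>t\<bar> > x} \<le> x\<^sup>2 * ((\<epsilon> * ?H x / x\<^sup>2) / (1 - 1/2))"
        using tail[OF elim(2)] by (rule mult_left_mono) simp
      also have "\<dots> = 2 * \<epsilon> * ?H x" using x by simp
      finally have "x\<^sup>2 * measure \<rho> {t. \<bar>t\<bar> > x} \<le> 2 * \<epsilon> * ?H x" .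
      from order_trans[OF smooth2_upper[OF x(1)] add_left_mono[OF this]]
      have "smooth2 \<rho> x \<le> (1 + 2 * \<epsilon>) * ?H x" by (simp add: distrib_right)
      also have "\<dots> < (1 + e) * ?H x" using \<epsilon> x by (intro mult_strict_right_mono) auto
      finally have up: "smooth2 \<rho> x / ?H x < 1 + e" using x by (simp add: divide_less_eq)
      have "?H (1 / K * x) / ?H x * (1 / (1 + 1 / K\<^sup>2)) = (?H (x / K) * (1 / (1 + 1 / K\<^sup>2))) / ?H x" by simp
      also have "\<dots> \<le> smooth2 \<rho> x / ?H x" using smooth2_lower[OF x(1) K(1)] x by (intro divide_right_mono) auto
      finally have "1 - e < smooth2 \<rho> x / ?H x" using elim(1) by simp
      thus ?case using up by (simp add: dist_real_def abs_less_iff)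
    qed
  qed
qed simp

lemma smooth2_limit:
  assumes "integrable \<rho> (\<lambda>x. x\<^sup>2)" shows "(smooth2 \<rho> \<longlongrightarrow> (\<integral>x. x\<^sup>2 \<partial>\<rho>)) at_top"
  unfolding smooth2_def
proof (rule integral_dominated_convergence_at_top[where w="\<lambda>x. x\<^sup>2"])
  show "\<forall>\<^sub>F y in at_top. AE x in \<rho>. norm (x\<^sup>2 * y\<^sup>2 / (x\<^sup>2 + y\<^sup>2)) \<le> x\<^sup>2"
    using kernel_le_x kernel_nonneg by (auto simp: abs_of_nonneg intro!: always_eventually)
  have "((\<lambda>y. x\<^sup>2 * y\<^sup>2 / (x\<^sup>2 + y\<^sup>2)) \<longlongrightarrow> x\<^sup>2) at_top" for x :: real by real_asymp
  thus "AE x in \<rho>. ((\<lambda>y. x\<^sup>2 * y\<^sup>2 / (x\<^sup>2 + y\<^sup>2)) \<longlongrightarrow> x\<^sup>2) at_top" by simp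
qed (use assms in auto)

end

section \<open>Estimates for a single reciprocal Cauchy transform\<close>

context real_distribution
begin

sublocale fb: fin_borel M
  by unfold_locales simp

lemma Nev_lipschitz:
  assumes "Im z > 0" "Im w > 0"
  shows "cmod (Nev M z - Nev M w) \<le> cmod (z - w) * sqrt (Im (Nev M z) / Im z * (Im (Nev M w) / Im w))"
proof -
  have "cmod (Nev M z - Nev M w) \<le> sqrt ((cmod (z - w))\<^sup>2 * (Im (Nev M z) / Im z * (Im (Nev M w) / Im w)))"
    by (rule real_le_rsqrt[OF Nev_lipschitz_sq[OF assms]])
  thus ?thesis unfolding real_sqrt_mult[of "(cmod (z - w))\<^sup>2"] by simp
qed

lemma Im_half:
  assumes "Im z > 0" "cmod (w - z) \<le> Im z / 2" shows "Im w \<ge> Im z / 2" "Im w > 0"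
proof -
  have "\<bar>Im w - Im z\<bar> \<le> Im z / 2" using abs_Im_le_cmod[of "w - z"] assms(2) by simp
  thus "Im w \<ge> Im z / 2" by linarith
  thus "Im w > 0" using assms(1) by linarith
qed

text \<open>At distance at most half the height, the Lipschitz bound becomes (a - b)^2 <= a b / 2
  for the two imaginary parts, which confines a / b between 1/2 and 2.\<close>

lemma Nev_harnack:
  assumes z: "Im z > 0" and w: "cmod (w - z) \<le> Im z / 2"
  shows "Im (Nev M w) \<le> 3 * Im (Nev M z)"
proof (rule ccontr)
  define a b where "a = Im (Nev M w)" and "b = Im (Nev M z)"
  assume "\<not> Im (Nev M w) \<le> 3 * Im (Nev M z)"
  hence ab: "a > 3 * b" by (simp add: a_def b_def)
  note Iw = Im_half[OF z w]
  have b0: "b \<ge> 0" using Im_Nev_nonneg[OF z] by (simp add: b_def)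
  have "(a - b)\<^sup>2 \<le> (cmod (Nev M w - Nev M z))\<^sup>2"
    using abs_Im_le_cmod[of "Nev M w - Nev M z"] by (simp add: a_def b_def abs_le_square_iff[symmetric])
  also have "\<dots> \<le> (cmod (w - z))\<^sup>2 * (a / Im w * (b / Im z))"
    unfolding a_def b_def by (rule Nev_lipschitz_sq[OF Iw(2) z])
  also have "\<dots> \<le> (Im z / 2)\<^sup>2 * (a / (Im z / 2) * (b / Im z))"
    using w z Iw ab b0 by (intro mult_mono power_mono divide_left_mono) auto
  also have "\<dots> = a * b / 2" using z by (simp add: power2_eq_square)
  finally have "a * (a - (5/2) * b) \<le> - (b * b)" by (simp add: power2_eq_square algebra_simps)
  also have "\<dots> \<le> 0" by simp
  finally have "a * (a - (5/2) * b) \<le> 0" .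
  moreover have "a * (a - (5/2) * b) > 0" using ab b0 by (intro mult_pos_pos) linarith+
  ultimately show False by simp
qed

text \<open>The Lipschitz bound with one imaginary part replaced through Harnack; the constant 3
  dominates sqrt 6.\<close>

lemma Nev_local:
  assumes z: "Im z > 0" and w: "cmod (w - z) \<le> Im z / 2"
  shows "cmod (Nev M w - Nev M z) \<le> 3 * cmod (w - z) * Im (Nev M z) / Im z"
proof -
  note Iw = Im_half[OF z w]
  have b0: "Im (Nev M z) \<ge> 0" using Im_Nev_nonneg[OF z] .
  have "Im (Nev M w) / Im w \<le> 3 * Im (Nev M z) / (Im z / 2)"
    using Nev_harnack[OF assms] Iw z b0 by (intro frac_le) auto
  hence "Im (Nev M w) / Im w * (Im (Nev M z) / Im z) \<le> (3 * Im (Nev M z) / (Im z / 2)) * (Im (Nev M z) / Im z)"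
    using b0 z by (intro mult_right_mono) auto
  also have "\<dots> = 6 * (Im (Nev M z) / Im z)\<^sup>2" by (simp add: power2_eq_square)
  also have "6 * a\<^sup>2 \<le> (3 * a)\<^sup>2" for a :: real by (simp add: power_mult_distrib)
  finally have "sqrt (Im (Nev M w) / Im w * (Im (Nev M z) / Im z)) \<le> 3 * (Im (Nev M z) / Im z)"
    using b0 z by (intro real_le_lsqrt) auto
  hence "cmod (w - z) * sqrt (Im (Nev M w) / Im w * (Im (Nev M z) / Im z)) \<le> cmod (w - z) * (3 * (Im (Nev M z) / Im z))"
    by (rule mult_left_mono) simp
  from order_trans[OF Nev_lipschitz[OF Iw(2) z] this] show ?thesis by (simp add: mult.commute mult.left_commute)
qed

section \<open>Behaviour along the imaginary axis\<close>

definition vert :: "real \<Rightarrow> complex" where "vert y = Nev M (\<i> * complex_of_real y)"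

definition height :: "real \<Rightarrow> real" where "height y = y * Im (vert y)"

lemma vert_nonneg: "y > 0 \<Longrightarrow> 0 \<le> Im (vert y)"
  unfolding vert_def by (rule Im_Nev_nonneg) simp

lemma height_nonneg: "y > 0 \<Longrightarrow> 0 \<le> height y"
  by (simp add: height_def vert_nonneg)

lemma vert_lipschitz_sq:
  assumes "0 < y" "0 < y'"
  shows "(cmod (vert y - vert y'))\<^sup>2 \<le> (y - y')\<^sup>2 * (Im (vert y) / y * (Im (vert y') / y'))"
proof -
  have "cmod (\<i> * complex_of_real y - \<i> * complex_of_real y') = \<bar>y - y'\<bar>"
    by (simp add: right_diff_distrib[symmetric] norm_mult flip: of_real_diff)
  thus ?thesis using Nev_lipschitz_sq[of "\<i> * complex_of_real y" "\<i> * complex_of_real y'"] assms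
    by (simp add: vert_def)
qed

text \<open>Visible from Nevanlinna's representation; here the two-point inequality factors as (y a
  - y' b) (y' a - y b) <= 0.\<close>

lemma height_mono:
  assumes "0 < y" "y \<le> y'" shows "height y \<le> height y'"
proof (rule ccontr)
  define a b where "a = Im (vert y)" and "b = Im (vert y')"
  assume "\<not> height y \<le> height y'"
  hence gt: "y * a > y' * b" by (simp add: height_def a_def b_def)
  have y': "0 < y'" using assms by simp
  have ab: "0 \<le> a" "0 \<le> b" using vert_nonneg assms(1) y' by (auto simp: a_def b_def)
  have "(a - b)\<^sup>2 \<le> (cmod (vert y - vert y'))\<^sup>2"
    using abs_Im_le_cmod[of "vert y - vert y'"] by (simp add: a_def b_def abs_le_square_iff[symmetric])
  also have "\<dots> \<le> (y - y')\<^sup>2 * (a / y * (b / y'))"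
    unfolding a_def b_def by (rule vert_lipschitz_sq[OF assms(1) y'])
  finally have "(a - b)\<^sup>2 * (y * y') \<le> (y - y')\<^sup>2 * (a * b)"
    using assms(1) y' by (simp add: field_simps)
  hence "(y * a - y' * b) * (y' * a - y * b) \<le> 0" by (simp add: power2_eq_square algebra_simps)
  moreover have "y * b \<le> y' * b" "y * a \<le> y' * a" using assms ab by (auto intro: mult_right_mono)
  hence "y' * a - y * b > 0" using gt by linarith
  ultimately show False using gt by (simp add: mult_le_0_iff)
qed

lemma F_vert: "F_transform M (\<i> * complex_of_real y) = \<i> * complex_of_real y + vert y"
  by (simp add: vert_def Nev_def)

lemma G_vert_re:
  assumes "y > 0"
  shows "1 - \<i> * complex_of_real y * G_transform M (\<i> * complex_of_real y)
    = (\<integral>x. - complex_of_real x / (\<i> * complex_of_real y - complex_of_real x) \<partial>M)"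
proof -
  have y: "Im (\<i> * complex_of_real y) \<noteq> 0" using assms by simp
  have e: "- complex_of_real x / (\<i> * complex_of_real y - complex_of_real x)
     = 1 - \<i> * complex_of_real y * (1 / (\<i> * complex_of_real y - complex_of_real x))" for x
    using resolvent_ne[OF y, of x] by (simp add: field_simps)
  have "(\<integral>x. 1 - \<i> * complex_of_real y * (1 / (\<i> * complex_of_real y - complex_of_real x)) \<partial>M)
      = (\<integral>x. 1 \<partial>M) - (\<integral>x. \<i> * complex_of_real y * (1 / (\<i> * complex_of_real y - complex_of_real x)) \<partial>M)"
    by (rule Bochner_Integration.integral_diff) (use integrable_resolvent[OF y, THEN integrable_mult_right] in auto)
  also have "\<dots> = 1 - \<i> * complex_of_real y * G_transform M (\<i> * complex_of_real y)"
    unfolding integral_mult_right_zero G_transform_def by (simp add: prob_space[unfolded space_eq_univ])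
  finally show ?thesis unfolding e ..
qed

lemma F_vert_ne: "y > 0 \<Longrightarrow> \<i> * complex_of_real y + vert y \<noteq> 0"
  using vert_nonneg[of y] by (auto simp: complex_eq_iff)

lemma vert_quot:
  assumes "y > 0"
  shows "(\<integral>x. - complex_of_real x / (\<i> * complex_of_real y - complex_of_real x) \<partial>M)
    = vert y / (\<i> * complex_of_real y + vert y)"
proof -
  have "G_transform M (\<i> * complex_of_real y) = 1 / (\<i> * complex_of_real y + vert y)"
    unfolding F_vert[symmetric] by (simp add: F_transform_def)
  thus ?thesis using F_vert_ne[OF assms] unfolding G_vert_re[OF assms, symmetric] by (simp add: field_simps)
qed

lemma norm_quot_le_1: "norm (- complex_of_real x / (\<i> * complex_of_real y - complex_of_real x)) \<le> 1"
proof -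
  have "\<bar>x\<bar> \<le> cmod (\<i> * complex_of_real y - complex_of_real x)"
    using abs_Re_le_cmod[of "\<i> * complex_of_real y - complex_of_real x"] by simp
  thus ?thesis by (simp add: norm_divide divide_le_eq_1)
qed

text \<open>The real part of 1 - i y G(i y) = N / F at the point i y, multiplied by y^2.\<close>

lemma smooth2_eq:
  assumes "y > 0"
  shows "smooth2 M y = y\<^sup>2 * (((cmod (vert y))\<^sup>2 + height y) / (cmod (\<i> * complex_of_real y + vert y))\<^sup>2)"
proof -
  have "Re (- complex_of_real x / (\<i> * complex_of_real y - complex_of_real x)) = x\<^sup>2 / (x\<^sup>2 + y\<^sup>2)" for x
    by (simp add: Re_divide power2_eq_square)
  moreover have "integrable M (\<lambda>x. - complex_of_real x / (\<i> * complex_of_real y - complex_of_real x))"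
    by (rule integrable_bdd[where B=1]) (use norm_quot_le_1 in auto)
  ultimately have "(\<integral>x. x\<^sup>2 / (x\<^sup>2 + y\<^sup>2) \<partial>M) = Re (vert y / (\<i> * complex_of_real y + vert y))"
    unfolding vert_quot[OF assms, symmetric] by (subst integral_Re[symmetric]) simp_all
  also have "\<dots> = ((cmod (vert y))\<^sup>2 + height y) / (cmod (\<i> * complex_of_real y + vert y))\<^sup>2"
    unfolding Re_divide cmod_power2 by (simp add: height_def power2_eq_square algebra_simps)
  finally have *: "(\<integral>x. x\<^sup>2 / (x\<^sup>2 + y\<^sup>2) \<partial>M) = \<dots>" .
  have "smooth2 M y = (\<integral>x. y\<^sup>2 * (x\<^sup>2 / (x\<^sup>2 + y\<^sup>2)) \<partial>M)" unfolding smooth2_def by (simp add: mult.commute)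
  also have "\<dots> = y\<^sup>2 * (\<integral>x. x\<^sup>2 / (x\<^sup>2 + y\<^sup>2) \<partial>M)" by (rule integral_mult_right_zero)
  finally show ?thesis by (simp only: *)
qed

lemma tail_le_smooth2:
  assumes "y > 0" shows "measure M {x. \<bar>x\<bar> > y} \<le> 2 * smooth2 M y / y\<^sup>2"
proof -
  have S: "{x. \<bar>x\<bar> > y} \<in> sets borel" by simp
  have "measure M {x. \<bar>x\<bar> > y} = (\<integral>x. indicator {x. \<bar>x\<bar> > y} x \<partial>M)" using S by simp
  also have "\<dots> \<le> (\<integral>x. 2 / y\<^sup>2 * (x\<^sup>2 * y\<^sup>2 / (x\<^sup>2 + y\<^sup>2)) \<partial>M)"
  proof (rule integral_mono)
    show "integrable M (indicator {x. \<bar>x\<bar> > y} :: real \<Rightarrow> real)"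
      using S by (intro integrable_bdd[where B=1]) (auto simp: indicator_def)
    show "integrable M (\<lambda>x. 2 / y\<^sup>2 * (x\<^sup>2 * y\<^sup>2 / (x\<^sup>2 + y\<^sup>2)))"
      by (intro integrable_mult_right fb.kernel_integrable)
    fix x
    show "indicator {x. \<bar>x\<bar> > y} x \<le> 2 / y\<^sup>2 * (x\<^sup>2 * y\<^sup>2 / (x\<^sup>2 + y\<^sup>2))"
    proof (cases "\<bar>x\<bar> > y")
      case True
      hence "y\<^sup>2 \<le> x\<^sup>2" using assms by (simp add: abs_le_square_iff[symmetric])
      moreover have "0 < y\<^sup>2" using assms by simp
      ultimately have "1 \<le> 2 * x\<^sup>2 / (x\<^sup>2 + y\<^sup>2)" using add_nonneg_pos[of "x\<^sup>2" "y\<^sup>2"]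
        by (simp add: pos_le_divide_eq del: zero_less_power2)
      thus ?thesis using True assms by simp
    qed simp
  qed
  also have "\<dots> = 2 / y\<^sup>2 * smooth2 M y" unfolding smooth2_def by (rule integral_mult_right_zero)
  finally show ?thesis by simp
qed

text \<open>If \<open>\<integral> x\<^sup>2 / (x\<^sup>2 + y\<^sup>2)\<close> decays like \<open>y\<^sup>-\<^sup>3\<^sup>/\<^sup>2\<close>, summing over dyadic \<open>y\<close> bounds the first absolute moment.\<close>

lemma integrable_of_decay:
  assumes "\<And>y. y \<ge> y0 \<Longrightarrow> smooth2 M y \<le> C * sqrt y" and y0: "y0 > 0"
  shows "integrable M (\<lambda>x. x)"
proof -
  let ?k = "\<lambda>n x. (2 ^ n * y0) * (x\<^sup>2 / (x\<^sup>2 + (2 ^ n * y0)\<^sup>2))"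
  have C0: "C \<ge> 0"
  proof -
    have "0 \<le> C * sqrt y0" using assms(1)[of y0] fb.smooth2_nonneg[of y0] by linarith
    thus ?thesis using y0 by (simp add: zero_le_mult_iff)
  qed
  have int_k: "integrable M (?k n)" for n
  proof (rule integrable_bdd[where B="2 ^ n * y0"])
    fix x
    have "0 < (2 ^ n * y0)\<^sup>2" using y0 by simp
    hence "x\<^sup>2 / (x\<^sup>2 + (2 ^ n * y0)\<^sup>2) \<le> 1" by (simp add: divide_le_eq_1 add_nonneg_pos)
    hence "(2 ^ n * y0) * (x\<^sup>2 / (x\<^sup>2 + (2 ^ n * y0)\<^sup>2)) \<le> (2 ^ n * y0) * 1" using y0 by (intro mult_left_mono) auto
    thus "norm (?k n x) \<le> 2 ^ n * y0" using y0 by (simp add: abs_of_nonneg)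
  qed simp
  have k_le: "(\<integral>x. ?k n x \<partial>M) \<le> C / sqrt y0 * (1 / sqrt 2) ^ n" for n
  proof -
    define y where "y = 2 ^ n * y0"
    have y: "y > 0" "y \<ge> y0" using y0 by (auto simp: y_def)
    have "(\<integral>x. ?k n x \<partial>M) = (\<integral>x. 1 / y * (x\<^sup>2 * y\<^sup>2 / (x\<^sup>2 + y\<^sup>2)) \<partial>M)"
      unfolding y_def[symmetric] using y by (intro Bochner_Integration.integral_cong) (auto simp: power2_eq_square)
    also have "\<dots> = 1 / y * smooth2 M y" unfolding smooth2_def by (rule integral_mult_right_zero)
    also have "\<dots> \<le> 1 / y * (C * sqrt y)" using y assms(1) by (intro mult_left_mono) auto
    also have "\<dots> = C / sqrt y" using y by (simp add: field_simps)
    also have "\<dots> = C / sqrt y0 * (1 / sqrt 2) ^ n"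
      by (simp add: y_def real_sqrt_mult real_sqrt_power power_divide)
    finally show ?thesis .
  qed
  have abs_le: "ennreal \<bar>x\<bar> \<le> ennreal y0 + ennreal 4 * (\<Sum>n. ennreal (?k n x))" for x
  proof (cases "\<bar>x\<bar> \<le> y0")
    case True
    thus ?thesis by (intro order_trans[OF ennreal_leI[OF True]]) simp
  next
    case False
    \<comment> \<open>The dyadic block containing |x|; its single term of the series already
      dominates |x| / 4.\<close>
    define n where "n = (LEAST n. \<bar>x\<bar> < 2 ^ Suc n * y0)"
    obtain m where "\<bar>x\<bar> / y0 < 2 ^ m" using real_arch_pow[of 2 "\<bar>x\<bar> / y0"] by auto
    hence "\<bar>x\<bar> < 2 ^ m * y0" using y0 by (simp add: divide_less_eq)
    also have "\<dots> \<le> 2 ^ Suc m * y0" using y0 by simp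
    finally have n1: "\<bar>x\<bar> < 2 ^ Suc n * y0" unfolding n_def by (rule LeastI)
    have n2: "2 ^ n * y0 \<le> \<bar>x\<bar>"
    proof (cases n)
      case (Suc k)
      hence "\<not> \<bar>x\<bar> < 2 ^ Suc k * y0" using not_less_Least[of k "\<lambda>n. \<bar>x\<bar> < 2 ^ Suc n * y0"] unfolding n_def by simp
      thus ?thesis using Suc by simp
    qed (use False in simp)
    define y where "y = 2 ^ n * y0"
    have y: "y > 0" "y \<le> \<bar>x\<bar>" "\<bar>x\<bar> < 2 * y" using y0 n1 n2 by (auto simp: y_def)
    have "y\<^sup>2 \<le> x\<^sup>2" using y by (simp add: abs_le_square_iff[symmetric])
    moreover have "0 < y\<^sup>2" using y by simp
    ultimately have "1 / 2 \<le> x\<^sup>2 / (x\<^sup>2 + y\<^sup>2)" using add_nonneg_pos[of "x\<^sup>2" "y\<^sup>2"]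
      by (simp add: pos_le_divide_eq del: zero_less_power2)
    hence "y * (1 / 2) \<le> ?k n x" unfolding y_def[symmetric] using y by (intro mult_left_mono) auto
    hence "\<bar>x\<bar> \<le> 4 * ?k n x" using y by linarith
    hence "ennreal \<bar>x\<bar> \<le> ennreal 4 * ennreal (?k n x)" using y0 by (subst ennreal_mult[symmetric]) (auto intro: ennreal_leI)
    also have "\<dots> \<le> ennreal 4 * (\<Sum>n. ennreal (?k n x))"
      by (intro mult_left_mono ennreal_suminf_lessD sum_le_suminf[of _ "{n}", simplified]) auto
    also have "\<dots> \<le> ennreal y0 + ennreal 4 * (\<Sum>n. ennreal (?k n x))" by simp
    finally show ?thesis .
  qed
  have summ: "summable (\<lambda>n. C / sqrt y0 * (1 / sqrt 2) ^ n)"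
    by (intro summable_mult summable_geometric) simp
  have "(\<integral>\<^sup>+x. ennreal \<bar>x\<bar> \<partial>M) \<le> (\<integral>\<^sup>+x. ennreal y0 + ennreal 4 * (\<Sum>n. ennreal (?k n x)) \<partial>M)"
    by (intro nn_integral_mono abs_le)
  also have "\<dots> = ennreal y0 + ennreal 4 * (\<Sum>n. \<integral>\<^sup>+x. ennreal (?k n x) \<partial>M)"
    by (subst nn_integral_add) (auto simp: nn_integral_cmult nn_integral_suminf emeasure_space_1[unfolded space_eq_univ])
  finally have A: "(\<integral>\<^sup>+x. ennreal \<bar>x\<bar> \<partial>M) \<le> ennreal y0 + ennreal 4 * (\<Sum>n. \<integral>\<^sup>+x. ennreal (?k n x) \<partial>M)" .
  have "(\<Sum>n. \<integral>\<^sup>+x. ennreal (?k n x) \<partial>M) \<le> (\<Sum>n. ennreal (C / sqrt y0 * (1 / sqrt 2) ^ n))"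
  proof (rule suminf_le)
    fix n
    have "(\<integral>\<^sup>+x. ennreal (?k n x) \<partial>M) = ennreal (\<integral>x. ?k n x \<partial>M)"
      using y0 by (intro nn_integral_eq_integral int_k) auto
    also have "\<dots> \<le> ennreal (C / sqrt y0 * (1 / sqrt 2) ^ n)" by (intro ennreal_leI k_le)
    finally show "(\<integral>\<^sup>+x. ennreal (?k n x) \<partial>M) \<le> \<dots>" .
  qed auto
  also have "(\<Sum>n. ennreal (C / sqrt y0 * (1 / sqrt 2) ^ n)) = ennreal (\<Sum>n. C / sqrt y0 * (1 / sqrt 2) ^ n)"
    using C0 y0 summ by (intro suminf_ennreal2) auto
  finally have "(\<Sum>n. \<integral>\<^sup>+x. ennreal (?k n x) \<partial>M) \<le> ennreal (\<Sum>n. C / sqrt y0 * (1 / sqrt 2) ^ n)" .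
  from order_trans[OF A add_left_mono[OF mult_left_mono[OF this]]]
  have "(\<integral>\<^sup>+x. ennreal \<bar>x\<bar> \<partial>M) \<le> ennreal y0 + ennreal 4 * ennreal (\<Sum>n. C / sqrt y0 * (1 / sqrt 2) ^ n)" by simp
  also have "\<dots> < \<infinity>" by (simp add: ennreal_mult_less_top)
  finally have "(\<integral>\<^sup>+x. ennreal \<bar>x\<bar> \<partial>M) < \<infinity>" .
  thus ?thesis by (intro integrableI_bounded) auto
qed

text \<open>Dominated convergence gives i y N / F -> -mean, and N is this quantity times 1 + N / (i
  y).\<close>

lemma vert_tendsto_mean:
  assumes int: "integrable M (\<lambda>x. x)" and small: "((\<lambda>y. vert y / complex_of_real y) \<longlongrightarrow> 0) at_top"
  shows "(vert \<longlongrightarrow> - complex_of_real (\<integral>x. x \<partial>M)) at_top"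
proof -
  let ?q = "\<lambda>y x. \<i> * complex_of_real y * (- complex_of_real x / (\<i> * complex_of_real y - complex_of_real x))"
  have "((\<lambda>y. (\<integral>x. ?q y x \<partial>M)) \<longlongrightarrow> (\<integral>x. - complex_of_real x \<partial>M)) at_top"
  proof (rule integral_dominated_convergence_at_top[where w="\<lambda>x. \<bar>x\<bar>"])
    show "\<forall>\<^sub>F y in at_top. AE x in M. norm (?q y x) \<le> \<bar>x\<bar>"
      using eventually_gt_at_top[of "0::real"]
    proof eventually_elim
      case (elim y)
      have "norm (?q y x) \<le> \<bar>x\<bar>" for x
      proof -
        have "\<bar>y\<bar> \<le> cmod (\<i> * complex_of_real y - complex_of_real x)"
          using abs_Im_le_cmod[of "\<i> * complex_of_real y - complex_of_real x"] by simp
        hence "\<bar>y\<bar> * \<bar>x\<bar> \<le> \<bar>x\<bar> * cmod (\<i> * complex_of_real y - complex_of_real x)"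
          by (subst mult.commute) (rule mult_left_mono, auto)
        moreover have "0 < cmod (\<i> * complex_of_real y - complex_of_real x)"
          using \<open>\<bar>y\<bar> \<le> _\<close> elim by linarith
        ultimately show ?thesis by (simp add: norm_mult norm_divide divide_le_eq)
      qed
      thus ?case by simp
    qed
    have "((\<lambda>y. ?q y x) \<longlongrightarrow> - complex_of_real x) at_top" for x
    proof -
      have "((\<lambda>y. - complex_of_real x / (1 - complex_of_real (x / y) / \<i>)) \<longlongrightarrow> - complex_of_real x / (1 - complex_of_real 0 / \<i>)) at_top"
        by (intro tendsto_intros real_tendsto_divide_at_top[OF tendsto_const filterlim_ident]) auto
      moreover have "\<forall>\<^sub>F y in at_top. - complex_of_real x / (1 - complex_of_real (x / y) / \<i>) = ?q y x"
        using eventually_gt_at_top[of "0::real"]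
      proof eventually_elim
        case (elim y)
        have "\<i> * complex_of_real y - complex_of_real x = \<i> * complex_of_real y * (1 - complex_of_real (x / y) / \<i>)"
          using elim by (simp add: field_simps)
        thus ?case using elim by simp
      qed
      ultimately show ?thesis by (simp add: Lim_transform_eventually)
    qed
    thus "AE x in M. ((\<lambda>y. ?q y x) \<longlongrightarrow> - complex_of_real x) at_top" by simp
  qed (use int in auto)
  also have "(\<integral>x. - complex_of_real x \<partial>M) = - complex_of_real (\<integral>x. x \<partial>M)" by simp
  finally have 1: "((\<lambda>y. (\<integral>x. ?q y x \<partial>M)) \<longlongrightarrow> - complex_of_real (\<integral>x. x \<partial>M)) at_top" .
  have "((\<lambda>y. (\<integral>x. ?q y x \<partial>M) * (1 + vert y / complex_of_real y / \<i>)) \<longlongrightarrow> - complex_of_real (\<integral>x. x \<partial>M) * (1 + 0 / \<i>)) at_top"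
    by (intro tendsto_intros 1 small) auto
  moreover have "\<forall>\<^sub>F y in at_top. (\<integral>x. ?q y x \<partial>M) * (1 + vert y / complex_of_real y / \<i>) = vert y"
    using eventually_gt_at_top[of "0::real"]
  proof eventually_elim
    case (elim y)
    have "(\<integral>x. ?q y x \<partial>M) = \<i> * complex_of_real y * (vert y / (\<i> * complex_of_real y + vert y))"
      unfolding integral_mult_right_zero vert_quot[OF elim] ..
    moreover have "1 + vert y / complex_of_real y / \<i> = (\<i> * complex_of_real y + vert y) / (\<i> * complex_of_real y)"
    proof -
      have "vert y / complex_of_real y / \<i> = vert y / (\<i> * complex_of_real y)"
        by (simp only: divide_divide_eq_left mult.commute)
      thus ?thesis using elim by (simp only: add_divide_distrib) simp
    qed
    ultimately show ?case using F_vert_ne[OF elim] elim by simp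
  qed
  ultimately show ?thesis by (simp add: Lim_transform_eventually)
qed

text \<open>Each doubling of \<open>y\<close> moves N by at most C / sqrt y, and these steps decay
  by the factor 1 / sqrt 2.\<close>

lemma vert_increment:
  assumes dec: "\<And>y. y \<ge> y0 \<Longrightarrow> Im (vert y) \<le> C / sqrt y" and y0: "y0 > 0" and y: "y0 \<le> y" "y \<le> y'"
  shows "cmod (vert y' - vert y) \<le> 4 * C / sqrt y"
proof -
  have C0: "0 \<le> C"
  proof -
    have "0 \<le> C / sqrt y0" using dec[of y0] vert_nonneg[OF y0] by linarith
    thus ?thesis using y0 by (simp add: zero_le_divide_iff)
  qed
  have near: "cmod (vert y' - vert y) \<le> C / sqrt y" if y: "y0 \<le> y" "y \<le> y'" "y' \<le> 2 * y" for y y'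
  proof -
    have p: "0 < y" "0 < y'" using y y0 by auto
    have "Im (vert y') \<le> C / sqrt y" using dec[of y'] y C0 p by (intro order_trans[OF dec[of y']] frac_le) auto
    have "(cmod (vert y' - vert y))\<^sup>2 \<le> (y' - y)\<^sup>2 * (Im (vert y') / y' * (Im (vert y) / y))"
      by (rule vert_lipschitz_sq[OF p(2,1)])
    also have "\<dots> \<le> y\<^sup>2 * ((C / sqrt y) / y * ((C / sqrt y) / y))"
      using y p dec[of y] \<open>Im (vert y') \<le> C / sqrt y\<close> vert_nonneg p C0
      by (intro mult_mono power_mono frac_le mult_nonneg_nonneg divide_nonneg_nonneg) auto
    also have "\<dots> = (C / sqrt y)\<^sup>2" using p by (simp add: power2_eq_square)
    finally show ?thesis by (rule power2_le_imp_le) (use C0 p in simp)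
  qed
  \<comment> \<open>Closes the induction: 4 / sqrt 2 for the remaining doublings plus 1 for the
    current one stays below 4.\<close>
  have sq2: "4 / sqrt 2 \<le> (3::real)"
  proof -
    have "4 / 3 \<le> sqrt (2::real)" by (rule real_le_rsqrt) (simp add: power2_eq_square)
    thus ?thesis by (simp add: divide_le_eq)
  qed
  have ind: "cmod (vert y' - vert y) \<le> 4 * C / sqrt y" if "y0 \<le> y" "y \<le> y'" "y' \<le> 2 ^ k * y" for k y
    using that
  proof (induction k arbitrary: y)
    case 0
    hence "y' = y" by simp
    thus ?case using C0 0 y0 by simp
  next
    case (Suc k)
    show ?case
    proof (cases "y' \<le> 2 * y")
      case True
      have "cmod (vert y' - vert y) \<le> C / sqrt y" using near Suc.prems True by blast
      also have "\<dots> \<le> 4 * C / sqrt y" using C0 Suc.prems y0 by (intro divide_right_mono) auto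
      finally show ?thesis .
    next
      case False
      have "cmod (vert y' - vert (2 * y)) \<le> 4 * C / sqrt (2 * y)"
        using Suc.prems False y0 by (intro Suc.IH) auto
      also have "\<dots> = (4 / sqrt 2) * (C / sqrt y)" by (simp add: real_sqrt_mult)
      also have "\<dots> \<le> 3 * (C / sqrt y)" using sq2 C0 Suc.prems y0 by (intro mult_right_mono) auto
      finally have "cmod (vert y' - vert (2 * y)) \<le> 3 * (C / sqrt y)" .
      moreover have "cmod (vert (2 * y) - vert y) \<le> C / sqrt y" using Suc.prems y0 by (intro near) auto
      ultimately have "cmod (vert y' - vert (2 * y)) + cmod (vert (2 * y) - vert y) \<le> 4 * C / sqrt y" by simp
      thus ?thesis using norm_triangle_ineq[of "vert y' - vert (2 * y)" "vert (2 * y) - vert y"] by simp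
    qed
  qed
  obtain k where "y' / y < 2 ^ k" using real_arch_pow[of 2 "y' / y"] by auto
  hence "y' \<le> 2 ^ k * y" using y y0 by (simp add: divide_less_eq)
  thus ?thesis using ind y by blast
qed

text \<open>The increments bound N(i y), so \<open>smooth2\<close> grows at most like sqrt y and the
  mean exists. The third claim depends only on \<open>C\<close> and \<open>y0\<close>, which later
  makes it uniform over small times.\<close>

lemma mean_of_decay:
  assumes dec: "\<And>y. y \<ge> y0 \<Longrightarrow> Im (vert y) \<le> C / sqrt y" and y0: "y0 > 0"
  shows "integrable M (\<lambda>x. x)" "(vert \<longlongrightarrow> - complex_of_real (\<integral>x. x \<partial>M)) at_top"
    "cmod (vert y0 + complex_of_real (\<integral>x. x \<partial>M)) \<le> 4 * C / sqrt y0"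
proof -
  note inc = vert_increment[OF dec y0]
  define B where "B = cmod (vert y0) + 4 * C / sqrt y0"
  have vB: "cmod (vert y) \<le> B" if "y \<ge> y0" for y
    using inc[OF _ order_refl that] norm_triangle_sub[of "vert y" "vert y0"] by (simp add: B_def)
  define y1 where "y1 = max y0 1"
  have y1: "y1 > 0" "y1 \<ge> 1" "y1 \<ge> y0" by (auto simp: y1_def)
  have C0: "0 \<le> C"
  proof -
    have "0 \<le> C / sqrt y0" using dec[of y0] vert_nonneg[OF y0] by linarith
    thus ?thesis using y0 by (simp add: zero_le_divide_iff)
  qed
  have "smooth2 M y \<le> (B\<^sup>2 + C) * sqrt y" if y: "y \<ge> y1" for y
  proof -
    have yp: "y > 0" "y \<ge> 1" "y \<ge> y0" using y y1 by auto
    have "y\<^sup>2 \<le> (cmod (\<i> * complex_of_real y + vert y))\<^sup>2"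
      unfolding cmod_power2 using vert_nonneg[OF yp(1)] yp by (simp add: power2_eq_square algebra_simps)
    hence q: "y\<^sup>2 / (cmod (\<i> * complex_of_real y + vert y))\<^sup>2 \<le> 1" by (simp add: divide_le_eq_1)
    have "smooth2 M y = (y\<^sup>2 / (cmod (\<i> * complex_of_real y + vert y))\<^sup>2) * ((cmod (vert y))\<^sup>2 + height y)"
      by (simp add: smooth2_eq[OF yp(1)])
    also have "\<dots> \<le> 1 * ((cmod (vert y))\<^sup>2 + height y)"
      using q height_nonneg[OF yp(1)] by (intro mult_right_mono) auto
    also have "\<dots> \<le> B\<^sup>2 * sqrt y + C * sqrt y"
    proof -
      have "(cmod (vert y))\<^sup>2 \<le> B\<^sup>2" using vB[OF yp(3)] by (intro power_mono) auto
      also have "\<dots> \<le> B\<^sup>2 * sqrt y" using yp by (simp add: mult_le_cancel_left1)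
      finally have "(cmod (vert y))\<^sup>2 \<le> B\<^sup>2 * sqrt y" .
      moreover have "height y \<le> y * (C / sqrt y)" unfolding height_def using dec[OF yp(3)] yp by (intro mult_left_mono) auto
      moreover have "y * (C / sqrt y) = C * sqrt y" using yp by (simp add: field_simps)
      ultimately show ?thesis by simp
    qed
    finally show ?thesis by (simp add: distrib_right)
  qed
  from integrable_of_decay[OF this y1(1)] show int: "integrable M (\<lambda>x. x)" .
  have "((\<lambda>y. vert y / complex_of_real y) \<longlongrightarrow> 0) at_top"
  proof (rule Lim_null_comparison)
    show "\<forall>\<^sub>F y in at_top. norm (vert y / complex_of_real y) \<le> B / y"
      using eventually_ge_at_top[of y0]
      by eventually_elim (use vB y0 in \<open>auto simp: norm_divide intro!: divide_right_mono\<close>)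
    show "((\<lambda>y. B / y) \<longlongrightarrow> 0) at_top" by (intro real_tendsto_divide_at_top[OF tendsto_const] filterlim_ident)
  qed
  from vert_tendsto_mean[OF int this] show lim: "(vert \<longlongrightarrow> - complex_of_real (\<integral>x. x \<partial>M)) at_top" .
  have "((\<lambda>y. cmod (vert y - vert y0)) \<longlongrightarrow> cmod (- complex_of_real (\<integral>x. x \<partial>M) - vert y0)) at_top"
    by (intro tendsto_intros lim)
  moreover have "\<forall>\<^sub>F y in at_top. cmod (vert y - vert y0) \<le> 4 * C / sqrt y0"
    using eventually_ge_at_top[of y0] by eventually_elim (use inc in simp)
  ultimately have "cmod (- complex_of_real (\<integral>x. x \<partial>M) - vert y0) \<le> 4 * C / sqrt y0"
    by (rule tendsto_upperbound) simp
  thus "cmod (vert y0 + complex_of_real (\<integral>x. x \<partial>M)) \<le> 4 * C / sqrt y0"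
    by (metis minus_add_distrib norm_minus_cancel add.commute uminus_add_conv_diff diff_conv_add_uminus)
qed

end

section \<open>Monotone convolution semigroups\<close>

text \<open>Boundedness near 0 and additivity give f r = O(1/n) for r < delta/n; \<open>T\<close> is
  a multiple of a fraction of \<open>t0\<close>, where \<open>f\<close> vanishes, plus such a small
  remainder.\<close>

lemma additive_vanishing:
  fixes f :: "real \<Rightarrow> real"
  assumes add: "\<And>s t. 0 < s \<Longrightarrow> 0 < t \<Longrightarrow> f (s + t) = f s + f t"
    and bdd: "\<And>t. 0 < t \<Longrightarrow> t < \<delta> \<Longrightarrow> \<bar>f t\<bar> \<le> B" and \<delta>: "0 < \<delta>"
    and t0: "0 < t0" "f t0 = 0" and T: "0 < T"
  shows "f T = 0"
proof -
  have mult: "f (real (Suc n) * r) = real (Suc n) * f r" if r: "0 < r" for n r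
  proof (induction n)
    case (Suc n)
    have "f (real (Suc (Suc n)) * r) = f (real (Suc n) * r + r)" by (simp add: algebra_simps)
    also have "\<dots> = f (real (Suc n) * r) + f r" using r by (intro add) auto
    finally show ?case using Suc by (simp add: algebra_simps)
  qed simp
  have small: "\<bar>f r\<bar> \<le> B / real (Suc n)" if r: "0 < r" "r < \<delta> / real (Suc n)" for r n
  proof -
    have "\<bar>f (real (Suc n) * r)\<bar> \<le> B" using r by (intro bdd) (auto simp: less_divide_eq mult.commute)
    hence "real (Suc n) * \<bar>f r\<bar> \<le> B" unfolding mult[OF r(1)] by (simp add: abs_mult)
    thus ?thesis by (simp add: le_divide_eq mult.commute)
  qed
  have zero: "f (real (Suc k) * (t0 / real (Suc n))) = 0" for k n
  proof -
    have "real (Suc n) * f (t0 / real (Suc n)) = f (real (Suc n) * (t0 / real (Suc n)))"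
      by (rule mult[symmetric]) (use t0 in simp)
    hence "f (t0 / real (Suc n)) = 0" using t0 by simp
    thus ?thesis using mult[of "t0 / real (Suc n)" k] t0 by simp
  qed
  have le: "\<bar>f T\<bar> \<le> B / real (Suc n)" for n
  proof -
    obtain m where "t0 / (\<delta> / real (Suc n)) < real (Suc m)"
      using reals_Archimedean2 by (metis less_trans of_nat_less_iff lessI)
    define d where "d = t0 / real (Suc m)"
    have d: "0 < d" "d < \<delta> / real (Suc n)"
      using \<open>t0 / _ < _\<close> t0 \<delta> by (auto simp: d_def field_simps)
    \<comment> \<open>Ceiling minus one instead of floor keeps the remainder strictly positive, as
      additivity is only available for positive times.\<close>
    define k where "k = nat (\<lceil>T / d\<rceil> - 1)"
    have "T / d > 0" using T d by simp
    hence k: "real k = of_int \<lceil>T / d\<rceil> - 1" unfolding k_def by simp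
    have "real k < T / d" "T / d \<le> real k + 1" unfolding k by linarith+
    hence rem: "0 < T - real k * d" "T - real k * d \<le> d" using d by (auto simp: field_simps)
    have r: "\<bar>f (T - real k * d)\<bar> \<le> B / real (Suc n)" using rem d by (intro small) auto
    show ?thesis
    proof (cases k)
      case 0 thus ?thesis using r by simp
    next
      case (Suc j)
      have "f T = f (real k * d + (T - real k * d))" by simp
      also have "\<dots> = f (real k * d) + f (T - real k * d)" using rem d Suc by (intro add) auto
      also have "f (real k * d) = 0" unfolding Suc d_def by (rule zero)
      finally show ?thesis using r by simp
    qed
  qed
  have "(\<lambda>n. B / real (Suc n)) \<longlonglongrightarrow> 0"
    using LIMSEQ_Suc[OF lim_const_over_n[of B]] .
  hence "\<bar>f T\<bar> \<le> 0" by (rule LIMSEQ_le_const) (use le in auto)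
  thus ?thesis by simp
qed

text \<open>What the analytic part retains of the process, free of operators: \<open>vanish\<close>
  is continuity at time 0 and \<open>mean0\<close> unites both alternatives of the hypothesis on the
  mean.\<close>

locale monotone_semigroup =
  fixes \<mu> :: "real \<Rightarrow> real measure"
  assumes dist: "0 < t \<Longrightarrow> real_distribution (\<mu> t)"
    and semi: "\<lbrakk>0 < s; 0 < t; 0 < Im z\<rbrakk> \<Longrightarrow>
      F_transform (\<mu> (s + t)) z = F_transform (\<mu> s) (F_transform (\<mu> t) z)"
    and vanish: "0 < Im z \<Longrightarrow> ((\<lambda>\<epsilon>. Nev (\<mu> \<epsilon>) z) \<longlongrightarrow> 0) (at_right 0)"
    and mean0: "\<exists>t0>0. \<not> integrable (\<mu> t0) (\<lambda>x. x) \<or> (\<integral>x. x \<partial>\<mu> t0) = 0"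
begin

abbreviation F :: "real \<Rightarrow> complex \<Rightarrow> complex" where "F t \<equiv> F_transform (\<mu> t)"
abbreviation N :: "real \<Rightarrow> complex \<Rightarrow> complex" where "N t \<equiv> Nev (\<mu> t)"

definition V :: "real \<Rightarrow> real \<Rightarrow> complex" where "V t y = N t (\<i> * complex_of_real y)"
definition H :: "real \<Rightarrow> real \<Rightarrow> real" where "H t y = y * Im (V t y)"

lemma vert_V: "0 < t \<Longrightarrow> real_distribution.vert (\<mu> t) = V t"
  by (rule ext) (simp add: real_distribution.vert_def[OF dist] V_def)

lemma height_H: "0 < t \<Longrightarrow> real_distribution.height (\<mu> t) = H t"
  by (rule ext) (simp add: real_distribution.height_def[OF dist] vert_V H_def)

lemma V_nonneg: "0 < t \<Longrightarrow> 0 < y \<Longrightarrow> 0 \<le> Im (V t y)"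
  using real_distribution.vert_nonneg[OF dist, of t y] by (simp add: vert_V)

lemma F_eq: "F t z = z + N t z"
  by (simp add: Nev_def)

lemma F_vert: "F t (\<i> * complex_of_real y) = \<i> * complex_of_real y + V t y"
  by (simp add: V_def F_eq)

lemma Im_F_pos: "0 < t \<Longrightarrow> 0 < Im z \<Longrightarrow> 0 < Im (F t z)"
  by (rule real_distribution.Im_F_pos[OF dist])

lemma N_add:
  assumes "0 < s" "0 < t" "0 < Im z" shows "N (s + t) z = N s (F t z) + N t z"
  using semi[OF assms] by (simp add: Nev_def)

lemma Im_N_mono:
  assumes "0 < t" "t \<le> u" "0 < Im z" shows "Im (N t z) \<le> Im (N u z)"
proof (cases "t = u")
  case False
  hence "N u z = N (u - t) (F t z) + N t z" using N_add[of "u - t" t z] assms by simp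
  moreover have "0 \<le> Im (N (u - t) (F t z))"
    using assms False by (intro real_distribution.Im_Nev_nonneg[OF dist] Im_F_pos) auto
  ultimately show ?thesis by simp
qed simp

lemma N_local:
  assumes "0 < s" "0 < y" "cmod v \<le> y / 2"
  shows "cmod (N s (\<i> * complex_of_real y + v) - V s y) \<le> 3 * cmod v * Im (V s y) / y"
    "Im (N s (\<i> * complex_of_real y + v)) \<le> 3 * Im (V s y)"
  using real_distribution.Nev_local[OF dist[OF assms(1)], of "\<i> * complex_of_real y" "\<i> * complex_of_real y + v"]
    real_distribution.Nev_harnack[OF dist[OF assms(1)], of "\<i> * complex_of_real y" "\<i> * complex_of_real y + v"] assms
  by (simp_all add: V_def)

text \<open>A consequence of slow variation, at the rate that \<open>sv_growth\<close> supplies,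
  which passes from one time to all others; slow variation itself is assumed at a single time
  only.\<close>

definition decays :: "real \<Rightarrow> bool" where
  "decays t \<longleftrightarrow> (\<exists>C y0. 0 < y0 \<and> (\<forall>y\<ge>y0. Im (V t y) \<le> C / sqrt y))"

lemma V_mean:
  assumes t: "0 < t" and d: "decays t"
  shows "integrable (\<mu> t) (\<lambda>x. x)" "(V t \<longlongrightarrow> - complex_of_real (\<integral>x. x \<partial>\<mu> t)) at_top"
proof -
  interpret real_distribution "\<mu> t" by (rule dist[OF t])
  obtain C y0 where "0 < y0" "\<And>y. y \<ge> y0 \<Longrightarrow> Im (vert y) \<le> C / sqrt y"
    using d unfolding decays_def vert_V[OF t, symmetric] by blast
  from mean_of_decay[OF this(2,1)]
  show "integrable (\<mu> t) (\<lambda>x. x)" "(V t \<longlongrightarrow> - complex_of_real (\<integral>x. x \<partial>\<mu> t)) at_top"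
    by (simp_all add: vert_V[OF t])
qed

lemma V_bounded:
  assumes "0 < t" "decays t"
  obtains B where "B > 0" "\<forall>\<^sub>F y in at_top. cmod (V t y) \<le> B"
proof -
  have "((\<lambda>y. cmod (V t y)) \<longlongrightarrow> cmod (- complex_of_real (\<integral>x. x \<partial>\<mu> t))) at_top"
    by (intro tendsto_norm V_mean assms)
  hence "\<forall>\<^sub>F y in at_top. cmod (V t y) < cmod (- complex_of_real (\<integral>x. x \<partial>\<mu> t)) + 1"
    by (rule order_tendstoD) simp
  hence "\<forall>\<^sub>F y in at_top. cmod (V t y) \<le> cmod (- complex_of_real (\<integral>x. x \<partial>\<mu> t)) + 1"
    by eventually_elim simp
  thus ?thesis by (intro that[of "cmod (- complex_of_real (\<integral>x. x \<partial>\<mu> t)) + 1"]) (auto intro: add_nonneg_pos)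
qed

lemma V_small:
  assumes "0 < t" "decays t"
  shows "\<forall>\<^sub>F y in at_top. 0 < y \<and> cmod (V t y) \<le> y / 2"
proof -
  obtain B where B: "B > 0" "\<forall>\<^sub>F y in at_top. cmod (V t y) \<le> B" by (rule V_bounded[OF assms])
  show ?thesis using B(2) eventually_ge_at_top[of "2 * B"] by eventually_elim (use B(1) in auto)
qed

lemma V_add: "0 < s \<Longrightarrow> 0 < t \<Longrightarrow> 0 < y \<Longrightarrow> V (s + t) y = N s (\<i> * complex_of_real y + V t y) + V t y"
  using N_add[of s t "\<i> * complex_of_real y"] by (simp add: V_def[of "s + t"] F_vert) (simp add: V_def)

lemma decays_add:
  assumes "0 < s" "0 < t" "decays s" "decays t" shows "decays (s + t)"
proof -
  obtain C y0 where C: "0 < y0" "\<And>y. y \<ge> y0 \<Longrightarrow> Im (V s y) \<le> C / sqrt y" using assms(3) by (auto simp: decays_def)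
  obtain D y1 where D: "0 < y1" "\<And>y. y \<ge> y1 \<Longrightarrow> Im (V t y) \<le> D / sqrt y" using assms(4) by (auto simp: decays_def)
  have "\<forall>\<^sub>F y in at_top. Im (V (s + t) y) \<le> (3 * C + D) / sqrt y"
    using V_small[OF assms(2,4)] eventually_ge_at_top[of y0] eventually_ge_at_top[of y1]
  proof eventually_elim
    case (elim y)
    have "Im (N s (\<i> * complex_of_real y + V t y)) \<le> 3 * Im (V s y)"
      using elim assms by (intro N_local) auto
    hence "Im (V (s + t) y) \<le> 3 * Im (V s y) + Im (V t y)" using elim assms by (simp add: V_add)
    also have "\<dots> \<le> 3 * (C / sqrt y) + D / sqrt y" using C(2)[of y] D(2)[of y] elim by linarith
    finally show ?case by (simp add: add_divide_distrib)
  qed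
  then obtain y2 where y2: "\<And>y. y \<ge> y2 \<Longrightarrow> Im (V (s + t) y) \<le> (3 * C + D) / sqrt y"
    by (auto simp: eventually_at_top_linorder)
  show ?thesis unfolding decays_def
    by (intro exI[of _ "3 * C + D"] exI[of _ "max y2 1"]) (use y2 in auto)
qed

lemma decays_le:
  assumes "0 < t" "t \<le> u" "decays u" shows "decays t"
proof -
  obtain C y0 where C: "0 < y0" "\<And>y. y \<ge> y0 \<Longrightarrow> Im (V u y) \<le> C / sqrt y" using assms(3) by (auto simp: decays_def)
  have "Im (V t y) \<le> C / sqrt y" if "y \<ge> y0" for y
    using Im_N_mono[OF assms(1,2), of "\<i> * complex_of_real y"] C(2)[OF that] that C(1) by (simp add: V_def)
  thus ?thesis using C(1) by (auto simp: decays_def)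
qed

lemma decays_all:
  assumes T: "0 < T" "decays T" and t: "0 < t" shows "decays t"
proof -
  have mult: "decays (real (Suc n) * T)" for n
  proof (induction n)
    case (Suc n)
    have "real (Suc (Suc n)) * T = real (Suc n) * T + T" by (simp add: algebra_simps)
    thus ?case using decays_add[of "real (Suc n) * T" T] Suc T by simp
  qed (use T in simp)
  obtain n where "t / T < real n" using reals_Archimedean2 by blast
  hence "t \<le> real (Suc n) * T" using T by (simp add: divide_less_eq distrib_right)
  thus ?thesis using decays_le[OF t _ mult] by blast
qed

text \<open>N at time s + t differs from the sum of N at times s and t by O(1/y) on the axis, so
  means are additive in time; they are bounded near time 0 and vanish at t0, hence vanish
  everywhere.\<close>

lemma mean_zero:
  assumes T: "0 < T" "decays T"
  shows "(V T \<longlongrightarrow> 0) at_top"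
proof -
  define m where "m = (\<lambda>t. \<integral>x. x \<partial>\<mu> t)"
  note dec = decays_all[OF T]
  have add: "m (s + t) = m s + m t" if st: "0 < s" "0 < t" for s t
  proof -
    obtain B where B: "B > 0" "\<forall>\<^sub>F y in at_top. cmod (V t y) \<le> B" by (rule V_bounded[OF st(2) dec[OF st(2)]])
    obtain D where D: "D > 0" "\<forall>\<^sub>F y in at_top. cmod (V s y) \<le> D" by (rule V_bounded[OF st(1) dec[OF st(1)]])
    have "((\<lambda>y. V (s + t) y - V s y - V t y) \<longlongrightarrow> 0) at_top"
    proof (rule Lim_null_comparison)
      show "\<forall>\<^sub>F y in at_top. norm (V (s + t) y - V s y - V t y) \<le> 3 * B * D / y"
        using V_small[OF st(2) dec[OF st(2)]] B(2) D(2)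
      proof eventually_elim
        case (elim y)
        have "norm (V (s + t) y - V s y - V t y) = cmod (N s (\<i> * complex_of_real y + V t y) - V s y)"
          using elim st by (simp add: V_add)
        also have "\<dots> \<le> 3 * cmod (V t y) * Im (V s y) / y" using elim st by (intro N_local) auto
        also have "\<dots> \<le> 3 * B * D / y"
          using elim st B D V_nonneg[of s y] abs_Im_le_cmod[of "V s y"]
          by (intro divide_right_mono mult_mono) auto
        finally show ?case .
      qed
      show "((\<lambda>y. 3 * B * D / y) \<longlongrightarrow> 0) at_top" by (intro real_tendsto_divide_at_top[OF tendsto_const] filterlim_ident)
    qed
    moreover have "((\<lambda>y. V (s + t) y - V s y - V t y) \<longlongrightarrow> - complex_of_real (m (s + t)) - (- complex_of_real (m s)) - (- complex_of_real (m t))) at_top"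
      unfolding m_def by (intro tendsto_diff V_mean dec st add_pos_pos)
    ultimately have "0 = - complex_of_real (m (s + t)) - (- complex_of_real (m s)) - (- complex_of_real (m t))"
      by (intro tendsto_unique[of at_top]) auto
    hence "complex_of_real (m (s + t)) = complex_of_real (m s + m t)" by (simp add: algebra_simps)
    thus ?thesis using of_real_eq_iff by blast
  qed
  obtain C y0 where C: "0 < y0" "\<And>y. y \<ge> y0 \<Longrightarrow> Im (V T y) \<le> C / sqrt y" using T by (auto simp: decays_def)
  have "\<forall>\<^sub>F \<epsilon> in at_right 0. cmod (V \<epsilon> y0) < 1"
    using tendstoD[OF vanish[of "\<i> * complex_of_real y0"], of 1] C(1) by (simp add: V_def dist_norm)
  then obtain \<delta> where \<delta>: "0 < \<delta>" "\<And>\<epsilon>. 0 < \<epsilon> \<Longrightarrow> \<epsilon> < \<delta> \<Longrightarrow> cmod (V \<epsilon> y0) < 1"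
    by (auto simp: eventually_at_right_field)
  \<comment> \<open>For t < T the imaginary part of N is below the one at time \<open>T\<close>, so
    the constants \<open>C\<close> and \<open>y0\<close> of \<open>T\<close> serve all small
    times.\<close>
  have bdd: "\<bar>m t\<bar> \<le> 1 + 4 * C / sqrt y0" if t: "0 < t" "t < min \<delta> T" for t
  proof -
    interpret real_distribution "\<mu> t" by (rule dist[OF t(1)])
    have "Im (vert y) \<le> C / sqrt y" if "y \<ge> y0" for y
      using Im_N_mono[of t T "\<i> * complex_of_real y"] C(2)[OF that] that C(1) t by (simp add: vert_V[OF t(1)] V_def)
    from mean_of_decay(3)[OF this C(1)] have "cmod (V t y0 + complex_of_real (m t)) \<le> 4 * C / sqrt y0"
      by (simp add: m_def vert_V[OF t(1)])
    moreover have "cmod (V t y0) < 1" using \<delta>(2) t by simp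
    moreover have "cmod (complex_of_real (m t)) \<le> cmod (V t y0 + complex_of_real (m t)) + cmod (V t y0)"
      using norm_triangle_ineq4[of "V t y0 + complex_of_real (m t)" "V t y0"] by simp
    ultimately show ?thesis by simp
  qed
  \<comment> \<open>The non-integrable alternative of \<open>mean0\<close> is excluded because every
    time decays.\<close>
  obtain t0 where t0: "0 < t0" "m t0 = 0" using mean0 V_mean(1)[OF _ dec] unfolding m_def by blast
  have "m T = 0"
    by (rule additive_vanishing[where \<delta>="min \<delta> T", OF add bdd _ t0 T(1)]) (use \<delta> T in auto)
  thus ?thesis using V_mean(2)[OF T] by (simp add: m_def)
qed

lemma H_sv_decays:
  assumes T: "0 < T" and sv: "sv (H T)" shows "decays T"
proof -
  interpret real_distribution "\<mu> T" by (rule dist[OF T])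
  obtain C y0 where C: "C > 0" "y0 > 0" "\<And>y. y \<ge> y0 \<Longrightarrow> 0 < H T y \<and> H T y \<le> C * sqrt y"
    using sv_growth[OF sv] height_mono unfolding height_H[OF T] by metis
  have "Im (V T y) \<le> C / sqrt y" if y: "y \<ge> y0" for y
  proof -
    have yp: "y > 0" using y C by simp
    have "y * Im (V T y) \<le> C * sqrt y" using C(3)[OF y] by (simp add: H_def)
    hence "Im (V T y) \<le> C * sqrt y / y" using yp by (simp add: le_divide_eq mult.commute)
    also have "C * sqrt y / y = C / sqrt y" using yp by (simp add: field_simps)
    finally show ?thesis .
  qed
  thus ?thesis using C(2) by (auto simp: decays_def)
qed

lemma smooth2_V:
  assumes "0 < T" "0 < y"
  shows "smooth2 (\<mu> T) y = y\<^sup>2 * (((cmod (V T y))\<^sup>2 + H T y) / (cmod (\<i> * complex_of_real y + V T y))\<^sup>2)"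
  using real_distribution.smooth2_eq[OF dist[OF assms(1)] assms(2)] by (simp add: vert_V height_H assms)

text \<open>A bootstrap: growth of order sqrt y of \<open>smooth2\<close> first gives |F| <= 2 y,
  then decay of N; the mean then vanishes, N tends to 0, and \<open>smooth2\<close> becomes
  asymptotic to \<open>H T\<close>.\<close>

lemma smooth2_sv_imp:
  assumes T: "0 < T" and sv: "sv (smooth2 (\<mu> T))"
  shows "sv (H T)"
proof -
  interpret real_distribution "\<mu> T" by (rule dist[OF T])
  obtain C y0 where C: "C > 0" "y0 > 0" "\<And>y. y \<ge> y0 \<Longrightarrow> 0 < smooth2 (\<mu> T) y \<and> smooth2 (\<mu> T) y \<le> C * sqrt y"
    using sv_growth[OF sv fb.smooth2_mono] by metis
  \<comment> \<open>Beyond (4C)^2 and 1 one has C sqrt y <= y^2 / 4, which yields |N| <= |F| /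
    2.\<close>
  define y1 where "y1 = max (max y0 1) ((4 * C)\<^sup>2)"
  have "Im (V T y) \<le> 4 * C / sqrt y" if y: "y \<ge> y1" for y
  proof -
    have yp: "y > 0" "y \<ge> y0" "y \<ge> 1" "y \<ge> (4 * C)\<^sup>2" using y by (auto simp: y1_def)
    define \<Phi> where "\<Phi> = cmod (\<i> * complex_of_real y + V T y)"
    have \<Phi>: "\<Phi> > 0" using F_vert_ne[OF yp(1)] by (simp add: \<Phi>_def vert_V[OF T])
    have sq: "sqrt y \<ge> 4 * C" using yp(4) by (rule real_le_rsqrt)
    have S: "y\<^sup>2 * ((cmod (V T y))\<^sup>2 + H T y) \<le> C * sqrt y * \<Phi>\<^sup>2"
      using C(3)[OF yp(2)] \<Phi> by (simp add: smooth2_V[OF T yp(1)] \<Phi>_def[symmetric] divide_le_eq)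
    have H0: "0 \<le> H T y" using height_nonneg[OF yp(1)] by (simp add: height_H[OF T])
    have "C * sqrt y \<le> y\<^sup>2 / 4"
    proof -
      have "C * sqrt y \<le> (sqrt y / 4) * sqrt y" using sq yp by (intro mult_right_mono) auto
      also have "\<dots> = y / 4" using yp by simp
      also have "\<dots> \<le> y\<^sup>2 / 4" using yp by (simp add: power2_eq_square)
      finally show ?thesis .
    qed
    hence "y\<^sup>2 * (cmod (V T y))\<^sup>2 \<le> y\<^sup>2 / 4 * \<Phi>\<^sup>2"
      using S H0 yp by (intro order_trans[OF _ order_trans[OF S mult_right_mono]]) (auto intro: mult_left_mono)
    hence "(cmod (V T y))\<^sup>2 \<le> (\<Phi> / 2)\<^sup>2" using yp by (simp add: power_divide)
    hence "cmod (V T y) \<le> \<Phi> / 2" by (rule power2_le_imp_le) (use \<Phi> in simp)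
    moreover have "\<Phi> \<le> y + cmod (V T y)"
      unfolding \<Phi>_def using norm_triangle_ineq[of "\<i> * complex_of_real y" "V T y"] yp by (simp add: norm_mult)
    ultimately have "\<Phi> \<le> 2 * y" by linarith
    hence "C * sqrt y * \<Phi>\<^sup>2 \<le> C * sqrt y * (2 * y)\<^sup>2" using C(1) yp \<Phi> by (intro mult_left_mono power_mono) auto
    hence "y\<^sup>2 * H T y \<le> C * sqrt y * (2 * y)\<^sup>2"
      using S by (intro order_trans[OF mult_left_mono order_trans[OF S]]) auto
    hence "y\<^sup>2 * H T y \<le> y\<^sup>2 * (4 * C * sqrt y)" by (simp add: power_mult_distrib algebra_simps)
    hence "H T y \<le> 4 * C * sqrt y" using yp by simp
    hence "Im (V T y) \<le> 4 * C * sqrt y / y" using yp by (simp add: H_def le_divide_eq mult.commute)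
    also have "4 * C * sqrt y / y = 4 * C / sqrt y" using yp by (simp add: field_simps)
    finally show ?thesis .
  qed
  moreover have "y1 > 0" by (simp add: y1_def)
  ultimately have dec: "decays T" by (auto simp: decays_def)
  have V0: "(V T \<longlongrightarrow> 0) at_top" by (rule mean_zero[OF T dec])
  \<comment> \<open>A positive lower bound for \<open>smooth2\<close>, so that |N|^2 is negligible
    against it.\<close>
  define c0 where "c0 = smooth2 (\<mu> T) y0"
  have c0: "c0 > 0" using C(3)[of y0] by (simp add: c0_def)
  have cle: "c0 \<le> smooth2 (\<mu> T) y" if "y \<ge> y0" for y
    unfolding c0_def using fb.smooth2_mono C(2) that by simp
  show ?thesis
  proof (rule sv_ratio[OF sv, of _ 1])
    have "((\<lambda>y. V T y / complex_of_real y) \<longlongrightarrow> 0) at_top"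
    proof (rule Lim_null_comparison)
      have "\<forall>\<^sub>F y in at_top. cmod (V T y) < 1" using tendstoD[OF V0, of 1] by (simp add: dist_norm)
      thus "\<forall>\<^sub>F y in at_top. norm (V T y / complex_of_real y) \<le> 1 / y"
        using eventually_gt_at_top[of 0] by eventually_elim (auto simp: norm_divide intro!: divide_right_mono)
      show "((\<lambda>y. 1 / y) \<longlongrightarrow> (0::real)) at_top" by (intro real_tendsto_divide_at_top[OF tendsto_const] filterlim_ident)
    qed
    hence "((\<lambda>y. (cmod (\<i> + V T y / complex_of_real y))\<^sup>2) \<longlongrightarrow> (cmod (\<i> + 0))\<^sup>2) at_top"
      by (intro tendsto_intros)
    moreover have "((\<lambda>y. (cmod (V T y))\<^sup>2 / smooth2 (\<mu> T) y) \<longlongrightarrow> 0) at_top"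
    proof (rule Lim_null_comparison)
      show "\<forall>\<^sub>F y in at_top. norm ((cmod (V T y))\<^sup>2 / smooth2 (\<mu> T) y) \<le> (cmod (V T y))\<^sup>2 / c0"
        using eventually_ge_at_top[of y0]
      proof eventually_elim
        case (elim y)
        have "(cmod (V T y))\<^sup>2 / smooth2 (\<mu> T) y \<le> (cmod (V T y))\<^sup>2 / c0" using cle[OF elim] c0 by (intro divide_left_mono) auto
        thus ?case using cle[OF elim] c0 by (simp add: abs_of_nonneg)
      qed
      have "((\<lambda>y. (cmod (V T y))\<^sup>2 / c0) \<longlongrightarrow> (cmod 0)\<^sup>2 / c0) at_top" by (intro tendsto_intros V0) (use c0 in simp)
      thus "((\<lambda>y. (cmod (V T y))\<^sup>2 / c0) \<longlongrightarrow> 0) at_top" by simp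
    qed
    ultimately have "((\<lambda>y. (cmod (\<i> + V T y / complex_of_real y))\<^sup>2 - (cmod (V T y))\<^sup>2 / smooth2 (\<mu> T) y) \<longlongrightarrow> (cmod (\<i> + 0))\<^sup>2 - 0) at_top"
      by (intro tendsto_diff)
    hence l: "((\<lambda>y. (cmod (\<i> + V T y / complex_of_real y))\<^sup>2 - (cmod (V T y))\<^sup>2 / smooth2 (\<mu> T) y) \<longlongrightarrow> 1) at_top" by simp
    have "\<forall>\<^sub>F y in at_top. (cmod (\<i> + V T y / complex_of_real y))\<^sup>2 - (cmod (V T y))\<^sup>2 / smooth2 (\<mu> T) y = H T y / smooth2 (\<mu> T) y"
      using eventually_ge_at_top[of y0]
    proof eventually_elim
      case (elim y)
      have yp: "y > 0" using elim C by simp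
      have s: "smooth2 (\<mu> T) y > 0" using cle[OF elim] c0 by linarith
      have "\<i> * complex_of_real y + V T y = complex_of_real y * (\<i> + V T y / complex_of_real y)"
        using yp by (simp add: distrib_left mult.commute)
      hence \<Phi>: "(cmod (\<i> * complex_of_real y + V T y))\<^sup>2 = y\<^sup>2 * (cmod (\<i> + V T y / complex_of_real y))\<^sup>2"
        by (simp add: norm_mult power_mult_distrib)
      have "(cmod (\<i> * complex_of_real y + V T y))\<^sup>2 > 0" using F_vert_ne[OF yp] by (simp add: vert_V[OF T])
      hence "(cmod (\<i> + V T y / complex_of_real y))\<^sup>2 > 0" unfolding \<Phi> by (simp add: zero_less_mult_iff)
      hence "smooth2 (\<mu> T) y * (cmod (\<i> + V T y / complex_of_real y))\<^sup>2 = (cmod (V T y))\<^sup>2 + H T y"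
        unfolding smooth2_V[OF T yp] \<Phi> using yp by simp
      hence "(cmod (\<i> + V T y / complex_of_real y))\<^sup>2 = ((cmod (V T y))\<^sup>2 + H T y) / smooth2 (\<mu> T) y"
        using s by (simp add: field_simps)
      thus ?case by (simp add: add_divide_distrib)
    qed
    from Lim_transform_eventually[OF l this] show "((\<lambda>y. H T y / smooth2 (\<mu> T) y) \<longlongrightarrow> 1) at_top" .
  qed simp
qed

text \<open>An Euler scheme: \<open>T\<close> is divided into equal short times, each of which
  displaces the point by nearly the same \<open>v\<close>. The error is relative to Im phi, as a
  comparison of slowly varying functions requires.\<close>

lemma generator_near:
  fixes \<phi> :: "complex \<Rightarrow> complex"
  assumes T: "0 < T"
    and gen: "\<And>z. 0 < Im z \<Longrightarrow> ((\<lambda>\<epsilon>. N \<epsilon> z / complex_of_real \<epsilon>) \<longlongrightarrow> \<phi> z) (at_right 0)"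
    and y: "0 < y" and c: "cmod (\<phi> (\<i> * complex_of_real y)) < c" and sm: "16 * T * c \<le> y"
  shows "cmod (V T y - complex_of_real T * \<phi> (\<i> * complex_of_real y))
    \<le> 24 * T * c / y * (T * Im (\<phi> (\<i> * complex_of_real y)))"
proof -
  let ?z = "\<i> * complex_of_real y"
  have z: "0 < Im ?z" using y by simp
  define \<tau> where "\<tau> = (\<lambda>n. T / real (Suc n))"
  have \<tau>: "0 < \<tau> n" for n using T by (simp add: \<tau>_def)
  have \<tau>0: "filterlim \<tau> (at_right 0) sequentially"
    unfolding filterlim_at
  proof
    show "\<tau> \<longlonglongrightarrow> 0" unfolding \<tau>_def using LIMSEQ_Suc[OF lim_const_over_n[of T]] .
    have "\<tau> n \<noteq> 0" for n using \<tau>[of n] by simp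
    thus "\<forall>\<^sub>F n in sequentially. \<tau> n \<in> {0<..} \<and> \<tau> n \<noteq> 0" using \<tau> by simp
  qed
  have "(\<lambda>n. complex_of_real T * (N (\<tau> n) ?z / complex_of_real (\<tau> n))) \<longlonglongrightarrow> complex_of_real T * \<phi> ?z"
    by (intro tendsto_intros filterlim_compose[OF gen[OF z] \<tau>0])
  hence lim: "(\<lambda>n. of_nat (Suc n) * V (\<tau> n) y) \<longlonglongrightarrow> complex_of_real T * \<phi> ?z"
    using T by (simp add: \<tau>_def V_def divide_simps mult.commute)
  have "\<forall>\<^sub>F n in sequentially. cmod (of_nat (Suc n) * V (\<tau> n) y) < 2 * (T * c)"
  proof (rule order_tendstoD(2)[OF tendsto_norm[OF lim]])
    have "0 < c" using c norm_ge_zero[of "\<phi> ?z"] by linarith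
    hence "T * cmod (\<phi> ?z) < T * c" "0 < T * c" using T c by auto
    hence "T * cmod (\<phi> ?z) < 2 * (T * c)" by linarith
    thus "cmod (complex_of_real T * \<phi> ?z) < 2 * (T * c)" using T by (simp add: norm_mult)
  qed
  hence "\<forall>\<^sub>F n in sequentially. cmod (V T y - of_nat (Suc n) * V (\<tau> n) y)
      \<le> 24 * T * c / y * Im (of_nat (Suc n) * V (\<tau> n) y)"
  proof eventually_elim
    case (elim n)
    define v where "v = V (\<tau> n) y"
    \<comment> \<open>A bound for one step; all steps together move at most 4 * 2 T c = 8 T c, which
      16 T c <= y keeps within half the height.\<close>
    define b where "b = 2 * (T * c) / real (Suc n)"
    have nv: "cmod v \<le> b"
      using elim by (simp add: v_def b_def norm_mult le_divide_eq mult.commute del: of_nat_Suc)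
    have b0: "b \<ge> 0" using nv norm_ge_zero[of v] by linarith
    have Iv: "0 \<le> Im v" unfolding v_def by (rule V_nonneg[OF \<tau> y])
    have step: "cmod (N (\<tau> n) (?z + d) - v) \<le> 3 * cmod d * Im v / y" if "cmod d \<le> y / 2" for d
      using N_local(1)[OF \<tau>[of n] y that] by (simp add: v_def)
    have bn: "real (Suc n) * b = 2 * T * c" by (simp add: b_def del: of_nat_Suc)
    \<comment> \<open>Two bounds run in one induction: the total displacement keeps the point where
      \<open>N_local\<close> applies, and this controls the deviation from equal steps.\<close>
    have sub: "cmod (V (real (Suc j) * \<tau> n) y) \<le> real (Suc j) * (4 * b)
        \<and> cmod (V (real (Suc j) * \<tau> n) y - of_nat (Suc j) * v) \<le> real (Suc j) * (12 * (real (Suc n) * b) * Im v / y)"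
      if "j \<le> n" for j using that
    proof (induction j)
      case 0
      have "0 \<le> 12 * (real (Suc n) * b) * Im v / y" using b0 Iv y by (intro divide_nonneg_nonneg mult_nonneg_nonneg) auto
      thus ?case using nv b0 by (simp add: v_def)
    next
      case (Suc j)
      define d where "d = V (real (Suc j) * \<tau> n) y"
      have IH: "cmod d \<le> real (Suc j) * (4 * b)" "cmod (d - of_nat (Suc j) * v) \<le> real (Suc j) * (12 * (real (Suc n) * b) * Im v / y)"
        using Suc by (auto simp: d_def)
      have d1: "cmod d \<le> 4 * (real (Suc n) * b)"
      proof -
        have "real (Suc j) * (4 * b) \<le> real (Suc n) * (4 * b)" using Suc.prems b0 by (intro mult_right_mono) auto
        thus ?thesis using IH(1) by simp
      qed
      have d2: "cmod d \<le> y / 2" using d1 sm unfolding bn by simp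
      have e: "real (Suc (Suc j)) * \<tau> n = \<tau> n + real (Suc j) * \<tau> n" by (simp add: algebra_simps)
      have V_e: "V (real (Suc (Suc j)) * \<tau> n) y = N (\<tau> n) (?z + d) + d"
        unfolding e d_def by (rule V_add) (use \<tau> y in auto)
      have s: "cmod (N (\<tau> n) (?z + d) - v) \<le> 3 * cmod d * Im v / y" by (rule step[OF d2])
      have "3 * cmod d * Im v / y \<le> 3 * (y / 2) * Im v / y" using d2 Iv y by (intro divide_right_mono mult_mono) auto
      also have "\<dots> \<le> 2 * b"
      proof -
        have "3 * (y / 2) * Im v / y = 3 / 2 * Im v" using y by simp
        moreover have "Im v \<le> b" using abs_Im_le_cmod[of v] nv by linarith
        ultimately show ?thesis using b0 by linarith
      qed
      finally have "cmod (N (\<tau> n) (?z + d) - v) \<le> 2 * b" using s by linarith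
      hence "cmod (N (\<tau> n) (?z + d)) \<le> 3 * b" using nv norm_triangle_sub[of "N (\<tau> n) (?z + d)" v] by linarith
      hence 1: "cmod (N (\<tau> n) (?z + d) + d) \<le> real (Suc (Suc j)) * (4 * b)"
        using IH(1) b0 norm_triangle_ineq[of "N (\<tau> n) (?z + d)" d] by (simp add: algebra_simps)
      have "3 * cmod d * Im v / y \<le> 3 * (4 * (real (Suc n) * b)) * Im v / y"
        using d1 Iv y by (intro divide_right_mono mult_right_mono mult_left_mono) auto
      hence s2: "cmod (N (\<tau> n) (?z + d) - v) \<le> 12 * (real (Suc n) * b) * Im v / y" using s by simp
      have "N (\<tau> n) (?z + d) + d - of_nat (Suc (Suc j)) * v = (N (\<tau> n) (?z + d) - v) + (d - of_nat (Suc j) * v)"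
        by (simp add: algebra_simps)
      hence "cmod (N (\<tau> n) (?z + d) + d - of_nat (Suc (Suc j)) * v) \<le> cmod (N (\<tau> n) (?z + d) - v) + cmod (d - of_nat (Suc j) * v)"
        by (simp only: norm_triangle_ineq)
      also have "\<dots> \<le> 12 * (real (Suc n) * b) * Im v / y + real (Suc j) * (12 * (real (Suc n) * b) * Im v / y)"
        using s2 IH(2) by (rule add_mono)
      also have "\<dots> = real (Suc (Suc j)) * (12 * (real (Suc n) * b) * Im v / y)"
        unfolding of_nat_Suc[of "Suc j"] distrib_right by simp
      finally show ?case unfolding V_e using 1 by blast
    qed
    have "real (Suc n) * \<tau> n = T" by (simp add: \<tau>_def del: of_nat_Suc)
    with sub[of n] have "cmod (V T y - of_nat (Suc n) * v) \<le> real (Suc n) * (12 * (real (Suc n) * b) * Im v / y)" by simp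
    also have "\<dots> = 24 * T * c / y * (real (Suc n) * Im v)" unfolding bn by simp
    also have "real (Suc n) * Im v = Im (of_nat (Suc n) * v)" by (simp del: of_nat_Suc)
    finally show ?case by (simp add: v_def)
  qed
  moreover have "(\<lambda>n. cmod (V T y - of_nat (Suc n) * V (\<tau> n) y)) \<longlonglongrightarrow> cmod (V T y - complex_of_real T * \<phi> ?z)"
    by (intro tendsto_intros lim)
  moreover have "(\<lambda>n. 24 * T * c / y * Im (of_nat (Suc n) * V (\<tau> n) y)) \<longlonglongrightarrow> 24 * T * c / y * Im (complex_of_real T * \<phi> ?z)"
    by (intro tendsto_intros lim)
  ultimately have "cmod (V T y - complex_of_real T * \<phi> ?z) \<le> 24 * T * c / y * Im (complex_of_real T * \<phi> ?z)"
    by (intro tendsto_le[of sequentially]) auto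
  thus ?thesis by simp
qed

text \<open>Taking c = 2 |phi| in \<open>generator_near\<close> makes the relative error O(|phi| /
  y), which tends to 0; thus \<open>H T\<close> is asymptotic to T y Im phi(i y).\<close>

lemma generator_sv_imp:
  fixes \<phi> :: "complex \<Rightarrow> complex"
  assumes T: "0 < T"
    and gen: "\<And>z. 0 < Im z \<Longrightarrow> ((\<lambda>\<epsilon>. N \<epsilon> z / complex_of_real \<epsilon>) \<longlongrightarrow> \<phi> z) (at_right 0)"
    and sv: "sv (\<lambda>y. y * Im (\<phi> (\<i> * complex_of_real y)))"
    and small: "((\<lambda>y. \<phi> (\<i> * complex_of_real y) / complex_of_real y) \<longlongrightarrow> 0) at_top"
  shows "sv (H T)"
proof (rule sv_ratio[OF sv _ T])
  define \<Phi> where "\<Phi> = (\<lambda>y. \<phi> (\<i> * complex_of_real y))"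
  have s0: "((\<lambda>y. cmod (\<Phi> y) / y) \<longlongrightarrow> 0) at_top"
  proof -
    have "((\<lambda>y. cmod (\<Phi> y / complex_of_real y)) \<longlongrightarrow> cmod 0) at_top" unfolding \<Phi>_def by (intro tendsto_norm small)
    moreover have "\<forall>\<^sub>F y in at_top. cmod (\<Phi> y / complex_of_real y) = cmod (\<Phi> y) / y"
      using eventually_gt_at_top[of "0::real"] by eventually_elim (simp add: norm_divide)
    ultimately show ?thesis by (simp add: Lim_transform_eventually)
  qed
  have "((\<lambda>y. H T y / (y * Im (\<Phi> y)) - T) \<longlongrightarrow> 0) at_top"
  proof (rule Lim_null_comparison)
    have "\<forall>\<^sub>F y in at_top. 0 < y * Im (\<Phi> y)" using sv by (simp add: sv_def \<Phi>_def)
    moreover have "\<forall>\<^sub>F y in at_top. cmod (\<Phi> y) / y < 1 / (32 * T)" using s0 T by (intro order_tendstoD(2)) auto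
    ultimately show "\<forall>\<^sub>F y in at_top. norm (H T y / (y * Im (\<Phi> y)) - T) \<le> 48 * T * T * (cmod (\<Phi> y) / y)"
      using eventually_gt_at_top[of 0]
    proof eventually_elim
      case (elim y)
      have p: "0 < Im (\<Phi> y)" using elim by (simp add: zero_less_mult_iff)
      have \<Phi>0: "0 < cmod (\<Phi> y)" using p by (auto simp: complex_eq_iff)
      have sm: "16 * T * (2 * cmod (\<Phi> y)) \<le> y" using elim T by (simp add: field_simps)
      have "cmod (V T y - complex_of_real T * \<Phi> y) \<le> 24 * T * (2 * cmod (\<Phi> y)) / y * (T * Im (\<Phi> y))"
        unfolding \<Phi>_def by (rule generator_near[OF T gen elim(3)]) (use \<Phi>0 sm in \<open>auto simp: \<Phi>_def\<close>)
      also have "24 * T * (2 * cmod (\<Phi> y)) = 48 * T * cmod (\<Phi> y)" by simp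
      finally have "cmod (V T y - complex_of_real T * \<Phi> y) \<le> 48 * T * cmod (\<Phi> y) / y * (T * Im (\<Phi> y))" .
      moreover have "\<bar>Im (V T y) - T * Im (\<Phi> y)\<bar> \<le> cmod (V T y - complex_of_real T * \<Phi> y)"
        using abs_Im_le_cmod[of "V T y - complex_of_real T * \<Phi> y"] by simp
      ultimately have "\<bar>Im (V T y) - T * Im (\<Phi> y)\<bar> \<le> 48 * T * cmod (\<Phi> y) / y * (T * Im (\<Phi> y))" by linarith
      hence "\<bar>Im (V T y) - T * Im (\<Phi> y)\<bar> / Im (\<Phi> y) \<le> 48 * T * cmod (\<Phi> y) / y * (T * Im (\<Phi> y)) / Im (\<Phi> y)"
        using p by (intro divide_right_mono) auto
      also have "\<dots> = 48 * T * T * (cmod (\<Phi> y) / y)" using p by simp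
      also have "\<bar>Im (V T y) - T * Im (\<Phi> y)\<bar> / Im (\<Phi> y) = \<bar>Im (V T y) / Im (\<Phi> y) - T\<bar>"
      proof -
        have "Im (V T y) / Im (\<Phi> y) - T = (Im (V T y) - T * Im (\<Phi> y)) / Im (\<Phi> y)"
          using p by (simp add: diff_divide_distrib)
        thus ?thesis using p by (simp add: abs_divide)
      qed
      also have "Im (V T y) / Im (\<Phi> y) = H T y / (y * Im (\<Phi> y))" using elim by (simp add: H_def)
      finally show ?case by simp
    qed
    have "((\<lambda>y. 48 * T * T * (cmod (\<Phi> y) / y)) \<longlongrightarrow> 48 * T * T * 0) at_top" by (intro tendsto_intros s0)
    thus "((\<lambda>y. 48 * T * T * (cmod (\<Phi> y) / y)) \<longlongrightarrow> 0) at_top" by simp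
  qed
  thus "((\<lambda>y. H T y / (y * Im (\<phi> (\<i> * complex_of_real y)))) \<longlongrightarrow> T) at_top"
    unfolding \<Phi>_def by (rule LIM_zero_cancel)
qed

end

section \<open>The arcsine scaling limit\<close>

context real_distribution
begin

text \<open>The fraction in \<open>smooth2_eq\<close> has numerator Re (N cnj F), which is at most
  |N| |F|.\<close>

lemma tail_le_vert:
  assumes "0 < y"
  shows "measure M {x. \<bar>x\<bar> > y} \<le> 2 * (cmod (vert y) / cmod (\<i> * complex_of_real y + vert y))"
proof -
  let ?F = "\<i> * complex_of_real y + vert y"
  have F: "0 < cmod ?F" using F_vert_ne[OF assms] by simp
  have "(cmod (vert y))\<^sup>2 + height y = Re (vert y * cnj ?F)"
    unfolding cmod_power2 by (simp add: height_def power2_eq_square algebra_simps)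
  also have "\<dots> \<le> cmod (vert y) * cmod ?F"
    using complex_Re_le_cmod[of "vert y * cnj ?F"] by (simp only: norm_mult complex_mod_cnj)
  finally have "((cmod (vert y))\<^sup>2 + height y) / (cmod ?F)\<^sup>2 \<le> cmod (vert y) * cmod ?F / (cmod ?F)\<^sup>2"
    by (rule divide_right_mono) simp
  also have "\<dots> = cmod (vert y) / cmod ?F" using F by (simp add: power2_eq_square)
  finally have "((cmod (vert y))\<^sup>2 + height y) / (cmod ?F)\<^sup>2 \<le> cmod (vert y) / cmod ?F" .
  moreover have "2 * smooth2 M y / y\<^sup>2 = 2 * (((cmod (vert y))\<^sup>2 + height y) / (cmod ?F)\<^sup>2)"
    using assms by (simp add: smooth2_eq)
  ultimately have "2 * smooth2 M y / y\<^sup>2 \<le> 2 * (cmod (vert y) / cmod ?F)" by linarith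
  from order_trans[OF tail_le_smooth2[OF assms] this] show ?thesis .
qed

text \<open>From height 1000 L the law looks like a point mass: |omega G - 1| <= 1/1000 + 3/250 <
  1/50, where the 3 accounts for the mass outside [-L, L], and N = omega (1 - omega G) / (omega
  G).\<close>

lemma Nev_le_of_tail:
  assumes L: "0 \<le> L" "measure M {x. \<bar>x\<bar> > L} \<le> 1 / 250" and \<omega>: "0 < Im \<omega>" "1000 * L \<le> Im \<omega>" "cmod \<omega> \<le> 2 * Im \<omega>"
  shows "cmod (Nev M \<omega>) \<le> cmod \<omega> / 20"
proof -
  let ?G = "G_transform M \<omega>" and ?S = "{x. \<bar>x\<bar> > L}"
  have S: "?S \<in> sets borel" by simp
  have ne: "\<omega> - complex_of_real x \<noteq> 0" for x using resolvent_ne[of \<omega> x] \<omega> by simp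
  have e: "complex_of_real x / (\<omega> - complex_of_real x) = \<omega> * (1 / (\<omega> - complex_of_real x)) - 1" for x
    using ne[of x] by (simp add: field_simps)
  have low: "Im \<omega> \<le> cmod (\<omega> - complex_of_real x)" for x
    using abs_Im_le_cmod[of "\<omega> - complex_of_real x"] by simp
  have pt: "cmod (complex_of_real x / (\<omega> - complex_of_real x)) \<le> 1 / 1000 + 3 * indicator ?S x" for x
  proof (cases "\<bar>x\<bar> > L")
    case True
    have "cmod (complex_of_real x / (\<omega> - complex_of_real x)) \<le> cmod (\<omega> * (1 / (\<omega> - complex_of_real x))) + cmod 1"
      unfolding e by (rule norm_triangle_ineq4)
    also have "cmod (\<omega> * (1 / (\<omega> - complex_of_real x))) = cmod \<omega> / cmod (\<omega> - complex_of_real x)" by (simp add: norm_divide)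
    also have "\<dots> \<le> 2 * Im \<omega> / Im \<omega>" using \<omega> low by (intro frac_le) auto
    finally show ?thesis using True \<omega> by simp
  next
    case False
    have "cmod (complex_of_real x / (\<omega> - complex_of_real x)) = \<bar>x\<bar> / cmod (\<omega> - complex_of_real x)" by (simp add: norm_divide)
    also have "\<dots> \<le> L / Im \<omega>" using False \<omega> low L by (intro frac_le) auto
    also have "\<dots> \<le> 1 / 1000" using \<omega> by (simp add: divide_le_eq)
    finally show ?thesis using False by simp
  qed
  have int: "integrable M (\<lambda>x. complex_of_real x / (\<omega> - complex_of_real x))"
  proof (rule integrable_bdd[where B=4])
    fix x
    have "3 * indicator ?S x \<le> (3::real)" by (simp add: indicator_def)
    thus "norm (complex_of_real x / (\<omega> - complex_of_real x)) \<le> 4" using pt[of x] by linarith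
  qed simp
  have "\<omega> * ?G - 1 = (\<integral>x. complex_of_real x / (\<omega> - complex_of_real x) \<partial>M)"
  proof -
    have i: "integrable M (\<lambda>x. \<omega> * (1 / (\<omega> - complex_of_real x)))"
      by (intro integrable_mult_right integrable_resolvent) (use \<omega> in simp)
    have "(\<integral>x. \<omega> * (1 / (\<omega> - complex_of_real x)) - 1 \<partial>M) = (\<integral>x. \<omega> * (1 / (\<omega> - complex_of_real x)) \<partial>M) - (\<integral>x. 1 \<partial>M)"
      by (rule Bochner_Integration.integral_diff[OF i]) simp
    thus ?thesis unfolding e integral_mult_right_zero G_transform_def by (simp add: prob_space[unfolded space_eq_univ])
  qed
  also have "cmod \<dots> \<le> (\<integral>x. cmod (complex_of_real x / (\<omega> - complex_of_real x)) \<partial>M)" by (rule integral_norm_bound)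
  also have "\<dots> \<le> (\<integral>x. 1 / 1000 + 3 * indicator ?S x \<partial>M)"
    by (rule integral_mono[OF integrable_norm[OF int] _ pt]) (use S in \<open>auto intro!: integrable_bdd[where B="4"] simp: indicator_def\<close>)
  also have "\<dots> = 1 / 1000 + 3 * measure M ?S"
    using S by (simp add: prob_space[unfolded space_eq_univ] emeasure_finite less_top[symmetric])
  also have "\<dots> \<le> 1 / 50" using L(2) by simp
  finally have d: "cmod (\<omega> * ?G - 1) \<le> 1 / 50" .
  have "cmod 1 \<le> cmod (\<omega> * ?G) + cmod (1 - \<omega> * ?G)" using norm_triangle_ineq[of "\<omega> * ?G" "1 - \<omega> * ?G"] by simp
  hence g: "49 / 50 \<le> cmod (\<omega> * ?G)" using d by (simp add: norm_minus_commute)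
  have G0: "?G \<noteq> 0" using G_nonzero \<omega> by simp
  have w0: "\<omega> \<noteq> 0" using \<omega> by auto
  have "Nev M \<omega> = \<omega> * (1 - \<omega> * ?G) / (\<omega> * ?G)"
    using G0 w0 by (simp add: Nev_def F_transform_def field_simps)
  hence "cmod (Nev M \<omega>) = cmod \<omega> * (cmod (\<omega> * ?G - 1) / cmod (\<omega> * ?G))"
    by (simp add: norm_mult norm_divide norm_minus_commute)
  also have "\<dots> \<le> cmod \<omega> * ((1 / 50) / (49 / 50))" using d g by (intro mult_left_mono frac_le) auto
  also have "\<dots> \<le> cmod \<omega> / 20" by simp
  finally show ?thesis .
qed

text \<open>The equation \<open>F \<omega> = u\<close> is solved as a fixed point of the contraction \<open>\<omega> \<mapsto> u - (F \<omega> - \<omega>)\<close>.\<close>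

lemma F_inverse_of_tail:
  assumes L: "0 \<le> L" "measure M {x. \<bar>x\<bar> > L} \<le> 1 / 250"
    and u: "0 < Im u" "2000 * L \<le> Im u" "\<bar>Re u\<bar> \<le> Im u / 10"
  obtains \<omega> where "F_transform M \<omega> = u" "cmod (\<omega> - u) \<le> Im u / 10"
proof -
  let ?D = "cball u (Im u / 10)"
  have D: "9 / 10 * Im u \<le> Im \<omega>" "0 < Im \<omega>" "cmod \<omega> \<le> 12 / 10 * Im u" "1000 * L \<le> Im \<omega>" "cmod \<omega> \<le> 2 * Im \<omega>" if "\<omega> \<in> ?D" for \<omega>
  proof -
    have d: "cmod (\<omega> - u) \<le> Im u / 10" using that by (simp add: dist_norm norm_minus_commute)
    have "\<bar>Im \<omega> - Im u\<bar> \<le> Im u / 10" using abs_Im_le_cmod[of "\<omega> - u"] d by simp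
    thus 1: "9 / 10 * Im u \<le> Im \<omega>" by linarith
    thus "0 < Im \<omega>" using u by linarith
    have "cmod u \<le> \<bar>Re u\<bar> + \<bar>Im u\<bar>" by (rule cmod_le)
    thus 2: "cmod \<omega> \<le> 12 / 10 * Im u" using norm_triangle_sub[of \<omega> u] d u by linarith
    show "1000 * L \<le> Im \<omega>" "cmod \<omega> \<le> 2 * Im \<omega>" using 1 2 u L(1) by linarith+
  qed
  \<comment> \<open>On the disc |omega| <= 1.2 Im u, and a twentieth of this keeps the map inside
    the disc of radius Im u / 10.\<close>
  have N: "cmod (Nev M \<omega>) \<le> 6 / 100 * Im u" if "\<omega> \<in> ?D" for \<omega>
    using Nev_le_of_tail[OF L D(2)[OF that] D(4)[OF that] D(5)[OF that]] D(3)[OF that] by linarith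
  have I: "0 \<le> Im (Nev M \<omega>) / Im \<omega>" "Im (Nev M \<omega>) / Im \<omega> \<le> 1 / 10" if "\<omega> \<in> ?D" for \<omega>
  proof -
    show "0 \<le> Im (Nev M \<omega>) / Im \<omega>" using Im_Nev_nonneg[OF D(2)[OF that]] D(2)[OF that] by simp
    have "Im (Nev M \<omega>) \<le> 6 / 100 * Im u" using abs_Im_le_cmod[of "Nev M \<omega>"] N[OF that] by linarith
    also have "\<dots> \<le> 1 / 10 * Im \<omega>" using D(1)[OF that] u(1) by linarith
    finally show "Im (Nev M \<omega>) / Im \<omega> \<le> 1 / 10" using D(2)[OF that] by (simp add: divide_le_eq)
  qed
  have "\<exists>!\<omega>. \<omega> \<in> ?D \<and> u - Nev M \<omega> = \<omega>"
  proof (rule Banach_fix[where c="1/10", OF complete_eq_closed[THEN iffD2, OF closed_cball]])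
    show "?D \<noteq> {}" using u by auto
    show "(\<lambda>\<omega>. u - Nev M \<omega>) ` ?D \<subseteq> ?D"
    proof safe
      fix \<omega> assume "\<omega> \<in> ?D"
      from N[OF this] show "u - Nev M \<omega> \<in> ?D" using u(1) by (simp add: dist_norm)
    qed
    show "dist (u - Nev M x) (u - Nev M y) \<le> 1 / 10 * dist x y" if x: "x \<in> ?D" and y: "y \<in> ?D" for x y
    proof -
      have "Im (Nev M x) / Im x * (Im (Nev M y) / Im y) \<le> 1 / 10 * (1 / 10)" using I[OF x] I[OF y] by (intro mult_mono) auto
      hence "sqrt (Im (Nev M x) / Im x * (Im (Nev M y) / Im y)) \<le> 1 / 10"
        by (intro real_le_lsqrt) (auto simp: power2_eq_square)
      hence "cmod (x - y) * sqrt (Im (Nev M x) / Im x * (Im (Nev M y) / Im y)) \<le> cmod (x - y) * (1 / 10)"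
        by (rule mult_left_mono) simp
      from order_trans[OF Nev_lipschitz[OF D(2)[OF x] D(2)[OF y]] this]
      show ?thesis by (simp add: dist_norm norm_minus_commute)
    qed
  qed auto
  then obtain \<omega> where w: "\<omega> \<in> ?D" "u - Nev M \<omega> = \<omega>" by blast
  have "F_transform M \<omega> = u" using w(2) by (simp add: Nev_def)
  moreover have "cmod (\<omega> - u) \<le> Im u / 10" using w(1) by (simp add: dist_norm norm_minus_commute)
  ultimately show ?thesis by (rule that)
qed

end

context monotone_semigroup
begin

lemma H_mono: "0 < t \<Longrightarrow> 0 < y \<Longrightarrow> y \<le> y' \<Longrightarrow> H t y \<le> H t y'"
  using real_distribution.height_mono[OF dist, of t y y'] by (simp add: height_H)

text \<open>Equality in the Pick inequality for the pair \<open>iy, 2iy\<close> would force \<open>Re N\<close> to be constant; slow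
  variation of \<open>H\<close> makes it nearly an equality.\<close>

lemma Re_step:
  assumes T: "0 < T" and y: "0 < y" and \<epsilon>: "0 \<le> \<epsilon>" "H T (2 * y) \<le> (1 + \<epsilon>) * H T y"
  shows "\<bar>Re (V T y) - Re (V T (2 * y))\<bar> \<le> sqrt \<epsilon> * H T y / y"
proof -
  interpret real_distribution "\<mu> T" by (rule dist[OF T])
  define h h' where "h = H T y" and "h' = H T (2 * y)"
  have hh: "0 \<le> h" "h \<le> h'" using H_mono[OF T y, of "2 * y"] y V_nonneg[OF T y] by (auto simp: h_def h'_def H_def)
  let ?V = "V T y" and ?W = "V T (2 * y)"
  have Iv: "Im ?V = h / y" "Im ?W = h' / y / 2" using y by (simp_all add: h_def h'_def H_def)
  have "(cmod (?V - cnj ?W))\<^sup>2 \<le> (cmod (\<i> * complex_of_real y - cnj (\<i> * complex_of_real (2 * y))))\<^sup>2 * (Im ?V / y * (Im ?W / (2 * y)))"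
    using Nev_pick[of "\<i> * complex_of_real y" "\<i> * complex_of_real (2 * y)"] y by (simp add: V_def)
  also have "cmod (\<i> * complex_of_real y - cnj (\<i> * complex_of_real (2 * y))) = 3 * y"
  proof -
    have "\<i> * complex_of_real y - cnj (\<i> * complex_of_real (2 * y)) = \<i> * complex_of_real (3 * y)" by simp
    thus ?thesis using y by (simp only: norm_mult norm_ii norm_of_real)
  qed
  finally have "(Re ?V - Re ?W)\<^sup>2 + (h / y + h' / y / 2)\<^sup>2 \<le> (3 * y)\<^sup>2 * (h / y / y * (h' / y / 2 / (2 * y)))"
    unfolding cmod_power2 by (simp only: Iv minus_complex.sel complex_cnj diff_minus_eq_add cnj.sel)
  also have "\<dots> = 9 / 4 * (h / y) * (h' / y)" using y by (simp add: power2_eq_square field_simps)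
  finally have q: "(Re ?V - Re ?W)\<^sup>2 + (h / y + h' / y / 2)\<^sup>2 \<le> 9 / 4 * (h / y) * (h' / y)" .
  \<comment> \<open>In the normalised heights \<open>a\<close> and \<open>b\<close> the slack of
    Pick's inequality factors; it vanishes when the two heights agree.\<close>
  have "d \<le> (b - a) * (4 * a - b) / 4" if "d + (a + b / 2)\<^sup>2 \<le> 9 / 4 * a * b" for a b d :: real
    using that by (simp add: power2_eq_square algebra_simps)
  from this[OF q] have "(Re ?V - Re ?W)\<^sup>2 \<le> (h' / y - h / y) * (4 * (h / y) - h' / y) / 4" .
  also have "\<dots> \<le> (\<epsilon> * (h / y)) * (3 * (h / y)) / 4"
  proof (intro divide_right_mono)
    define a b where "a = h / y" and "b = h' / y"
    have "h' \<le> h + \<epsilon> * h" using \<epsilon>(2) by (simp add: h_def h'_def distrib_right)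
    hence "h' / y \<le> (h + \<epsilon> * h) / y" using y by (intro divide_right_mono) auto
    hence ab: "0 \<le> a" "a \<le> b" "b - a \<le> \<epsilon> * a" using hh y by (auto simp: a_def b_def divide_right_mono add_divide_distrib)
    have "(b - a) * (4 * a - b) \<le> (b - a) * (3 * a)" using ab by (intro mult_left_mono) auto
    also have "\<dots> \<le> (\<epsilon> * a) * (3 * a)" using ab by (intro mult_right_mono) auto
    finally show "(h' / y - h / y) * (4 * (h / y) - h' / y) \<le> (\<epsilon> * (h / y)) * (3 * (h / y))" by (simp only: a_def b_def)
  qed simp
  also have "\<dots> = 3 / 4 * (\<epsilon> * (h / y)\<^sup>2)" by (simp add: power2_eq_square)
  also have "\<dots> \<le> \<epsilon> * (h / y)\<^sup>2" using mult_nonneg_nonneg[OF \<epsilon>(1) zero_le_power2[of "h / y"]] by linarith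
  also have "\<dots> = (sqrt \<epsilon> * h / y)\<^sup>2" using \<epsilon>(1) by (simp add: power_mult_distrib power_divide)
  finally have "\<bar>Re ?V - Re ?W\<bar> \<le> \<bar>sqrt \<epsilon> * h / y\<bar>" by (simp only: abs_le_square_iff)
  thus ?thesis using \<epsilon>(1) hh y by (simp add: h_def abs_mult)
qed

text \<open>\<open>Re_step\<close> is summed over dyadic scales from infinity, where Re N tends to
  0.\<close>

lemma Re_negligible:
  assumes T: "0 < T" and sv: "sv (H T)" and V0: "(V T \<longlongrightarrow> 0) at_top"
  shows "((\<lambda>y. y * Re (V T y) / H T y) \<longlongrightarrow> 0) at_top"
proof (rule tendstoI)
  fix e :: real assume e: "e > 0"
  \<comment> \<open>The cap 1/2 makes the dyadic ratio (3/2) / 2 = 3/4, whose sum is 4; then (e/5)^2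
    leaves 4 sqrt epsilon < e.\<close>
  define \<epsilon> where "\<epsilon> = min (1 / 2) ((e / 5)\<^sup>2)"
  have \<epsilon>: "0 < \<epsilon>" "\<epsilon> \<le> 1 / 2" using e by (auto simp: \<epsilon>_def)
  have se: "4 * sqrt \<epsilon> < e"
  proof -
    have "sqrt \<epsilon> \<le> sqrt ((e / 5)\<^sup>2)" by (rule real_sqrt_le_mono) (simp add: \<epsilon>_def)
    thus ?thesis using e by simp
  qed
  have pos: "\<forall>\<^sub>F x in at_top. 0 < H T x" using sv by (simp add: sv_def)
  have "((\<lambda>y. H T (2 * y) / H T y) \<longlongrightarrow> 1) at_top" using sv by (simp add: sv_def)
  hence "\<forall>\<^sub>F x in at_top. H T (2 * x) / H T x < 1 + \<epsilon>" by (rule order_tendstoD) (use \<epsilon> in simp)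
  hence "\<forall>\<^sub>F x in at_top. x > 0 \<and> 0 < H T x \<and> H T (2 * x) \<le> (1 + \<epsilon>) * H T x"
    using pos eventually_gt_at_top[of 0] by eventually_elim (simp add: divide_less_eq)
  then obtain R0 where R0: "\<And>x. x \<ge> R0 \<Longrightarrow> x > 0 \<and> 0 < H T x \<and> H T (2 * x) \<le> (1 + \<epsilon>) * H T x"
    by (auto simp: eventually_at_top_linorder)
  have R0p: "R0 > 0" using R0[of R0] by simp
  have bound: "\<bar>Re (V T R)\<bar> \<le> (sqrt \<epsilon> * H T R / R) / (1 - 3 / 4)" if "R \<ge> R0" for R
  proof (rule telescope_bound[where e="\<lambda>R. sqrt \<epsilon> * H T R / R" and ?R0.0=R0])
    fix R assume R: "R0 \<le> R"
    show "\<bar>Re (V T R)\<bar> \<le> sqrt \<epsilon> * H T R / R + \<bar>Re (V T (2 * R))\<bar>"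
      using Re_step[OF T, of R \<epsilon>] R0[OF R] \<epsilon> by linarith
    have "H T (2 * R) \<le> (1 + \<epsilon>) * H T R" using R0[OF R] by simp
    also have "\<dots> \<le> 3 / 2 * H T R" using R0[OF R] \<epsilon>(2) by (intro mult_right_mono) auto
    finally have "H T (2 * R) \<le> 3 / 2 * H T R" .
    hence "sqrt \<epsilon> * H T (2 * R) / (2 * R) \<le> sqrt \<epsilon> * (3 / 2 * H T R) / (2 * R)"
      using R0[OF R] \<epsilon> by (intro divide_right_mono mult_left_mono) auto
    thus "sqrt \<epsilon> * H T (2 * R) / (2 * R) \<le> 3 / 4 * (sqrt \<epsilon> * H T R / R)" by simp
  next
    show "((\<lambda>R. \<bar>Re (V T R)\<bar>) \<longlongrightarrow> 0) at_top"
      using tendsto_rabs[OF tendsto_Re[OF V0]] by simp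
  qed (use that R0p in auto)
  show "\<forall>\<^sub>F y in at_top. dist (y * Re (V T y) / H T y) 0 < e"
    using eventually_ge_at_top[of R0]
  proof eventually_elim
    case (elim y)
    have y: "0 < y" "0 < H T y" using R0[OF elim] by auto
    have "y * \<bar>Re (V T y)\<bar> \<le> y * ((sqrt \<epsilon> * H T y / y) / (1 - 3 / 4))" using bound[OF elim] y by (intro mult_left_mono) auto
    also have "\<dots> = 4 * sqrt \<epsilon> * H T y" using y by simp
    also have "\<dots> < e * H T y" using se y by (intro mult_strict_right_mono) auto
    finally show ?case using y by (simp add: abs_mult divide_less_eq)
  qed
qed

context
  fixes T :: real
  assumes T: "0 < T" and H_sv: "sv (H T)" and V0: "(V T \<longlongrightarrow> 0) at_top"
begin

lemma H_quot: "((\<lambda>B. H T B / B\<^sup>2) \<longlongrightarrow> 0) at_top"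
proof (rule Lim_null_comparison)
  have "\<forall>\<^sub>F y in at_top. cmod (V T y) < 1" using tendstoD[OF V0, of 1] by (simp add: dist_norm)
  thus "\<forall>\<^sub>F B in at_top. norm (H T B / B\<^sup>2) \<le> 1 / B"
    using eventually_gt_at_top[of 0]
  proof eventually_elim
    case (elim B)
    have "\<bar>Im (V T B)\<bar> \<le> 1" using abs_Im_le_cmod[of "V T B"] elim by linarith
    thus ?case using elim by (simp add: H_def power2_eq_square abs_mult divide_right_mono)
  qed
  show "((\<lambda>B. 1 / B) \<longlongrightarrow> (0::real)) at_top" by (intro real_tendsto_divide_at_top[OF tendsto_const] filterlim_ident)
qed

text \<open>On the axis z N(z) = -H(y) + i y Re N, where the second term is negligible and slow
  variation replaces H(y) by H(B); \<open>N_local\<close> carries this to nearby points.\<close>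

lemma N_near_axis:
  assumes \<delta>: "0 < \<delta>" "\<delta> \<le> 1" and C: "100 \<le> C"
  shows "\<forall>\<^sub>F B in at_top. 0 < B \<and> 0 < H T B \<and> (\<forall>y v. 100 * B \<le> y \<longrightarrow> y \<le> C * B \<longrightarrow> cmod v \<le> \<delta> * B \<longrightarrow>
     cmod ((\<i> * complex_of_real y + v) * N T (\<i> * complex_of_real y + v) + complex_of_real (H T B)) \<le> \<delta> * H T B
     \<and> (cmod (N T (\<i> * complex_of_real y + v)))\<^sup>2 \<le> \<delta> * H T B)"
proof -
  define \<kappa> where "\<kappa> = \<delta> / 10"
  have \<kappa>: "0 < \<kappa>" "\<kappa> \<le> 1 / 10" using \<delta> by (auto simp: \<kappa>_def)
  have pos: "\<forall>\<^sub>F x in at_top. 0 < H T x" using H_sv by (simp add: sv_def)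
  have "\<forall>\<^sub>F y in at_top. \<bar>y * Re (V T y) / H T y\<bar> < \<kappa>"
    using tendstoD[OF Re_negligible[OF T H_sv V0] \<kappa>(1)] by (simp add: dist_real_def)
  hence "\<forall>\<^sub>F y in at_top. 0 < y \<and> 0 < H T y \<and> y * \<bar>Re (V T y)\<bar> \<le> \<kappa> * H T y"
    using pos eventually_gt_at_top[of 0] by eventually_elim (simp add: abs_mult divide_less_eq)
  then obtain R0 where R0: "\<And>y. y \<ge> R0 \<Longrightarrow> 0 < y \<and> 0 < H T y \<and> y * \<bar>Re (V T y)\<bar> \<le> \<kappa> * H T y"
    by (auto simp: eventually_at_top_linorder)
  have "((\<lambda>B. H T (C * B) / H T B) \<longlongrightarrow> 1) at_top" using H_sv C by (simp add: sv_def)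
  hence "\<forall>\<^sub>F B in at_top. H T (C * B) / H T B < 1 + \<kappa>" by (rule order_tendstoD) (use \<kappa> in simp)
  moreover have "\<forall>\<^sub>F B in at_top. H T B / B\<^sup>2 < \<delta>" using order_tendstoD(2)[OF H_quot \<delta>(1)] .
  ultimately show ?thesis using eventually_ge_at_top[of R0]
  proof eventually_elim
    case (elim B)
    have B: "0 < B" "0 < H T B" using R0[OF elim(3)] by auto
    have HC: "H T (C * B) \<le> (1 + \<kappa>) * H T B" using elim(1) B by (simp add: divide_less_eq)
    have HB: "H T B \<le> \<delta> * B\<^sup>2" using elim(2) B by (simp add: divide_less_eq)
    have "cmod ((\<i> * complex_of_real y + v) * N T (\<i> * complex_of_real y + v) + complex_of_real (H T B)) \<le> \<delta> * H T B
       \<and> (cmod (N T (\<i> * complex_of_real y + v)))\<^sup>2 \<le> \<delta> * H T B"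
      if y: "100 * B \<le> y" "y \<le> C * B" and v: "cmod v \<le> \<delta> * B" for y v
    proof -
      have yB: "B \<le> y" "0 < y" using y B by linarith+
      have yR: "y \<ge> R0" using yB elim(3) by linarith
      define h where "h = H T y"
      have h: "0 < h" "y * \<bar>Re (V T y)\<bar> \<le> \<kappa> * h" using R0[OF yR] by (auto simp: h_def)
      have hB: "H T B \<le> h" "h \<le> (1 + \<kappa>) * H T B"
        unfolding h_def using H_mono[OF T B(1) yB(1)] H_mono[OF T yB(2) y(2)] HC by auto
      have "(1 + \<kappa>) * H T B \<le> 2 * H T B" using \<kappa> B by (intro mult_right_mono) auto
      hence h2: "h \<le> 2 * H T B" using hB(2) by linarith
      define N' where "N' = N T (\<i> * complex_of_real y + v)"
      have "\<delta> * B \<le> 1 * B" using \<delta> B by (intro mult_right_mono) auto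
      hence vB: "cmod v \<le> B" using v by linarith
      have v2: "cmod v \<le> y / 2" using vB y B by linarith
      have ImV: "Im (V T y) = h / y" using yB by (simp add: h_def H_def)
      have nV: "cmod (V T y) \<le> 2 * (h / y)"
      proof -
        have "\<bar>Re (V T y)\<bar> \<le> \<kappa> * h / y" using h(2) yB by (simp add: le_divide_eq mult.commute)
        also have "\<dots> \<le> 1 * h / y" using \<kappa> h yB by (intro divide_right_mono mult_right_mono) auto
        finally have "\<bar>Re (V T y)\<bar> \<le> h / y" by simp
        moreover have "\<bar>Im (V T y)\<bar> = h / y" using ImV h yB by simp
        ultimately show ?thesis using cmod_le[of "V T y"] by linarith
      qed
      have diff: "cmod (N' - V T y) \<le> 3 * cmod v * (h / y) / y"
        using N_local(1)[OF T yB(2) v2] by (simp add: N'_def ImV)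
      have vy: "cmod v / y \<le> \<delta> / 100"
      proof -
        have "cmod v \<le> \<delta> / 100 * (100 * B)" using v by simp
        also have "\<dots> \<le> \<delta> / 100 * y" using y \<delta> by (intro mult_left_mono) auto
        finally show ?thesis using yB by (simp add: divide_le_eq)
      qed
      let ?z = "\<i> * complex_of_real y + v"
      have nz: "cmod ?z \<le> 2 * y"
        using norm_triangle_ineq[of "\<i> * complex_of_real y" v] v2 yB by (simp add: norm_mult)
      have a1: "cmod (?z * (N' - V T y)) \<le> 6 * (\<delta> / 100) * h"
      proof -
        have "cmod (?z * (N' - V T y)) \<le> (2 * y) * (3 * cmod v * (h / y) / y)"
          unfolding norm_mult using nz diff yB by (intro mult_mono) auto
        also have "\<dots> = 6 * (cmod v / y) * h" using yB by simp
        also have "\<dots> \<le> 6 * (\<delta> / 100) * h" using h by (intro mult_right_mono mult_left_mono vy) auto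
        finally show ?thesis .
      qed
      have a2: "cmod (v * V T y) \<le> 2 * (\<delta> / 100) * h"
      proof -
        have "cmod (v * V T y) \<le> cmod v * (2 * (h / y))" unfolding norm_mult using nV by (intro mult_left_mono) auto
        also have "\<dots> = 2 * (cmod v / y) * h" by simp
        also have "\<dots> \<le> 2 * (\<delta> / 100) * h" using h by (intro mult_right_mono mult_left_mono vy) auto
        finally show ?thesis .
      qed
      have a3: "cmod (\<i> * complex_of_real y * V T y + complex_of_real h) \<le> \<kappa> * h"
      proof -
        have "\<i> * complex_of_real y * V T y + complex_of_real h = \<i> * complex_of_real (y * Re (V T y))"
          using yB by (simp add: complex_eq_iff ImV)
        thus ?thesis using h yB by (simp add: norm_mult abs_mult)
      qed
      have a4: "cmod (complex_of_real (H T B) - complex_of_real h) \<le> \<kappa> * H T B"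
        using hB by (simp add: distrib_right flip: of_real_diff)
      have four: "cmod (a + b + c + d) \<le> cmod a + cmod b + cmod c + cmod d" for a b c d :: complex
        using norm_triangle_ineq[of "a + b + c" d] norm_triangle_ineq[of "a + b" c] norm_triangle_ineq[of a b] by linarith
      have "?z * N' + complex_of_real (H T B)
        = ?z * (N' - V T y) + v * V T y + (\<i> * complex_of_real y * V T y + complex_of_real h) + (complex_of_real (H T B) - complex_of_real h)"
        by (simp add: algebra_simps)
      hence "cmod (?z * N' + complex_of_real (H T B)) \<le> cmod (?z * (N' - V T y)) + cmod (v * V T y)
          + cmod (\<i> * complex_of_real y * V T y + complex_of_real h) + cmod (complex_of_real (H T B) - complex_of_real h)"
        using four by metis
      hence "cmod (?z * N' + complex_of_real (H T B)) \<le> 6 * (\<delta> / 100) * h + 2 * (\<delta> / 100) * h + \<kappa> * h + \<kappa> * H T B"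
        using a1 a2 a3 a4 by linarith
      also have "\<dots> = 18 / 100 * \<delta> * h + \<delta> / 10 * H T B" by (simp add: \<kappa>_def algebra_simps)
      also have "\<dots> \<le> 18 / 100 * \<delta> * (2 * H T B) + \<delta> / 10 * H T B" using h2 \<delta> by (intro add_right_mono mult_left_mono) auto
      also have "\<dots> = 46 / 100 * (\<delta> * H T B)" by simp
      also have "\<dots> \<le> 1 * (\<delta> * H T B)" using \<delta> B by (intro mult_right_mono) auto
      finally have 1: "cmod (?z * N' + complex_of_real (H T B)) \<le> \<delta> * H T B" by simp
      have "3 * cmod v * (h / y) / y = 3 * (cmod v / y) * (h / y)" by simp
      also have "\<dots> \<le> 3 * (\<delta> / 100) * (h / y)" using h yB by (intro mult_right_mono mult_left_mono vy) auto
      also have "\<dots> \<le> 1 * (h / y)" using \<delta> h yB by (intro mult_right_mono) auto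
      finally have "cmod (N' - V T y) \<le> h / y" using diff by simp
      hence "cmod N' \<le> 3 * (h / y)" using nV norm_triangle_sub[of N' "V T y"] by linarith
      also have "\<dots> \<le> 3 * (2 * H T B / (100 * B))" using h2 y B h by (intro mult_left_mono frac_le) auto
      also have "\<dots> = 3 / 50 * (H T B / B)" using B by simp
      also have "\<dots> \<le> 1 * (H T B / B)" using B by (intro mult_right_mono) auto
      also have "\<dots> = H T B / B" by simp
      finally have "(cmod N')\<^sup>2 \<le> (H T B / B)\<^sup>2" by (intro power_mono) auto
      also have "\<dots> = H T B / B\<^sup>2 * H T B" by (simp add: power2_eq_square)
      also have "\<dots> \<le> \<delta> * H T B" using elim(2) B by (intro mult_right_mono) auto
      finally show ?thesis using 1 by (simp add: N'_def)
    qed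
    thus ?case using B by blast
  qed
qed

text \<open>Stated for \<open>Suc k\<close> because the semigroup law is given for positive times
  only.\<close>

lemma F_funpow: "0 < Im z \<Longrightarrow> F (real (Suc k) * T) z = (F T ^^ Suc k) z"
proof (induction k)
  case (Suc k)
  have "real (Suc (Suc k)) * T = T + real (Suc k) * T" by (simp add: algebra_simps)
  hence "F (real (Suc (Suc k)) * T) z = F T (F (real (Suc k) * T) z)"
    using semi[of T "real (Suc k) * T" z] T Suc.prems by simp
  thus ?case using Suc by simp
qed simp

text \<open>One step \<open>z \<mapsto> z + N z\<close> changes \<open>z\<^sup>2\<close> by about \<open>-2H(B)\<close>, which yields the arcsine law's
  \<open>F(z) = sqrt (z\<^sup>2 - 2s)\<close> after rescaling.\<close>

lemma iterate_near_axis: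
  assumes \<delta>: "0 < \<delta>" "\<delta> \<le> 1" and \<eta>: "100 \<le> \<eta>"
  shows "\<forall>\<^sub>F B in at_top. \<forall>k. real k * H T B \<le> 2 * B\<^sup>2 \<longrightarrow>
    cmod ((F T ^^ k) (\<i> * complex_of_real (B * \<eta>)) - \<i> * complex_of_real (sqrt ((B * \<eta>)\<^sup>2 + 2 * real k * H T B))) \<le> \<delta> * B"
proof -
  have C: "100 \<le> \<eta> + 1" using \<eta> by simp
  show ?thesis using N_near_axis[OF \<delta> C]
  proof eventually_elim
    case (elim B)
    have B: "0 < B" "0 < H T B" using elim by auto
    define h where "h = H T B"
    define z0 where "z0 = \<i> * complex_of_real (B * \<eta>)"
    \<comment> \<open>The ideal orbit: its point i Y k has square lowered by exactly 2 h in each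
      step.\<close>
    define Y where "Y = (\<lambda>k. sqrt ((B * \<eta>)\<^sup>2 + 2 * real k * h))"
    have h: "0 < h" using B by (simp add: h_def)
    have Y2: "(Y k)\<^sup>2 = (B * \<eta>)\<^sup>2 + 2 * real k * h" for k using h by (simp add: Y_def)
    have Y1: "100 * B \<le> Y k" for k
    proof -
      have "100 * B \<le> B * \<eta>" using \<eta> B by simp
      also have "\<dots> \<le> Y k" unfolding Y_def using h by (intro real_le_rsqrt) auto
      finally show ?thesis .
    qed
    have Y3: "Y k \<le> (\<eta> + 1) * B" if "real k * h \<le> 2 * B\<^sup>2" for k
    proof -
      have "(B * \<eta>)\<^sup>2 + 2 * real k * h \<le> (B * \<eta>)\<^sup>2 + 4 * B\<^sup>2"
        using that by linarith
      also have "\<dots> \<le> ((\<eta> + 1) * B)\<^sup>2"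
      proof -
        have "4 * B\<^sup>2 \<le> 2 * \<eta> * B\<^sup>2" using \<eta> by (intro mult_right_mono) auto
        moreover have "((\<eta> + 1) * B)\<^sup>2 = (B * \<eta>)\<^sup>2 + 2 * \<eta> * B\<^sup>2 + B\<^sup>2" by (simp add: power2_eq_square algebra_simps)
        moreover have "0 \<le> B\<^sup>2" by simp
        ultimately show ?thesis by linarith
      qed
      finally show ?thesis unfolding Y_def using \<eta> B by (intro real_le_lsqrt) auto
    qed
    have ImZ: "0 < Im ((F T ^^ k) z0)" for k
      by (induction k) (use B \<eta> Im_F_pos[OF T] in \<open>auto simp: z0_def\<close>)
    \<comment> \<open>From squares back to points: z - i Y is (z^2 + Y^2) / (z + i Y), and |z + i Y|
      >= 100 B.\<close>
    have close: "cmod ((F T ^^ k) z0 - \<i> * complex_of_real (Y k)) \<le> \<delta> * B"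
      if sq: "cmod (((F T ^^ k) z0)\<^sup>2 + complex_of_real ((Y k)\<^sup>2)) \<le> real k * (3 * \<delta> * h)" and k: "real k * h \<le> 2 * B\<^sup>2" for k
    proof -
      let ?z = "(F T ^^ k) z0"
      have "100 * B \<le> cmod (?z + \<i> * complex_of_real (Y k))"
        using abs_Im_le_cmod[of "?z + \<i> * complex_of_real (Y k)"] ImZ[of k] Y1[of k] by simp
      hence "cmod (?z - \<i> * complex_of_real (Y k)) * (100 * B) \<le> cmod (?z - \<i> * complex_of_real (Y k)) * cmod (?z + \<i> * complex_of_real (Y k))"
        by (rule mult_left_mono) simp
      also have "\<dots> = cmod (?z\<^sup>2 + complex_of_real ((Y k)\<^sup>2))"
      proof -
        have "(?z - \<i> * complex_of_real (Y k)) * (?z + \<i> * complex_of_real (Y k)) = ?z\<^sup>2 + complex_of_real ((Y k)\<^sup>2)"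
          by (simp add: power2_eq_square algebra_simps)
        thus ?thesis by (simp only: norm_mult[symmetric])
      qed
      also have "\<dots> \<le> 3 * \<delta> * (real k * h)" using sq by (simp add: mult.assoc mult.left_commute)
      also have "\<dots> \<le> 3 * \<delta> * (2 * B\<^sup>2)" by (intro mult_left_mono k) (use \<delta> in auto)
      also have "\<dots> \<le> \<delta> * B * (100 * B)" using \<delta> B by (simp add: power2_eq_square)
      finally show ?thesis using B by simp
    qed
    \<comment> \<open>Each step adds at most 3 delta h: twice delta h from z N + h, once from
      N^2.\<close>
    have sq: "cmod (((F T ^^ k) z0)\<^sup>2 + complex_of_real ((Y k)\<^sup>2)) \<le> real k * (3 * \<delta> * h)" if "real k * h \<le> 2 * B\<^sup>2" for k
      using that
    proof (induction k)
      case 0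
      have "z0\<^sup>2 + complex_of_real ((Y 0)\<^sup>2) = 0" unfolding Y2 by (simp add: z0_def power_mult_distrib)
      thus ?case by simp
    next
      case (Suc k)
      have k: "real k * h \<le> 2 * B\<^sup>2" using Suc.prems h by (simp add: distrib_right)
      let ?z = "(F T ^^ k) z0"
      define v where "v = ?z - \<i> * complex_of_real (Y k)"
      have zv: "?z = \<i> * complex_of_real (Y k) + v" by (simp add: v_def)
      have "cmod v \<le> \<delta> * B" unfolding v_def by (rule close[OF Suc.IH[OF k] k])
      hence N: "cmod (?z * N T ?z + complex_of_real h) \<le> \<delta> * h" "(cmod (N T ?z))\<^sup>2 \<le> \<delta> * h"
        using elim Y1[of k] Y3[OF k] unfolding zv h_def by blast+
      have e: "((F T ^^ Suc k) z0)\<^sup>2 + complex_of_real ((Y (Suc k))\<^sup>2)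
        = (?z\<^sup>2 + complex_of_real ((Y k)\<^sup>2)) + 2 * (?z * N T ?z + complex_of_real h) + (N T ?z)\<^sup>2"
        unfolding Y2 by (simp add: F_eq power2_eq_square algebra_simps)
      have "cmod (((F T ^^ Suc k) z0)\<^sup>2 + complex_of_real ((Y (Suc k))\<^sup>2))
         \<le> cmod (?z\<^sup>2 + complex_of_real ((Y k)\<^sup>2)) + cmod (2 * (?z * N T ?z + complex_of_real h)) + cmod ((N T ?z)\<^sup>2)"
        unfolding e by (intro norm_triangle_le add_mono norm_triangle_ineq order_refl)
      also have "\<dots> \<le> real k * (3 * \<delta> * h) + 2 * (\<delta> * h) + \<delta> * h"
        unfolding norm_mult[of 2] norm_power using Suc.IH[OF k] N by simp
      also have "\<dots> = real (Suc k) * (3 * \<delta> * h)" by (simp add: algebra_simps)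
      finally show ?case .
    qed
    show ?case
    proof (intro allI impI)
      fix k assume "real k * H T B \<le> 2 * B\<^sup>2"
      hence k: "real k * h \<le> 2 * B\<^sup>2" by (simp add: h_def)
      from close[OF sq[OF k] k]
      show "cmod ((F T ^^ k) (\<i> * complex_of_real (B * \<eta>)) - \<i> * complex_of_real (sqrt ((B * \<eta>)\<^sup>2 + 2 * real k * H T B))) \<le> \<delta> * B"
        by (simp add: z0_def Y_def h_def)
    qed
  qed
qed

text \<open>Rounding down keeps steps * H(B) <= B^2, so that even twice as many steps satisfy the
  bound 2 B^2 of \<open>iterate_near_axis\<close>.\<close>

definition steps :: "real \<Rightarrow> nat" where "steps B = nat \<lfloor>B\<^sup>2 / H T B\<rfloor>"

lemma steps_ge: "\<forall>\<^sub>F B in at_top. 0 < B \<and> 0 < H T B \<and> 1 \<le> steps B \<and> real (steps B) * H T B \<le> B\<^sup>2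
   \<and> B\<^sup>2 - H T B \<le> real (steps B) * H T B"
proof -
  have "\<forall>\<^sub>F B in at_top. H T B / B\<^sup>2 < 1" using order_tendstoD(2)[OF H_quot, of 1] by simp
  moreover have "\<forall>\<^sub>F x in at_top. 0 < H T x" using H_sv by (simp add: sv_def)
  ultimately show ?thesis using eventually_gt_at_top[of 0]
  proof eventually_elim
    case (elim B)
    have q: "1 \<le> B\<^sup>2 / H T B" using elim by (simp add: divide_less_eq le_divide_eq)
    have s: "real (steps B) = of_int \<lfloor>B\<^sup>2 / H T B\<rfloor>" unfolding steps_def using q by simp
    have "real (steps B) \<le> B\<^sup>2 / H T B" "B\<^sup>2 / H T B - 1 \<le> real (steps B)" unfolding s by linarith+
    hence "real (steps B) * H T B \<le> B\<^sup>2" "B\<^sup>2 - H T B \<le> real (steps B) * H T B"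
      using elim by (auto simp: field_simps)
    moreover have "1 \<le> steps B" unfolding steps_def using q by (simp add: le_nat_iff)
    ultimately show ?case using elim by simp
  qed
qed

lemma steps_quot: "((\<lambda>B. real (steps B) * H T B / B\<^sup>2) \<longlongrightarrow> 1) at_top"
proof (rule tendsto_sandwich)
  show "\<forall>\<^sub>F B in at_top. 1 - H T B / B\<^sup>2 \<le> real (steps B) * H T B / B\<^sup>2"
    using steps_ge
  proof eventually_elim
    case (elim B)
    have "(B\<^sup>2 - H T B) / B\<^sup>2 \<le> real (steps B) * H T B / B\<^sup>2" using elim by (intro divide_right_mono) auto
    thus ?case using elim by (simp add: diff_divide_distrib)
  qed
  show "\<forall>\<^sub>F B in at_top. real (steps B) * H T B / B\<^sup>2 \<le> 1"
    using steps_ge by eventually_elim (simp add: field_simps)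
  show "((\<lambda>B. 1 - H T B / B\<^sup>2) \<longlongrightarrow> 1) at_top" using tendsto_diff[OF tendsto_const H_quot, of 1] by simp
qed simp

lemma scaling_limit:
  assumes \<eta>: "100 \<le> \<eta>" and m: "m = 1 \<or> m = (2::nat)"
  shows "((\<lambda>B. F (real (m * steps B) * T) (\<i> * complex_of_real (B * \<eta>)) / complex_of_real B)
    \<longlongrightarrow> \<i> * complex_of_real (sqrt (\<eta>\<^sup>2 + 2 * real m))) at_top"
proof -
  let ?f = "\<lambda>B. F (real (m * steps B) * T) (\<i> * complex_of_real (B * \<eta>)) / complex_of_real B"
  let ?g = "\<lambda>B. \<i> * complex_of_real (sqrt (\<eta>\<^sup>2 + 2 * real m * (real (steps B) * H T B / B\<^sup>2)))"
  have "((\<lambda>B. ?f B - ?g B) \<longlongrightarrow> 0) at_top"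
  proof (rule tendstoI)
    fix e :: real assume e: "e > 0"
    define \<delta> where "\<delta> = min 1 (e / 2)"
    have \<delta>: "0 < \<delta>" "\<delta> \<le> 1" "\<delta> < e" using e by (auto simp: \<delta>_def)
    show "\<forall>\<^sub>F B in at_top. dist (?f B - ?g B) 0 < e"
      using iterate_near_axis[OF \<delta>(1,2) \<eta>] steps_ge
    proof eventually_elim
      case (elim B)
      have B: "0 < B" using elim by simp
      define k where "k = m * steps B"
      have k1: "1 \<le> k" using elim m by (auto simp: k_def)
      have "real k * H T B = real m * (real (steps B) * H T B)" by (simp add: k_def)
      also have "\<dots> \<le> real m * B\<^sup>2" using elim by (intro mult_left_mono) auto
      also have "\<dots> \<le> 2 * B\<^sup>2" using m by (intro mult_right_mono) auto
      finally have k: "real k * H T B \<le> 2 * B\<^sup>2" .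
      obtain j where j: "k = Suc j" using k1 by (cases k) auto
      have Fk: "F (real k * T) (\<i> * complex_of_real (B * \<eta>)) = (F T ^^ k) (\<i> * complex_of_real (B * \<eta>))"
        unfolding j by (rule F_funpow) (use B \<eta> in simp)
      have sq: "sqrt ((B * \<eta>)\<^sup>2 + 2 * real k * H T B) = B * sqrt (\<eta>\<^sup>2 + 2 * real m * (real (steps B) * H T B / B\<^sup>2))"
      proof -
        have "(B * \<eta>)\<^sup>2 + 2 * real k * H T B = B\<^sup>2 * (\<eta>\<^sup>2 + 2 * real m * (real (steps B) * H T B / B\<^sup>2))"
          using B by (simp add: k_def distrib_left power_mult_distrib)
        thus ?thesis using B by (simp add: real_sqrt_mult)
      qed
      have "?f B - ?g B = (F (real k * T) (\<i> * complex_of_real (B * \<eta>)) - \<i> * complex_of_real (sqrt ((B * \<eta>)\<^sup>2 + 2 * real k * H T B))) / complex_of_real B"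
        unfolding sq using B by (simp add: k_def diff_divide_distrib)
      hence "cmod (?f B - ?g B) = cmod (F (real k * T) (\<i> * complex_of_real (B * \<eta>)) - \<i> * complex_of_real (sqrt ((B * \<eta>)\<^sup>2 + 2 * real k * H T B))) / B"
        using B by (simp add: norm_divide)
      also have "\<dots> \<le> \<delta> * B / B" unfolding Fk using elim(1) k B by (intro divide_right_mono) auto
      also have "\<dots> < e" using \<delta> B by simp
      finally show ?case by (simp add: dist_norm)
    qed
  qed
  moreover have "(?g \<longlongrightarrow> \<i> * complex_of_real (sqrt (\<eta>\<^sup>2 + 2 * real m * 1))) at_top"
    by (intro tendsto_intros steps_quot)
  ultimately have "((\<lambda>B. (?f B - ?g B) + ?g B) \<longlongrightarrow> 0 + \<i> * complex_of_real (sqrt (\<eta>\<^sup>2 + 2 * real m * 1))) at_top"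
    by (rule tendsto_add)
  thus ?thesis by simp
qed

end

end

section \<open>Pick's inequality for the increment\<close>

text \<open>The inequality is equivalent to (w1 d1 - w2 d2) (w2 d1 - w1 d2) <= 0, so
  \<open>w d\<close> may not decrease while \<open>w\<close> increases and \<open>d\<close>
  decreases.\<close>

lemma pick_conflict:
  fixes d1 d2 w1 w2 :: real
  assumes "(d1 - d2)\<^sup>2 \<le> (w1 - w2)\<^sup>2 * (d1 / w1 * (d2 / w2))"
    and "0 < d2" "d2 < d1" "0 < w1" "w1 < w2" "w2 * d2 < w1 * d1"
  shows False
proof -
  have "(d1 - d2)\<^sup>2 * (w1 * w2) \<le> (w1 - w2)\<^sup>2 * (d1 / w1 * (d2 / w2)) * (w1 * w2)"
    using assms by (intro mult_right_mono) auto
  also have "\<dots> = (w1 - w2)\<^sup>2 * (d1 * d2)" using assms by simp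
  finally have "(w1 * d1 - w2 * d2) * (w2 * d1 - w1 * d2) \<le> 0"
    by (simp add: power2_eq_square algebra_simps)
  moreover have "w1 * d2 < w2 * d1" using assms by (intro mult_strict_mono) auto
  hence "0 < (w1 * d1 - w2 * d2) * (w2 * d1 - w1 * d2)" using assms by (intro mult_pos_pos) auto
  ultimately show False by linarith
qed

lemma pick_witness:
  obtains \<eta> where "10 ^ 6 \<le> \<eta>"
    "\<eta> - sqrt (\<eta>\<^sup>2 - 2) < 10 ^ 6 - sqrt ((10 ^ 6)\<^sup>2 - 2)"
    "sqrt ((10 ^ 6)\<^sup>2 + 2) + sqrt ((10 ^ 6)\<^sup>2 - 2) - 10 ^ 6 < sqrt (\<eta>\<^sup>2 + 2) + sqrt (\<eta>\<^sup>2 - 2) - \<eta>"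
    "(sqrt (\<eta>\<^sup>2 + 2) + sqrt (\<eta>\<^sup>2 - 2) - \<eta>) * (\<eta> - sqrt (\<eta>\<^sup>2 - 2))
      < (sqrt ((10 ^ 6)\<^sup>2 + 2) + sqrt ((10 ^ 6)\<^sup>2 - 2) - 10 ^ 6) * (10 ^ 6 - sqrt ((10 ^ 6)\<^sup>2 - 2))"
proof -
  define b :: real where "b = sqrt ((10 ^ 6)\<^sup>2 - 2)"
  define a :: real where "a = sqrt ((10 ^ 6)\<^sup>2 + 2)"
  \<comment> \<open>The roots differ from 10^6 by about 10^-6. These bounds are just good enough for
    2 a + b > 3 * 10^6, which says that \<open>w d\<close> exceeds (10^6 + b) (10^6 - b) / 2 =
    1.\<close>
  have a: "10 ^ 6 + 9 / 10 ^ 7 \<le> a" unfolding a_def by (rule real_le_rsqrt) (simp add: power2_eq_square)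
  have b: "10 ^ 6 - 11 / 10 ^ 7 \<le> b" unfolding b_def by (rule real_le_rsqrt) (simp add: power2_eq_square)
  have b2: "b < 10 ^ 6" unfolding b_def by (rule real_less_lsqrt) auto
  have bb: "b * b = (10 ^ 6)\<^sup>2 - 2" unfolding b_def by (simp add: power2_eq_square)
  have "(10 ^ 6 + b) * (10 ^ 6 - b) = 2" using bb by (simp add: algebra_simps)
  moreover have "(10 ^ 6 + b) * (10 ^ 6 - b) < 2 * (a + b - 10 ^ 6) * (10 ^ 6 - b)"
    using a b b2 by (intro mult_strict_right_mono) auto
  ultimately have "2 < 2 * ((a + b - 10 ^ 6) * (10 ^ 6 - b))" by (simp only: mult.assoc)
  hence big: "1 < (a + b - 10 ^ 6) * (10 ^ 6 - b)" by linarith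
  have "((\<lambda>\<eta>::real. (sqrt (\<eta>\<^sup>2 + 2) + sqrt (\<eta>\<^sup>2 - 2) - \<eta>) * (\<eta> - sqrt (\<eta>\<^sup>2 - 2))) \<longlongrightarrow> 1) at_top" by real_asymp
  from order_tendstoD(2)[OF this big]
  have 1: "\<forall>\<^sub>F \<eta> in at_top. (sqrt (\<eta>\<^sup>2 + 2) + sqrt (\<eta>\<^sup>2 - 2) - \<eta>) * (\<eta> - sqrt (\<eta>\<^sup>2 - 2)) < (a + b - 10 ^ 6) * (10 ^ 6 - b)" .
  have "((\<lambda>\<eta>::real. \<eta> - sqrt (\<eta>\<^sup>2 - 2)) \<longlongrightarrow> 0) at_top" by real_asymp
  hence 2: "\<forall>\<^sub>F \<eta> in at_top. \<eta> - sqrt (\<eta>\<^sup>2 - 2) < 10 ^ 6 - b" by (rule order_tendstoD) (use b2 in simp)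
  have "filterlim (\<lambda>\<eta>::real. sqrt (\<eta>\<^sup>2 + 2) + sqrt (\<eta>\<^sup>2 - 2) - \<eta>) at_top at_top" by real_asymp
  hence 3: "\<forall>\<^sub>F \<eta> in at_top. a + b - 10 ^ 6 < sqrt (\<eta>\<^sup>2 + 2) + sqrt (\<eta>\<^sup>2 - 2) - \<eta>"
    by (simp add: filterlim_at_top_dense)
  have "\<forall>\<^sub>F \<eta>::real in at_top. 10 ^ 6 \<le> \<eta> \<and> \<eta> - sqrt (\<eta>\<^sup>2 - 2) < 10 ^ 6 - b
      \<and> a + b - 10 ^ 6 < sqrt (\<eta>\<^sup>2 + 2) + sqrt (\<eta>\<^sup>2 - 2) - \<eta>
      \<and> (sqrt (\<eta>\<^sup>2 + 2) + sqrt (\<eta>\<^sup>2 - 2) - \<eta>) * (\<eta> - sqrt (\<eta>\<^sup>2 - 2)) < (a + b - 10 ^ 6) * (10 ^ 6 - b)"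
    using 1 2 3 eventually_ge_at_top[of "10 ^ 6"] by eventually_elim blast
  then obtain \<eta> :: real where "10 ^ 6 \<le> \<eta> \<and> \<eta> - sqrt (\<eta>\<^sup>2 - 2) < 10 ^ 6 - b
      \<and> a + b - 10 ^ 6 < sqrt (\<eta>\<^sup>2 + 2) + sqrt (\<eta>\<^sup>2 - 2) - \<eta>
      \<and> (sqrt (\<eta>\<^sup>2 + 2) + sqrt (\<eta>\<^sup>2 - 2) - \<eta>) * (\<eta> - sqrt (\<eta>\<^sup>2 - 2)) < (a + b - 10 ^ 6) * (10 ^ 6 - b)"
    using eventually_happens'[OF trivial_limit_at_top_linorder] by blast
  thus thesis by (intro that) (auto simp: a_def b_def)
qed

text \<open>The interface to the operator part: all that the contradiction uses of freeness is
  subordination at solved points and tightness of increments.\<close>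

locale free_semigroup = monotone_semigroup \<mu> for \<mu> +
  fixes \<nu> :: "real \<Rightarrow> real \<Rightarrow> real measure"
  assumes dist_incr: "\<lbrakk>0 < s; s < t\<rbrakk> \<Longrightarrow> real_distribution (\<nu> s t)"
    and subord: "\<lbrakk>0 < s; s < t; 0 < Im \<omega>1; 0 < Im \<omega>2; F_transform (\<mu> s) \<omega>1 = u; F_transform (\<nu> s t) \<omega>2 = u;
      0 < Im (\<omega>1 + \<omega>2 - u)\<rbrakk> \<Longrightarrow> F_transform (\<mu> t) (\<omega>1 + \<omega>2 - u) = u"
    and incr_tail: "\<lbrakk>0 < s; s < t; 0 \<le> K\<rbrakk> \<Longrightarrow> measure (\<nu> s t) {x. \<bar>x\<bar> > 2 * K}
      \<le> 2 * (measure (\<mu> s) {x. \<bar>x\<bar> > K} + measure (\<mu> t) {x. \<bar>x\<bar> > K})"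
begin

context
  fixes T :: real
  assumes T: "0 < T" and H_sv: "sv (H T)" and V0: "(V T \<longlongrightarrow> 0) at_top"
begin

abbreviation time :: "nat \<Rightarrow> real \<Rightarrow> real" where "time m B \<equiv> real (m * steps T B) * T"

lemmas lim = scaling_limit[OF T H_sv V0]

lemma ev_times: "\<forall>\<^sub>F B in at_top. 0 < B \<and> 0 < time 1 B \<and> time 1 B < time 2 B"
  using steps_ge[OF T H_sv V0] by eventually_elim (use T in auto)

text \<open>After scaling, \<open>F\<close> sends 100 i to i c with c = sqrt (100^2 + 2 m), which is
  within 1/40 of 100; \<open>tail_le_vert\<close> turns this into a bound of 2 (c - 100) /
  c.\<close>

lemma tail_small:
  assumes m: "m = 1 \<or> m = 2"
  shows "\<forall>\<^sub>F B in at_top. measure (\<mu> (time m B)) {x. \<bar>x\<bar> > 100 * B} \<le> 1 / 1000"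
proof -
  define c where "c = sqrt (100\<^sup>2 + 2 * real m)"
  have c: "100 < c" "c < 100 + 1 / 40"
  proof -
    show "100 < c" unfolding c_def by (rule real_less_rsqrt) (use m in auto)
    show "c < 100 + 1 / 40" unfolding c_def by (rule real_less_lsqrt) (use m in \<open>auto simp: power2_eq_square\<close>)
  qed
  let ?q = "\<lambda>B. F (time m B) (\<i> * complex_of_real (B * 100)) / complex_of_real B"
  have "(?q \<longlongrightarrow> \<i> * complex_of_real c) at_top" using lim[of 100 m] m by (simp add: c_def)
  hence "((\<lambda>B. 2 * (cmod (?q B - \<i> * 100) / cmod (?q B))) \<longlongrightarrow> 2 * (cmod (\<i> * complex_of_real c - \<i> * 100) / cmod (\<i> * complex_of_real c))) at_top"
    by (intro tendsto_intros) (use c in auto)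
  moreover have "cmod (\<i> * complex_of_real c - \<i> * 100) = c - 100"
  proof -
    have "\<i> * complex_of_real c - \<i> * 100 = \<i> * complex_of_real (c - 100)" by (simp add: algebra_simps)
    thus ?thesis using c by (simp only: norm_mult norm_of_real) simp
  qed
  moreover have "cmod (\<i> * complex_of_real c) = c" using c by (simp add: norm_mult)
  ultimately have "((\<lambda>B. 2 * (cmod (?q B - \<i> * 100) / cmod (?q B))) \<longlongrightarrow> 2 * ((c - 100) / c)) at_top" by (simp only:)
  moreover have "2 * ((c - 100) / c) < 1 / 1000" using c by (simp add: divide_less_eq)
  ultimately have "\<forall>\<^sub>F B in at_top. 2 * (cmod (?q B - \<i> * 100) / cmod (?q B)) < 1 / 1000"
    by (rule order_tendstoD(2))
  thus ?thesis using ev_times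
  proof eventually_elim
    case (elim B)
    have B: "0 < B" and tm: "0 < time m B" using elim m by auto
    interpret D: real_distribution "\<mu> (time m B)" by (rule dist[OF tm])
    define v where "v = V (time m B) (100 * B)"
    have e: "?q B = (\<i> * complex_of_real (100 * B) + v) / complex_of_real B"
      unfolding v_def using F_vert[of "time m B" "100 * B"] by (simp add: mult.commute)
    have "?q B - \<i> * 100 = v / complex_of_real B" unfolding e using B by (simp add: add_divide_distrib)
    hence "cmod (?q B - \<i> * 100) / cmod (?q B) = cmod v / cmod (\<i> * complex_of_real (100 * B) + v)"
      unfolding e using B by (simp add: norm_divide)
    moreover have "measure (\<mu> (time m B)) {x. \<bar>x\<bar> > 100 * B} \<le> 2 * (cmod v / cmod (\<i> * complex_of_real (100 * B) + v))"
      using D.tail_le_vert[of "100 * B"] B unfolding vert_V[OF tm] v_def by simp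
    ultimately show ?case using elim(1) order_trans by fastforce
  qed
qed

lemma incr_tail_small:
  "\<forall>\<^sub>F B in at_top. measure (\<nu> (time 1 B) (time 2 B)) {x. \<bar>x\<bar> > 2 * (100 * B)} \<le> 1 / 250"
  using tail_small[of 1, OF disjI1[OF refl]] tail_small[of 2, OF disjI2[OF refl]] ev_times
proof eventually_elim
  case (elim B)
  have "measure (\<nu> (time 1 B) (time 2 B)) {x. \<bar>x\<bar> > 2 * (100 * B)}
    \<le> 2 * (measure (\<mu> (time 1 B)) {x. \<bar>x\<bar> > 100 * B} + measure (\<mu> (time 2 B)) {x. \<bar>x\<bar> > 100 * B})"
    using elim by (intro incr_tail) auto
  also have "\<dots> \<le> 2 * (1 / 1000 + 1 / 1000)" using elim by (intro mult_left_mono add_mono) auto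
  finally show ?case by simp
qed

text \<open>The subordination relation forces the increment's transform to take the value \<open>i a B\<close> at the
  point \<open>i (a + b - \<eta>) B\<close>, up to \<open>o(B)\<close>.\<close>

lemma increment_profile:
  assumes \<eta>: "10 ^ 6 \<le> \<eta>"
  obtains \<omega> where "\<forall>\<^sub>F B in at_top. 0 < Im (\<omega> B)"
    "((\<lambda>B. \<omega> B / complex_of_real B) \<longlongrightarrow> \<i> * complex_of_real (sqrt (\<eta>\<^sup>2 + 2) + sqrt (\<eta>\<^sup>2 - 2) - \<eta>)) at_top"
    "((\<lambda>B. Nev (\<nu> (time 1 B) (time 2 B)) (\<omega> B) / complex_of_real B) \<longlongrightarrow> \<i> * complex_of_real (\<eta> - sqrt (\<eta>\<^sup>2 - 2))) at_top"
proof -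
  define a where "a = sqrt (\<eta>\<^sup>2 + 2)"
  define b where "b = sqrt (\<eta>\<^sup>2 - 2)"
  have a: "\<eta> \<le> a" "a \<le> \<eta> + 1"
  proof -
    show "\<eta> \<le> a" unfolding a_def by (rule real_le_rsqrt) simp
    show "a \<le> \<eta> + 1" unfolding a_def by (rule real_le_lsqrt) (use \<eta> in \<open>auto simp: power2_sum\<close>)
  qed
  have e2: "2 \<le> \<eta>\<^sup>2" using power_mono[of 2 \<eta> 2] \<eta> by simp
  have b: "\<eta> - 1 \<le> b" unfolding b_def by (rule real_le_rsqrt) (use \<eta> in \<open>auto simp: power2_diff\<close>)
  have b2: "b\<^sup>2 = \<eta>\<^sup>2 - 2" using e2 by (simp add: b_def)
  define u where "u = (\<lambda>B. F (time 1 B) (\<i> * complex_of_real (B * \<eta>)))"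
  \<comment> \<open>b^2 + 4 = eta^2 + 2, so the second scaling limit takes at \<open>b\<close> the
    value that the first takes at eta.\<close>
  define w where "w = (\<lambda>B. \<i> * complex_of_real (B * b))"
  \<comment> \<open>A solution exists only for large \<open>B\<close>, hence the choice
    operator.\<close>
  define \<omega> where "\<omega> = (\<lambda>B. SOME \<omega>. F_transform (\<nu> (time 1 B) (time 2 B)) \<omega> = u B \<and> cmod (\<omega> - u B) \<le> Im (u B) / 10)"
  define z where "z = (\<lambda>B. \<i> * complex_of_real (B * \<eta>) + \<omega> B - u B)"
  have u: "((\<lambda>B. u B / complex_of_real B) \<longlongrightarrow> \<i> * complex_of_real a) at_top"
    using lim[of \<eta> 1] \<eta> by (simp add: u_def a_def)
  have Fw: "((\<lambda>B. F (time 2 B) (w B) / complex_of_real B) \<longlongrightarrow> \<i> * complex_of_real a) at_top"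
    using lim[of b 2] \<eta> b by (simp add: w_def a_def b2 add.commute)
  have near: "\<bar>Re c\<bar> \<le> B \<and> (a - 1) * B \<le> Im c \<and> Im c \<le> (a + 1) * B"
    if "dist (c / complex_of_real B) (\<i> * complex_of_real a) < 1" "0 < B" for c B
  proof -
    let ?q = "c / complex_of_real B - \<i> * complex_of_real a"
    have "cmod ?q \<le> 1" using that by (simp add: dist_norm)
    hence q: "\<bar>Re ?q\<bar> \<le> 1" "\<bar>Im ?q\<bar> \<le> 1" using abs_Re_le_cmod[of ?q] abs_Im_le_cmod[of ?q] by linarith+
    have "Re ?q = Re c / B" "Im ?q = Im c / B - a" by (simp_all add: Re_divide_of_real Im_divide_of_real)
    hence q': "\<bar>Re c / B\<bar> \<le> 1" "Im c / B \<le> a + 1" "a - 1 \<le> Im c / B" using q by auto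
    show ?thesis using q' that(2) by (auto simp: abs_divide divide_le_eq le_divide_eq)
  qed
  have ev: "\<forall>\<^sub>F B in at_top. 0 < B \<and> 0 < Im (\<omega> B) \<and> F_transform (\<nu> (time 1 B) (time 2 B)) (\<omega> B) = u B
      \<and> cmod (z B / complex_of_real B - \<i> * complex_of_real b) \<le> 4 / 3 * cmod (u B / complex_of_real B - F (time 2 B) (w B) / complex_of_real B)"
    using ev_times incr_tail_small tendstoD[OF u, of 1, OF zero_less_one] tendstoD[OF Fw, of 1, OF zero_less_one]
  proof eventually_elim
    case (elim B)
    let ?\<nu> = "\<nu> (time 1 B) (time 2 B)"
    have B: "0 < B" "0 < time 1 B" "time 1 B < time 2 B" using elim by auto
    have t2: "0 < time 2 B" using B by linarith
    interpret I: real_distribution ?\<nu> by (rule dist_incr[OF B(2,3)])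
    interpret D: real_distribution "\<mu> (time 2 B)" by (rule dist[OF t2])
    have un: "\<bar>Re (u B)\<bar> \<le> B" "(a - 1) * B \<le> Im (u B)" "Im (u B) \<le> (a + 1) * B" using near[OF elim(3) B(1)] by auto
    have wn: "Im (F (time 2 B) (w B)) \<le> (a + 1) * B" using near[OF elim(4) B(1)] by auto
    \<comment> \<open>The fixed-point lemma requires 2000 * 200 B = 400000 B; this is where 10^6
      enters.\<close>
    have big: "500000 * B \<le> Im (u B)"
    proof -
      have "500000 * B \<le> (a - 1) * B" using a \<eta> B by (intro mult_right_mono) auto
      thus ?thesis using un by linarith
    qed
    have up: "0 < Im (u B)" using big B by linarith
    obtain \<omega>' where "F_transform ?\<nu> \<omega>' = u B" "cmod (\<omega>' - u B) \<le> Im (u B) / 10"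
      by (rule I.F_inverse_of_tail[of "2 * (100 * B)" "u B"]) (use elim(2) B big un up in auto)
    hence "F_transform ?\<nu> (\<omega> B) = u B \<and> cmod (\<omega> B - u B) \<le> Im (u B) / 10" unfolding \<omega>_def by (intro someI conjI)
    hence om: "F_transform ?\<nu> (\<omega> B) = u B" "cmod (\<omega> B - u B) \<le> Im (u B) / 10" by auto
    have dIm: "\<bar>Im (\<omega> B) - Im (u B)\<bar> \<le> Im (u B) / 10" using abs_Im_le_cmod[of "\<omega> B - u B"] om(2) by simp
    hence Imo: "0 < Im (\<omega> B)" using up by linarith
    have aB: "(a + 1) * B \<le> (\<eta> + 2) * B" using a B by (intro mult_right_mono) auto
    have "(\<eta> + 2) * B \<le> 5 / 4 * ((9 / 10 * \<eta> - 1 / 5) * B)"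
    proof -
      have "(\<eta> + 2) * B \<le> (5 / 4 * (9 / 10 * \<eta> - 1 / 5)) * B" using \<eta> B by (intro mult_right_mono) auto
      thus ?thesis by (simp only: mult.assoc)
    qed
    moreover have "(9 / 10 * \<eta> - 1 / 5) * B = B * \<eta> - (\<eta> + 2) * B / 10" by (simp add: field_simps)
    moreover have "B * \<eta> - Im (u B) / 10 \<le> Im (z B)"
    proof -
      have "Im (z B) = B * \<eta> + (Im (\<omega> B) - Im (u B))" by (simp add: z_def)
      thus ?thesis using dIm by linarith
    qed
    \<comment> \<open>Together with \<open>ww\<close> this bounds Im N / Im by 1/4 at both
      \<open>z\<close> and \<open>w\<close>, the Lipschitz constant used next.\<close>
    ultimately have zz: "Im (u B) \<le> 5 / 4 * Im (z B)" using un(3) aB by linarith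
    hence Imz: "0 < Im (z B)" using up by linarith
    have Imw: "0 < Im (w B)" using B b \<eta> by (simp add: w_def)
    have "(\<eta> + 2) * B \<le> (5 / 4 * b) * B" using b \<eta> B by (intro mult_right_mono) auto
    hence ww: "Im (F (time 2 B) (w B)) \<le> 5 / 4 * Im (w B)" using wn aB by (simp add: w_def mult.commute)
    have Fz: "F (time 2 B) (z B) = u B"
      unfolding z_def 
      by (rule subord[OF B(2,3) _ Imo _ om(1)]) (use B(1) \<eta> Imz in \<open>auto simp: u_def z_def\<close>)
    have Iz: "Im (N (time 2 B) (z B)) / Im (z B) \<le> 1 / 4"
      using Imz zz Fz unfolding Nev_def by (simp add: divide_le_eq)
    have Iw: "Im (N (time 2 B) (w B)) / Im (w B) \<le> 1 / 4"
      using Imw ww unfolding Nev_def by (simp add: divide_le_eq)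
    have "Im (N (time 2 B) (z B)) / Im (z B) * (Im (N (time 2 B) (w B)) / Im (w B)) \<le> 1 / 4 * (1 / 4)"
      using Iz Iw D.Im_Nev_nonneg[OF Imz] D.Im_Nev_nonneg[OF Imw] Imz Imw by (intro mult_mono) auto
    hence "sqrt (Im (N (time 2 B) (z B)) / Im (z B) * (Im (N (time 2 B) (w B)) / Im (w B))) \<le> sqrt (1 / 4 * (1 / 4))"
      by (rule real_sqrt_le_mono)
    also have "\<dots> = 1 / 4" by (rule real_sqrt_unique) (auto simp: power2_eq_square)
    finally have "cmod (z B - w B) * sqrt (Im (N (time 2 B) (z B)) / Im (z B) * (Im (N (time 2 B) (w B)) / Im (w B))) \<le> cmod (z B - w B) * (1 / 4)"
      by (rule mult_left_mono) simp
    with D.Nev_lipschitz[OF Imz Imw] have "cmod (N (time 2 B) (z B) - N (time 2 B) (w B)) \<le> cmod (z B - w B) * (1 / 4)"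
      by (rule order_trans)
    moreover have "z B - w B = (u B - F (time 2 B) (w B)) - (N (time 2 B) (z B) - N (time 2 B) (w B))"
      using Fz by (simp add: Nev_def)
    hence "cmod (z B - w B) \<le> cmod (u B - F (time 2 B) (w B)) + cmod (N (time 2 B) (z B) - N (time 2 B) (w B))"
      by (metis norm_triangle_ineq4)
    \<comment> \<open>N has Lipschitz constant 1/4 between the two points, so \<open>F\<close> is
      invertible there with constant 1 / (1 - 1/4); equal limits of \<open>F\<close> force equal
      limits of \<open>z\<close> and \<open>w\<close>.\<close>
    ultimately have "cmod (z B - w B) \<le> 4 / 3 * cmod (u B - F (time 2 B) (w B))" by linarith
    hence "cmod (z B - w B) / B \<le> 4 / 3 * cmod (u B - F (time 2 B) (w B)) / B" using B by (intro divide_right_mono) auto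
    moreover have "cmod (z B - w B) / B = cmod (z B / complex_of_real B - \<i> * complex_of_real b)"
    proof -
      have "z B / complex_of_real B - \<i> * complex_of_real b = (z B - w B) / complex_of_real B"
        using B by (simp add: w_def diff_divide_distrib)
      thus ?thesis using B by (simp add: norm_divide)
    qed
    moreover have "cmod (u B - F (time 2 B) (w B)) / B = cmod (u B / complex_of_real B - F (time 2 B) (w B) / complex_of_real B)"
      unfolding diff_divide_distrib[symmetric] using B by (simp add: norm_divide)
    ultimately show ?case using B(1) Imo om(1) by simp
  qed
  have "((\<lambda>B. z B / complex_of_real B - \<i> * complex_of_real b) \<longlongrightarrow> 0) at_top"
  proof (rule Lim_null_comparison)
    show "\<forall>\<^sub>F B in at_top. cmod (z B / complex_of_real B - \<i> * complex_of_real b)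
        \<le> 4 / 3 * cmod (u B / complex_of_real B - F (time 2 B) (w B) / complex_of_real B)"
      using ev by eventually_elim blast
    have "((\<lambda>B. 4 / 3 * cmod (u B / complex_of_real B - F (time 2 B) (w B) / complex_of_real B))
        \<longlongrightarrow> 4 / 3 * cmod (\<i> * complex_of_real a - \<i> * complex_of_real a)) at_top"
      by (intro tendsto_intros u Fw)
    thus "((\<lambda>B. 4 / 3 * cmod (u B / complex_of_real B - F (time 2 B) (w B) / complex_of_real B)) \<longlongrightarrow> 0) at_top" by simp
  qed
  hence zl: "((\<lambda>B. z B / complex_of_real B) \<longlongrightarrow> \<i> * complex_of_real b) at_top" by (rule LIM_zero_cancel)
  have "((\<lambda>B. z B / complex_of_real B + u B / complex_of_real B - \<i> * complex_of_real \<eta>)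
     \<longlongrightarrow> \<i> * complex_of_real b + \<i> * complex_of_real a - \<i> * complex_of_real \<eta>) at_top"
    by (intro tendsto_intros zl u)
  moreover have "\<forall>\<^sub>F B in at_top. z B / complex_of_real B + u B / complex_of_real B - \<i> * complex_of_real \<eta> = \<omega> B / complex_of_real B"
    using eventually_gt_at_top[of 0] by eventually_elim (simp add: z_def add_divide_distrib diff_divide_distrib)
  ultimately have "((\<lambda>B. \<omega> B / complex_of_real B) \<longlongrightarrow> \<i> * complex_of_real b + \<i> * complex_of_real a - \<i> * complex_of_real \<eta>) at_top"
    by (rule Lim_transform_eventually)
  hence ol: "((\<lambda>B. \<omega> B / complex_of_real B) \<longlongrightarrow> \<i> * complex_of_real (a + b - \<eta>)) at_top" by (simp add: algebra_simps)
  have "((\<lambda>B. u B / complex_of_real B - \<omega> B / complex_of_real B) \<longlongrightarrow> \<i> * complex_of_real a - \<i> * complex_of_real (a + b - \<eta>)) at_top"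
    by (intro tendsto_intros u ol)
  moreover have "\<forall>\<^sub>F B in at_top. u B / complex_of_real B - \<omega> B / complex_of_real B = Nev (\<nu> (time 1 B) (time 2 B)) (\<omega> B) / complex_of_real B"
    using ev by eventually_elim (simp add: Nev_def diff_divide_distrib)
  ultimately have "((\<lambda>B. Nev (\<nu> (time 1 B) (time 2 B)) (\<omega> B) / complex_of_real B) \<longlongrightarrow> \<i> * complex_of_real a - \<i> * complex_of_real (a + b - \<eta>)) at_top"
    by (rule Lim_transform_eventually)
  hence nl: "((\<lambda>B. Nev (\<nu> (time 1 B) (time 2 B)) (\<omega> B) / complex_of_real B) \<longlongrightarrow> \<i> * complex_of_real (\<eta> - b)) at_top"
    by (simp add: algebra_simps)
  have "\<forall>\<^sub>F B in at_top. 0 < Im (\<omega> B)" using ev by eventually_elim blast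
  from that[OF this] ol nl show thesis unfolding a_def b_def by blast
qed

text \<open>The two-point inequality is invariant under scaling by \<open>B\<close>. For the
  increment law at the two profiles it passes to the limit, where the witness contradicts
  it.\<close>

lemma arcsine_conflict: False
proof -
  obtain \<eta> where \<eta>: "10 ^ 6 \<le> \<eta>"
    "\<eta> - sqrt (\<eta>\<^sup>2 - 2) < 10 ^ 6 - sqrt ((10 ^ 6)\<^sup>2 - 2)"
    "sqrt ((10 ^ 6)\<^sup>2 + 2) + sqrt ((10 ^ 6)\<^sup>2 - 2) - 10 ^ 6 < sqrt (\<eta>\<^sup>2 + 2) + sqrt (\<eta>\<^sup>2 - 2) - \<eta>"
    "(sqrt (\<eta>\<^sup>2 + 2) + sqrt (\<eta>\<^sup>2 - 2) - \<eta>) * (\<eta> - sqrt (\<eta>\<^sup>2 - 2))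
      < (sqrt ((10 ^ 6)\<^sup>2 + 2) + sqrt ((10 ^ 6)\<^sup>2 - 2) - 10 ^ 6) * (10 ^ 6 - sqrt ((10 ^ 6)\<^sup>2 - 2))"
    by (rule pick_witness)
  define d1 :: real where "d1 = 10 ^ 6 - sqrt ((10 ^ 6)\<^sup>2 - 2)"
  define w1 :: real where "w1 = sqrt ((10 ^ 6)\<^sup>2 + 2) + sqrt ((10 ^ 6)\<^sup>2 - 2) - 10 ^ 6"
  define d2 where "d2 = \<eta> - sqrt (\<eta>\<^sup>2 - 2)"
  define w2 where "w2 = sqrt (\<eta>\<^sup>2 + 2) + sqrt (\<eta>\<^sup>2 - 2) - \<eta>"
  have d2: "0 < d2"
  proof -
    have "sqrt (\<eta>\<^sup>2 - 2) < \<eta>" by (rule real_less_lsqrt) (use \<eta>(1) in auto)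
    thus ?thesis by (simp add: d2_def)
  qed
  have w1: "0 < w1"
  proof -
    have "10 ^ 6 \<le> sqrt ((10 ^ 6)\<^sup>2 + 2 :: real)" by (rule real_le_rsqrt) simp
    moreover have "0 < sqrt ((10 ^ 6)\<^sup>2 - 2 :: real)" by simp
    ultimately show ?thesis unfolding w1_def by linarith
  qed
  have w2: "0 < w2" using w1 \<eta>(3) by (simp add: w1_def w2_def)
  obtain o1 where o1: "\<forall>\<^sub>F B in at_top. 0 < Im (o1 B)"
    "((\<lambda>B. o1 B / complex_of_real B) \<longlongrightarrow> \<i> * complex_of_real w1) at_top"
    "((\<lambda>B. Nev (\<nu> (time 1 B) (time 2 B)) (o1 B) / complex_of_real B) \<longlongrightarrow> \<i> * complex_of_real d1) at_top"
    using increment_profile[of "10 ^ 6"] unfolding d1_def w1_def by blast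
  obtain o2 where o2: "\<forall>\<^sub>F B in at_top. 0 < Im (o2 B)"
    "((\<lambda>B. o2 B / complex_of_real B) \<longlongrightarrow> \<i> * complex_of_real w2) at_top"
    "((\<lambda>B. Nev (\<nu> (time 1 B) (time 2 B)) (o2 B) / complex_of_real B) \<longlongrightarrow> \<i> * complex_of_real d2) at_top"
    using increment_profile[OF \<eta>(1)] unfolding d2_def w2_def by blast
  let ?N = "\<lambda>B. Nev (\<nu> (time 1 B) (time 2 B))"
  have "(cmod (\<i> * complex_of_real d1 - \<i> * complex_of_real d2))\<^sup>2 \<le> (cmod (\<i> * complex_of_real w1 - \<i> * complex_of_real w2))\<^sup>2
    * (Im (\<i> * complex_of_real d1) / Im (\<i> * complex_of_real w1) * (Im (\<i> * complex_of_real d2) / Im (\<i> * complex_of_real w2)))"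
  proof (rule tendsto_le[where F=at_top])
    show "((\<lambda>B. (cmod (?N B (o1 B) / complex_of_real B - ?N B (o2 B) / complex_of_real B))\<^sup>2)
      \<longlongrightarrow> (cmod (\<i> * complex_of_real d1 - \<i> * complex_of_real d2))\<^sup>2) at_top"
      by (intro tendsto_intros o1 o2)
    show "((\<lambda>B. (cmod (o1 B / complex_of_real B - o2 B / complex_of_real B))\<^sup>2
      * (Im (?N B (o1 B) / complex_of_real B) / Im (o1 B / complex_of_real B) * (Im (?N B (o2 B) / complex_of_real B) / Im (o2 B / complex_of_real B))))
      \<longlongrightarrow> (cmod (\<i> * complex_of_real w1 - \<i> * complex_of_real w2))\<^sup>2
    * (Im (\<i> * complex_of_real d1) / Im (\<i> * complex_of_real w1) * (Im (\<i> * complex_of_real d2) / Im (\<i> * complex_of_real w2)))) at_top"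
      by (intro tendsto_intros o1 o2) (use w1 w2 in auto)
    show "\<forall>\<^sub>F B in at_top. (cmod (?N B (o1 B) / complex_of_real B - ?N B (o2 B) / complex_of_real B))\<^sup>2
      \<le> (cmod (o1 B / complex_of_real B - o2 B / complex_of_real B))\<^sup>2
      * (Im (?N B (o1 B) / complex_of_real B) / Im (o1 B / complex_of_real B) * (Im (?N B (o2 B) / complex_of_real B) / Im (o2 B / complex_of_real B)))"
      using o1(1) o2(1) ev_times
    proof eventually_elim
      case (elim B)
      have B: "0 < B" using elim by simp
      interpret I: real_distribution "\<nu> (time 1 B) (time 2 B)" by (rule dist_incr) (use elim in blast)+
      have q: "(cmod (x / complex_of_real B - y / complex_of_real B))\<^sup>2 = (cmod (x - y))\<^sup>2 / B\<^sup>2" for x y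
        unfolding diff_divide_distrib[symmetric] using B by (simp add: norm_divide power_divide)
      have r: "Im (x / complex_of_real B) / Im (y / complex_of_real B) = Im x / Im y" for x y
        using B by (simp add: Im_divide_of_real)
      show ?case unfolding q r
        using divide_right_mono[OF I.Nev_lipschitz_sq[OF elim(1,2)], of "B\<^sup>2"] by (simp only: times_divide_eq_left zero_le_power2)
    qed
  qed simp
  moreover have "cmod (\<i> * complex_of_real p - \<i> * complex_of_real q) = \<bar>p - q\<bar>" for p q
    unfolding right_diff_distrib[symmetric] of_real_diff[symmetric] norm_mult norm_of_real by simp
  ultimately have "(d1 - d2)\<^sup>2 \<le> (w1 - w2)\<^sup>2 * (d1 / w1 * (d2 / w2))" by simp
  thus False
    by (rule pick_conflict) (use d2 w1 \<eta> in \<open>simp_all add: d1_def d2_def w1_def w2_def\<close>)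
qed

end

theorem not_sv_H: "0 < T \<Longrightarrow> \<not> sv (H T)"
  using arcsine_conflict mean_zero H_sv_decays by blast

end

section \<open>From the process to the semigroup\<close>

lemma (in real_distribution) eq_return:
  assumes "AE x in M. x = a" shows "M = return borel a"
proof (rule measure_eqI)
  fix A assume A: "A \<in> sets M"
  show "emeasure M A = emeasure (return borel a) A"
  proof (cases "a \<in> A")
    case True
    have "emeasure M A = emeasure M (space M)" using assms True A by (intro emeasure_eq_AE) auto
    thus ?thesis using True A unfolding emeasure_space_1 by simp
  next
    case False
    have "emeasure M A = emeasure M {}" using assms False A by (intro emeasure_eq_AE) auto
    thus ?thesis using False A by simp
  qed
qed simp

text \<open>The L2 norm of \<open>dev z\<close> vanishes, so t = z - F z for almost every t.\<close>

lemma (in real_distribution) eq_return_of_Nev: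
  assumes z: "0 < Im z" and N: "Im (Nev M z) = 0"
  obtains a where "M = return borel a"
proof -
  have "(\<integral>t. (cmod (dev z t))\<^sup>2 \<partial>M) = 0" using dev_norm_sq[OF z] N by simp
  hence "AE t in M. (cmod (dev z t))\<^sup>2 = 0"
    using integral_nonneg_eq_0_iff_AE[OF dev_sq_integrable[of z]] z by simp
  hence "AE t in M. t = Re (z - F_transform M z)"
  proof eventually_elim
    case (elim t)
    hence "F_transform M z = z - complex_of_real t"
      using resolvent_ne[of z t] z by (simp add: dev_def divide_eq_eq split: if_splits)
    thus ?case by simp
  qed
  thus thesis using eq_return that by blast
qed

lemma (in real_distribution) second_moment_pos:
  assumes "integrable M (\<lambda>x. x\<^sup>2)" "M \<noteq> return borel 0" shows "0 < (\<integral>x. x\<^sup>2 \<partial>M)"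
proof -
  have "(\<integral>x. x\<^sup>2 \<partial>M) \<noteq> 0"
  proof
    assume "(\<integral>x. x\<^sup>2 \<partial>M) = 0"
    hence "AE x in M. x = 0" using integral_nonneg_eq_0_iff_AE[OF assms(1)] by simp
    thus False using eq_return assms(2) by blast
  qed
  moreover have "0 \<le> (\<integral>x. x\<^sup>2 \<partial>M)" by simp
  ultimately show ?thesis by linarith
qed

lemma F_return_0: "F_transform (return borel 0) z = z"
  by (simp add: F_transform_def G_transform_def integral_return)

lemma freely_independent_reindex:
  fixes \<tau> :: "('h::complex_hilbert_space \<Rightarrow> 'h) \<Rightarrow> complex" and I :: "'i set" and J :: "'j set"
  assumes "freely_independent \<tau> I X" "inj_on f J" "f ` J \<subseteq> I"
  shows "freely_independent \<tau> J (\<lambda>j. X (f j))"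
  unfolding freely_independent_def
proof (intro allI impI, elim conjE)
  fix ws :: "('j \<times> ('h \<Rightarrow> 'h)) list"
  assume ws: "ws \<noteq> []" "distinct_adj (map fst ws)"
    "\<forall>(i, A)\<in>set ws. i \<in> J \<and> A \<in> generated_vN (X (f i)) \<and> \<tau> A = 0"
  define vs where "vs = map (\<lambda>(i, A). (f i, A)) ws"
  have m: "map fst vs = map f (map fst ws)" "map snd vs = map snd ws" by (auto simp: vs_def)
  have "set (map fst ws) \<subseteq> J" using ws(3) by auto
  hence "distinct_adj (map fst vs)" unfolding m by (rule distinct_adj_mapI[OF ws(2) inj_on_subset[OF assms(2)]])
  moreover have "vs \<noteq> []" using ws by (simp add: vs_def)
  moreover have "\<forall>(i, A)\<in>set vs. i \<in> I \<and> A \<in> generated_vN (X i) \<and> \<tau> A = 0"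
    using ws(3) assms(3) unfolding vs_def by fastforce
  ultimately have "\<tau> (foldr (\<circ>) (map snd vs) id) = 0" using assms(1) unfolding freely_independent_def by blast
  thus "\<tau> (foldr (\<circ>) (map snd ws) id) = 0" unfolding m .
qed

lemma (in free_additive_process) increment_pair:
  assumes st: "0 \<le> s" "s < t"
  shows "free_pair M \<tau> (Z s) (op_diff (Z t) (Z s)) (Z t) (\<mu> s) (\<nu> s t) (\<mu> t)"
proof -
  define ts where "ts = (\<lambda>i::nat. if i = 0 then s else t)"
  have "freely_independent \<tau> {..1} (increment Z ts)"
    by (rule free_increments) (use st in \<open>auto simp: ts_def strict_mono_on_def\<close>)
  hence "freely_independent \<tau> UNIV (\<lambda>b. increment Z ts (if b then 1 else 0))"
    by (rule freely_independent_reindex) (auto simp: inj_on_def)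
  moreover have "(\<lambda>b. increment Z ts (if b then 1 else 0)) = (\<lambda>b. if b then op_diff (Z t) (Z s) else Z s)"
    by (rule ext) (simp add: increment_def ts_def split: nat.split)
  ultimately have free: "freely_independent \<tau> UNIV (\<lambda>b. if b then op_diff (Z t) (Z s) else Z s)" by simp
  show ?thesis
    by unfold_locales (use st free in \<open>auto intro: marginal_law increment_law\<close>)
qed

lemma (in free_Levy_process_second_kind) free_semigroup:
  assumes L: "is_Levy_measure \<mu> \<rho>" and m: "\<exists>t0>0. mean (\<mu> t0) = 0 \<or> mean (\<mu> t0) = \<infinity>"
  shows "free_semigroup \<mu> \<nu>"
proof (intro free_semigroup.intro monotone_semigroup.intro free_semigroup_axioms.intro)
  have distr: "real_distribution (\<mu> t)" if "0 \<le> t" for t using marginal_law[OF that] by (simp add: has_law_def)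
  fix s t :: real
  show "real_distribution (\<mu> t)" if "0 < t" using distr that by simp
  show "real_distribution (\<nu> s t)" if "0 < s" "s < t"
    using increment_law[of s t] that by (simp add: has_law_def)
  show "F_transform (\<mu> (s + t)) z = F_transform (\<mu> s) (F_transform (\<mu> t) z)" if st: "0 < s" "0 < t" and z: "0 < Im z" for z
  proof -
    obtain \<sigma> where \<sigma>: "subordination_family \<mu> \<sigma>" "\<And>s t h. 0 \<le> s \<Longrightarrow> s < t \<Longrightarrow> 0 \<le> h \<Longrightarrow> \<sigma> (s + h) (t + h) = \<sigma> s t"
      using stationary by blast
    have con: "F_transform (\<mu> u) z = F_transform (\<mu> r) (F_transform (\<sigma> r u) z)" if "0 \<le> r" "r < u" for r u
      using \<sigma>(1) that z unfolding subordination_family_def is_monotone_convolution_def by blast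
    \<comment> \<open>Stationarity; and \<sigma> 0 t has the transform of \<mu> t because the law at
      time 0 has the identity as its \<open>F\<close>.\<close>
    have "\<sigma> s (s + t) = \<sigma> 0 t" using \<sigma>(2)[of 0 t s] st by (simp add: add.commute)
    moreover have "F_transform (\<mu> t) z = F_transform (\<sigma> 0 t) z" using con[of 0 t] st by (simp add: law_0 F_return_0)
    ultimately show ?thesis using con[of s "s + t"] st by simp
  qed
  show "((\<lambda>\<epsilon>. Nev (\<mu> \<epsilon>) z) \<longlongrightarrow> 0) (at_right 0)" if z: "0 < Im z" for z
  proof -
    obtain l where l: "((\<lambda>\<epsilon>. (F_transform (\<mu> \<epsilon>) z - z) / complex_of_real \<epsilon>) \<longlongrightarrow> l) (at_right 0)"
      using L z unfolding is_Levy_measure_def by blast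
    have "((\<lambda>\<epsilon>. complex_of_real \<epsilon>) \<longlongrightarrow> complex_of_real 0) (at_right 0)" by (intro tendsto_intros)
    from tendsto_mult[OF this l]
    have "((\<lambda>\<epsilon>. complex_of_real \<epsilon> * ((F_transform (\<mu> \<epsilon>) z - z) / complex_of_real \<epsilon>)) \<longlongrightarrow> 0) (at_right 0)" by simp
    moreover have "\<forall>\<^sub>F \<epsilon> in at_right 0. complex_of_real \<epsilon> * ((F_transform (\<mu> \<epsilon>) z - z) / complex_of_real \<epsilon>) = Nev (\<mu> \<epsilon>) z"
      using eventually_at_right_less[of "0::real"] by eventually_elim (simp add: Nev_def)
    ultimately show ?thesis by (rule Lim_transform_eventually)
  qed
  show "\<exists>t0>0. \<not> integrable (\<mu> t0) (\<lambda>x. x) \<or> (\<integral>x. x \<partial>\<mu> t0) = 0"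
    using m by (auto simp: mean_def split: if_splits)
  show "F_transform (\<mu> t) (\<omega>1 + \<omega>2 - u) = u"
    if "0 < s" "s < t" "0 < Im \<omega>1" "0 < Im \<omega>2" "F_transform (\<mu> s) \<omega>1 = u" "F_transform (\<nu> s t) \<omega>2 = u" "0 < Im (\<omega>1 + \<omega>2 - u)" for \<omega>1 \<omega>2 u
    using free_pair.subordination[OF increment_pair[of s t]] that by simp
  show "measure (\<nu> s t) {x. \<bar>x\<bar> > 2 * K} \<le> 2 * (measure (\<mu> s) {x. \<bar>x\<bar> > K} + measure (\<mu> t) {x. \<bar>x\<bar> > K})"
    if "0 < s" "s < t" "0 \<le> K" for K
    using free_pair.tail_bound[OF increment_pair[of s t]] that by simp
qed

section \<open>The generator along the imaginary axis\<close>

context fin_borel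
begin

definition gen_mass :: "real \<Rightarrow> real" where "gen_mass y = (\<integral>x. y\<^sup>2 / (x\<^sup>2 + y\<^sup>2) \<partial>\<rho>)"

lemma ratio_le_1: "y\<^sup>2 / (x\<^sup>2 + y\<^sup>2) \<le> (1::real)"
proof (cases "y = 0")
  case False
  hence "0 < x\<^sup>2 + y\<^sup>2" by (simp add: add_nonneg_pos)
  thus ?thesis by (simp add: divide_le_eq_1)
qed simp

lemma gen_mass_limit: "(gen_mass \<longlongrightarrow> measure \<rho> UNIV) at_top"
proof -
  have "((\<lambda>y. \<integral>x. y\<^sup>2 / (x\<^sup>2 + y\<^sup>2) \<partial>\<rho>) \<longlongrightarrow> (\<integral>x. 1 \<partial>\<rho>)) at_top"
  proof (rule integral_dominated_convergence_at_top[where w="\<lambda>_. 1"])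
    show "\<forall>\<^sub>F y in at_top. AE x in \<rho>. norm (y\<^sup>2 / (x\<^sup>2 + y\<^sup>2)) \<le> 1"
      by (intro always_eventually allI AE_I2) (simp add: ratio_le_1)
    have "((\<lambda>y. y\<^sup>2 / (x\<^sup>2 + y\<^sup>2)) \<longlongrightarrow> 1) at_top" for x :: real by real_asymp
    thus "AE x in \<rho>. ((\<lambda>y. y\<^sup>2 / (x\<^sup>2 + y\<^sup>2)) \<longlongrightarrow> 1) at_top" by simp
  qed auto
  thus ?thesis by (simp add: gen_mass_def[abs_def])
qed

definition kern :: "complex \<Rightarrow> real \<Rightarrow> complex" where
  "kern z x = (1 + complex_of_real x * z) / (complex_of_real x - z)"

lemma kern_measurable [measurable]: "kern z \<in> borel_measurable borel"
  unfolding kern_def[abs_def] by simp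

lemma kern_norm_sq: "0 < y \<Longrightarrow> (cmod (kern (\<i> * complex_of_real y) x))\<^sup>2 = (1 + x\<^sup>2 * y\<^sup>2) / (x\<^sup>2 + y\<^sup>2)"
  by (simp add: kern_def norm_divide power_divide cmod_power2 power_mult_distrib)

lemma kern_bound: assumes "1 \<le> y" shows "cmod (kern (\<i> * complex_of_real y) x) \<le> y"
proof (rule power2_le_imp_le)
  have y: "1 \<le> y\<^sup>2" using assms by simp
  hence "1 * 1 \<le> y\<^sup>2 * y\<^sup>2" by (intro mult_mono) auto
  hence "1 + x\<^sup>2 * y\<^sup>2 \<le> y\<^sup>2 * (x\<^sup>2 + y\<^sup>2)" by (simp add: algebra_simps)
  moreover have "0 < x\<^sup>2 + y\<^sup>2" using y zero_le_power2[of x] by linarith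
  ultimately show "(cmod (kern (\<i> * complex_of_real y) x))\<^sup>2 \<le> y\<^sup>2" using assms by (simp add: kern_norm_sq divide_le_eq)
qed (use assms in simp)

lemma kern_im: assumes "0 < y" shows "y * Im (kern (\<i> * complex_of_real y) x) = x\<^sup>2 * y\<^sup>2 / (x\<^sup>2 + y\<^sup>2) + y\<^sup>2 / (x\<^sup>2 + y\<^sup>2)"
  using assms by (simp add: kern_def Im_divide power2_eq_square add_divide_distrib[symmetric] algebra_simps)

lemma kern_integrable: "1 \<le> y \<Longrightarrow> integrable \<rho> (kern (\<i> * complex_of_real y))"
  by (rule int_bdd[where B=y]) (auto intro: kern_bound)

text \<open>The imaginary part of the generator kernel at i y is y (1 + x^2) / (x^2 + y^2): the x^2
  part yields \<open>smooth2\<close>, the constant part a term tending to the total mass.\<close>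

lemma gen_im:
  assumes "1 \<le> y"
  shows "y * Im (complex_of_real a + (\<integral>x. kern (\<i> * complex_of_real y) x \<partial>\<rho>)) = smooth2 \<rho> y + gen_mass y"
proof -
  have "y * Im (\<integral>x. kern (\<i> * complex_of_real y) x \<partial>\<rho>) = (\<integral>x. y * Im (kern (\<i> * complex_of_real y) x) \<partial>\<rho>)"
    using kern_integrable[OF assms] by simp
  also have "\<dots> = (\<integral>x. x\<^sup>2 * y\<^sup>2 / (x\<^sup>2 + y\<^sup>2) + y\<^sup>2 / (x\<^sup>2 + y\<^sup>2) \<partial>\<rho>)"
    using assms by (intro Bochner_Integration.integral_cong refl kern_im) simp
  also have "\<dots> = smooth2 \<rho> y + gen_mass y" unfolding smooth2_def gen_mass_def
  proof (rule Bochner_Integration.integral_add)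
    show "integrable \<rho> (\<lambda>x. x\<^sup>2 * y\<^sup>2 / (x\<^sup>2 + y\<^sup>2))"
      by (rule int_bdd[where B="y\<^sup>2"]) (auto intro: kernel_le_y)
    show "integrable \<rho> (\<lambda>x. y\<^sup>2 / (x\<^sup>2 + y\<^sup>2))"
      by (rule int_bdd[where B=1]) (simp_all add: ratio_le_1)
  qed
  finally show ?thesis by simp
qed

lemma gen_small:
  "((\<lambda>y. (complex_of_real a + (\<integral>x. kern (\<i> * complex_of_real y) x \<partial>\<rho>)) / complex_of_real y) \<longlongrightarrow> 0) at_top"
proof -
  have "((\<lambda>y. \<integral>x. kern (\<i> * complex_of_real y) x / complex_of_real y \<partial>\<rho>) \<longlongrightarrow> (\<integral>x. 0 \<partial>\<rho>)) at_top"
  proof (rule integral_dominated_convergence_at_top[where w="\<lambda>_. 1"])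
    show "\<forall>\<^sub>F y in at_top. AE x in \<rho>. norm (kern (\<i> * complex_of_real y) x / complex_of_real y) \<le> 1"
      using eventually_ge_at_top[of 1] by eventually_elim (simp add: norm_divide kern_bound divide_le_eq_1)
    have "((\<lambda>y. kern (\<i> * complex_of_real y) x / complex_of_real y) \<longlongrightarrow> 0) at_top" for x
    proof (rule Lim_null_comparison)
      show "\<forall>\<^sub>F y in at_top. cmod (kern (\<i> * complex_of_real y) x / complex_of_real y) \<le> sqrt ((1 + x\<^sup>2 * y\<^sup>2) / (x\<^sup>2 + y\<^sup>2)) / y"
        using eventually_gt_at_top[of 0]
        by eventually_elim (simp add: norm_divide kern_norm_sq[symmetric])
      show "((\<lambda>y. sqrt ((1 + x\<^sup>2 * y\<^sup>2) / (x\<^sup>2 + y\<^sup>2)) / y) \<longlongrightarrow> 0) at_top"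
      proof (cases "x = 0")
        case True thus ?thesis by simp real_asymp
      next
        case False
        hence "0 < x\<^sup>2" by simp
        thus ?thesis by real_asymp
      qed
    qed
    thus "AE x in \<rho>. ((\<lambda>y. kern (\<i> * complex_of_real y) x / complex_of_real y) \<longlongrightarrow> 0) at_top" by simp
  qed auto
  moreover have "((\<lambda>y. complex_of_real a / complex_of_real y) \<longlongrightarrow> 0) at_top"
  proof (rule Lim_null_comparison)
    show "\<forall>\<^sub>F y in at_top. cmod (complex_of_real a / complex_of_real y) \<le> \<bar>a\<bar> / y"
      using eventually_gt_at_top[of 0] by eventually_elim (simp add: norm_divide)
    show "((\<lambda>y. \<bar>a\<bar> / y) \<longlongrightarrow> 0) at_top" by real_asymp
  qed
  ultimately show ?thesis by (auto simp: add_divide_distrib dest: tendsto_add)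
qed

end

theorem theorem3p7:
  fixes M :: "('h::complex_hilbert_space \<Rightarrow> 'h) set"
    and \<tau> :: "('h \<Rightarrow> 'h) \<Rightarrow> complex"
    and Z :: "real \<Rightarrow> ('h \<times> 'h) set"
    and \<mu> :: "real \<Rightarrow> real measure"
    and \<nu> :: "real \<Rightarrow> real \<Rightarrow> real measure"
    and \<rho> :: "real measure"
  assumes "free_Levy_process_second_kind M \<tau> Z \<mu> \<nu>"
    and "is_Levy_measure \<mu> \<rho>"
    and "\<exists>t0>0. mean (\<mu> t0) = 0 \<or> mean (\<mu> t0) = \<infinity>"
  shows "(\<forall>t>0. \<not> slowly_varying (truncated_second_moment (\<mu> t))) \<and>
    \<not> slowly_varying (truncated_second_moment \<rho>) \<and>
    second_moment \<rho> = \<infinity> \<and>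
    (\<forall>t>0. second_moment (\<mu> t) = \<infinity>)"
proof -
  interpret P: free_Levy_process_second_kind M \<tau> Z \<mu> \<nu> by fact
  interpret S: free_semigroup \<mu> \<nu> by (rule P.free_semigroup[OF assms(2,3)])
  have fb: "fin_borel (\<mu> t)" if "0 < t" for t
    using S.dist[OF that] by (simp add: fin_borel_def real_distribution.finite_borel_measure_M)
  have sv: "sv f" if "slowly_varying f" for f using that by (simp add: slowly_varying_def sv_def)
  have no: "\<not> sv (smooth2 (\<mu> t))" if "0 < t" for t
    using S.smooth2_sv_imp[OF that] S.not_sv_H[OF that] by blast
  have 1: "\<not> slowly_varying (truncated_second_moment (\<mu> t))" if "0 < t" for t
    using fin_borel.smooth2_sv[OF fb[OF that]] no[OF that] sv by blast
  have 4: "second_moment (\<mu> t) = \<infinity>" if t: "0 < t" for t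
  proof (rule ccontr)
    assume "second_moment (\<mu> t) \<noteq> \<infinity>"
    hence int: "integrable (\<mu> t) (\<lambda>x. x\<^sup>2)" by (rule contrapos_np) (simp add: second_moment_def)
    \<comment> \<open>A zero second moment would make the law the point mass at 0, against
      nondegeneracy.\<close>
    have "0 < (\<integral>x. x\<^sup>2 \<partial>\<mu> t)"
      using real_distribution.second_moment_pos[OF S.dist[OF t] int] P.nondegenerate[OF t] by blast
    hence "sv (smooth2 (\<mu> t))" using sv_const_limit[OF fin_borel.smooth2_limit[OF fb[OF t] int]] by blast
    thus False using no[OF t] by blast
  qed
  have "finite_borel_measure \<rho>" using assms(2) by (simp add: is_Levy_measure_def)
  then interpret R: fin_borel \<rho> by (rule fin_borel.intro)
  obtain a where gen: "\<And>z. 0 < Im z \<Longrightarrow> ((\<lambda>\<epsilon>. Nev (\<mu> \<epsilon>) z / complex_of_real \<epsilon>)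
      \<longlongrightarrow> complex_of_real a + (\<integral>x. R.kern z x \<partial>\<rho>)) (at_right 0)"
    using assms(2) unfolding is_Levy_measure_def Nev_def R.kern_def by blast
  define \<phi> where "\<phi> = (\<lambda>z. complex_of_real a + (\<integral>x. R.kern z x \<partial>\<rho>))"
  have gen': "((\<lambda>\<epsilon>. Nev (\<mu> \<epsilon>) z / complex_of_real \<epsilon>) \<longlongrightarrow> \<phi> z) (at_right 0)" if "0 < Im z" for z
    unfolding \<phi>_def by (rule gen[OF that])
  have nog: "\<not> sv (\<lambda>y. smooth2 \<rho> y + R.gen_mass y)"
  proof
    assume "sv (\<lambda>y. smooth2 \<rho> y + R.gen_mass y)"
    moreover have "((\<lambda>y. y * Im (\<phi> (\<i> * complex_of_real y)) / (smooth2 \<rho> y + R.gen_mass y)) \<longlongrightarrow> 1) at_top"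
    proof (rule Lim_transform_eventually[OF tendsto_const])
      have "\<forall>\<^sub>F y in at_top. 0 < smooth2 \<rho> y + R.gen_mass y" using calculation by (simp add: sv_def)
      thus "\<forall>\<^sub>F y in at_top. 1 = y * Im (\<phi> (\<i> * complex_of_real y)) / (smooth2 \<rho> y + R.gen_mass y)"
        using eventually_ge_at_top[of 1]
      proof eventually_elim
        case (elim y)
        thus ?case unfolding \<phi>_def R.gen_im[OF elim(2)] by simp
      qed
    qed
    ultimately have "sv (\<lambda>y. y * Im (\<phi> (\<i> * complex_of_real y)))" by (rule sv_ratio) simp
    hence "sv (S.H 1)" using S.generator_sv_imp[of 1 \<phi>] gen R.gen_small[of a] by (simp add: \<phi>_def)
    thus False using S.not_sv_H[of 1] by simp
  qed
  \<comment> \<open>A zero Levy measure makes the generator a real constant, hence \<mu> 1 a point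
    mass.\<close>
  have mass: "0 < measure \<rho> UNIV"
  proof (rule ccontr)
    assume "\<not> 0 < measure \<rho> UNIV"
    hence "emeasure \<rho> UNIV = 0" using R.emeasure_eq_measure[of UNIV] measure_nonneg[of \<rho> UNIV] by simp
    hence "AE x in \<rho>. False" by (intro AE_I[where N=UNIV]) auto
    hence "(\<integral>x. f x \<partial>\<rho>) = 0" for f :: "real \<Rightarrow> complex" by (intro integral_eq_zero_AE) auto
    hence \<phi>: "\<phi> z = complex_of_real a" for z by (simp add: \<phi>_def)
    \<comment> \<open>Meets the smallness condition of \<open>generator_near\<close> with T = 1 and
      c = |a| + 1.\<close>
    define y where "y = 16 * (\<bar>a\<bar> + 1)"
    have "cmod (S.V 1 y - complex_of_real 1 * \<phi> (\<i> * complex_of_real y)) \<le> 24 * 1 * (\<bar>a\<bar> + 1) / y * (1 * Im (\<phi> (\<i> * complex_of_real y)))"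
      by (rule S.generator_near[OF zero_less_one gen']) (auto simp: \<phi> y_def)
    hence "S.V 1 y = complex_of_real a" by (simp add: \<phi>)
    hence "Im (Nev (\<mu> 1) (\<i> * complex_of_real y)) = 0" by (simp add: S.V_def)
    then obtain b where "\<mu> 1 = return borel b"
      by (rule real_distribution.eq_return_of_Nev[OF S.dist, rotated 2]) (auto simp: y_def)
    thus False using P.nondegenerate[of 1 b] by simp
  qed
  have 2: "\<not> slowly_varying (truncated_second_moment \<rho>)"
    using sv_add_limit[OF R.smooth2_sv R.gen_mass_limit mass] nog sv by blast
  have 3: "second_moment \<rho> = \<infinity>"
  proof (rule ccontr)
    assume "second_moment \<rho> \<noteq> \<infinity>"
    hence int: "integrable \<rho> (\<lambda>x. x\<^sup>2)" by (rule contrapos_np) (simp add: second_moment_def)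
    have "0 \<le> (\<integral>x. x\<^sup>2 \<partial>\<rho>)" by simp
    \<comment> \<open>The mass keeps the limit positive even if \<rho> sits at 0 and its second
      moment is 0.\<close>
    hence "0 < (\<integral>x. x\<^sup>2 \<partial>\<rho>) + measure \<rho> UNIV" using mass by linarith
    from sv_const_limit[OF tendsto_add[OF R.smooth2_limit[OF int] R.gen_mass_limit] this] show False using nog by blast
  qed
  show ?thesis using 1 2 3 4 by blast
qed

end
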